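(* Let $C$ be a symmetrizable generalized Cartan matrix with symmetrizer $D$ and orientation $\Omega$, and for $k\ge 1$ let $H(k)=H(C,kD,\Omega)$. Then the $H(k)$-canonical decompositions of rank vectors do not depend on $k$: for all $k,k'\ge 1$, every rank vector $\mathbf r\in\mathbb N^n$ and every tuple $(\mathbf r_1,\ldots,\mathbf r_t)$ of rank vectors with $\mathbf r=\mathbf r_1+\cdots+\mathbf r_t$, the tuple $(\mathbf r_1,\ldots,\mathbf r_t)$ is the $H(k)$-canonical decomposition of $\mathbf r$ if and only if it is the $H(k')$-canonical decomposition of $\mathbf r$ (decompositions being considered up to permutation of their entries).
   Context: $K$ is an algebraically closed field, $\mathbb N=\{0,1,2,\ldots\}$; modules are finite-dimensional left modules. The algebra $H(C,D,\Omega)$: $C=(c_{ij})\in M_n(\mathbb Z)$ satisfies $c_{ii}=2$ and $c_{ij}\le 0$ for $i\ne j$; a symmetrizer is $D=\mathrm{diag}(c_1,\ldots,c_n)$ with $c_i\in\mathbb Z_{>0}$ and $c_ic_{ij}=c_jc_{ji}$ for all $i,j$. When $c_{ij}<0$ put $g_{ij}=|\gcd(c_{ij},c_{ji})|$, $f_{ij}=|c_{ij}|/g_{ij}$. An orientation is a subset $\Omega\subset\{1,\ldots,n\}^2$ such that $\{(i,j),(j,i)\}\cap\Omega\neq\varnothing$ iff $c_{ij}<0$, and such that for each sequence $(i_1,i_2),(i_2,i_3),\ldots,(i_t,i_{t+1})$ of elements of $\Omega$ with $t\ge 1$ one has $i_1\neq i_{t+1}$. Let $Q$ be the quiver with vertices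 $1,\ldots,n$ and arrows $\alpha_{ij}^{(g)}\colon j\to i$ for $(i,j)\in\Omega$, $1\le g\le g_{ij}$, and loops $\varepsilon_i\colon i\to i$ for $1\le i\le n$. Then $H(C,D,\Omega)=KQ/I$, where $I$ is generated by the relations $\varepsilon_i^{c_i}=0$ for all $i$ and $\varepsilon_i^{f_{ji}}\alpha_{ij}^{(g)}=\alpha_{ij}^{(g)}\varepsilon_j^{f_{ij}}$ for all $(i,j)\in\Omega$, $1\le g\le g_{ij}$. The algebra $H(k)=H(C,kD,\Omega)$ is defined in the same way with each $c_i$ in $D$ replaced by $kc_i$. Let $H_i(k)\cong K[x]/(x^{kc_i})$ be the subalgebra of $H(k)$ generated by $\varepsilon_i$. An $H(k)$-module $M$, viewed as a representation $(M_i,M(\varepsilon_i),M(\alpha_{ij}^{(g)}))$, is locally free if each $M_i$ is a free $H_i(k)$-module; its rank vector is $(\mathrm{rank}(M_1),\ldots,\mathrm{rank}(M_n))\in\mathbb N^n$. For a rank vector $\mathbf r\in\mathbb N^n$, $\mathrm{rep}_{\mathrm{l.f.}}(H(k),\mathbf r)$ is the variety of locally free $H(k)$-modules of rank vector $\mathbf r$, i.e. the subset of locally free modules (of rank vector $\mathbf r$) in the affine variety of representations of $H(k)$ with dimension vector $(kc_1r_1,\ldots,kc_nr_n)$, with Zariski topology. A tuple $(\mathbf r_1,\ldots,\mathbf r_t)$ of rank vectors with $\mathbf r=\mathbf r_1+\cdots+\mathbf r_t$ is the $H(k)$-canonical decomposition of $\mathbf r$ if there is a dense open subset $\mathcal U$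 of $\mathrm{rep}_{\mathrm{l.f.}}(H(k),\mathbf r)$ such that each $M\in\mathcal U$ is isomorphic to $M_1\oplus\cdots\oplus M_t$ with $M_i$ an indecomposable locally free $H(k)$-module with rank vector $\mathbf r_i$ for $1\le i\le t$. (Such a decomposition exists and is unique up to permutation.) *)

theory Defs
  imports
    "HOL-Analysis.Abstract_Topology"
    "HOL-Computational_Algebra.Polynomial"
    "Jordan_Normal_Form.Matrix"
begin

text \<open>
  Following the indexing of the matrix library, vertices are numbered \<open>0, \<dots>, n - 1\<close>.
  Symmetrizers are diagonal matrices over \<open>nat\<close>, so that \<open>k D\<close> is literally \<open>k \<cdot>\<^sub>m D\<close>.
  Rank vectors and dimension vectors are elements of \<open>carrier_vec n\<close> over \<open>nat\<close>.
\<close>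

definition generalized_cartan_matrix :: "nat \<Rightarrow> int mat \<Rightarrow> bool" where
  "generalized_cartan_matrix n C \<longleftrightarrow>
     C \<in> carrier_mat n n \<and>
     (\<forall>i<n. C $$ (i,i) = 2) \<and>
     (\<forall>i<n. \<forall>j<n. i \<noteq> j \<longrightarrow> C $$ (i,j) \<le> 0)"

definition symmetrizer :: "nat \<Rightarrow> int mat \<Rightarrow> nat mat \<Rightarrow> bool" where
  "symmetrizer n C D \<longleftrightarrow>
     D \<in> carrier_mat n n \<and> diagonal_mat D \<and>
     (\<forall>i<n. D $$ (i,i) > 0) \<and>
     (\<forall>i<n. \<forall>j<n. int (D $$ (i,i)) * C $$ (i,j) = int (D $$ (j,j)) * C $$ (j,i))"

definition orientation :: "nat \<Rightarrow> int mat \<Rightarrow> (nat \<times> nat) set \<Rightarrow> bool" where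
  "orientation n C \<Omega> \<longleftrightarrow>
     \<Omega> \<subseteq> {..<n} \<times> {..<n} \<and>
     (\<forall>i<n. \<forall>j<n. {(i,j), (j,i)} \<inter> \<Omega> \<noteq> {} \<longleftrightarrow> C $$ (i,j) < 0) \<and>
     acyclic \<Omega>"

definition g_num :: "int mat \<Rightarrow> nat \<Rightarrow> nat \<Rightarrow> nat" where
  "g_num C i j = nat \<bar>gcd (C $$ (i,j)) (C $$ (j,i))\<bar>"

definition f_num :: "int mat \<Rightarrow> nat \<Rightarrow> nat \<Rightarrow> nat" where
  "f_num C i j = nat \<bar>C $$ (i,j)\<bar> div g_num C i j"

datatype arrow = Eps nat | Alpha nat nat nat

fun src :: "arrow \<Rightarrow> nat" where
  "src (Eps i) = i"
| "src (Alpha i j g) = j"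

fun tgt :: "arrow \<Rightarrow> nat" where
  "tgt (Eps i) = i"
| "tgt (Alpha i j g) = i"

definition arrows :: "nat \<Rightarrow> int mat \<Rightarrow> (nat \<times> nat) set \<Rightarrow> arrow set" where
  "arrows n C \<Omega> =
     {Eps i | i. i < n} \<union> {Alpha i j g | i j g. (i,j) \<in> \<Omega> \<and> 1 \<le> g \<and> g \<le> g_num C i j}"

text \<open>
  A representation assigns to each arrow \<open>a\<close> a matrix for a linear map
  \<open>K\<^bsup>d(src a)\<^esup> \<rightarrow> K\<^bsup>d(tgt a)\<^esup>\<close> acting on column vectors.  The affine space of all
  representations of the quiver with dimension vector \<open>d\<close>:
\<close>

type_synonym 'a rep = "arrow \<Rightarrow> 'a mat"

definition rep_space :: "nat \<Rightarrow> int mat \<Rightarrow> (nat \<times> nat) set \<Rightarrow> nat vec \<Rightarrow> 'a rep set" where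
  "rep_space n C \<Omega> d = (\<Pi>\<^sub>E a\<in>arrows n C \<Omega>. carrier_mat (d $ tgt a) (d $ src a))"

text \<open>
  Modules over \<open>H(C,D,\<Omega>) = KQ/I\<close> are the representations of \<open>Q\<close> that satisfy the
  relations generating \<open>I\<close>.
\<close>

definition rep_variety ::
    "nat \<Rightarrow> int mat \<Rightarrow> nat mat \<Rightarrow> (nat \<times> nat) set \<Rightarrow> nat vec \<Rightarrow> 'a::field rep set" where
  "rep_variety n C D \<Omega> d =
     {M \<in> rep_space n C \<Omega> d.
        (\<forall>i<n. M (Eps i) ^\<^sub>m (D $$ (i,i)) = 0\<^sub>m (d $ i) (d $ i)) \<and>
        (\<forall>i j g. (i,j) \<in> \<Omega> \<and> 1 \<le> g \<and> g \<le> g_num C i j \<longrightarrow>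
           M (Eps i) ^\<^sub>m (f_num C j i) * M (Alpha i j g) =
           M (Alpha i j g) * M (Eps j) ^\<^sub>m (f_num C i j))}"

definition eval_mat :: "'a::field poly \<Rightarrow> 'a mat \<Rightarrow> 'a mat" where
  "eval_mat p E =
     mat (dim_row E) (dim_row E) (\<lambda>(a,b). \<Sum>t\<le>degree p. coeff p t * (E ^\<^sub>m t) $$ (a,b))"

text \<open>
  For a square matrix \<open>E\<close> with \<open>E\<^sup>m = 0\<close> and \<open>m \<ge> 1\<close>, the module over \<open>K[x]/(x\<^sup>m)\<close> on which
  \<open>x\<close> acts as \<open>E\<close> is free of rank \<open>r\<close> iff it has a basis \<open>b\<^sub>0, \<dots>, b\<^bsub>r-1\<^esub>\<close>, i.e. each vector
  is a linear combination of the \<open>b\<^sub>s\<close> with unique coefficients in \<open>K[x]/(x\<^sup>m)\<close>.  Elements of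
  \<open>K[x]/(x\<^sup>m)\<close> are represented by polynomials of degree less than \<open>m\<close>.
\<close>

definition free_of_rank :: "nat \<Rightarrow> 'a::field mat \<Rightarrow> nat \<Rightarrow> bool" where
  "free_of_rank m E r \<longleftrightarrow>
     (\<exists>b \<in> {..<r} \<rightarrow> carrier_vec (dim_row E). \<forall>v \<in> carrier_vec (dim_row E).
        \<exists>!h. h \<in> {..<r} \<rightarrow>\<^sub>E {p. degree p < m} \<and>
             v = finsum_vec TYPE('a) (dim_row E) (\<lambda>s. eval_mat (h s) E *\<^sub>v b s) {..<r})"

definition locally_free_of_rank ::
    "nat \<Rightarrow> nat mat \<Rightarrow> 'a::field rep \<Rightarrow> nat vec \<Rightarrow> bool" where
  "locally_free_of_rank n D M r \<longleftrightarrow> (\<forall>i<n. free_of_rank (D $$ (i,i)) (M (Eps i)) (r $ i))"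

definition dimension_vector :: "nat \<Rightarrow> nat mat \<Rightarrow> nat vec \<Rightarrow> nat vec" where
  "dimension_vector n D r = vec n (\<lambda>i. D $$ (i,i) * r $ i)"

definition rep_lf ::
    "nat \<Rightarrow> int mat \<Rightarrow> nat mat \<Rightarrow> (nat \<times> nat) set \<Rightarrow> nat vec \<Rightarrow> 'a::field rep set" where
  "rep_lf n C D \<Omega> r =
     {M \<in> rep_variety n C D \<Omega> (dimension_vector n D r). locally_free_of_rank n D M r}"

definition rep_iso ::
    "nat \<Rightarrow> int mat \<Rightarrow> (nat \<times> nat) set \<Rightarrow> nat vec \<Rightarrow> 'a::field rep \<Rightarrow> 'a rep \<Rightarrow> bool" where
  "rep_iso n C \<Omega> d M N \<longleftrightarrow>
     (\<exists>P. (\<forall>i<n. P i \<in> carrier_mat (d $ i) (d $ i) \<and> invertible_mat (P i)) \<and>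
          (\<forall>a\<in>arrows n C \<Omega>. P (tgt a) * M a = N a * P (src a)))"

definition direct_sum ::
    "nat \<Rightarrow> int mat \<Rightarrow> (nat \<times> nat) set \<Rightarrow> 'a::field rep list \<Rightarrow> 'a rep" where
  "direct_sum n C \<Omega> Ms = (\<lambda>a\<in>arrows n C \<Omega>. diag_block_mat (map (\<lambda>M. M a) Ms))"

definition indecomposable ::
    "nat \<Rightarrow> int mat \<Rightarrow> nat mat \<Rightarrow> (nat \<times> nat) set \<Rightarrow> nat vec \<Rightarrow> 'a::field rep \<Rightarrow> bool" where
  "indecomposable n C D \<Omega> d M \<longleftrightarrow>
     M \<in> rep_variety n C D \<Omega> d \<and> d \<noteq> 0\<^sub>v n \<and>
     \<not> (\<exists>d1 d2 M1 M2.
          d1 \<in> carrier_vec n \<and> d1 \<noteq> 0\<^sub>v n \<and> d2 \<in> carrier_vec n \<and> d2 \<noteq> 0\<^sub>v n \<and>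
          d = d1 + d2 \<and>
          M1 \<in> rep_variety n C D \<Omega> d1 \<and> M2 \<in> rep_variety n C D \<Omega> d2 \<and>
          rep_iso n C \<Omega> d M (direct_sum n C \<Omega> [M1, M2]))"

inductive_set polynomial_functions ::
    "nat \<Rightarrow> int mat \<Rightarrow> (nat \<times> nat) set \<Rightarrow> nat vec \<Rightarrow> ('a::field rep \<Rightarrow> 'a) set"
  for n C \<Omega> d where
  const: "(\<lambda>M. c) \<in> polynomial_functions n C \<Omega> d"
| coord: "a \<in> arrows n C \<Omega> \<Longrightarrow> p < d $ tgt a \<Longrightarrow> q < d $ src a \<Longrightarrow>
          (\<lambda>M. M a $$ (p,q)) \<in> polynomial_functions n C \<Omega> d"
| add: "f \<in> polynomial_functions n C \<Omega> d \<Longrightarrow> g \<in> polynomial_functions n C \<Omega> d \<Longrightarrow>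
          (\<lambda>M. f M + g M) \<in> polynomial_functions n C \<Omega> d"
| mult: "f \<in> polynomial_functions n C \<Omega> d \<Longrightarrow> g \<in> polynomial_functions n C \<Omega> d \<Longrightarrow>
          (\<lambda>M. f M * g M) \<in> polynomial_functions n C \<Omega> d"

definition zero_locus ::
    "nat \<Rightarrow> int mat \<Rightarrow> (nat \<times> nat) set \<Rightarrow> nat vec \<Rightarrow> ('a::field rep \<Rightarrow> 'a) set \<Rightarrow> 'a rep set" where
  "zero_locus n C \<Omega> d S = {M \<in> rep_space n C \<Omega> d. \<forall>f\<in>S. f M = 0}"

definition zariski ::
    "nat \<Rightarrow> int mat \<Rightarrow> (nat \<times> nat) set \<Rightarrow> nat vec \<Rightarrow> 'a::field rep topology" where
  "zariski n C \<Omega> d =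
     topology (\<lambda>U. \<exists>S \<subseteq> polynomial_functions n C \<Omega> d.
       U = rep_space n C \<Omega> d - zero_locus n C \<Omega> d S)"

lemma openin_zariski:
  "openin (zariski n C \<Omega> d) U \<longleftrightarrow>
     (\<exists>S \<subseteq> (polynomial_functions n C \<Omega> d :: ('a::field rep \<Rightarrow> 'a) set).
        U = rep_space n C \<Omega> d - zero_locus n C \<Omega> d S)"
proof -
  let ?P = "polynomial_functions n C \<Omega> d :: ('a rep \<Rightarrow> 'a) set"
  let ?V = "rep_space n C \<Omega> d :: 'a rep set"
  let ?O = "\<lambda>U. \<exists>S \<subseteq> ?P. U = ?V - zero_locus n C \<Omega> d S"
  have "istopology ?O"
    unfolding istopology_def
  proof (intro conjI allI impI)
    fix U W assume "?O U" "?O W"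
    then obtain S T where ST: "S \<subseteq> ?P" "T \<subseteq> ?P"
      "U = ?V - zero_locus n C \<Omega> d S" "W = ?V - zero_locus n C \<Omega> d T" by blast
    let ?R = "{\<lambda>M. f M * g M | f g. f \<in> S \<and> g \<in> T}"
    have "?R \<subseteq> ?P" using ST by (auto intro: polynomial_functions.mult)
    moreover have "U \<inter> W = ?V - zero_locus n C \<Omega> d ?R"
    proof (rule Set.set_eqI)
      fix M
      have "(\<forall>h\<in>?R. h M = 0) \<longleftrightarrow> (\<forall>f\<in>S. \<forall>g\<in>T. f M * g M = 0)"
        by (rule iffI; clarsimp; metis mult_eq_0_iff)
      also have "\<dots> \<longleftrightarrow> (\<forall>f\<in>S. f M = 0) \<or> (\<forall>g\<in>T. g M = 0)"
        unfolding mult_eq_0_iff by blast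
      finally show "M \<in> U \<inter> W \<longleftrightarrow> M \<in> ?V - zero_locus n C \<Omega> d ?R"
        unfolding ST(3,4) zero_locus_def Int_iff Diff_iff mem_Collect_eq by argo
    qed
    ultimately show "?O (U \<inter> W)" by blast
  next
    fix \<U> assume "\<forall>U\<in>\<U>. ?O U"
    from bchoice[OF this] obtain S where "\<forall>U\<in>\<U>. S U \<subseteq> ?P \<and> U = ?V - zero_locus n C \<Omega> d (S U)" ..
    then have S: "\<And>U. U \<in> \<U> \<Longrightarrow> S U \<subseteq> ?P"
      "\<And>U. U \<in> \<U> \<Longrightarrow> U = ?V - zero_locus n C \<Omega> d (S U)" by blast+
    have "(\<Union>U\<in>\<U>. S U) \<subseteq> ?P" using S(1) by blast
    moreover have "\<Union>\<U> = (\<Union>U\<in>\<U>. ?V - zero_locus n C \<Omega> d (S U))"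
      using S(2) by blast
    then have "\<Union>\<U> = ?V - zero_locus n C \<Omega> d (\<Union>U\<in>\<U>. S U)"
      unfolding zero_locus_def by auto
    ultimately show "?O (\<Union>\<U>)" by blast
  qed
  then show ?thesis unfolding zariski_def by (simp only: topology_inverse')
qed

lemma topspace_zariski: "topspace (zariski n C \<Omega> d) = rep_space n C \<Omega> d"
proof
  show "topspace (zariski n C \<Omega> d) \<subseteq> rep_space n C \<Omega> d"
    unfolding topspace_def openin_zariski by blast
  have "openin (zariski n C \<Omega> d) (rep_space n C \<Omega> d)"
    unfolding openin_zariski
    by (rule exI[of _ "{\<lambda>M. 1}"]) (auto simp: zero_locus_def intro: polynomial_functions.const)
  then show "rep_space n C \<Omega> d \<subseteq> topspace (zariski n C \<Omega> d)"
    by (rule openin_subset)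
qed

definition lf_topology ::
    "nat \<Rightarrow> int mat \<Rightarrow> nat mat \<Rightarrow> (nat \<times> nat) set \<Rightarrow> nat vec \<Rightarrow> 'a::field rep topology" where
  "lf_topology n C D \<Omega> r =
     subtopology (zariski n C \<Omega> (dimension_vector n D r)) (rep_lf n C D \<Omega> r)"

text \<open>
  The type argument is the ground field.  The predicate is invariant under permutation of
  the list \<open>rs\<close>.
\<close>

definition canonical_decomposition ::
    "'a::field itself \<Rightarrow> nat \<Rightarrow> int mat \<Rightarrow> nat mat \<Rightarrow> (nat \<times> nat) set \<Rightarrow>
     nat vec \<Rightarrow> nat vec list \<Rightarrow> bool" where
  "canonical_decomposition _ n C D \<Omega> r rs \<longleftrightarrow>
     set rs \<subseteq> carrier_vec n \<and> r = foldr (+) rs (0\<^sub>v n) \<and>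
     (\<exists>U :: 'a rep set.
        openin (lf_topology n C D \<Omega> r) U \<and>
        Abstract_Topology.closure_of (lf_topology n C D \<Omega> r) U = topspace (lf_topology n C D \<Omega> r) \<and>
        (\<forall>M\<in>U. \<exists>Ms. length Ms = length rs \<and>
           (\<forall>s<length rs. Ms ! s \<in> rep_lf n C D \<Omega> (rs ! s) \<and>
              indecomposable n C D \<Omega> (dimension_vector n D (rs ! s)) (Ms ! s)) \<and>
           rep_iso n C \<Omega> (dimension_vector n D r) M (direct_sum n C \<Omega> Ms)))"

end

theory Submission
  imports Defs "Jordan_Normal_Form.Determinant"
begin

text \<open>
  Fix a symmetrizer with entries \<open>c\<^sub>i\<close> and put \<open>E = \<Sum> \<epsilon>\<^sub>i\<^bsup>c\<^sub>i\<^esup>\<close>.  On an \<open>H(k)\<close>-module \<open>M\<close> the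
  operator \<open>E\<close> commutes with all arrows and \<open>E\<^sup>k = 0\<close>; if \<open>M\<close> is locally free, then \<open>N = M/EM\<close> is a
  locally free \<open>H(1)\<close>-module of the same rank vector.  It suffices to compare \<open>k\<close> with \<open>1\<close>.

  An idempotent \<open>e\<close> of \<open>End N\<close> is lifted to \<open>End M\<close> step by step along the powers of \<open>E\<close>.  The
  obstruction is a commutator \<open>[e,X]\<close>, where \<open>X\<close> is a first order deformation of \<open>N\<close> that fixes the
  loops.  If the rank of \<open>h \<mapsto> [N,h]\<close> is maximal among all \<open>N\<close> of the given rank vector, then
  \<open>[N + tX, e] = t [X,e]\<close> does not increase it, and \<open>[X,e]\<close> is of the form \<open>[N,h]\<close>.  Hence for
  generic \<open>N\<close> the decompositions of \<open>M\<close> and of \<open>N\<close> into indecomposables correspond to each other.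

  It remains to carry open sets from \<open>H(k)\<close> to \<open>H(1)\<close> and back.  After conjugation all locally free
  modules of a fixed rank vector have the same loops, and the remaining arrows form a vector space
  on which both \<open>M \<mapsto> M/EM\<close> and a lift \<open>N \<mapsto> M\<close>, given by Higman's trace map, are linear.  Joining
  two modules by a line also shows that nonempty invariant open sets meet.
\<close>

section \<open>Linear operators\<close>

text \<open>The map from End M to End N has a nilpotent kernel, so idempotents would lift for purely
  ring-theoretic reasons if it were onto. In general it is not, and genericity of N has to make up
  for this. It helps that only idempotents are lifted: if f is an idempotent lift of e on the
  vertices and [f,M] = E^l Y, then f D + D f = D for D = [f,M], so modulo E the error Y is
  off-diagonal with respect to e. This is why it equals [e,X] for the cocycle X = [e,Y]. Reduction
  is a functor, so decompositions of M always pass to N; only the passage from N to M needs the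
  lifting. M/EM involves a choice of basis, so reduction is not directly a map of varieties. It
  becomes linear once the loops are constant, and near a given module the loops can be made constant
  by a conjugation with rational entries. Freeness is expressed by Higman's equation rather than by
  bases because a trace can be pushed through module maps: it is inherited by summands, and it turns
  any linear lift of a module map into an equivariant one by a formula linear in that lift.\<close>

text \<open>
  Matrices of all sizes are embedded into one ring, the linear endomorphisms of \<open>nat \<Rightarrow> 'a\<close>, so
  that products carry no side conditions on dimensions.  The corner \<open>Hom r c\<close> consists of the
  operators \<open>K\<^sup>c \<rightarrow> K\<^sup>r\<close> (target first), and \<open>idop d\<close> is the identity of \<open>K\<^sup>d\<close>.
\<close>

typedef (overloaded) 'a lop = "{f :: (nat \<Rightarrow> 'a::field) \<Rightarrow> nat \<Rightarrow> 'a.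
    (\<forall>x y. f (\<lambda>p. x p + y p) = (\<lambda>p. f x p + f y p)) \<and>
    (\<forall>c x. f (\<lambda>p. c * x p) = (\<lambda>p. c * f x p))}"
  morphisms app Lop
  by (rule exI[of _ "\<lambda>x. x"]) auto

setup_lifting type_definition_lop

instantiation lop :: (field) ring_1
begin

lift_definition zero_lop :: "'a lop" is "\<lambda>x p. 0" by auto
lift_definition one_lop :: "'a lop" is "\<lambda>x. x" by auto
lift_definition plus_lop :: "'a lop \<Rightarrow> 'a lop \<Rightarrow> 'a lop" is "\<lambda>f g x p. f x p + g x p"
  by (auto simp: fun_eq_iff algebra_simps)
lift_definition minus_lop :: "'a lop \<Rightarrow> 'a lop \<Rightarrow> 'a lop" is "\<lambda>f g x p. f x p - g x p"
  by (auto simp: fun_eq_iff algebra_simps)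
lift_definition uminus_lop :: "'a lop \<Rightarrow> 'a lop" is "\<lambda>f x p. - f x p"
  by (auto simp: fun_eq_iff algebra_simps)
lift_definition times_lop :: "'a lop \<Rightarrow> 'a lop \<Rightarrow> 'a lop" is "\<lambda>f g x. f (g x)"
  by auto

instance
proof
  fix a b c :: "'a lop"
  show "a + b + c = a + (b + c)" by transfer (auto simp: algebra_simps)
  show "a + b = b + a" by transfer (auto simp: algebra_simps)
  show "0 + a = a" by transfer auto
  show "- a + a = 0" by transfer auto
  show "a - b = a + - b" by transfer auto
  show "a * b * c = a * (b * c)" by transfer auto
  show "1 * a = a" by transfer auto
  show "a * 1 = a" by transfer auto
  show "(a + b) * c = a * c + b * c" by transfer auto
  show "a * (b + c) = a * b + a * c" by transfer auto
  show "(0::'a lop) \<noteq> 1"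
    by transfer (auto simp: fun_eq_iff intro!: exI[of _ "\<lambda>_. 1"])
qed

end

lemma app_simps [simp]:
  "app 0 x p = 0" "app 1 x = x" "app (X + Y) x p = app X x p + app Y x p"
  "app (X - Y) x p = app X x p - app Y x p" "app (- X) x p = - app X x p"
  "app (X * Y) x = app X (app Y x)"
  by (transfer; simp)+

lemma app_add: "app X (\<lambda>p. x p + y p) = (\<lambda>p. app X x p + app X y p)"
  by transfer auto

lemma app_scale: "app X (\<lambda>p. c * x p) = (\<lambda>p. c * app X x p)"
  by transfer auto

lemma app_zero: "app X (\<lambda>p. 0) = (\<lambda>p. 0)"
  using app_scale[of X 0 "\<lambda>_. 0"] by simp

lemma app_sum: "app X (\<lambda>p. \<Sum>s\<in>S. x s p) = (\<lambda>p. \<Sum>s\<in>S. app X (x s) p)"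
  by (induction S rule: infinite_finite_induct) (auto simp: app_zero app_add)

lemma lop_eqI: "(\<And>x p. app X x p = app Y x p) \<Longrightarrow> X = Y"
  by (auto simp: app_inject[symmetric] fun_eq_iff)

lift_definition mat_op :: "'a::field mat \<Rightarrow> 'a lop" is
  "\<lambda>A x p. if p < dim_row A then \<Sum>q<dim_col A. A $$ (p,q) * x q else 0"
  by (auto simp: fun_eq_iff algebra_simps sum.distrib sum_distrib_left)

lift_definition idop :: "nat \<Rightarrow> 'a::field lop" is "\<lambda>d x p. if p < d then x p else 0"
  by (auto simp: fun_eq_iff)

lift_definition scal :: "'a::field \<Rightarrow> 'a lop" is "\<lambda>c x p. c * x p"
  by (auto simp: fun_eq_iff algebra_simps)

lift_definition unit_op :: "nat \<Rightarrow> nat \<Rightarrow> 'a::field lop" is "\<lambda>p q x s. if s = p then x q else 0"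
  by (auto simp: fun_eq_iff)

definition entry :: "'a::field lop \<Rightarrow> nat \<Rightarrow> nat \<Rightarrow> 'a" where
  "entry X p q = app X (\<lambda>s. if s = q then 1 else 0) p"

definition Hom :: "nat \<Rightarrow> nat \<Rightarrow> 'a::field lop set" where
  "Hom r c = {X. idop r * X * idop c = X}"

definition mat_of :: "nat \<Rightarrow> nat \<Rightarrow> 'a::field lop \<Rightarrow> 'a mat" where
  "mat_of r c X = mat r c (\<lambda>(p,q). entry X p q)"

lemma app_mat_op: "app (mat_op A) x p = (if p < dim_row A then \<Sum>q<dim_col A. A $$ (p,q) * x q else 0)"
  by (simp add: mat_op.rep_eq)
lemma app_idop: "app (idop d) x p = (if p < d then x p else 0)"
  by (simp add: idop.rep_eq)
lemma app_scal: "app (scal c) x p = c * x p"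
  by (simp add: scal.rep_eq)
lemma app_unit_op: "app (unit_op a b) x p = (if p = a then x b else 0)"
  by (simp add: unit_op.rep_eq)

lemma idop_idem: "idop d * idop d = idop d"
  by (rule lop_eqI) (auto simp: app_idop)

lemma idop_le: "c \<le> d \<Longrightarrow> idop c * idop d = idop c" "c \<le> d \<Longrightarrow> idop d * idop c = idop c"
  by (rule lop_eqI; auto simp: app_idop)+

lemma Hom_left: "X \<in> Hom r c \<Longrightarrow> idop r * X = X"
proof -
  assume "X \<in> Hom r c"
  then have X: "idop r * X * idop c = X" by (simp add: Hom_def)
  have "idop r * X = (idop r * idop r) * X * idop c"
    using arg_cong[OF X, of "\<lambda>Z. idop r * Z"] by (simp add: mult.assoc)
  then show ?thesis using X by (simp add: idop_idem)
qed

lemma Hom_right: "X \<in> Hom r c \<Longrightarrow> X * idop c = X"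
proof -
  assume "X \<in> Hom r c"
  then have X: "idop r * X * idop c = X" by (simp add: Hom_def)
  have "X * idop c = idop r * X * (idop c * idop c)"
    using arg_cong[OF X, of "\<lambda>Z. Z * idop c"] by (simp add: mult.assoc)
  then show ?thesis using X by (simp add: idop_idem)
qed

lemma Hom_leftA: "X \<in> Hom r c \<Longrightarrow> idop r * (X * Z) = X * Z"
  by (metis Hom_left mult.assoc)

lemma Hom_rightA: "X \<in> Hom r c \<Longrightarrow> X * (idop c * Z) = X * Z"
  by (metis Hom_right mult.assoc)

lemma Hom_I: "idop r * X = X \<Longrightarrow> X * idop c = X \<Longrightarrow> X \<in> Hom r c"
  unfolding Hom_def by simp

lemma Hom_mult: "X \<in> Hom r c \<Longrightarrow> Y \<in> Hom c' d \<Longrightarrow> X * Y \<in> Hom r d"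
  by (rule Hom_I) (metis Hom_left mult.assoc, metis Hom_right mult.assoc)

lemma Hom_add: "X \<in> Hom r c \<Longrightarrow> Y \<in> Hom r c \<Longrightarrow> X + Y \<in> Hom r c"
  by (rule Hom_I) (simp_all add: distrib_left distrib_right Hom_left Hom_right)

lemma Hom_diff: "X \<in> Hom r c \<Longrightarrow> Y \<in> Hom r c \<Longrightarrow> X - Y \<in> Hom r c"
  by (rule Hom_I) (simp_all add: left_diff_distrib right_diff_distrib Hom_left Hom_right)

lemma Hom_uminus: "X \<in> Hom r c \<Longrightarrow> - X \<in> Hom r c"
  by (rule Hom_I) (simp_all add: Hom_left Hom_right)

lemma Hom_0: "0 \<in> Hom r c"
  by (rule Hom_I) simp_all

lemma Hom_idop: "idop d \<in> Hom d d"
  by (rule Hom_I) (simp_all add: idop_idem)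

lemma Hom_sum: "(\<And>s. s \<in> S \<Longrightarrow> X s \<in> Hom r c) \<Longrightarrow> sum X S \<in> Hom r c"
  by (induction S rule: infinite_finite_induct) (auto intro: Hom_0 Hom_add)

text \<open>The exponent must be positive: the zeroth power is 1, the identity on all of
  \<open>nat \<Rightarrow> 'a\<close>, which lies in no corner. The next two lemmas absorb it into a
  neighbouring factor.\<close>

lemma Hom_pow: "X \<in> Hom d d \<Longrightarrow> n > 0 \<Longrightarrow> X ^ n \<in> Hom d d"
proof (induction n)
  case (Suc n)
  show ?case
  proof (cases "n = 0")
    case True with Suc show ?thesis by simp
  next
    case False with Suc have "X ^ n \<in> Hom d d" by simp
    then show ?thesis using Hom_mult[OF Suc.prems(1)] by simp
  qed
qed simp

lemma Hom_pow_mult: "X \<in> Hom d d \<Longrightarrow> Y \<in> Hom d c \<Longrightarrow> X ^ n * Y \<in> Hom d c"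
  by (cases "n = 0") (auto intro: Hom_mult Hom_pow)

lemma Hom_mult_pow: "X \<in> Hom d d \<Longrightarrow> Y \<in> Hom c d \<Longrightarrow> Y * X ^ n \<in> Hom c d"
  by (cases "n = 0") (auto intro: Hom_mult Hom_pow)

lemma Hom_mono:
  assumes X: "X \<in> Hom r c" and le: "r \<le> r'" "c \<le> c'"
  shows "X \<in> Hom r' c'"
proof (rule Hom_I)
  have "idop r' * X = (idop r' * idop r) * X" using Hom_left[OF X] by (simp add: mult.assoc)
  also have "\<dots> = X" unfolding idop_le(2)[OF le(1)] by (rule Hom_left[OF X])
  finally show "idop r' * X = X" .
  have "X * idop c' = X * (idop c * idop c')" using Hom_rightA[OF X] by simp
  also have "\<dots> = X" unfolding idop_le(1)[OF le(2)] by (rule Hom_right[OF X])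
  finally show "X * idop c' = X" .
qed

lemmas HH_intros = Hom_mult Hom_add Hom_diff Hom_uminus Hom_0 Hom_idop Hom_sum Hom_pow Hom_pow_mult Hom_mult_pow

lemma scal_comm: "scal c * X = X * scal c"
proof (rule lop_eqI)
  fix x p
  have "app (scal c) x = (\<lambda>p. c * x p)" by (simp add: fun_eq_iff app_scal)
  then show "app (scal c * X) x p = app (X * scal c) x p" by (simp add: app_scal app_scale)
qed

lemma scal_left_comm: "X * (scal c * Z) = scal c * (X * Z)"
proof -
  have "X * (scal c * Z) = (X * scal c) * Z" by (simp add: mult.assoc)
  also have "\<dots> = scal c * (X * Z)" unfolding scal_comm[symmetric] by (simp add: mult.assoc)
  finally show ?thesis .
qed

lemma Hom_scal:
  assumes X: "X \<in> Hom r c" shows "scal a * X \<in> Hom r c"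
proof (rule Hom_I)
  have "idop r * (scal a * X) = scal a * (idop r * X)" by (simp only: scal_comm[of a "idop r"] mult.assoc[symmetric])
  then show "idop r * (scal a * X) = scal a * X" using Hom_left[OF X] by simp
  show "scal a * X * idop c = scal a * X" using Hom_right[OF X] by (simp add: mult.assoc)
qed

lemma scal_mult: "scal a * scal b = scal (a * b)" "scal 1 = 1"
  by (rule lop_eqI; simp add: app_scal)+

lemma Hom_app: "X \<in> Hom r c \<Longrightarrow> app X x p = (if p < r then \<Sum>q<c. entry X p q * x q else 0)"
proof -
  assume X: "X \<in> Hom r c"
  have e: "app (idop c) x = (\<lambda>p. \<Sum>q<c. x q * (if p = q then 1 else 0))"
    by (auto simp: fun_eq_iff app_idop if_distrib[of "\<lambda>z. _ * z"] cong: if_cong)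
  have "app X x p = app (idop r * X * idop c) x p" using X by (simp add: Hom_def)
  also have "\<dots> = (if p < r then app X (app (idop c) x) p else 0)" by (simp add: app_idop)
  also have "app X (app (idop c) x) p = (\<Sum>q<c. entry X p q * x q)"
    unfolding e app_sum entry_def by (simp add: app_scale mult.commute)
  finally show ?thesis .
qed

lemma Hom_eqI: "X \<in> Hom r c \<Longrightarrow> Y \<in> Hom r c \<Longrightarrow> (\<And>p q. p < r \<Longrightarrow> q < c \<Longrightarrow> entry X p q = entry Y p q) \<Longrightarrow> X = Y"
  by (rule lop_eqI) (simp add: Hom_app)

lemma entry_zero: "X \<in> Hom r c \<Longrightarrow> \<not> (p < r \<and> q < c) \<Longrightarrow> entry X p q = 0"
  unfolding entry_def[of X p q] by (subst Hom_app) (auto intro!: sum.neutral)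

lemma entry_mult: "X \<in> Hom r m \<Longrightarrow> entry (X * Y) p q = (\<Sum>s<m. entry X p s * entry Y s q)"
proof -
  assume X: "X \<in> Hom r m"
  have "entry (X * Y) p q = (if p < r then \<Sum>s<m. entry X p s * entry Y s q else 0)"
    unfolding entry_def[of "X * Y"] by (simp add: Hom_app[OF X] entry_def[of Y])
  also have "\<dots> = (\<Sum>s<m. entry X p s * entry Y s q)" using entry_zero[OF X] by auto
  finally show ?thesis .
qed

lemma entry_simps [simp]: "entry 0 p q = 0" "entry (X + Y) p q = entry X p q + entry Y p q"
  "entry (X - Y) p q = entry X p q - entry Y p q" "entry (- X) p q = - entry X p q"
  "entry (scal c * X) p q = c * entry X p q"
  by (simp_all add: entry_def app_scal)

lemma entry_sum: "entry (\<Sum>s\<in>S. X s) p q = (\<Sum>s\<in>S. entry (X s) p q)"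
  by (induction S rule: infinite_finite_induct) auto

lemma entry_idop: "entry (idop d) p q = (if p = q \<and> p < d then 1 else 0)"
  by (simp add: entry_def app_idop)

lemma entry_mat_op: "entry (mat_op A) p q = (if p < dim_row A \<and> q < dim_col A then A $$ (p,q) else 0)"
  by (simp add: entry_def app_mat_op if_distrib[of "\<lambda>z. _ * z"] cong: if_cong)

lemma mat_op_Hom: "A \<in> carrier_mat r c \<Longrightarrow> mat_op A \<in> Hom r c"
  unfolding Hom_def by (auto intro!: lop_eqI sum.cong simp: app_idop app_mat_op)

lemma mat_op_one: "mat_op (1\<^sub>m d) = idop d"
  by (rule Hom_eqI[of _ d d]) (auto intro: mat_op_Hom Hom_idop simp: entry_mat_op entry_idop)

lemma mat_op_zero: "mat_op (0\<^sub>m r c) = 0"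
  by (rule Hom_eqI[of _ r c]) (auto intro: mat_op_Hom Hom_0 simp: entry_mat_op)

lemma mat_op_mult: "A \<in> carrier_mat r m \<Longrightarrow> B \<in> carrier_mat m c \<Longrightarrow> mat_op (A * B) = mat_op A * mat_op B"
  apply (rule Hom_eqI[of _ r c])
    apply (auto intro!: mat_op_Hom Hom_mult[of _ r m _ m c] mult_carrier_mat[of _ r m] simp: entry_mat_op)
  by (subst entry_mult[OF mat_op_Hom]) (auto simp: entry_mat_op scalar_prod_def atLeast0LessThan intro!: sum.cong)

lemma mat_op_pow: "A \<in> carrier_mat d d \<Longrightarrow> mat_op (A ^\<^sub>m t) = idop d * mat_op A ^ t"
proof (induction t)
  case 0 then show ?case by (simp add: mat_op_one)
next
  case (Suc t)
  then show ?case by (simp add: mat_op_mult[OF pow_carrier_mat] power_commutes mult.assoc)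
qed

lemma mat_of_carrier [simp]: "mat_of r c X \<in> carrier_mat r c"
  by (simp add: mat_of_def)

lemma mat_op_mat_of: "X \<in> Hom r c \<Longrightarrow> mat_op (mat_of r c X) = X"
  by (rule Hom_eqI[of _ r c]) (auto intro: mat_op_Hom simp: entry_mat_op mat_of_def)

lemma mat_of_mat_op: "A \<in> carrier_mat r c \<Longrightarrow> mat_of r c (mat_op A) = A"
  by (auto simp: mat_of_def entry_mat_op)

lemma mat_op_inj: "A \<in> carrier_mat r c \<Longrightarrow> B \<in> carrier_mat r c \<Longrightarrow> mat_op A = mat_op B \<Longrightarrow> A = B"
  by (metis mat_of_mat_op)

text \<open>If m < n, then X padded to a square matrix of size n has a zero column at position m,
  and the product cannot have determinant 1.\<close>

lemma Hom_dim_le: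
  assumes X: "X \<in> Hom n m" and Y: "Y \<in> Hom m n" and XY: "X * Y = (idop n :: 'a::field lop)"
  shows "n \<le> m"
proof (rule ccontr)
  assume "\<not> n \<le> m"
  then have m: "m < n" by simp
  let ?A = "mat_of n n X" and ?B = "mat_of n n Y"
  have H: "X \<in> Hom n n" "Y \<in> Hom n n" using X Y m by (auto intro: Hom_mono)
  have "mat_op (?A * ?B) = mat_op (1\<^sub>m n)"
    using XY by (simp add: mat_op_mult[of _ n n _ n] mat_op_mat_of[OF H(1)] mat_op_mat_of[OF H(2)] mat_op_one)
  then have "?A * ?B = 1\<^sub>m n" by (intro mat_op_inj[of _ n n] mult_carrier_mat[of _ n n]) auto
  then have d: "det ?A * det ?B = 1"
    by (metis det_mult det_one mat_of_carrier)
  have "?A *\<^sub>v unit_vec n m = 0\<^sub>v n"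
    using m entry_zero[OF X, of _ m] by (intro eq_vecI) (auto simp: mat_of_def)
  moreover have "unit_vec n m \<noteq> 0\<^sub>v n" using m by simp
  ultimately have "det ?A = 0"
    using det_0_iff_vec_prod_zero_field[OF mat_of_carrier[of n n X]] unit_vec_carrier by blast
  with d show False by simp
qed

lemma Hom_dim_eq:
  assumes "X \<in> Hom n m" "Y \<in> Hom m n" "X * Y = (idop n :: 'a::field lop)" "Y * X = idop m"
  shows "n = m"
  using Hom_dim_le assms by (meson le_antisym)

lemma unit_op_Hom: "p < r \<Longrightarrow> q < c \<Longrightarrow> unit_op p q \<in> Hom r c"
  unfolding Hom_def by (auto intro!: lop_eqI simp: app_unit_op app_idop)

lemma unit_op_sandwich: "unit_op a p * (X :: 'a::field lop) * unit_op q a = scal (entry X p q) * unit_op a a"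
proof (rule lop_eqI)
  fix x :: "nat \<Rightarrow> 'a" and s
  have e: "app (unit_op q a) x = (\<lambda>s. x a * (if s = q then 1 else 0))"
    by (auto simp: fun_eq_iff app_unit_op)
  show "app (unit_op a p * X * unit_op q a) x s = app (scal (entry X p q) * unit_op a a) x s"
    by (simp add: e app_unit_op app_scal app_scale entry_def)
qed

text \<open>The rank of e is taken as the largest r such that the identity of \<open>K^r\<close>
  factors as \<open>a * e * b\<close>. If the Schur complement \<open>e' = e - e * b * a * e\<close>
  had a nonzero entry, that entry would enlarge the factorization by one dimension. So
  \<open>e'\<close> vanishes, and \<open>e * b\<close> and \<open>a * e\<close> split e.\<close>

lemma idempotent_split:
  assumes e: "e \<in> Hom d d" "e * e = (e :: 'a::field lop)"
  shows "\<exists>r \<rho> \<pi>. \<rho> \<in> Hom d r \<and> \<pi> \<in> Hom r d \<and> \<rho> * \<pi> = e \<and> \<pi> * \<rho> = idop r"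
proof -
  define P where "P r = (\<exists>a\<in>Hom r d. \<exists>b\<in>Hom d r. a * e * b = idop r)" for r
  have P0: "P 0" unfolding P_def
    by (intro bexI[of _ 0]) (auto intro!: Hom_0 lop_eqI simp: app_idop)
  have bd: "r \<le> d" if "P r" for r
    using that unfolding P_def by (auto dest!: Hom_dim_le[rotated 2] intro: Hom_mult e(1))
  obtain r where r: "P r" "\<And>r'. P r' \<Longrightarrow> r' \<le> r"
    using Nat.ex_has_greatest_nat[of P 0 d] P0 bd by blast
  then obtain a b where ab: "a \<in> Hom r d" "b \<in> Hom d r" "a * e * b = idop r"
    unfolding P_def by blast
  have aeb: "a * (e * (b * Z)) = idop r * Z" for Z
    using ab(3) by (metis mult.assoc)
  define e' where "e' = e - e * b * a * e"
  have e'H: "e' \<in> Hom d d" unfolding e'_def by (blast intro: Hom_mult Hom_diff e ab)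
  have "e' = 0"
  proof (rule ccontr)
    assume "e' \<noteq> 0"
    then obtain p q where pq: "p < d" "q < d" "entry e' p q \<noteq> 0"
      using Hom_eqI[OF e'H Hom_0] by auto
    \<comment> \<open>The new row and column are corrected so as to be orthogonal to the old ones
      with respect to e: \<open>x * e * b = 0\<close>, \<open>a * e * y = 0\<close>, and
      \<open>x * e * y\<close> is the single new diagonal unit.\<close>
    define x where "x = unit_op r p * (idop d - e * b * a)"
    define y where "y = scal (inverse (entry e' p q)) * ((idop d - b * a * e) * unit_op q r)"
    have xH: "x \<in> Hom (Suc r) d" unfolding x_def
      by (rule Hom_mult[OF unit_op_Hom[of _ _ _ d]]) (use pq in \<open>auto intro: Hom_mult Hom_diff Hom_idop e ab\<close>)
    have yH: "y \<in> Hom d (Suc r)" unfolding y_def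
      by (rule Hom_scal, rule Hom_mult[OF _ unit_op_Hom[of _ d]]) (use pq in \<open>auto intro: Hom_mult Hom_diff Hom_idop e ab\<close>)
    have aey: "a * (e * y) = 0"
    proof -
      have "a * (e * ((idop d - b * a * e) * unit_op q r)) = 0"
        using ab e by (simp add: algebra_simps aeb Hom_rightA[OF e(1)] Hom_leftA[OF ab(1)])
      then show ?thesis unfolding y_def by (simp add: scal_left_comm)
    qed
    have xeb: "x * (e * b) = 0"
      unfolding x_def using ab e by (simp add: algebra_simps aeb Hom_leftA[OF e(1)] Hom_right[OF ab(2)])
    have xey: "x * (e * y) = unit_op r r"
    proof -
      have ee: "e * (e * Z) = e * Z" for Z using e(2) by (metis mult.assoc)
      have "(idop d - e * b * a) * (e * (idop d - b * a * e)) = e'"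
        unfolding e'_def using ab e
        by (simp add: algebra_simps aeb ee Hom_right[OF e(1)] Hom_left[OF e(1)] Hom_leftA[OF e(1)] Hom_leftA[OF ab(1)])
      then have "unit_op r p * ((idop d - e * b * a) * (e * (idop d - b * a * e))) * unit_op q r
          = scal (entry e' p q) * unit_op r r"
        by (simp add: unit_op_sandwich)
      then have "x * (e * ((idop d - b * a * e) * unit_op q r)) = scal (entry e' p q) * unit_op r r"
        unfolding x_def by (simp add: mult.assoc)
      moreover have "x * (e * y) = scal (inverse (entry e' p q)) * (x * (e * ((idop d - b * a * e) * unit_op q r)))"
        unfolding y_def by (simp add: scal_left_comm)
      ultimately show ?thesis using pq(3) by (simp add: mult.assoc[symmetric] scal_mult)
    qed
    have "(a + x) * e * (b + y) = idop r + unit_op r r"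
      using ab(3) aey xeb xey by (simp add: algebra_simps)
    also have "\<dots> = idop (Suc r)" by (rule lop_eqI) (auto simp: app_idop app_unit_op less_Suc_eq)
    finally have "P (Suc r)" unfolding P_def
      using ab xH yH by (meson Hom_add Hom_mono Suc_n_not_le_n le_refl nat_le_linear)
    with r(2) show False by fastforce
  qed
  then have "(e * b) * (a * e) = e" by (simp add: e'_def mult.assoc)
  moreover have "(a * e) * (e * b) = idop r"
    using ab(3) e(2) by (metis mult.assoc)
  ultimately show ?thesis using ab e by (meson Hom_mult)
qed

section \<open>Higman's criterion\<close>

lemma assoc_eq: "A * B = C \<Longrightarrow> A * (B * Z) = C * (Z :: 'r::ring_1)"
  by (simp add: mult.assoc[symmetric])

lemma pow_intertwine: "(p :: 'r::ring_1) * x = y * p \<Longrightarrow> p * x ^ t = y ^ t * p"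
proof (induction t)
  case (Suc t)
  have "p * x ^ Suc t = (p * x) * x ^ t" by (simp add: mult.assoc)
  also have "\<dots> = y * (p * x ^ t)" using Suc.prems by (simp add: mult.assoc)
  also have "\<dots> = y ^ Suc t * p" using Suc by (simp add: mult.assoc)
  finally show ?case .
qed simp

lemma sum_lessThan_split: "(\<Sum>t<a + (b::nat). g t) = (\<Sum>t<a. g t) + (\<Sum>t<b. g (a + t) :: 'r::comm_monoid_add)"
  by (induction b) (auto simp: add.assoc)

text \<open>Higman's trace map.  A module over \<open>K[x]/(x\<^sup>m)\<close> is free iff the identity is in its image.\<close>

definition higman :: "nat \<Rightarrow> 'r::ring_1 \<Rightarrow> 'r \<Rightarrow> 'r \<Rightarrow> 'r" where
  "higman m x Z y = (\<Sum>t<m. x ^ t * Z * y ^ (m - 1 - t))"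

text \<open>The difference telescopes. If \<open>x ^ m\<close> and \<open>y ^ m\<close> vanish, the
  trace of an arbitrary linear map Z is therefore a module map.\<close>

lemma higman_intertwine: "x * higman m x Z y - higman m x Z y * y = x ^ m * Z - Z * y ^ m"
proof -
  let ?a = "\<lambda>t. x ^ t * Z * y ^ (m - t)"
  have 1: "x * higman m x Z y = (\<Sum>t<m. ?a (Suc t))"
    unfolding higman_def by (simp add: sum_distrib_left mult.assoc)
  have 2: "higman m x Z y * y = (\<Sum>t<m. ?a t)"
    unfolding higman_def sum_distrib_right
  proof (rule sum.cong)
    fix t assume "t \<in> {..<m}"
    then have "m - t = Suc (m - 1 - t)" by auto
    then show "x ^ t * Z * y ^ (m - 1 - t) * y = ?a t" by (simp add: mult.assoc power_commutes)
  qed simp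
  have "x * higman m x Z y - higman m x Z y * y = (\<Sum>t<m. ?a (Suc t) - ?a t)"
    unfolding 1 2 by (rule sum_subtractf[symmetric])
  also have "\<dots> = ?a m - ?a 0" by (rule sum_lessThan_telescope)
  finally show ?thesis by simp
qed

lemma higman_left: "p * x = x' * p \<Longrightarrow> p * higman m x Z y = higman m x' (p * Z) y"
proof -
  assume "p * x = x' * p"
  then have "p * (x ^ t * W) = x' ^ t * (p * W)" for t W
    using assoc_eq[OF pow_intertwine] by (simp add: mult.assoc)
  then show ?thesis by (simp add: higman_def sum_distrib_left mult.assoc)
qed

lemma higman_right: "y * q = q * y' \<Longrightarrow> higman m x Z y * q = higman m x (Z * q) y'"
proof -
  assume "y * q = q * y'"
  then have "y ^ t * q = q * y' ^ t" for t by (intro pow_intertwine[symmetric]) simp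
  then show ?thesis by (simp add: higman_def sum_distrib_right mult.assoc)
qed

text \<open>Transitivity of the trace along K[x^f] inside K[x]: write each exponent as f b + a with
  a < f. Used with f = \<open>c i\<close> for freeness over the powers of E, and with f =
  \<open>rx a\<close> for freeness over the subalgebra in the relation of an arrow.\<close>

lemma higman_power:
  assumes "f > 0"
  shows "higman (f * m) x Z y = higman m (x ^ f) (higman f x Z y) (y ^ f)"
proof -
  have grp: "(\<Sum>t<f * m. g t) = (\<Sum>b<m. \<Sum>a<f. g (f * b + a) :: 'a)" for g
    by (induction m) (auto simp: sum_lessThan_split add.commute[of f])
  show ?thesis
    unfolding higman_def[of "f * m"] grp higman_def[of m]
  proof (rule sum.cong)
    fix b assume "b \<in> {..<m}"
    then obtain e where e: "m = Suc b + e" using less_iff_Suc_add by auto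
    have "f * m - 1 - (f * b + a) = (f - 1 - a) + f * (m - 1 - b)" if "a < f" for a
      using that unfolding e by (simp add: algebra_simps)
    then have "y ^ (f * m - 1 - (f * b + a)) = y ^ (f - 1 - a) * (y ^ f) ^ (m - 1 - b)" if "a < f" for a
      using that by (simp only: power_add power_mult)
    then show "(\<Sum>a<f. x ^ (f * b + a) * Z * y ^ (f * m - 1 - (f * b + a))) =
        (x ^ f) ^ b * higman f x Z y * (y ^ f) ^ (m - 1 - b)"
      unfolding higman_def sum_distrib_left sum_distrib_right
      by (intro sum.cong) (auto simp: mult.assoc power_add power_mult)
  qed simp
qed

lemma higman_Hom:
  "x \<in> Hom d d \<Longrightarrow> y \<in> Hom e e \<Longrightarrow> Z \<in> Hom d e \<Longrightarrow> higman m x Z y \<in> Hom d e"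
  unfolding higman_def by (intro Hom_sum Hom_mult_pow Hom_pow_mult) auto

text \<open>Over the self-injective algebra \<open>K[x]/(x\<^sup>k)\<close> a free module is exact:
  the kernel of \<open>x\<^bsup>k-l\<^esup>\<close> is the image of \<open>x\<^sup>l\<close>.\<close>

lemma higman_exact:
  assumes "higman k E \<Theta> E = u" "u * D = D" "l \<le> k" "E ^ (k - l) * D = 0"
  shows "D = E ^ l * (\<Sum>b<k - l. E ^ b * \<Theta> * E ^ (k - 1 - (l + b)) * D)"
proof -
  have "D = (\<Sum>b<l + (k - l). E ^ b * \<Theta> * E ^ (k - 1 - b) * D)"
    using assms by (simp add: higman_def sum_distrib_right[symmetric])
  also have "\<dots> = (\<Sum>b<l. E ^ b * \<Theta> * E ^ (k - 1 - b) * D)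
      + (\<Sum>b<k - l. E ^ (l + b) * \<Theta> * E ^ (k - 1 - (l + b)) * D)"
    by (rule sum_lessThan_split)
  also have "(\<Sum>b<l. E ^ b * \<Theta> * E ^ (k - 1 - b) * D) = 0"
  proof (rule sum.neutral, safe)
    fix b assume "b < l"
    then have "k - 1 - b = (l - 1 - b) + (k - l)" using assms(3) by simp
    then have "E ^ (k - 1 - b) * D = E ^ (l - 1 - b) * (E ^ (k - l) * D)"
      by (simp only: power_add mult.assoc)
    then show "E ^ b * \<Theta> * E ^ (k - 1 - b) * D = 0" using assms(4) by (simp add: mult.assoc)
  qed
  finally show ?thesis by (simp add: sum_distrib_left power_add mult.assoc)
qed

text \<open>Free modules are projective, with an explicit lift. \<open>D'\<close> is any linear lift
  of the module map D along p; the trace of \<open>D' * \<Theta>\<close> is equivariant and still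
  lies over D, since p moves inside the trace and D moves out again.\<close>

lemma higman_projective:
  assumes "higman m \<tau> \<Theta> \<tau> = u" "D * u = D" "D * \<tau> = \<tau>'' * D" "p * \<tau>' = \<tau>'' * p" "p * D' = D"
    and "\<tau> ^ m = 0" "\<tau>' ^ m = 0"
  shows "p * higman m \<tau>' (D' * \<Theta>) \<tau> = D" "\<tau>' * higman m \<tau>' (D' * \<Theta>) \<tau> = higman m \<tau>' (D' * \<Theta>) \<tau> * \<tau>"
proof -
  have "p * higman m \<tau>' (D' * \<Theta>) \<tau> = higman m \<tau>'' (D * \<Theta>) \<tau>"
    using assms(5) by (simp add: higman_left[OF assms(4)] mult.assoc[symmetric])
  also have "\<dots> = D * higman m \<tau> \<Theta> \<tau>" by (rule higman_left[OF assms(3), symmetric])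
  finally show "p * higman m \<tau>' (D' * \<Theta>) \<tau> = D" using assms by simp
  show "\<tau>' * higman m \<tau>' (D' * \<Theta>) \<tau> = higman m \<tau>' (D' * \<Theta>) \<tau> * \<tau>"
    using higman_intertwine[of \<tau>' m "D' * \<Theta>" \<tau>] assms by simp
qed

section \<open>Modules and their reductions\<close>

text \<open>\<open>Ar\<close> is the set of arrows, and the relation attached to an arrow \<open>a\<close> is
  \<open>\<epsilon>\<^bsup>lx a\<^esup> a = a \<epsilon>\<^bsup>rx a\<^esup>\<close>, where the loops are given the trivial relation.\<close>

locale quiver_relations =
  fixes n :: nat and Ar :: "arrow set" and c :: "nat \<Rightarrow> nat" and lx rx :: "arrow \<Rightarrow> nat"
  assumes Eps_Ar: "i < n \<Longrightarrow> Eps i \<in> Ar"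
    and tgt_lt: "a \<in> Ar \<Longrightarrow> tgt a < n" and src_lt: "a \<in> Ar \<Longrightarrow> src a < n"
    and c_pos: "i < n \<Longrightarrow> c i > 0"
    and c_factor: "a \<in> Ar \<Longrightarrow> \<exists>u. c (tgt a) = lx a * u \<and> c (src a) = rx a * u"
begin

definition is_rep :: "(nat \<Rightarrow> nat) \<Rightarrow> (arrow \<Rightarrow> 'a::field lop) \<Rightarrow> bool" where
  "is_rep d M \<longleftrightarrow> (\<forall>a\<in>Ar. M a \<in> Hom (d (tgt a)) (d (src a)))"

definition is_mod :: "nat \<Rightarrow> (nat \<Rightarrow> nat) \<Rightarrow> (arrow \<Rightarrow> 'a::field lop) \<Rightarrow> bool" where
  "is_mod k d M \<longleftrightarrow> is_rep d M \<and> (\<forall>i<n. M (Eps i) ^ (k * c i) = 0) \<and>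
     (\<forall>a\<in>Ar. M (Eps (tgt a)) ^ lx a * M a = M a * M (Eps (src a)) ^ rx a)"

text \<open>Ranks are absent because the dimension of a free module over K[x]/(x^m) determines its
  rank. \<open>free_of_rank_iff_higman\<close> makes the link to bases.\<close>

definition loc_free :: "nat \<Rightarrow> (nat \<Rightarrow> nat) \<Rightarrow> (arrow \<Rightarrow> 'a::field lop) \<Rightarrow> bool" where
  "loc_free k d M \<longleftrightarrow> is_mod k d M \<and>
     (\<forall>i<n. \<exists>\<Theta>\<in>Hom (d i) (d i). higman (k * c i) (M (Eps i)) \<Theta> (M (Eps i)) = idop (d i))"

definition hom ::
    "(nat \<Rightarrow> nat) \<Rightarrow> (arrow \<Rightarrow> 'a::field lop) \<Rightarrow> (nat \<Rightarrow> nat) \<Rightarrow> (arrow \<Rightarrow> 'a lop) \<Rightarrow> (nat \<Rightarrow> 'a lop) \<Rightarrow> bool" where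
  "hom d M d' N h \<longleftrightarrow> (\<forall>i<n. h i \<in> Hom (d' i) (d i)) \<and> (\<forall>a\<in>Ar. h (tgt a) * M a = N a * h (src a))"

text \<open>The mixed composites of \<open>p\<close> with \<open>\<iota>'\<close> and of
  \<open>p'\<close> with \<open>\<iota>\<close> vanish as a consequence; this is derived inside
  \<open>biprod_unique\<close>. The relations for A and B likewise follow from those of M.\<close>

definition biprod_by where
  "biprod_by d M d1 A d2 B \<iota> p \<iota>' p' \<longleftrightarrow> is_rep d1 A \<and> is_rep d2 B \<and>
     hom d1 A d M \<iota> \<and> hom d M d1 A p \<and> hom d2 B d M \<iota>' \<and> hom d M d2 B p' \<and>
     (\<forall>i<n. p i * \<iota> i = idop (d1 i) \<and> p' i * \<iota>' i = idop (d2 i) \<and>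
            \<iota> i * p i + \<iota>' i * p' i = idop (d i))"

definition biprod where
  "biprod d M d1 A d2 B \<longleftrightarrow> (\<exists>\<iota> p \<iota>' p'. biprod_by d M d1 A d2 B \<iota> p \<iota>' p')"

text \<open>\<open>N\<close> is the reduction \<open>M/EM\<close>, where \<open>E = \<epsilon>\<^bsup>c\<^esup>\<close>: the kernel of the surjection \<open>\<pi>\<close> is the
  image of \<open>E\<close>, as witnessed by \<open>\<rho>\<close> and \<open>\<kappa>\<close>.\<close>

definition reduces_by where
  "reduces_by d M s N \<pi> \<rho> \<kappa> \<longleftrightarrow> hom d M s N \<pi> \<and>
     (\<forall>i<n. \<rho> i \<in> Hom (d i) (s i) \<and> \<kappa> i \<in> Hom (d i) (d i) \<and> \<pi> i * \<rho> i = idop (s i) \<and>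
            \<rho> i * \<pi> i + M (Eps i) ^ c i * \<kappa> i = idop (d i))"

definition reduces where
  "reduces d M s N \<longleftrightarrow> (\<exists>\<pi> \<rho> \<kappa>. reduces_by d M s N \<pi> \<rho> \<kappa>)"

text \<open>A cocycle is a direction in which \<open>M\<close> can be deformed with its loops fixed; \<open>N\<close> is
  unobstructed if the action of \<open>End N\<close> by commutators on the cocycles has values in the coboundaries.\<close>

definition cocycle :: "(nat \<Rightarrow> nat) \<Rightarrow> (arrow \<Rightarrow> 'a::field lop) \<Rightarrow> (arrow \<Rightarrow> 'a lop) \<Rightarrow> bool" where
  "cocycle d M X \<longleftrightarrow> is_rep d X \<and> (\<forall>i<n. X (Eps i) = 0) \<and>
     (\<forall>a\<in>Ar. M (Eps (tgt a)) ^ lx a * X a = X a * M (Eps (src a)) ^ rx a)"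

definition unobstructed :: "(nat \<Rightarrow> nat) \<Rightarrow> (arrow \<Rightarrow> 'a::field lop) \<Rightarrow> bool" where
  "unobstructed s N \<longleftrightarrow> (\<forall>v X. hom s N s N v \<longrightarrow> cocycle s N X \<longrightarrow>
     (\<exists>h. (\<forall>i<n. h i \<in> Hom (s i) (s i)) \<and>
          (\<forall>a\<in>Ar. v (tgt a) * X a - X a * v (src a) = N a * h (src a) - h (tgt a) * N a)))"

lemma hom_Hom: "hom d M d' N h \<Longrightarrow> i < n \<Longrightarrow> h i \<in> Hom (d' i) (d i)"
  by (simp add: hom_def)

lemma hom_eq: "hom d M d' N h \<Longrightarrow> a \<in> Ar \<Longrightarrow> h (tgt a) * M a = N a * h (src a)"
  by (simp add: hom_def)

lemma hom_eqA: "hom d M d' N h \<Longrightarrow> a \<in> Ar \<Longrightarrow> h (tgt a) * (M a * Z) = N a * (h (src a) * Z)"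
  using assoc_eq[OF hom_eq] by (simp add: mult.assoc)

lemma hom_pow: "hom d M d' N h \<Longrightarrow> i < n \<Longrightarrow> h i * M (Eps i) ^ t = N (Eps i) ^ t * h i"
  using hom_eq[OF _ Eps_Ar, of d M d' N h i] by (intro pow_intertwine) auto

lemma hom_powA: "hom d M d' N h \<Longrightarrow> i < n \<Longrightarrow> h i * (M (Eps i) ^ t * Z) = N (Eps i) ^ t * (h i * Z)"
  using assoc_eq[OF hom_pow] by (simp add: mult.assoc)

lemma hom_comp: "hom d M d' N h \<Longrightarrow> hom d' N d'' L h' \<Longrightarrow> hom d M d'' L (\<lambda>i. h' i * h i)"
  unfolding hom_def by (auto intro: Hom_mult simp: mult.assoc) (metis mult.assoc)

lemma hom_id: "is_rep d M \<Longrightarrow> hom d M d M (\<lambda>i. idop (d i))"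
  unfolding hom_def is_rep_def by (auto intro: Hom_idop simp: Hom_left Hom_right)

lemma hom_diff: "hom d M d' N h \<Longrightarrow> hom d M d' N h' \<Longrightarrow> hom d M d' N (\<lambda>i. h i - h' i)"
  unfolding hom_def by (auto intro: Hom_diff simp: left_diff_distrib right_diff_distrib)

lemma biprod_by_sym: "biprod_by d M d1 A d2 B \<iota> p \<iota>' p' \<Longrightarrow> biprod_by d M d2 B d1 A \<iota>' p' \<iota> p"
  unfolding biprod_by_def by (auto simp: add.commute)

lemma is_mod_Hom: "is_mod k d M \<Longrightarrow> a \<in> Ar \<Longrightarrow> M a \<in> Hom (d (tgt a)) (d (src a))"
  by (simp add: is_mod_def is_rep_def)

lemma is_mod_Eps: "is_mod k d M \<Longrightarrow> i < n \<Longrightarrow> M (Eps i) \<in> Hom (d i) (d i)"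
  using is_mod_Hom[OF _ Eps_Ar] by fastforce

lemma is_mod_rel: "is_mod k d M \<Longrightarrow> a \<in> Ar \<Longrightarrow> M (Eps (tgt a)) ^ lx a * M a = M a * M (Eps (src a)) ^ rx a"
  by (simp add: is_mod_def)

text \<open>The exponents of the relation divide the two \<open>c\<close>-values with the same
  quotient u, so its u-th power says that X commutes with E. This holds for arrows and cocycles
  alike.\<close>

lemma rel_E:
  fixes M :: "arrow \<Rightarrow> 'a::field lop"
  assumes "a \<in> Ar" "M (Eps (tgt a)) ^ lx a * X = X * M (Eps (src a)) ^ rx a"
  shows "M (Eps (tgt a)) ^ c (tgt a) * X = X * M (Eps (src a)) ^ c (src a)"
proof -
  obtain u where u: "c (tgt a) = lx a * u" "c (src a) = rx a * u" using c_factor assms by blast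
  show ?thesis unfolding u power_mult using pow_intertwine[of X "M (Eps (src a)) ^ rx a" "M (Eps (tgt a)) ^ lx a" u] assms(2) by simp
qed

lemma is_mod_E: "is_mod k d M \<Longrightarrow> a \<in> Ar \<Longrightarrow> M (Eps (tgt a)) ^ c (tgt a) * M a = M a * M (Eps (src a)) ^ c (src a)"
  by (rule rel_E) (auto simp: is_mod_rel)

lemma is_mod_summand:
  assumes M: "is_mod k d M" and b: "biprod_by d M d1 A d2 B \<iota> p \<iota>' p'"
  shows "is_mod k d1 A"
proof -
  have h: "hom d1 A d M \<iota>" "hom d M d1 A p" "is_rep d1 A" and pi: "\<And>i. i < n \<Longrightarrow> p i * \<iota> i = idop (d1 i)"
    using b by (auto simp: biprod_by_def)
  have AH: "A a \<in> Hom (d1 (tgt a)) (d1 (src a))" if "a \<in> Ar" for a using h(3) that by (simp add: is_rep_def)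
  have Aeq: "A a = p (tgt a) * (M a * \<iota> (src a))" if a: "a \<in> Ar" for a
    using hom_eqA[OF h(2) a] pi[OF src_lt[OF a]] Hom_right[OF AH[OF a]] by simp
  have Apow: "A (Eps i) ^ t * X = p i * (M (Eps i) ^ t * (\<iota> i * X))" if "i < n" "idop (d1 i) * X = X" for i t X
    using hom_powA[OF h(2) that(1)] assoc_eq[OF pi[OF that(1)]] that(2) by simp
  have "A (Eps i) ^ (k * c i) = 0" if i: "i < n" for i
  proof (cases "k * c i = 0")
    case True
    \<comment> \<open>A contradictory case, since a zeroth power is 1 and 1 is nonzero in the ring
      of operators.\<close>
    then have "M (Eps i) ^ 0 = 0" using M i unfolding is_mod_def by metis
    then show ?thesis by simp
  next
    case False
    have A0: "A (Eps i) ^ (k * c i) \<in> Hom (d1 i) (d1 i)" using AH[OF Eps_Ar[OF i]] False by (auto intro: Hom_pow)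
    have "A (Eps i) ^ (k * c i) = A (Eps i) ^ (k * c i) * idop (d1 i)" using Hom_right[OF A0] by simp
    also have "\<dots> = 0" using Apow[OF i, of "idop (d1 i)"] M i by (simp add: is_mod_def idop_idem)
    finally show ?thesis .
  qed
  moreover have "A (Eps (tgt a)) ^ lx a * A a = A a * A (Eps (src a)) ^ rx a" if a: "a \<in> Ar" for a
  proof -
    have "A (Eps (tgt a)) ^ lx a * A a = p (tgt a) * (M (Eps (tgt a)) ^ lx a * (\<iota> (tgt a) * A a))"
      by (rule Apow) (use a tgt_lt[OF a] Hom_left[OF AH[OF a]] in auto)
    also have "\<dots> = p (tgt a) * ((M (Eps (tgt a)) ^ lx a * M a) * \<iota> (src a))"
      using hom_eq[OF h(1) a] by (simp add: mult.assoc)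
    also have "\<dots> = p (tgt a) * (M a * (M (Eps (src a)) ^ rx a * \<iota> (src a)))"
      unfolding is_mod_rel[OF M a] by (simp add: mult.assoc)
    also have "M (Eps (src a)) ^ rx a * \<iota> (src a) = \<iota> (src a) * A (Eps (src a)) ^ rx a"
      using hom_pow[OF h(1) src_lt[OF a]] by simp
    also have "p (tgt a) * (M a * (\<iota> (src a) * A (Eps (src a)) ^ rx a)) = A a * A (Eps (src a)) ^ rx a"
      unfolding Aeq[OF a, symmetric] using Aeq[OF a] by (simp add: mult.assoc)
    finally show ?thesis .
  qed
  ultimately show ?thesis using h(3) by (simp add: is_mod_def)
qed

text \<open>The trace commutes with module maps, so compressing \<open>\<Theta>\<close> to the
  summand solves Higman's equation there.\<close>

lemma loc_free_summand:
  assumes M: "loc_free k d M" and b: "biprod_by d M d1 A d2 B \<iota> p \<iota>' p'"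
  shows "loc_free k d1 A"
proof -
  have h: "hom d1 A d M \<iota>" "hom d M d1 A p" and pi: "\<And>i. i < n \<Longrightarrow> p i * \<iota> i = idop (d1 i)"
    using b by (auto simp: biprod_by_def)
  have "\<exists>\<Theta>\<in>Hom (d1 i) (d1 i). higman (k * c i) (A (Eps i)) \<Theta> (A (Eps i)) = idop (d1 i)" if i: "i < n" for i
  proof -
    obtain \<Theta> where \<Theta>: "\<Theta> \<in> Hom (d i) (d i)" "higman (k * c i) (M (Eps i)) \<Theta> (M (Eps i)) = idop (d i)"
      using M i by (auto simp: loc_free_def)
    have e: "p i * M (Eps i) = A (Eps i) * p i" "M (Eps i) * \<iota> i = \<iota> i * A (Eps i)"
      using hom_eq[OF h(2) Eps_Ar[OF i]] hom_eq[OF h(1) Eps_Ar[OF i]] by auto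
    have "higman (k * c i) (A (Eps i)) (p i * \<Theta> * \<iota> i) (A (Eps i)) = p i * idop (d i) * \<iota> i"
      unfolding \<Theta>(2)[symmetric] higman_left[OF e(1)] higman_right[OF e(2)] by simp
    also have "\<dots> = idop (d1 i)" using pi[OF i] Hom_right[OF hom_Hom[OF h(2) i]] by simp
    finally show ?thesis using \<Theta>(1) hom_Hom[OF h(1) i] hom_Hom[OF h(2) i] by (meson Hom_mult)
  qed
  moreover have "is_mod k d1 A" using is_mod_summand[OF _ b] M by (auto simp: loc_free_def)
  ultimately show ?thesis by (simp add: loc_free_def)
qed

text \<open>The idempotent and its complement are split at each vertex separately; because they
  commute with the arrows, the splitting maps become module maps for the compressed arrows.\<close>

lemma is_mod_split:
  assumes M: "is_mod k d M" and e: "hom d M d M e" "\<And>i. i < n \<Longrightarrow> e i * e i = e i"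
  shows "\<exists>d1 A d2 B \<iota> p \<iota>' p'. biprod_by d M d1 A d2 B \<iota> p \<iota>' p' \<and> (\<forall>i<n. \<iota> i * p i = e i)"
proof -
  define f where "f i = idop (d i) - e i" for i
  have eH: "\<And>i. i < n \<Longrightarrow> e i \<in> Hom (d i) (d i)" using e(1) by (simp add: hom_def)
  have f: "f i \<in> Hom (d i) (d i)" "f i * f i = f i" if "i < n" for i
    using eH[OF that] e(2)[OF that] unfolding f_def
    by (auto intro: Hom_diff Hom_idop simp: algebra_simps idop_idem Hom_left Hom_right)
  have fh: "hom d M d M f" unfolding f_def using e(1) M by (intro hom_diff hom_id) (auto simp: is_mod_def)
  have sp: "\<exists>d1 A \<iota> p. is_rep d1 A \<and> hom d1 A d M \<iota> \<and> hom d M d1 A p \<and>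
       (\<forall>i<n. p i * \<iota> i = idop (d1 i) \<and> \<iota> i * p i = g i)"
    if g: "hom d M d M g" "\<And>i. i < n \<Longrightarrow> g i * g i = g i" for g
  proof -
    have "\<forall>i. \<exists>r \<rho> \<pi>. i < n \<longrightarrow> \<rho> \<in> Hom (d i) r \<and> \<pi> \<in> Hom r (d i) \<and> \<rho> * \<pi> = g i \<and> \<pi> * \<rho> = idop r"
      using idempotent_split hom_Hom[OF g(1)] g(2) by blast
    then obtain r \<rho> \<pi> where r: "\<And>i. i < n \<Longrightarrow> \<rho> i \<in> Hom (d i) (r i) \<and> \<pi> i \<in> Hom (r i) (d i) \<and>
        \<rho> i * \<pi> i = g i \<and> \<pi> i * \<rho> i = idop (r i)" by metis
    have H: "\<rho> i \<in> Hom (d i) (r i)" "\<pi> i \<in> Hom (r i) (d i)" if "i < n" for i using r[OF that] by auto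
    have \<rho>\<pi>: "\<rho> i * (\<pi> i * Z) = g i * Z" if "i < n" for i Z using r[OF that] by (intro assoc_eq) auto
    have g\<rho>: "g i * \<rho> i = \<rho> i" if "i < n" for i
      using \<rho>\<pi>[OF that, of "\<rho> i"] r[OF that] Hom_right[OF H(1)[OF that]] by simp
    have \<pi>\<rho>: "\<pi> i * (\<rho> i * Z) = idop (r i) * Z" if "i < n" for i Z using r[OF that] by (intro assoc_eq) auto
    have \<pi>g: "\<pi> i * (g i * Z) = \<pi> i * Z" if "i < n" for i Z
      using \<pi>\<rho>[OF that, of "\<pi> i * Z"] \<rho>\<pi>[OF that, of Z] Hom_leftA[OF H(2)[OF that]] by simp
    define A where "A a = \<pi> (tgt a) * M a * \<rho> (src a)" for a
    have 1: "is_rep r A" unfolding is_rep_def A_def using H tgt_lt src_lt is_mod_Hom[OF M] by (meson Hom_mult)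
    have 2: "hom r A d M \<rho>" unfolding hom_def
    proof safe
      fix a assume a: "a \<in> Ar"
      have "\<rho> (tgt a) * A a = g (tgt a) * (M a * \<rho> (src a))"
        unfolding A_def by (simp add: mult.assoc \<rho>\<pi>[OF tgt_lt[OF a]])
      also have "\<dots> = M a * (g (src a) * \<rho> (src a))" by (rule hom_eqA[OF g(1) a])
      finally show "\<rho> (tgt a) * A a = M a * \<rho> (src a)" by (simp add: g\<rho>[OF src_lt[OF a]])
    qed (use H in auto)
    have 3: "hom d M r A \<pi>" unfolding hom_def
    proof safe
      fix a assume a: "a \<in> Ar"
      have "A a * \<pi> (src a) = \<pi> (tgt a) * (M a * (\<rho> (src a) * \<pi> (src a)))"
        unfolding A_def by (simp add: mult.assoc)
      also have "\<dots> = \<pi> (tgt a) * (g (tgt a) * M a)"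
        using hom_eq[OF g(1) a] r[OF src_lt[OF a]] by simp
      finally show "\<pi> (tgt a) * M a = A a * \<pi> (src a)" by (simp add: \<pi>g[OF tgt_lt[OF a]])
    qed (use H in auto)
    show ?thesis using 1 2 3 r by blast
  qed
  obtain d1 A \<iota> p where 1: "is_rep d1 A" "hom d1 A d M \<iota>" "hom d M d1 A p"
       "\<forall>i<n. p i * \<iota> i = idop (d1 i) \<and> \<iota> i * p i = e i" using sp[OF e] by blast
  obtain d2 B \<iota>' p' where 2: "is_rep d2 B" "hom d2 B d M \<iota>'" "hom d M d2 B p'"
       "\<forall>i<n. p' i * \<iota>' i = idop (d2 i) \<and> \<iota>' i * p' i = f i" using sp[OF fh f(2)] by blast
  have "biprod_by d M d1 A d2 B \<iota> p \<iota>' p'" unfolding biprod_by_def using 1 2 by (simp add: f_def)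
  with 1 show ?thesis by blast
qed

end

section \<open>Free modules over truncated polynomial rings\<close>

lemma higman_Suc_left: "higman (Suc m) x \<Theta> y = x * higman m x \<Theta> y + \<Theta> * y ^ m"
  unfolding higman_def sum.lessThan_Suc_shift by (simp add: sum_distrib_left mult.assoc add.commute)

lemma higman_Suc_right: "higman (Suc m) x \<Theta> y = higman m x \<Theta> y * y + x ^ m * \<Theta>"
proof -
  have "(\<Sum>t<m. x ^ t * \<Theta> * y ^ (m - t)) = (\<Sum>t<m. x ^ t * \<Theta> * y ^ (m - 1 - t) * y)"
  proof (rule sum.cong)
    fix t assume "t \<in> {..<m}"
    then have "m - t = Suc (m - 1 - t)" by auto
    then show "x ^ t * \<Theta> * y ^ (m - t) = x ^ t * \<Theta> * y ^ (m - 1 - t) * y"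
      by (simp add: mult.assoc power_commutes)
  qed simp
  then show ?thesis by (simp add: higman_def sum_distrib_right)
qed

text \<open>With m = l + 1, the operator \<open>f = \<Theta> * \<tau> ^ l\<close> is an idempotent
  whose kernel is the image of \<open>\<tau>\<close>. Its image B is thus a complement of that
  image, which is the span of a basis. \<open>R t\<close> reads off the coefficient of
  \<open>\<tau> ^ t\<close>.\<close>

lemma free_basis:
  fixes \<tau> \<Theta> :: "'a::field lop"
  assumes H: "\<tau> \<in> Hom d d" "\<Theta> \<in> Hom d d" and nil: "\<tau> ^ m = 0" and "m > 0"
    and hig: "higman m \<tau> \<Theta> \<tau> = idop d"
  shows "\<exists>r B R. B \<in> Hom d r \<and> (\<forall>t. R t \<in> Hom r d) \<and> (\<Sum>t<m. \<tau> ^ t * B * R t) = idop d \<and>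
      (\<forall>u<m. \<forall>t<m. R u * (\<tau> ^ t * B) = (if u = t then idop r else 0))"
proof -
  obtain l where m: "m = Suc l" using \<open>m > 0\<close> gr0_implies_Suc by blast
  define f where "f = \<Theta> * \<tau> ^ l"
  define S where "S = higman l \<tau> \<Theta> \<tau>"
  have \<tau>S: "\<tau> * S + f = idop d" using hig unfolding m S_def f_def higman_Suc_left .
  have S\<tau>: "S * \<tau> + \<tau> ^ l * \<Theta> = idop d" using hig unfolding m S_def higman_Suc_right .
  have ll: "\<tau> ^ l * \<tau> = 0" "\<tau> * \<tau> ^ l = 0" using nil unfolding m by (simp_all add: power_commutes)
  have f\<tau>: "f * \<tau> = 0" using ll by (simp add: f_def mult.assoc)
  have fH: "f \<in> Hom d d" unfolding f_def using H by (intro Hom_mult_pow)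
  have SH: "S \<in> Hom d d" unfolding S_def using H by (intro higman_Hom)
  have \<tau>loc_free: "\<tau> ^ l * f = \<tau> ^ l * idop d"
    unfolding \<tau>S[symmetric] by (simp add: distrib_left mult.assoc[symmetric] ll)
  have ff: "f * f = f"
  proof -
    have "f * f = \<Theta> * (\<tau> ^ l * f)" by (simp add: f_def mult.assoc)
    also have "\<dots> = f * idop d" unfolding \<tau>loc_free by (simp add: f_def mult.assoc)
    finally show ?thesis using Hom_right[OF fH] by simp
  qed
  obtain r B \<pi> where B: "B \<in> Hom d r" "\<pi> \<in> Hom r d" "B * \<pi> = f" "\<pi> * B = idop r"
    using idempotent_split[OF fH ff] by blast
  have \<pi>f: "\<pi> * f = \<pi>" using assoc_eq[OF B(4), of \<pi>] B Hom_left[OF B(2)] by simp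
  have fB: "f * B = B" using assoc_eq[OF B(3), of B] B Hom_right[OF B(1)] by simp
  have \<pi>\<tau>: "\<pi> * \<tau> = 0" using assoc_eq[OF \<pi>f, of \<tau>] f\<tau> by simp
  \<comment> \<open>S is a right inverse of \<open>\<tau>\<close> up to f. Subtracting
    \<open>S * f\<close> preserves this and in addition makes \<open>S'\<close> kill B, so that
    \<open>S'\<close> lowers the power of \<open>\<tau>\<close> in an expansion by one.\<close>
  define S' where "S' = S - S * f"
  have S'H: "S' \<in> Hom d d" unfolding S'_def using SH fH by (intro Hom_diff Hom_mult)
  have \<tau>S'': "\<tau> * S = idop d - f" using \<tau>S by (simp add: algebra_simps)
  have \<tau>S': "f + \<tau> * S' = idop d"
    unfolding S'_def right_diff_distrib mult.assoc[symmetric] \<tau>S'' using ff Hom_left[OF fH]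
    by (simp add: left_diff_distrib)
  have S'\<tau>: "S' * \<tau> = idop d - \<tau> ^ l * \<Theta>"
    unfolding S'_def left_diff_distrib mult.assoc f\<tau> using S\<tau> by (simp add: algebra_simps)
  have S'B: "S' * B = 0" unfolding S'_def left_diff_distrib mult.assoc fB by simp
  define R where "R t = \<pi> * S' ^ t" for t
  have RH: "R t \<in> Hom r d" for t unfolding R_def using B S'H by (intro Hom_mult_pow)
  have "idop d = (\<Sum>t<j. \<tau> ^ t * B * R t) + \<tau> ^ j * (idop d * S' ^ j)" for j
  proof (induction j)
    case (Suc j)
    have "idop d * S' ^ j = B * R j + \<tau> * S' ^ Suc j"
      unfolding \<tau>S'[symmetric] B(3)[symmetric] R_def by (simp add: distrib_right mult.assoc)
    then have "\<tau> ^ j * (idop d * S' ^ j) = \<tau> ^ j * B * R j + \<tau> ^ Suc j * S' ^ Suc j"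
      by (simp add: distrib_left mult.assoc power_commutes[symmetric])
    also have "S' ^ Suc j = idop d * S' ^ Suc j" using Hom_leftA[OF S'H] by simp
    finally show ?case using Suc by (simp add: add.assoc)
  qed simp
  from this[of m] have sum: "(\<Sum>t<m. \<tau> ^ t * B * R t) = idop d" using nil by simp
  \<comment> \<open>\<open>S' * \<tau>\<close> differs from the identity by
    \<open>\<tau> ^ l * \<Theta>\<close>; the premise is what removes this term. It holds for u < l,
    so the recursion runs over all of the basis.\<close>
  have rec: "R (Suc u) * \<tau> ^ Suc t = R u * \<tau> ^ t" if "R u * \<tau> ^ l = 0" for u t
  proof -
    have "R (Suc u) * \<tau> ^ Suc t = R u * ((S' * \<tau>) * \<tau> ^ t)"
      unfolding R_def power_Suc2[of S'] power_Suc[of \<tau>] by (simp add: mult.assoc)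
    also have "\<dots> = R u * \<tau> ^ t - (R u * \<tau> ^ l) * (\<Theta> * \<tau> ^ t)"
      unfolding S'\<tau> using Hom_rightA[OF RH] by (simp add: algebra_simps)
    finally show ?thesis using that by simp
  qed
  have Q: "(\<forall>x>u. R u * \<tau> ^ x = 0) \<and> (\<forall>t\<le>u. R u * \<tau> ^ t = R (u - t))" if "u < m" for u
    using that
  proof (induction u)
    case 0
    have "\<pi> * \<tau> ^ x = 0" if "x > 0" for x
      using that assoc_eq[OF \<pi>\<tau>, of "\<tau> ^ (x - 1)"] by (cases x) auto
    then show ?case by (auto simp: R_def)
  next
    case (Suc u)
    then have IH: "\<And>x. x > u \<Longrightarrow> R u * \<tau> ^ x = 0" "\<And>t. t \<le> u \<Longrightarrow> R u * \<tau> ^ t = R (u - t)" by auto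
    have "R u * \<tau> ^ l = 0" using IH(1) Suc.prems m by auto
    note r = rec[OF this]
    show ?case
    proof (intro conjI allI impI)
      fix x assume "Suc u < x"
      then show "R (Suc u) * \<tau> ^ x = 0" using r[of "x - 1"] IH(1)[of "x - 1"] by (cases x) auto
    next
      fix t assume "t \<le> Suc u"
      then show "R (Suc u) * \<tau> ^ t = R (Suc u - t)" using r[of "t - 1"] IH(2)[of "t - 1"] by (cases t) auto
    qed
  qed
  have "R u * (\<tau> ^ t * B) = (if u = t then idop r else 0)" if "u < m" "t < m" for u t
  proof -
    have "R (Suc j) * B = 0" for j
      unfolding R_def power_Suc2 using S'B by (simp add: mult.assoc)
    then have RB: "R j * B = (if j = 0 then idop r else 0)" for j
      by (cases j) (auto simp: R_def B(4))
    have "R u * (\<tau> ^ t * B) = (R u * \<tau> ^ t) * B" by (simp add: mult.assoc)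
    also have "\<dots> = (if u = t then idop r else 0)"
    proof (cases "t \<le> u")
      case True then show ?thesis using Q[OF that(1)] RB[of "u - t"] by auto
    next
      case False then show ?thesis using Q[OF that(1)] by auto
    qed
    finally show ?thesis .
  qed
  then show ?thesis using B(1) RH sum by blast
qed

text \<open>K^(m r) is cut into m consecutive blocks of length r. The coordinate maps of block t
  serve to compare d with \<open>m * r\<close> and, in \<open>free_exists\<close>, to build a
  standard free module.\<close>

lift_definition block_proj :: "nat \<Rightarrow> nat \<Rightarrow> 'a::field lop" is
  "\<lambda>r t x p. if p < r then x (t * r + p) else 0"
  by (auto simp: fun_eq_iff)

lift_definition block_incl :: "nat \<Rightarrow> nat \<Rightarrow> 'a::field lop" is
  "\<lambda>r t x p. if t * r \<le> p \<and> p < t * r + r then x (p - t * r) else 0"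
  by (auto simp: fun_eq_iff)

lemma block_proj_Hom: "t < m \<Longrightarrow> block_proj r t \<in> Hom r (m * r)" and block_incl_Hom: "t < m \<Longrightarrow> block_incl r t \<in> Hom (m * r) r"
proof -
  assume "t < m"
  then have "Suc t * r \<le> m * r" by (intro mult_le_mono1) auto
  then have "t * r + r \<le> m * r" by simp
  then show "block_proj r t \<in> Hom r (m * r)" "block_incl r t \<in> Hom (m * r) r"
    by (auto intro!: Hom_I lop_eqI simp: block_proj.rep_eq block_incl.rep_eq app_idop)
qed

lemma block_proj_block_incl: "block_proj r t * block_incl r u = (if u = t then idop r else 0)"
proof -
  have disj: "\<not> (u * r \<le> t * r + p \<and> t * r + p < u * r + r)" if "u \<noteq> t" "p < r" for p
  proof -
    have "(t * r + p) div r = t" using that by simp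
    moreover have "(u * r + q) div r = u" if "q < r" for q using that by simp
    ultimately show ?thesis using that
      by (metis add_diff_inverse_nat add_less_cancel_left not_less)
  qed
  then show ?thesis
    by (auto intro!: lop_eqI simp: block_proj.rep_eq block_incl.rep_eq app_idop)
qed

lemma sum_block_incl_block_proj: "(\<Sum>t<j. block_incl r t * block_proj r t) = idop (j * r)"
proof (induction j)
  case 0 show ?case by (rule lop_eqI) (simp add: app_idop)
next
  case (Suc j)
  have "idop (j * r) + block_incl r j * block_proj r j = idop (Suc j * r)"
    by (rule lop_eqI) (auto simp: block_proj.rep_eq block_incl.rep_eq app_idop)
  with Suc show ?case by simp
qed

lemma free_basis_dim:
  fixes \<tau> B :: "'a::field lop"
  assumes H: "\<tau> \<in> Hom d d" "B \<in> Hom d r" "\<And>t. R t \<in> Hom r d" and "(\<Sum>t<m. \<tau> ^ t * B * R t) = idop d"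
    and dual: "\<And>u t. u < m \<Longrightarrow> t < m \<Longrightarrow> R u * (\<tau> ^ t * B) = (if u = t then idop r else 0)"
  shows "d = m * r"
proof -
  define V W where "V t = (block_proj r t :: 'a lop)" and "W t = (block_incl r t :: 'a lop)" for t
  have VH: "V t \<in> Hom r (m * r)" and WH: "W t \<in> Hom (m * r) r" if "t < m" for t
    using that unfolding V_def W_def by (auto intro: block_proj_Hom block_incl_Hom)
  have VW: "V t * W u = (if u = t then idop r else 0)" for t u
    unfolding V_def W_def by (rule block_proj_block_incl)
  have WV: "(\<Sum>t<j. W t * V t) = idop (j * r)" for j unfolding V_def W_def by (rule sum_block_incl_block_proj)
  define G G' where "G = (\<Sum>t<m. \<tau> ^ t * B * V t)" and "G' = (\<Sum>t<m. W t * R t)"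
  have "G \<in> Hom d (m * r)" unfolding G_def
    by (intro Hom_sum Hom_mult[OF Hom_pow_mult[OF H(1,2)] VH]) auto
  moreover have "G' \<in> Hom (m * r) d" unfolding G'_def by (intro Hom_sum Hom_mult[OF WH H(3)]) auto
  moreover have "G * G' = idop d"
  proof -
    have "G * G' = (\<Sum>t<m. \<Sum>u<m. \<tau> ^ t * B * (V t * W u) * R u)"
      by (simp add: G_def G'_def sum_distrib_left sum_distrib_right mult.assoc) (rule sum.swap)
    also have "\<dots> = (\<Sum>t<m. \<Sum>u<m. if u = t then \<tau> ^ t * B * R t else 0)"
      by (intro sum.cong) (auto simp: VW mult.assoc Hom_left[OF H(3)])
    finally show ?thesis using assms(4) by simp
  qed
  moreover have "G' * G = idop (m * r)"
  proof -
    have "G' * G = (\<Sum>u<m. \<Sum>t<m. W u * (R u * (\<tau> ^ t * B)) * V t)"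
      by (simp add: G_def G'_def sum_distrib_left sum_distrib_right mult.assoc) (rule sum.swap)
    also have "\<dots> = (\<Sum>u<m. \<Sum>t<m. if t = u then W u * V u else 0)"
    proof (intro sum.cong refl)
      fix u t assume "u \<in> {..<m}" "t \<in> {..<m}"
      then show "W u * (R u * (\<tau> ^ t * B)) * V t = (if t = u then W u * V u else 0)"
        using dual[of u t] Hom_left[OF VH] by (auto simp: mult.assoc)
    qed
    finally show ?thesis using WV by simp
  qed
  ultimately show ?thesis by (rule Hom_dim_eq)
qed

text \<open>Equal dimension forces equal rank, and the isomorphism sends \<open>x ^ t * B\<close> to
  \<open>y ^ t * B'\<close>. This is what allows all locally free modules of one rank vector to be
  given the same loops.\<close>

lemma free_iso:
  fixes x y :: "'a::field lop"
  assumes H: "x \<in> Hom d d" "\<Theta> \<in> Hom d d" "y \<in> Hom d d" "\<Phi> \<in> Hom d d" and nil: "x ^ m = 0" "y ^ m = 0" and m: "m > 0"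
    and hig: "higman m x \<Theta> x = idop d" "higman m y \<Phi> y = idop d"
  shows "\<exists>g\<in>Hom d d. \<exists>g'\<in>Hom d d. g * g' = idop d \<and> g' * g = idop d \<and> g * x = y * g"
proof -
  obtain r B R where B: "B \<in> Hom d r" "\<And>t. R t \<in> Hom r d" "(\<Sum>t<m. x ^ t * B * R t) = idop d"
      "\<And>u t. u < m \<Longrightarrow> t < m \<Longrightarrow> R u * (x ^ t * B) = (if u = t then idop r else 0)"
    using free_basis[OF H(1,2) nil(1) m hig(1)] by blast
  obtain r' B' R' where B': "B' \<in> Hom d r'" "\<And>t. R' t \<in> Hom r' d" "(\<Sum>t<m. y ^ t * B' * R' t) = idop d"
      "\<And>u t. u < m \<Longrightarrow> t < m \<Longrightarrow> R' u * (y ^ t * B') = (if u = t then idop r' else 0)"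
    using free_basis[OF H(3,4) nil(2) m hig(2)] by blast
  have "m * r = m * r'" using free_basis_dim[OF H(1) B] free_basis_dim[OF H(3) B'] by metis
  then have rr: "r' = r" using m by simp
  note B' = B'[unfolded rr]
  define T where "T z A P = (\<Sum>t<m. z ^ t * A * P t)" for z A :: "'a lop" and P
  have TB: "T z A P * (w ^ u * C) = z ^ u * A"
    if "u < m" "A \<in> Hom d r" "\<And>u t. u < m \<Longrightarrow> t < m \<Longrightarrow> P u * (w ^ t * C) = (if u = t then idop r else 0)" for z A P w C u
  proof -
    have "T z A P * (w ^ u * C) = (\<Sum>t<m. if t = u then z ^ t * A else 0)"
      unfolding T_def sum_distrib_right
      by (intro sum.cong) (use that Hom_right[OF that(2)] in \<open>auto simp: mult.assoc\<close>)
    then show ?thesis using that(1) by simp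
  qed
  have comp: "T z A P * T w C P' = T z A P'"
    if "A \<in> Hom d r" "\<And>u t. u < m \<Longrightarrow> t < m \<Longrightarrow> P u * (w ^ t * C) = (if u = t then idop r else 0)" for z A P w C P'
  proof -
    have "T z A P * T w C P' = (\<Sum>t<m. (T z A P * (w ^ t * C)) * P' t)"
      unfolding T_def[of w] by (simp add: sum_distrib_left mult.assoc)
    also have "\<dots> = T z A P'" unfolding T_def[of z A P']
      by (intro sum.cong) (use TB[OF _ that] in auto)
    finally show ?thesis .
  qed
  have TH: "T z A P \<in> Hom d d" if "z \<in> Hom d d" "A \<in> Hom d r" "\<And>t. P t \<in> Hom r d" for z A P
    unfolding T_def by (intro Hom_sum Hom_mult[OF Hom_pow_mult[OF that(1,2)] that(3)])
  define g g' where "g = T y B' R" and "g' = T x B R'"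
  have gx: "g * (x ^ u * B) = y ^ u * B'" if "u \<le> m" for u
    using TB[OF _ B'(1) B(4), of u y] that nil unfolding g_def by (cases "u = m") auto
  have "g * x = g * x * T x B R" using B(3) Hom_right[OF H(1)] by (simp add: T_def mult.assoc)
  also have "\<dots> = (\<Sum>t<m. (g * (x ^ Suc t * B)) * R t)"
    unfolding T_def by (simp add: sum_distrib_left mult.assoc)
  also have "\<dots> = (\<Sum>t<m. y ^ Suc t * B' * R t)"
  proof (rule sum.cong)
    fix t assume "t \<in> {..<m}"
    then show "g * (x ^ Suc t * B) * R t = y ^ Suc t * B' * R t" using gx[of "Suc t"] by auto
  qed simp
  also have "\<dots> = y * g" unfolding g_def T_def by (simp add: sum_distrib_left mult.assoc)
  finally have "g * x = y * g" .
  moreover have "g * g' = T y B' R'" unfolding g_def g'_def by (rule comp) (use B'(1) B(4) in auto)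
  moreover have "g' * g = T x B R" unfolding g_def g'_def by (rule comp) (use B(1) B'(4) in auto)
  moreover have "g \<in> Hom d d" "g' \<in> Hom d d" unfolding g_def g'_def by (intro TH H B B')+
  ultimately show ?thesis using B(3) B'(3) unfolding T_def by auto
qed

section \<open>Units and idempotents modulo a nilpotent operator\<close>

lemma one_plus_nilpotent_unit:
  fixes q :: "'r::ring_1"
  assumes "q ^ k = 0"
  shows "\<exists>g'. (1 + q) * g' = 1 \<and> g' * (1 + q) = 1"
proof -
  have z: "(- q) ^ k = 0"
    using assms by (cases "even k") auto
  \<comment> \<open>The geometric series of -q is a trace with trivial second operator, so the
    telescoping identity inverts 1 + q.\<close>
  have "- q * higman k (- q) 1 1 - higman k (- q) 1 1 * 1 = - 1"
    unfolding higman_intertwine z by simp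
  then have 1: "(1 + q) * higman k (- q) 1 1 = 1" by (simp add: algebra_simps)
  have "1 * higman k 1 1 (- q) - higman k 1 1 (- q) * - q = 1"
    unfolding higman_intertwine z by simp
  then have 2: "higman k 1 1 (- q) * (1 + q) = 1" by (simp add: algebra_simps)
  have "higman k 1 1 (- q) = higman k (- q) 1 1"
    using assoc_eq[OF 2, of "higman k (- q) 1 1"] 1 by simp
  with 1 2 show ?thesis by metis
qed

lemma commute_inverse:
  fixes g :: "'r::ring_1"
  assumes "g * g' = 1" "g' * g = 1" "w * g = g * w"
  shows "w * g' = g' * w"
proof -
  have "w * g' = g' * (g * w) * g'" using assoc_eq[OF assms(2)] by (simp add: mult.assoc)
  also have "\<dots> = g' * (w * (g * g'))" unfolding assms(3)[symmetric] by (simp add: mult.assoc)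
  finally show ?thesis using assms(1) by simp
qed

lemma commute_power: "x * h = h * x \<Longrightarrow> x ^ t * h = h * (x::'r::ring_1) ^ t"
  using pow_intertwine[of h x x t] by simp

lemma commute_powerA: "x * h = h * x \<Longrightarrow> x ^ t * (h * Z) = h * ((x::'r::ring_1) ^ t * Z)"
  using assoc_eq[OF commute_power] by (simp add: mult.assoc)

text \<open>The substitution \<open>h \<mapsto> 3h\<^sup>2 - 2h\<^sup>3\<close> squares the defect \<open>h\<^sup>2 - h\<close> up to a factor.\<close>

lemma idempotent_refine:
  fixes h :: "'r::ring_1"
  defines "\<nu> \<equiv> h * h - h"
  defines "h' \<equiv> h * h + h * h + h * h - h * h * h - h * h * h"
  shows "h' * h' - h' = \<nu> * (\<nu> * (\<nu> + \<nu> + \<nu> + \<nu> - 1 - 1 - 1))"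
  unfolding \<nu>_def h'_def by (simp add: algebra_simps)

text \<open>The lifting at one vertex, inside the commutant of the loop x. The defect
  \<open>\<nu> = h * h - h\<close> is measured by the power of E that kills it: \<open>P l\<close>
  says that \<open>E ^ (k - l)\<close> does, and \<open>P k\<close> says that h is idempotent. The
  hypothesis on \<open>dec\<close> makes every operator killed by \<open>\<pi>\<close> a multiple of
  E.\<close>

lemma lift_idem:
  fixes x E \<pi> \<rho> \<kappa> h0 eb :: "'a::field lop"
  assumes k: "k \<ge> 1" and Ek: "E ^ k = 0" and dec: "\<rho> * \<pi> + E * \<kappa> = idop d"
    and E: "\<And>h. x * h = h * x \<Longrightarrow> E * h = h * E"
    and h0: "h0 \<in> Hom d d" "x * h0 = h0 * x" "\<pi> * h0 = eb * \<pi>" "eb * eb = eb"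
  shows "\<exists>h\<in>Hom d d. x * h = h * x \<and> \<pi> * h = eb * \<pi> \<and> h * h = h"
proof -
  define P where "P l = (\<exists>h\<in>Hom d d. x * h = h * x \<and> \<pi> * h = eb * \<pi> \<and> E ^ (k - l) * (h * h - h) = 0)" for l
  have \<pi>h2: "\<pi> * (h * h) = eb * \<pi>" if "\<pi> * h = eb * \<pi>" for h
  proof -
    have "\<pi> * (h * h) = eb * (\<pi> * h)" using assoc_eq[OF that] by (simp add: mult.assoc)
    then show ?thesis using that assoc_eq[OF h0(4)] by simp
  qed
  have kill: "h * h - h = E * (\<kappa> * (h * h - h))" if "\<pi> * h = eb * \<pi>" "h \<in> Hom d d" for h
  proof -
    have "\<pi> * (h * h - h) = 0" using \<pi>h2[OF that(1)] that(1) by (simp add: right_diff_distrib)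
    moreover have "h * h - h = idop d * (h * h - h)" using that(2) by (simp add: right_diff_distrib Hom_leftA Hom_left)
    ultimately show ?thesis unfolding dec[symmetric] by (simp add: distrib_right mult.assoc)
  qed
  have "P (Suc l)" if "Suc l \<le> k" for l
    using that
  proof (induction l)
    case 0
    have "E ^ (k - 1) * (h0 * h0 - h0) = E ^ (k - 1) * (E * (\<kappa> * (h0 * h0 - h0)))"
      using kill[OF h0(3,1)] by simp
    also have "\<dots> = E ^ Suc (k - 1) * (\<kappa> * (h0 * h0 - h0))" by (simp only: power_Suc2 mult.assoc)
    also have "\<dots> = 0" using Ek k by simp
    finally show ?case unfolding P_def using h0 by auto
  next
    case (Suc l)
    then obtain h where h: "h \<in> Hom d d" "x * h = h * x" "\<pi> * h = eb * \<pi>" "E ^ (k - Suc l) * (h * h - h) = 0"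
      unfolding P_def by auto
    define \<nu> where "\<nu> = h * h - h"
    define h' where "h' = h * h + h * h + h * h - h * h * h - h * h * h"
    define W where "W = \<nu> + \<nu> + \<nu> + \<nu> - 1 - 1 - 1"
    have def: "h' * h' - h' = \<nu> * (\<nu> * W)" unfolding W_def \<nu>_def h'_def by (rule idempotent_refine)
    have xh: "x * (h * Z) = h * (x * Z)" for Z using assoc_eq[OF h(2)] by (simp add: mult.assoc)
    have xh': "x * h' = h' * x" unfolding h'_def by (simp add: algebra_simps xh h(2))
    have "x * \<nu> = \<nu> * x" unfolding \<nu>_def by (simp add: algebra_simps xh h(2))
    then have E\<nu>: "E ^ t * (\<nu> * Z) = \<nu> * (E ^ t * Z)" for t Z by (intro commute_powerA E)
    have \<nu>E: "\<nu> = E * (\<kappa> * \<nu>)" unfolding \<nu>_def by (rule kill[OF h(3,1)])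
    have \<nu>0: "E ^ (k - Suc l) * (\<nu> * Z) = 0" for Z using assoc_eq[OF h(4)] unfolding \<nu>_def by simp
    have ks: "k - Suc l = Suc (k - Suc (Suc l))" using Suc.prems by simp
    \<comment> \<open>Of the two factors \<open>\<nu>\<close> in the new defect, one supplies an E,
      which raises the exponent to \<open>k - Suc l\<close>; at this exponent the other factor is
      annihilated.\<close>
    have "E ^ (k - Suc (Suc l)) * (h' * h' - h') = \<nu> * (E ^ (k - Suc (Suc l)) * (\<nu> * W))"
      unfolding def E\<nu> ..
    also have "\<nu> * W = E * (\<kappa> * (\<nu> * W))" using arg_cong[OF \<nu>E, of "\<lambda>z. z * W"] by (simp add: mult.assoc)
    also have "\<nu> * (E ^ (k - Suc (Suc l)) * (E * (\<kappa> * (\<nu> * W)))) = \<nu> * (E ^ (k - Suc l) * (\<kappa> * (\<nu> * W)))"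
      unfolding ks by (simp only: power_Suc2 mult.assoc)
    also have "\<dots> = 0" unfolding E\<nu>[symmetric] by (rule \<nu>0)
    finally have "E ^ (k - Suc (Suc l)) * (h' * h' - h') = 0" .
    moreover have "\<pi> * h' = eb * \<pi>"
    proof -
      have "\<pi> * (h * h * h) = eb * \<pi>"
        using assoc_eq[OF \<pi>h2[OF h(3)], of h] h(3) assoc_eq[OF h0(4)] by (simp add: mult.assoc)
      then show ?thesis unfolding h'_def using \<pi>h2[OF h(3)] by (simp add: right_diff_distrib distrib_left)
    qed
    moreover have "h' \<in> Hom d d" unfolding h'_def using h(1) by (intro Hom_diff Hom_add Hom_mult)
    ultimately show ?case unfolding P_def using xh' by blast
  qed
  from this[of "k - 1"] k have "P k" by simp
  then show ?thesis unfolding P_def by auto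
qed

section \<open>Functoriality of reduction\<close>

context quiver_relations begin

lemma reduces_by_D:
  assumes "reduces_by d M s N \<pi> \<rho> \<kappa>" "i < n"
  shows "\<pi> i \<in> Hom (s i) (d i)" "\<rho> i \<in> Hom (d i) (s i)" "\<kappa> i \<in> Hom (d i) (d i)" "\<pi> i * \<rho> i = idop (s i)"
    "\<rho> i * \<pi> i + M (Eps i) ^ c i * \<kappa> i = idop (d i)"
  using assms by (auto simp: reduces_by_def hom_def)

lemma reduces_hom1: "reduces_by d M s N \<pi> \<rho> \<kappa> \<Longrightarrow> hom d M s N \<pi>"
  by (simp add: reduces_by_def)

lemma reduces_cancel:
  assumes "reduces_by d M s N \<pi> \<rho> \<kappa>" "i < n" "X \<in> Hom r (s i)" "Y \<in> Hom r (s i)" "X * \<pi> i = Y * \<pi> i"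
  shows "X = Y"
proof -
  have "X * (\<pi> i * \<rho> i) = Y * (\<pi> i * \<rho> i)" using assms(5) by (simp add: mult.assoc[symmetric])
  then show ?thesis using reduces_by_D(4)[OF assms(1,2)] Hom_right assms(3,4) by metis
qed

lemma reduces_pi_E:
  assumes "reduces_by d M s N \<pi> \<rho> \<kappa>" "is_mod 1 s N" "i < n"
  shows "\<pi> i * (M (Eps i) ^ c i * Z) = 0"
proof -
  have "\<pi> i * (M (Eps i) ^ c i * Z) = N (Eps i) ^ c i * (\<pi> i * Z)"
    by (rule hom_powA[OF reduces_hom1[OF assms(1)] assms(3)])
  then show ?thesis using assms(2,3) by (simp add: is_mod_def)
qed

lemma reduces_kill:
  assumes "reduces_by d M s N \<pi> \<rho> \<kappa>" "i < n" "Z \<in> Hom (d i) r" "\<pi> i * Z = 0"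
  shows "Z = M (Eps i) ^ c i * (\<kappa> i * Z)"
proof -
  have "Z = (\<rho> i * \<pi> i + M (Eps i) ^ c i * \<kappa> i) * Z"
    unfolding reduces_by_D(5)[OF assms(1,2)] using Hom_left[OF assms(3)] by simp
  then show ?thesis using assms(4) by (simp add: distrib_right mult.assoc)
qed

text \<open>Y carries multiples of E to multiples of E, which \<open>\<pi>'\<close> kills; hence
  \<open>\<pi>' * Y\<close> vanishes on the image of E and factors through \<open>\<pi>\<close>. It
  applies to module maps (i = j) and to single arrows.\<close>

lemma reduces_factor:
  assumes R: "reduces_by d M s N \<pi> \<rho> \<kappa>" and N': "is_mod 1 s' N'" and R': "reduces_by d' M' s' N' \<pi>' \<rho>' \<kappa>'"
    and ij: "i < n" "j < n" and Y: "Y \<in> Hom (d' i) (d j)"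
    and E: "Y * M (Eps j) ^ c j = M' (Eps i) ^ c i * Y"
  shows "\<pi>' i * Y * \<rho> j * \<pi> j = \<pi>' i * Y"
proof -
  have "\<pi>' i * Y = \<pi>' i * (Y * (\<rho> j * \<pi> j + M (Eps j) ^ c j * \<kappa> j))"
    unfolding reduces_by_D(5)[OF R ij(2)] using Hom_right[OF Y] by simp
  also have "\<dots> = \<pi>' i * Y * \<rho> j * \<pi> j + \<pi>' i * ((Y * M (Eps j) ^ c j) * \<kappa> j)"
    by (simp add: distrib_left mult.assoc)
  also have "\<pi>' i * ((Y * M (Eps j) ^ c j) * \<kappa> j) = 0"
    unfolding E using reduces_pi_E[OF R' N' ij(1)] by (simp add: mult.assoc)
  finally show ?thesis by simp
qed

text \<open>The induced map on reductions is \<open>\<pi>' * h * \<rho>\<close>. The section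
  \<open>\<rho>\<close> is only linear; by the factorization through \<open>\<pi>\<close> the result
  is a module map all the same, checked after cancelling \<open>\<pi>\<close>.\<close>

lemma reduces_hom:
  assumes R: "reduces_by d M s N \<pi> \<rho> \<kappa>" and N: "is_rep s N" and R': "reduces_by d' M' s' N' \<pi>' \<rho>' \<kappa>'" and N': "is_mod 1 s' N'"
    and h: "hom d M d' M' h"
  shows "\<And>i. i < n \<Longrightarrow> \<pi>' i * h i * \<rho> i * \<pi> i = \<pi>' i * h i"
    and "hom s N s' N' (\<lambda>i. \<pi>' i * h i * \<rho> i)"
proof -
  show 1: "\<pi>' i * h i * \<rho> i * \<pi> i = \<pi>' i * h i" if "i < n" for i
    by (rule reduces_factor[OF R N' R' that that hom_Hom[OF h that] hom_pow[OF h that]])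
  have H: "\<pi>' i * h i * \<rho> i \<in> Hom (s' i) (s i)" if "i < n" for i
    using reduces_by_D[OF R that] reduces_by_D[OF R' that] hom_Hom[OF h that] by (meson Hom_mult)
  show "hom s N s' N' (\<lambda>i. \<pi>' i * h i * \<rho> i)"
    unfolding hom_def
  proof (intro conjI allI impI ballI)
    fix a assume a: "a \<in> Ar"
    note t = tgt_lt[OF a] and u = src_lt[OF a]
    let ?h = "\<lambda>i. \<pi>' i * h i * \<rho> i"
    have "?h (tgt a) * N a * \<pi> (src a) = ?h (tgt a) * \<pi> (tgt a) * M a"
      using hom_eq[OF reduces_hom1[OF R] a] by (simp add: mult.assoc)
    also have "\<dots> = \<pi>' (tgt a) * (M' a * h (src a))"
      unfolding 1[OF t] using hom_eq[OF h a] by (simp add: mult.assoc)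
    also have "\<dots> = N' a * (\<pi>' (src a) * h (src a))" by (rule hom_eqA[OF reduces_hom1[OF R'] a])
    also have "\<dots> = N' a * ?h (src a) * \<pi> (src a)" using 1[OF u] by (simp add: mult.assoc)
    finally show "?h (tgt a) * N a = N' a * ?h (src a)"
    proof (rule reduces_cancel[OF R u, rotated 2])
      show "?h (tgt a) * N a \<in> Hom (s' (tgt a)) (s (src a))"
        using H[OF t] N a by (auto simp: is_rep_def intro: Hom_mult)
      show "N' a * ?h (src a) \<in> Hom (s' (tgt a)) (s (src a))"
        using H[OF u] is_mod_Hom[OF N' a] by (rule Hom_mult[rotated])
    qed
  qed (use H in auto)
qed

lemma is_mod_is_rep: "is_mod k d M \<Longrightarrow> is_rep d M"
  by (simp add: is_mod_def)

lemma reduces_biprod: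
  assumes b: "biprod_by d M d1 A d2 B \<iota> p \<iota>' p'"
    and R: "reduces_by d M s N \<pi> \<rho> \<kappa>" and R1: "reduces_by d1 A s1 N1 \<pi>1 \<rho>1 \<kappa>1" and R2: "reduces_by d2 B s2 N2 \<pi>2 \<rho>2 \<kappa>2"
    and N: "is_mod 1 s N" and N1: "is_mod 1 s1 N1" and N2: "is_mod 1 s2 N2"
  shows "biprod s N s1 N1 s2 N2"
proof -
  have h: "hom d1 A d M \<iota>" "hom d M d1 A p" "hom d2 B d M \<iota>'" "hom d M d2 B p'" 
    and eq: "\<And>i. i < n \<Longrightarrow> p i * \<iota> i = idop (d1 i)" "\<And>i. i < n \<Longrightarrow> p' i * \<iota>' i = idop (d2 i)"
     "\<And>i. i < n \<Longrightarrow> \<iota> i * p i + \<iota>' i * p' i = idop (d i)"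
    using b by (auto simp: biprod_by_def)
  note i1 = reduces_hom[OF R1 is_mod_is_rep[OF N1] R N h(1)] and p1 = reduces_hom[OF R is_mod_is_rep[OF N] R1 N1 h(2)]
    and i2 = reduces_hom[OF R2 is_mod_is_rep[OF N2] R N h(3)] and p2 = reduces_hom[OF R is_mod_is_rep[OF N] R2 N2 h(4)]
  have 1: "(\<pi>1 i * p i * \<rho> i) * (\<pi> i * \<iota> i * \<rho>1 i) = idop (s1 i)" if i: "i < n" for i
  proof (rule reduces_cancel[OF R1 i])
    have "(\<pi>1 i * p i * \<rho> i) * (\<pi> i * \<iota> i * \<rho>1 i) * \<pi>1 i = (\<pi>1 i * p i * \<rho> i * \<pi> i) * \<iota> i"
      using i1(1)[OF i] by (simp add: mult.assoc)
    also have "\<dots> = \<pi>1 i * idop (d1 i)" unfolding p1(1)[OF i] using eq(1)[OF i] by (simp add: mult.assoc)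
    finally show "(\<pi>1 i * p i * \<rho> i) * (\<pi> i * \<iota> i * \<rho>1 i) * \<pi>1 i = idop (s1 i) * \<pi>1 i"
      using Hom_right[OF reduces_by_D(1)[OF R1 i]] Hom_left[OF reduces_by_D(1)[OF R1 i]] by simp
  qed (use hom_Hom[OF i1(2) i] hom_Hom[OF p1(2) i] Hom_idop Hom_mult in auto)
  have 2: "(\<pi>2 i * p' i * \<rho> i) * (\<pi> i * \<iota>' i * \<rho>2 i) = idop (s2 i)" if i: "i < n" for i
  proof (rule reduces_cancel[OF R2 i])
    have "(\<pi>2 i * p' i * \<rho> i) * (\<pi> i * \<iota>' i * \<rho>2 i) * \<pi>2 i = (\<pi>2 i * p' i * \<rho> i * \<pi> i) * \<iota>' i"
      using i2(1)[OF i] by (simp add: mult.assoc)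
    also have "\<dots> = \<pi>2 i * idop (d2 i)" unfolding p2(1)[OF i] using eq(2)[OF i] by (simp add: mult.assoc)
    finally show "(\<pi>2 i * p' i * \<rho> i) * (\<pi> i * \<iota>' i * \<rho>2 i) * \<pi>2 i = idop (s2 i) * \<pi>2 i"
      using Hom_right[OF reduces_by_D(1)[OF R2 i]] Hom_left[OF reduces_by_D(1)[OF R2 i]] by simp
  qed (use hom_Hom[OF i2(2) i] hom_Hom[OF p2(2) i] Hom_idop Hom_mult in auto)
  have 3: "(\<pi> i * \<iota> i * \<rho>1 i) * (\<pi>1 i * p i * \<rho> i) + (\<pi> i * \<iota>' i * \<rho>2 i) * (\<pi>2 i * p' i * \<rho> i) = idop (s i)"
    (is "?l = _") if i: "i < n" for i
  proof -
    have "?l = (\<pi> i * \<iota> i * \<rho>1 i * \<pi>1 i) * (p i * \<rho> i) + (\<pi> i * \<iota>' i * \<rho>2 i * \<pi>2 i) * (p' i * \<rho> i)"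
      by (simp add: mult.assoc)
    also have "\<dots> = \<pi> i * ((\<iota> i * p i + \<iota>' i * p' i) * \<rho> i)"
      unfolding i1(1)[OF i] i2(1)[OF i] by (simp add: mult.assoc distrib_right distrib_left)
    finally show ?thesis using reduces_by_D(4)[OF R i] Hom_left[OF reduces_by_D(2)[OF R i]] unfolding eq(3)[OF i] by simp
  qed
  show ?thesis unfolding biprod_def biprod_by_def using i1(2) i2(2) p1(2) p2(2) 1 2 3 N1 N2 is_mod_is_rep by blast
qed

text \<open>The premise on \<open>\<pi>\<close> says that the idempotent cutting out A lies over the
  one cutting out \<open>N1\<close>. All three witnesses of the reduction can then be compressed to
  the summands.\<close>

lemma reduces_summand:
  assumes bM: "biprod_by d M d1 A d2 B \<iota>m pm \<iota>m' pm'" and bN: "biprod_by s N s1 N1 s2 N2 \<iota> p \<iota>' p'"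
    and R: "reduces_by d M s N \<pi> \<rho> \<kappa>" and e: "\<And>i. i < n \<Longrightarrow> \<pi> i * (\<iota>m i * pm i) = (\<iota> i * p i) * \<pi> i"
  shows "reduces_by d1 A s1 N1 (\<lambda>i. p i * \<pi> i * \<iota>m i) (\<lambda>i. pm i * \<rho> i * \<iota> i) (\<lambda>i. pm i * \<kappa> i * \<iota>m i)"
  unfolding reduces_by_def
proof (intro conjI allI impI)
  have h: "hom d1 A d M \<iota>m" "hom d M d1 A pm" "hom s1 N1 s N \<iota>" "hom s N s1 N1 p" 
    using bM bN by (auto simp: biprod_by_def)
  have eq: "pm i * \<iota>m i = idop (d1 i)" "p i * \<iota> i = idop (s1 i)" if "i < n" for i
    using bM bN that by (auto simp: biprod_by_def)
  show "hom d1 A s1 N1 (\<lambda>i. p i * \<pi> i * \<iota>m i)"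
    using hom_comp[OF h(1) hom_comp[OF reduces_hom1[OF R] h(4)]] .
  fix i assume i: "i < n"
  note rd = reduces_by_D[OF R i] and H = hom_Hom[OF h(1) i] hom_Hom[OF h(2) i] hom_Hom[OF h(3) i] hom_Hom[OF h(4) i]
  have p\<iota>p: "p i * (\<iota> i * Z) = idop (s1 i) * Z" for Z using assoc_eq[OF eq(2)[OF i]] .
  show "pm i * \<rho> i * \<iota> i \<in> Hom (d1 i) (s1 i)" "pm i * \<kappa> i * \<iota>m i \<in> Hom (d1 i) (d1 i)"
    using rd H by (meson Hom_mult)+
  have "(p i * \<pi> i * \<iota>m i) * (pm i * \<rho> i * \<iota> i) = p i * (\<pi> i * (\<iota>m i * pm i)) * (\<rho> i * \<iota> i)"
    by (simp add: mult.assoc)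
  also have "\<dots> = p i * (\<iota> i * (p i * ((\<pi> i * \<rho> i) * \<iota> i)))" unfolding e[OF i] by (simp add: mult.assoc)
  also have "\<dots> = idop (s1 i)" unfolding rd(4) p\<iota>p using Hom_leftA[OF H(4)] Hom_left[OF H(3)] eq(2)[OF i] by (simp add: idop_idem)
  finally show "(p i * \<pi> i * \<iota>m i) * (pm i * \<rho> i * \<iota> i) = idop (s1 i)" .
  have "(pm i * \<rho> i * \<iota> i) * (p i * \<pi> i * \<iota>m i) = pm i * \<rho> i * ((\<iota> i * p i) * \<pi> i) * \<iota>m i"
    by (simp add: mult.assoc)
  also have "\<dots> = pm i * ((\<rho> i * \<pi> i) * (\<iota>m i * (pm i * \<iota>m i)))" unfolding e[OF i, symmetric] by (simp add: mult.assoc)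
  also have "\<dots> = pm i * ((\<rho> i * \<pi> i) * \<iota>m i)" using eq(1)[OF i] Hom_right[OF H(1)] by simp
  also have "\<rho> i * \<pi> i = idop (d i) - M (Eps i) ^ c i * \<kappa> i" using rd(5) by (simp add: eq_diff_eq)
  also have "pm i * ((idop (d i) - M (Eps i) ^ c i * \<kappa> i) * \<iota>m i) = idop (d1 i) - pm i * (M (Eps i) ^ c i * (\<kappa> i * \<iota>m i))"
    using eq(1)[OF i] Hom_left[OF H(1)] by (simp add: left_diff_distrib right_diff_distrib mult.assoc)
  also have "pm i * (M (Eps i) ^ c i * (\<kappa> i * \<iota>m i)) = A (Eps i) ^ c i * (pm i * \<kappa> i * \<iota>m i)"
    using hom_powA[OF h(2) i] by (simp add: mult.assoc)
  finally show "pm i * \<rho> i * \<iota> i * (p i * \<pi> i * \<iota>m i) + A (Eps i) ^ c i * (pm i * \<kappa> i * \<iota>m i) = idop (d1 i)"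
    by simp
qed

text \<open>An endomorphism and a cocycle of the summand are extended by zero to N; the family that
  solves the problem for N is compressed back.\<close>

lemma unobstructed_summand:
  assumes S: "unobstructed s N" and b: "biprod_by s N s1 N1 s2 N2 \<iota> p \<iota>' p'"
  shows "unobstructed s1 N1"
  unfolding unobstructed_def
proof (intro allI impI)
  fix v X assume v: "hom s1 N1 s1 N1 v" and X: "cocycle s1 N1 X"
  have h: "hom s1 N1 s N \<iota>" "hom s N s1 N1 p" using b by (auto simp: biprod_by_def)
  have eq: "p i * \<iota> i = idop (s1 i)" if "i < n" for i using b that by (auto simp: biprod_by_def)
  have p\<iota>: "p i * (\<iota> i * Z) = Z" if "i < n" "Z \<in> Hom (s1 i) r" for i r Z
    using assoc_eq[OF eq[OF that(1)], of Z] Hom_left[OF that(2)] by simp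
  have p\<iota>2: "Z * (p i * \<iota> i) = Z" if "i < n" "Z \<in> Hom r (s1 i)" for i r Z
    using eq[OF that(1)] Hom_right[OF that(2)] by simp
  define V where "V i = \<iota> i * v i * p i" for i
  define Y where "Y a = \<iota> (tgt a) * X a * p (src a)" for a
  have XH: "X a \<in> Hom (s1 (tgt a)) (s1 (src a))" if "a \<in> Ar" for a using X that by (auto simp: cocycle_def is_rep_def)
  have "hom s N s N V" unfolding V_def using hom_comp[OF h(2) hom_comp[OF v h(1)]] by (simp add: mult.assoc)
  moreover have "cocycle s N Y" unfolding cocycle_def
  proof (intro conjI allI impI ballI)
    show "is_rep s Y" unfolding is_rep_def Y_def
      using XH hom_Hom[OF h(1)] hom_Hom[OF h(2)] tgt_lt src_lt by (meson Hom_mult)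
    show "Y (Eps i) = 0" if "i < n" for i using X that by (simp add: Y_def cocycle_def)
    fix a assume a: "a \<in> Ar"
    have "N (Eps (tgt a)) ^ lx a * Y a = \<iota> (tgt a) * ((N1 (Eps (tgt a)) ^ lx a * X a) * p (src a))"
      unfolding Y_def using hom_powA[OF h(1) tgt_lt[OF a]] by (simp add: mult.assoc)
    also have "N1 (Eps (tgt a)) ^ lx a * X a = X a * N1 (Eps (src a)) ^ rx a" using X a by (simp add: cocycle_def)
    also have "\<iota> (tgt a) * (X a * N1 (Eps (src a)) ^ rx a * p (src a)) = Y a * N (Eps (src a)) ^ rx a"
      unfolding Y_def using hom_pow[OF h(2) src_lt[OF a]] by (simp add: mult.assoc)
    finally show "N (Eps (tgt a)) ^ lx a * Y a = Y a * N (Eps (src a)) ^ rx a" .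
  qed
  ultimately obtain g where g: "\<And>i. i < n \<Longrightarrow> g i \<in> Hom (s i) (s i)"
    "\<And>a. a \<in> Ar \<Longrightarrow> V (tgt a) * Y a - Y a * V (src a) = N a * g (src a) - g (tgt a) * N a"
    using S unfolding unobstructed_def by blast
  show "\<exists>h. (\<forall>i<n. h i \<in> Hom (s1 i) (s1 i)) \<and>
         (\<forall>a\<in>Ar. v (tgt a) * X a - X a * v (src a) = N1 a * h (src a) - h (tgt a) * N1 a)"
  proof (intro exI[of _ "\<lambda>i. p i * g i * \<iota> i"] conjI allI impI ballI)
    show "p i * g i * \<iota> i \<in> Hom (s1 i) (s1 i)" if "i < n" for i
      using g(1)[OF that] hom_Hom[OF h(1) that] hom_Hom[OF h(2) that] by (meson Hom_mult)
    fix a assume a: "a \<in> Ar"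
    note t = tgt_lt[OF a] and u = src_lt[OF a] and Xa = XH[OF a]
    note vt = hom_Hom[OF v t] and vu = hom_Hom[OF v u]
    have "p (tgt a) * (V (tgt a) * Y a) * \<iota> (src a) = p (tgt a) * (\<iota> (tgt a) * (v (tgt a) * (p (tgt a) * (\<iota> (tgt a) * (X a * (p (src a) * \<iota> (src a)))))))"
      unfolding V_def Y_def by (simp add: mult.assoc)
    also have "\<dots> = v (tgt a) * X a"
      using p\<iota>2[OF u Xa] p\<iota>[OF t Xa] p\<iota>[OF t Hom_mult[OF vt Xa]] by simp
    finally have 1: "p (tgt a) * (V (tgt a) * Y a) * \<iota> (src a) = v (tgt a) * X a" .
    have "p (tgt a) * (Y a * V (src a)) * \<iota> (src a) = p (tgt a) * (\<iota> (tgt a) * (X a * (p (src a) * (\<iota> (src a) * (v (src a) * (p (src a) * \<iota> (src a)))))))"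
      unfolding V_def Y_def by (simp add: mult.assoc)
    also have "\<dots> = X a * v (src a)"
      using p\<iota>2[OF u vu] p\<iota>[OF u vu] p\<iota>[OF t Hom_mult[OF Xa vu]] by simp
    finally have 2: "p (tgt a) * (Y a * V (src a)) * \<iota> (src a) = X a * v (src a)" .
    have "v (tgt a) * X a - X a * v (src a) = p (tgt a) * (V (tgt a) * Y a - Y a * V (src a)) * \<iota> (src a)"
      unfolding 1[symmetric] 2[symmetric] by (simp add: left_diff_distrib right_diff_distrib mult.assoc)
    also have "\<dots> = p (tgt a) * (N a * (g (src a) * \<iota> (src a))) - p (tgt a) * (g (tgt a) * (N a * \<iota> (src a)))"
      unfolding g(2)[OF a] by (simp add: left_diff_distrib right_diff_distrib mult.assoc)
    also have "\<dots> = N1 a * (p (src a) * g (src a) * \<iota> (src a)) - (p (tgt a) * g (tgt a) * \<iota> (tgt a)) * N1 a"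
      using hom_eqA[OF h(2) a] hom_eq[OF h(1) a] by (simp add: mult.assoc)
    finally show "v (tgt a) * X a - X a * v (src a) =
      N1 a * (p (src a) * g (src a) * \<iota> (src a)) - (p (tgt a) * g (tgt a) * \<iota> (tgt a)) * N1 a" .
  qed
qed


section \<open>Lifting and dividing maps on locally free modules\<close>

lemma loc_free_is_mod: "loc_free k d M \<Longrightarrow> is_mod k d M"
  by (simp add: loc_free_def)

lemma factor_pos:
  assumes "a \<in> Ar" "c (tgt a) = lx a * u" "c (src a) = rx a * u"
  shows "lx a > 0" "rx a > 0"
  using assms c_pos[OF tgt_lt[of a]] c_pos[OF src_lt[of a]] by (auto intro: Nat.gr0I)

text \<open>At each vertex a locally free module is free over K[E]/(E^k), by transitivity of the
  trace.\<close>

lemma loc_free_Eps_higman: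
  assumes M: "loc_free k d M" and i: "i < n"
  shows "\<exists>\<Theta>\<in>Hom (d i) (d i). higman k (M (Eps i) ^ c i) (higman (c i) (M (Eps i)) \<Theta> (M (Eps i))) (M (Eps i) ^ c i) = idop (d i)"
    and "(M (Eps i) ^ c i) ^ k = 0"
proof -
  obtain \<Theta> where \<Theta>: "\<Theta> \<in> Hom (d i) (d i)" "higman (k * c i) (M (Eps i)) \<Theta> (M (Eps i)) = idop (d i)"
    using M i by (auto simp: loc_free_def)
  have "higman k (M (Eps i) ^ c i) (higman (c i) (M (Eps i)) \<Theta> (M (Eps i))) (M (Eps i) ^ c i) = idop (d i)"
    unfolding higman_power[OF c_pos[OF i], symmetric] using \<Theta>(2) by (simp add: mult.commute)
  with \<Theta>(1) show "\<exists>\<Theta>\<in>Hom (d i) (d i). higman k (M (Eps i) ^ c i) (higman (c i) (M (Eps i)) \<Theta> (M (Eps i))) (M (Eps i) ^ c i) = idop (d i)"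
    by blast
  show "(M (Eps i) ^ c i) ^ k = 0"
    using loc_free_is_mod[OF M] i by (simp add: is_mod_def power_mult[symmetric] mult.commute)
qed

text \<open>The relation of an arrow says that it is linear over K[x]/(x^m), where x acts by
  \<open>\<epsilon>^rx\<close> at the source and by \<open>\<epsilon>^lx\<close> at the target. With
  m = k u, u the common quotient, x^m vanishes at both ends, and the source is free.\<close>

lemma loc_free_arrow_higman:
  assumes M: "loc_free k d M" and a: "a \<in> Ar"
  shows "\<exists>m. \<exists>\<Theta>\<in>Hom (d (src a)) (d (src a)).
      higman m (M (Eps (src a)) ^ rx a) \<Theta> (M (Eps (src a)) ^ rx a) = idop (d (src a)) \<and>
      (M (Eps (src a)) ^ rx a) ^ m = 0 \<and> (M (Eps (tgt a)) ^ lx a) ^ m = 0"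
proof -
  obtain u where u: "c (tgt a) = lx a * u" "c (src a) = rx a * u" using c_factor a by blast
  note pos = factor_pos[OF a u]
  obtain \<Theta> where \<Theta>: "\<Theta> \<in> Hom (d (src a)) (d (src a))"
    "higman (k * c (src a)) (M (Eps (src a))) \<Theta> (M (Eps (src a))) = idop (d (src a))"
    using M src_lt[OF a] by (auto simp: loc_free_def)
  have e: "k * c (src a) = rx a * (k * u)" "k * c (tgt a) = lx a * (k * u)" unfolding u by simp_all
  have x: "M (Eps (src a)) \<in> Hom (d (src a)) (d (src a))" using is_mod_Eps[OF loc_free_is_mod[OF M] src_lt[OF a]] .
  show ?thesis
  proof (intro exI[of _ "k * u"] bexI[of _ "higman (rx a) (M (Eps (src a))) \<Theta> (M (Eps (src a)))"] conjI)
    show "higman (k * u) (M (Eps (src a)) ^ rx a) (higman (rx a) (M (Eps (src a))) \<Theta> (M (Eps (src a)))) (M (Eps (src a)) ^ rx a) = idop (d (src a))"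
      unfolding higman_power[OF pos(2), symmetric] e(1)[symmetric] by (rule \<Theta>(2))
    show "(M (Eps (src a)) ^ rx a) ^ (k * u) = 0" "(M (Eps (tgt a)) ^ lx a) ^ (k * u) = 0"
      unfolding power_mult[symmetric] e[symmetric] using loc_free_is_mod[OF M] src_lt[OF a] tgt_lt[OF a]
      by (auto simp: is_mod_def)
  qed (intro higman_Hom x \<Theta>(1))
qed

text \<open>A map satisfying the relation of an arrow is a module map out of a free module, so it
  lifts along p as soon as it lifts linearly.\<close>

lemma cocycle_lift:
  assumes M: "loc_free k d M" and a: "a \<in> Ar"
    and p: "p * M (Eps (tgt a)) ^ lx a = y * p" and D: "D \<in> Hom r (d (src a))" "D * M (Eps (src a)) ^ rx a = y * D"
    and D': "D' \<in> Hom (d (tgt a)) (d (src a))" "p * D' = D"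
  shows "\<exists>Y\<in>Hom (d (tgt a)) (d (src a)). p * Y = D \<and> M (Eps (tgt a)) ^ lx a * Y = Y * M (Eps (src a)) ^ rx a"
proof -
  obtain m \<Theta> where \<Theta>: "\<Theta> \<in> Hom (d (src a)) (d (src a))"
      "higman m (M (Eps (src a)) ^ rx a) \<Theta> (M (Eps (src a)) ^ rx a) = idop (d (src a))"
      "(M (Eps (src a)) ^ rx a) ^ m = 0" "(M (Eps (tgt a)) ^ lx a) ^ m = 0"
    using loc_free_arrow_higman[OF M a] by blast
  have pos: "lx a > 0" "rx a > 0" using factor_pos c_factor a by blast+
  have x: "M (Eps (tgt a)) ^ lx a \<in> Hom (d (tgt a)) (d (tgt a))" "M (Eps (src a)) ^ rx a \<in> Hom (d (src a)) (d (src a))"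
    using is_mod_Eps[OF loc_free_is_mod[OF M]] tgt_lt[OF a] src_lt[OF a] pos by (auto intro: Hom_pow)
  note pr = higman_projective[OF \<Theta>(2) Hom_right[OF D(1)] D(2) p D'(2) \<Theta>(3,4)]
  have "higman m (M (Eps (tgt a)) ^ lx a) (D' * \<Theta>) (M (Eps (src a)) ^ rx a) \<in> Hom (d (tgt a)) (d (src a))"
    by (intro higman_Hom x Hom_mult[OF D'(1) \<Theta>(1)])
  with pr show ?thesis by blast
qed

text \<open>Exactness of E on a free module gives a linear quotient of D by \<open>E ^ l\<close>;
  projectivity of the source, applied to p = \<open>E ^ l\<close>, replaces it by one that satisfies
  the relation.\<close>

lemma cocycle_divide:
  assumes M: "loc_free k d M" and a: "a \<in> Ar" and l: "l \<le> k" "l > 0"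
    and D: "D \<in> Hom (d (tgt a)) (d (src a))" "M (Eps (tgt a)) ^ lx a * D = D * M (Eps (src a)) ^ rx a"
      "(M (Eps (tgt a)) ^ c (tgt a)) ^ (k - l) * D = 0"
  shows "\<exists>Y\<in>Hom (d (tgt a)) (d (src a)). (M (Eps (tgt a)) ^ c (tgt a)) ^ l * Y = D \<and>
      M (Eps (tgt a)) ^ lx a * Y = Y * M (Eps (src a)) ^ rx a"
proof -
  let ?x = "M (Eps (tgt a))"
  obtain \<Theta> where \<Theta>: "\<Theta> \<in> Hom (d (tgt a)) (d (tgt a))"
    "higman k (?x ^ c (tgt a)) (higman (c (tgt a)) ?x \<Theta> ?x) (?x ^ c (tgt a)) = idop (d (tgt a))"
    using loc_free_Eps_higman(1)[OF M tgt_lt[OF a]] by blast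
  note xH = is_mod_Eps[OF loc_free_is_mod[OF M] tgt_lt[OF a]]
  have EH: "?x ^ c (tgt a) \<in> Hom (d (tgt a)) (d (tgt a))" by (intro Hom_pow xH c_pos tgt_lt a)
  note ex = higman_exact[OF \<Theta>(2) Hom_left[OF D(1)] l(1) D(3)]
  show ?thesis
  proof (rule cocycle_lift[OF M a _ D(1)])
    show "(?x ^ c (tgt a)) ^ l * ?x ^ lx a = ?x ^ lx a * (?x ^ c (tgt a)) ^ l"
      by (simp add: power_mult[symmetric] power_add[symmetric] add.commute)
    show "D * M (Eps (src a)) ^ rx a = ?x ^ lx a * D" using D(2) by simp
  next
    show "(\<Sum>b<k - l. (?x ^ c (tgt a)) ^ b * higman (c (tgt a)) ?x \<Theta> ?x * (?x ^ c (tgt a)) ^ (k - 1 - (l + b)) * D) \<in> Hom (d (tgt a)) (d (src a))"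
      by (intro Hom_sum Hom_mult[OF Hom_mult_pow[OF EH Hom_pow_mult[OF EH higman_Hom[OF xH xH \<Theta>(1)]]] D(1)])
  qed (rule ex[symmetric])
qed

text \<open>For l < k the kernel of \<open>E ^ l\<close> is the image of \<open>E ^ (k - l)\<close>,
  hence consists of multiples of E. So an equation that holds after multiplication by
  \<open>E ^ l\<close> holds in the reduction.\<close>

lemma E_kernel:
  assumes M: "loc_free k d M" and R: "reduces_by d M s N \<pi> \<rho> \<kappa>" and N: "is_mod 1 s N" and i: "i < n" and l: "l < k"
    and Z: "Z \<in> Hom (d i) r" "(M (Eps i) ^ c i) ^ l * Z = 0"
  shows "\<pi> i * Z = 0"
proof -
  let ?x = "M (Eps i)"
  obtain \<Theta> where \<Theta>: "higman k (?x ^ c i) (higman (c i) ?x \<Theta> ?x) (?x ^ c i) = idop (d i)"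
    using loc_free_Eps_higman(1)[OF M i] by blast
  have "(?x ^ c i) ^ (k - (k - l)) * Z = 0" using Z(2) l by simp
  from higman_exact[OF \<Theta> Hom_left[OF Z(1)] _ this] obtain W where W: "Z = (?x ^ c i) ^ (k - l) * W" by auto
  have "k - l = Suc (k - l - 1)" using l by simp
  then have "Z = ?x ^ c i * ((?x ^ c i) ^ (k - l - 1) * W)" using W by (metis mult.assoc power_Suc)
  then show ?thesis using reduces_pi_E[OF R N i] by metis
qed

text \<open>Only compatibility with the loop at one vertex is asked for, and there the module is
  free, so projectivity provides the lift. The other arrows carry the whole obstruction.\<close>

lemma end_lift:
  assumes M: "loc_free k d M" and R: "reduces_by d M s N \<pi> \<rho> \<kappa>" and N: "is_mod 1 s N" and i: "i < n"
    and h: "h \<in> Hom (s i) (s i)" "N (Eps i) * h = h * N (Eps i)"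
  shows "\<exists>h'\<in>Hom (d i) (d i). M (Eps i) * h' = h' * M (Eps i) \<and> \<pi> i * h' = h * \<pi> i"
proof -
  let ?x = "M (Eps i)"
  obtain \<Theta> where \<Theta>: "\<Theta> \<in> Hom (d i) (d i)" "higman (k * c i) ?x \<Theta> ?x = idop (d i)"
    using M i by (auto simp: loc_free_def)
  have x: "?x \<in> Hom (d i) (d i)" using is_mod_Eps[OF loc_free_is_mod[OF M] i] .
  have nil: "?x ^ (k * c i) = 0" using loc_free_is_mod[OF M] i by (simp add: is_mod_def)
  note rd = reduces_by_D[OF R i]
  have px: "\<pi> i * ?x = N (Eps i) * \<pi> i" using hom_eq[OF reduces_hom1[OF R] Eps_Ar[OF i]] by simp
  have hpx: "h * \<pi> i * ?x = N (Eps i) * (h * \<pi> i)"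
    using px assoc_eq[OF h(2)] by (simp add: mult.assoc)
  have hp: "h * \<pi> i * idop (d i) = h * \<pi> i" using Hom_right[OF Hom_mult[OF h(1) rd(1)]] .
  have pr: "\<pi> i * (\<rho> i * (h * \<pi> i)) = h * \<pi> i"
    using assoc_eq[OF rd(4)] Hom_leftA[OF h(1)] by simp
  note pj = higman_projective[OF \<Theta>(2) hp hpx px pr nil nil]
  have "higman (k * c i) ?x (\<rho> i * (h * \<pi> i) * \<Theta>) ?x \<in> Hom (d i) (d i)"
    by (intro higman_Hom x Hom_mult[OF Hom_mult[OF rd(2) Hom_mult[OF h(1) rd(1)]] \<Theta>(1)])
  with pj show ?thesis by blast
qed

text \<open>A basis B of M over K[E]/(E^k) with coordinates R yields the reduction:
  \<open>\<pi>\<close> is the coordinate \<open>R 0\<close>, \<open>\<rho>\<close> is B, and the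
  higher coordinates are collected in \<open>\<kappa>\<close>.\<close>

lemma reduces_ex:
  assumes M: "loc_free k d M" and k: "k \<ge> 1"
  shows "\<exists>s N. loc_free 1 s N \<and> reduces d M s N \<and> (\<forall>i<n. d i = k * s i)"
proof -
  have "\<exists>r \<rho> \<pi> \<kappa>. \<rho> \<in> Hom (d i) r \<and> \<pi> \<in> Hom r (d i) \<and> \<kappa> \<in> Hom (d i) (d i) \<and> \<pi> * \<rho> = idop r \<and>
     \<rho> * \<pi> + M (Eps i) ^ c i * \<kappa> = idop (d i) \<and> \<pi> * M (Eps i) ^ c i = 0 \<and> d i = k * r" if i: "i < n" for i
  proof -
    let ?E = "M (Eps i) ^ c i"
    obtain \<Theta> where \<Theta>: "\<Theta> \<in> Hom (d i) (d i)"
      "higman k ?E (higman (c i) (M (Eps i)) \<Theta> (M (Eps i))) ?E = idop (d i)"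
      using loc_free_Eps_higman(1)[OF M i] by blast
    note x = is_mod_Eps[OF loc_free_is_mod[OF M] i]
    have E: "?E \<in> Hom (d i) (d i)" by (intro Hom_pow x c_pos i)
    have Ek: "?E ^ k = 0" by (rule loc_free_Eps_higman(2)[OF M i])
    have k0: "k > 0" using k by simp
    obtain r B R where B: "B \<in> Hom (d i) r" "\<And>t. R t \<in> Hom r (d i)" "(\<Sum>t<k. ?E ^ t * B * R t) = idop (d i)"
      "\<And>u t. u < k \<Longrightarrow> t < k \<Longrightarrow> R u * (?E ^ t * B) = (if u = t then idop r else 0)"
      using free_basis[OF E higman_Hom[OF x x \<Theta>(1)] Ek k0 \<Theta>(2)] by blast
    have dim: "d i = k * r" by (rule free_basis_dim[OF E B])
    have kk: "k = Suc (k - 1)" using k by simp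
    let ?\<kappa> = "\<Sum>t<k - 1. ?E ^ t * B * R (Suc t)"
    have sum: "B * R 0 + ?E * ?\<kappa> = idop (d i)"
      using B(3) unfolding sum.lessThan_Suc_shift[of _ "k - 1", folded kk] by (simp add: sum_distrib_left mult.assoc)
    have RB: "R 0 * B = idop r" using B(4)[of 0 0] k by simp
    have RE: "R 0 * ?E ^ Suc t * B = 0" for t
    proof (cases "Suc t < k")
      case True then show ?thesis using B(4)[of 0 "Suc t"] k by (simp add: mult.assoc)
    next
      case False
      then have "?E ^ Suc t = ?E ^ (Suc t - k) * ?E ^ k" by (metis le_add_diff_inverse2 not_less power_add)
      then show ?thesis using Ek by simp
    qed
    have "R 0 * ?E = R 0 * (?E * (\<Sum>t<k. ?E ^ t * B * R t))" unfolding B(3) using Hom_right[OF E] by simp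
    also have "\<dots> = (\<Sum>t<k. R 0 * ?E ^ Suc t * B * R t)" by (simp add: sum_distrib_left mult.assoc)
    also have "\<dots> = 0" using RE by simp
    finally have "R 0 * ?E = 0" .
    moreover have "?\<kappa> \<in> Hom (d i) (d i)" by (intro Hom_sum Hom_mult[OF Hom_pow_mult[OF E B(1)] B(2)])
    ultimately show ?thesis using B(1,2) RB sum dim by blast
  qed
  then obtain s \<rho> \<pi> \<kappa> where "\<forall>i. i < n \<longrightarrow> \<rho> i \<in> Hom (d i) (s i) \<and> \<pi> i \<in> Hom (s i) (d i) \<and> \<kappa> i \<in> Hom (d i) (d i) \<and> \<pi> i * \<rho> i = idop (s i) \<and>
     \<rho> i * \<pi> i + M (Eps i) ^ c i * \<kappa> i = idop (d i) \<and> \<pi> i * M (Eps i) ^ c i = 0 \<and> d i = k * s i" by metis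
  then have r: "\<rho> i \<in> Hom (d i) (s i)" "\<pi> i \<in> Hom (s i) (d i)" "\<kappa> i \<in> Hom (d i) (d i)" "\<pi> i * \<rho> i = idop (s i)"
     "\<rho> i * \<pi> i + M (Eps i) ^ c i * \<kappa> i = idop (d i)" "\<pi> i * M (Eps i) ^ c i = 0" "d i = k * s i" if "i < n" for i
    using that by auto
  define N where "N a = \<pi> (tgt a) * M a * \<rho> (src a)" for a
  have NH: "N a \<in> Hom (s (tgt a)) (s (src a))" if "a \<in> Ar" for a
    unfolding N_def using r(1,2) tgt_lt src_lt that is_mod_Hom[OF loc_free_is_mod[OF M] that] by (meson Hom_mult)
  have \<pi>E: "\<pi> i * (M (Eps i) ^ c i * Z) = 0" if "i < n" for i Z using assoc_eq[OF r(6)[OF that]] by simp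
  have h: "hom d M s N \<pi>" unfolding hom_def
  proof (intro conjI allI impI ballI)
    fix a assume a: "a \<in> Ar"
    note t = tgt_lt[OF a] and u = src_lt[OF a]
    have "\<pi> (tgt a) * M a = \<pi> (tgt a) * (M a * (\<rho> (src a) * \<pi> (src a) + M (Eps (src a)) ^ c (src a) * \<kappa> (src a)))"
      unfolding r(5)[OF u] using Hom_right[OF is_mod_Hom[OF loc_free_is_mod[OF M] a]] by simp
    also have "\<dots> = N a * \<pi> (src a) + \<pi> (tgt a) * ((M a * M (Eps (src a)) ^ c (src a)) * \<kappa> (src a))"
      unfolding N_def by (simp add: distrib_left mult.assoc)
    also have "\<pi> (tgt a) * ((M a * M (Eps (src a)) ^ c (src a)) * \<kappa> (src a)) = 0"
      unfolding is_mod_E[OF loc_free_is_mod[OF M] a, symmetric] using \<pi>E[OF t] by (simp add: mult.assoc)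
    finally show "\<pi> (tgt a) * M a = N a * \<pi> (src a)" by simp
  qed (use r in auto)
  have R: "reduces_by d M s N \<pi> \<rho> \<kappa>" unfolding reduces_by_def using h r by simp
  have Nc: "N (Eps i) ^ c i = 0" if i: "i < n" for i
  proof (rule reduces_cancel[OF R i Hom_pow Hom_0])
    show "N (Eps i) \<in> Hom (s i) (s i)" "0 < c i" using NH[OF Eps_Ar[OF i]] c_pos[OF i] by auto
    show "N (Eps i) ^ c i * \<pi> i = 0 * \<pi> i" using hom_pow[OF h i, of "c i"] r(6)[OF i] by simp
  qed
  have "N (Eps (tgt a)) ^ lx a * N a = N a * N (Eps (src a)) ^ rx a" if a: "a \<in> Ar" for a
  proof (rule reduces_cancel[OF R src_lt[OF a]])
    note t = tgt_lt[OF a] and u = src_lt[OF a]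
    show "N (Eps (tgt a)) ^ lx a * N a \<in> Hom (s (tgt a)) (s (src a))"
      using NH[OF Eps_Ar[OF t]] NH[OF a] by (auto intro: Hom_pow_mult)
    show "N a * N (Eps (src a)) ^ rx a \<in> Hom (s (tgt a)) (s (src a))"
      using NH[OF Eps_Ar[OF u]] NH[OF a] by (auto intro: Hom_mult_pow)
    have "N (Eps (tgt a)) ^ lx a * N a * \<pi> (src a) = \<pi> (tgt a) * (M (Eps (tgt a)) ^ lx a * M a)"
      using hom_powA[OF h t] hom_eq[OF h a] by (simp add: mult.assoc)
    also have "\<dots> = N a * (N (Eps (src a)) ^ rx a * \<pi> (src a))"
      unfolding is_mod_rel[OF loc_free_is_mod[OF M] a] using hom_eqA[OF h a] hom_pow[OF h u] by (simp add: mult.assoc)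
    finally show "N (Eps (tgt a)) ^ lx a * N a * \<pi> (src a) = N a * N (Eps (src a)) ^ rx a * \<pi> (src a)"
      by (simp add: mult.assoc)
  qed
  then have mdN: "is_mod 1 s N" using NH Nc by (simp add: is_mod_def is_rep_def)
  have "\<exists>\<Theta>\<in>Hom (s i) (s i). higman (1 * c i) (N (Eps i)) \<Theta> (N (Eps i)) = idop (s i)" if i: "i < n" for i
  proof -
    let ?x = "M (Eps i)" and ?y = "N (Eps i)"
    let ?E = "?x ^ c i"
    obtain \<Theta> where \<Theta>: "\<Theta> \<in> Hom (d i) (d i)" "higman k ?E (higman (c i) ?x \<Theta> ?x) ?E = idop (d i)"
      using loc_free_Eps_higman(1)[OF M i] by blast
    have x: "?x \<in> Hom (d i) (d i)" using is_mod_Eps[OF loc_free_is_mod[OF M] i] .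
    have E: "?E \<in> Hom (d i) (d i)" by (intro Hom_pow x c_pos i)
    have Ek: "?E ^ k = 0" by (rule loc_free_Eps_higman(2)[OF M i])
    \<comment> \<open>Multiplication by \<open>E ^ (k - 1)\<close> makes \<open>\<Theta>\<close>
      vanish on multiples of E, so that it descends to N. In the trace over E all summands but the
      one ending in \<open>E ^ (k - 1)\<close> begin with E and are killed by \<open>\<pi>\<close>;
      hence the descended operator has trace 1.\<close>
    define Z where "Z = \<Theta> * ?E ^ (k - 1)"
    have ZE: "Z * (?E * W) = 0" for W
    proof -
      have "Z * (?E * W) = \<Theta> * (?E ^ Suc (k - 1) * W)" unfolding Z_def by (simp only: power_Suc2 mult.assoc)
      then show ?thesis using Ek k by simp
    qed
    have \<pi>x: "\<pi> i * ?x = ?y * \<pi> i" using hom_eq[OF h Eps_Ar[OF i]] by simp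
    have "\<rho> i * ?y = (\<rho> i * \<pi> i) * (?x * \<rho> i)" unfolding N_def by (simp add: mult.assoc)
    also have "\<rho> i * \<pi> i = idop (d i) - ?E * \<kappa> i" using r(5)[OF i] by (simp add: eq_diff_eq)
    also have "(idop (d i) - ?E * \<kappa> i) * (?x * \<rho> i) = ?x * \<rho> i - ?E * (\<kappa> i * (?x * \<rho> i))"
      by (simp add: left_diff_distrib mult.assoc Hom_leftA[OF x])
    finally have \<rho>y: "\<rho> i * ?y = ?x * \<rho> i - ?E * (\<kappa> i * (?x * \<rho> i))" .
    have Z\<rho>: "Z * (\<rho> i * ?y ^ t) = Z * (?x ^ t * \<rho> i)" for t
    proof (induction t)
      case (Suc t)
      have "Z * (\<rho> i * ?y ^ Suc t) = Z * (\<rho> i * ?y ^ t) * ?y" by (simp only: power_Suc2 mult.assoc)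
      also have "\<dots> = Z * (?x ^ t * (\<rho> i * ?y))" unfolding Suc by (simp add: mult.assoc)
      also have "\<dots> = Z * (?x ^ t * (?x * \<rho> i)) - Z * ((?x ^ t * ?E) * (\<kappa> i * (?x * \<rho> i)))"
        unfolding \<rho>y by (simp add: right_diff_distrib mult.assoc)
      also have "?x ^ t * ?E = ?E * ?x ^ t" by (simp add: power_add[symmetric] add.commute)
      finally show ?case using ZE by (simp add: mult.assoc power_commutes) (simp add: mult.assoc[symmetric] power_commutes)
    qed simp
    have xE: "?x * ?E ^ (k - 1) = ?E ^ (k - 1) * ?x"
      by (simp add: power_mult[symmetric] power_commutes)
    have "higman (c i) ?y (\<pi> i * (Z * \<rho> i)) ?y = \<pi> i * higman (c i) ?x (Z * \<rho> i) ?y" by (rule higman_left[OF \<pi>x, symmetric])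
    also have "higman (c i) ?x (Z * \<rho> i) ?y = higman (c i) ?x Z ?x * \<rho> i"
      unfolding higman_def by (simp add: sum_distrib_right mult.assoc Z\<rho>)
    also have "higman (c i) ?x Z ?x = higman (c i) ?x \<Theta> ?x * ?E ^ (k - 1)"
      unfolding Z_def by (rule higman_right[OF xE, symmetric])
    also have "\<pi> i * (higman (c i) ?x \<Theta> ?x * ?E ^ (k - 1) * \<rho> i) = \<pi> i * (higman k ?E (higman (c i) ?x \<Theta> ?x) ?E * \<rho> i)"
    proof -
      obtain j where j: "k = Suc j" using k by (metis Suc_le_D One_nat_def)
      show ?thesis unfolding j higman_Suc_left[of j ?E] using \<pi>E[OF i] by (simp add: distrib_right distrib_left mult.assoc)
    qed
    also have "\<dots> = idop (s i)" unfolding \<Theta>(2) using Hom_left[OF r(1)[OF i]] r(4)[OF i] by simp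
    finally have "higman (1 * c i) ?y (\<pi> i * (Z * \<rho> i)) ?y = idop (s i)" by simp
    moreover have "Z \<in> Hom (d i) (d i)" unfolding Z_def by (intro Hom_mult_pow E \<Theta>)
    then have "\<pi> i * (Z * \<rho> i) \<in> Hom (s i) (s i)" using r(1,2)[OF i] by (meson Hom_mult)
    ultimately show ?thesis by blast
  qed
  then have "loc_free 1 s N" using mdN by (simp add: loc_free_def)
  then show ?thesis using R r(7) unfolding reduces_def by blast
qed


section \<open>Lifting idempotents\<close>

text \<open>An approximate endomorphism: it is an exact idempotent, exactly over e and exactly
  compatible with the loops, while its commutators with the arrows are divisible by
  \<open>E ^ l\<close>. Divisibility is stated as annihilation by \<open>E ^ (k - l)\<close>, which
  is equivalent on free modules and is an equation.\<close>

definition near_end where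
  "near_end d M \<pi> e k l f \<longleftrightarrow>
     (\<forall>i<n. f i \<in> Hom (d i) (d i) \<and> M (Eps i) * f i = f i * M (Eps i) \<and> \<pi> i * f i = e i * \<pi> i \<and> f i * f i = f i) \<and>
     (\<forall>a\<in>Ar. (M (Eps (tgt a)) ^ c (tgt a)) ^ (k - l) * (f (tgt a) * M a - M a * f (src a)) = 0)"

text \<open>Write \<open>[f,M] = E\<^sup>l Y\<close>.  Modulo \<open>E\<close> one has \<open>Y = [e,[e,Y]]\<close>, and the hypothesis \<open>unobstructed\<close>
  turns this into \<open>Y = [N,h]\<close>.  Conjugation by \<open>1 + E\<^sup>l z\<close>, where \<open>z\<close> lifts \<open>[e,h]\<close>, then
  improves \<open>l\<close> by one.\<close>

lemma near_end_step:
  assumes M: "loc_free k d M" and R: "reduces_by d M s N \<pi> \<rho> \<kappa>" and N: "is_mod 1 s N" and S: "unobstructed s N"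
    and e: "hom s N s N e" "\<And>i. i < n \<Longrightarrow> e i * e i = e i"
    and l: "0 < l" "l < k" and f: "near_end d M \<pi> e k l f"
  shows "\<exists>f'. near_end d M \<pi> e k (Suc l) f'"
proof -
  note mM = loc_free_is_mod[OF M]
  define x where "x i = M (Eps i)" for i
  define E where "E i = x i ^ c i" for i
  define y where "y i = N (Eps i)" for i
  have fH: "f i \<in> Hom (d i) (d i)" and xf: "x i * f i = f i * x i" and \<pi>f: "\<pi> i * f i = e i * \<pi> i"
    and ff: "f i * f i = f i" if "i < n" for i
    using f that unfolding near_end_def x_def by auto
  have ffA: "f i * (f i * Z) = f i * Z" if "i < n" for i Z using assoc_eq[OF ff[OF that]] .
  have \<pi>fA: "\<pi> i * (f i * Z) = e i * (\<pi> i * Z)" if "i < n" for i Z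
    using assoc_eq[OF \<pi>f[OF that]] by (simp add: mult.assoc)
  have MH: "M a \<in> Hom (d (tgt a)) (d (src a))" if "a \<in> Ar" for a using is_mod_Hom[OF mM that] .
  have NH: "N a \<in> Hom (s (tgt a)) (s (src a))" if "a \<in> Ar" for a using is_mod_Hom[OF N that] .
  have eH: "e i \<in> Hom (s i) (s i)" if "i < n" for i using hom_Hom[OF e(1) that] .
  have xH: "x i \<in> Hom (d i) (d i)" if "i < n" for i unfolding x_def using is_mod_Eps[OF mM that] .
  have EH: "E i \<in> Hom (d i) (d i)" if "i < n" for i unfolding E_def using xH[OF that] c_pos[OF that] by (rule Hom_pow)
  have Ecomm: "E i ^ t * w = w * E i ^ t" if "x i * w = w * x i" for i t w
    unfolding E_def power_mult[symmetric] using that by (rule commute_power)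
  have EcommA: "E i ^ t * (w * Z) = w * (E i ^ t * Z)" if "x i * w = w * x i" for i t w Z
    unfolding E_def power_mult[symmetric] using that by (rule commute_powerA)
  have EM: "E (tgt a) ^ t * M a = M a * E (src a) ^ t" if "a \<in> Ar" for a t
    using pow_intertwine[of "M a" "E (src a)" "E (tgt a)" t] is_mod_E[OF mM that] by (simp add: E_def x_def)
  have \<pi>E: "\<pi> i * (E i * Z) = 0" if "i < n" for i Z using reduces_pi_E[OF R N that] by (simp add: E_def x_def)
  have kill: "Z = E i * (\<kappa> i * Z)" if "i < n" "Z \<in> Hom (d i) r" "\<pi> i * Z = 0" for i r Z
    using reduces_kill[OF R that] by (simp add: E_def x_def)
  have \<pi>N: "\<pi> (tgt a) * M a = N a * \<pi> (src a)" if "a \<in> Ar" for a using hom_eq[OF reduces_hom1[OF R] that] .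
  have \<pi>NA: "\<pi> (tgt a) * (M a * Z) = N a * (\<pi> (src a) * Z)" if "a \<in> Ar" for a Z using hom_eqA[OF reduces_hom1[OF R] that] .
  have eN: "e (tgt a) * N a = N a * e (src a)" if "a \<in> Ar" for a using hom_eq[OF e(1) that] .
  have eNA: "e (tgt a) * (N a * Z) = N a * (e (src a) * Z)" if "a \<in> Ar" for a Z using hom_eqA[OF e(1) that] .
  have ee: "e i * (e i * Z) = e i * Z" if "i < n" for i Z using assoc_eq[OF e(2)[OF that]] .

  define D where "D a = f (tgt a) * M a - M a * f (src a)" for a
  have D0: "E (tgt a) ^ (k - l) * D a = 0" if "a \<in> Ar" for a
    using f that unfolding near_end_def D_def E_def x_def by auto
  have DH: "D a \<in> Hom (d (tgt a)) (d (src a))" if "a \<in> Ar" for a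
    unfolding D_def using fH[OF tgt_lt[OF that]] fH[OF src_lt[OF that]] MH[OF that] by (auto intro: Hom_diff Hom_mult)
  have Drel: "x (tgt a) ^ lx a * D a = D a * x (src a) ^ rx a" if a: "a \<in> Ar" for a
  proof -
    have "x (tgt a) ^ lx a * D a = f (tgt a) * (x (tgt a) ^ lx a * M a) - (x (tgt a) ^ lx a * M a) * f (src a)"
      unfolding D_def using commute_powerA[OF xf[OF tgt_lt[OF a]]] by (simp add: right_diff_distrib mult.assoc)
    also have "\<dots> = D a * x (src a) ^ rx a"
      unfolding D_def is_mod_rel[OF mM a, folded x_def] using commute_power[OF xf[OF src_lt[OF a]]]
      by (simp add: left_diff_distrib mult.assoc)
    finally show ?thesis .
  qed
  \<comment> \<open>The last clause forces Y to vanish on the loops, where D vanishes; a cocycle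
    must be zero there.\<close>
  have "\<exists>Y. Y \<in> Hom (d (tgt a)) (d (src a)) \<and> E (tgt a) ^ l * Y = D a \<and>
      x (tgt a) ^ lx a * Y = Y * x (src a) ^ rx a \<and> (D a = 0 \<longrightarrow> Y = 0)" if a: "a \<in> Ar" for a
  proof (cases "D a = 0")
    case True then show ?thesis by (intro exI[of _ 0]) (auto intro: Hom_0)
  next
    case False
    then show ?thesis
      using cocycle_divide[OF M a less_imp_le[OF l(2)] l(1) DH[OF a] Drel[OF a, unfolded x_def] D0[OF a, unfolded E_def x_def]]
      unfolding E_def x_def by blast
  qed
  then obtain Y where Y: "\<And>a. a \<in> Ar \<Longrightarrow> Y a \<in> Hom (d (tgt a)) (d (src a))" "\<And>a. a \<in> Ar \<Longrightarrow> E (tgt a) ^ l * Y a = D a"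
      "\<And>a. a \<in> Ar \<Longrightarrow> x (tgt a) ^ lx a * Y a = Y a * x (src a) ^ rx a" "\<And>a. a \<in> Ar \<Longrightarrow> D a = 0 \<Longrightarrow> Y a = 0"
    by metis
  define Yb where "Yb a = \<pi> (tgt a) * Y a * \<rho> (src a)" for a
  have YbH: "Yb a \<in> Hom (s (tgt a)) (s (src a))" if a: "a \<in> Ar" for a
    unfolding Yb_def using reduces_by_D[OF R tgt_lt[OF a]] reduces_by_D[OF R src_lt[OF a]] Y(1)[OF a] by (meson Hom_mult)
  have YE: "Y a * E (src a) = E (tgt a) * Y a" if a: "a \<in> Ar" for a
    using rel_E[OF a Y(3)[OF a, unfolded x_def]] by (simp add: E_def x_def)
  have Yb\<pi>: "\<pi> (tgt a) * Y a = Yb a * \<pi> (src a)" if a: "a \<in> Ar" for a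
    unfolding Yb_def using reduces_factor[OF R N R tgt_lt[OF a] src_lt[OF a] Y(1)[OF a]] YE[OF a] by (simp add: E_def x_def)
  have Yb\<pi>A: "\<pi> (tgt a) * (Y a * Z) = Yb a * (\<pi> (src a) * Z)" if a: "a \<in> Ar" for a Z
    using assoc_eq[OF Yb\<pi>[OF a]] by (simp add: mult.assoc)
  have cancel: "X = X'" if "a \<in> Ar" "X \<in> Hom (s (tgt a)) (s (src a))" "X' \<in> Hom (s (tgt a)) (s (src a))"
      "X * \<pi> (src a) = X' * \<pi> (src a)" for a X X'
    using reduces_cancel[OF R src_lt[OF that(1)] that(2-4)] .
  have \<pi>xp: "\<pi> i * x i ^ t = y i ^ t * \<pi> i" if "i < n" for i t
    unfolding x_def y_def using hom_pow[OF reduces_hom1[OF R] that] .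
  have \<pi>xpA: "\<pi> i * (x i ^ t * Z) = y i ^ t * (\<pi> i * Z)" if "i < n" for i t Z
    unfolding x_def y_def using hom_powA[OF reduces_hom1[OF R] that] .
  have yH: "y i \<in> Hom (s i) (s i)" if "i < n" for i unfolding y_def using is_mod_Eps[OF N that] .
  have Ybrel: "y (tgt a) ^ lx a * Yb a = Yb a * y (src a) ^ rx a" if a: "a \<in> Ar" for a
  proof (rule cancel[OF a Hom_pow_mult[OF yH[OF tgt_lt[OF a]] YbH[OF a]] Hom_mult_pow[OF yH[OF src_lt[OF a]] YbH[OF a]]])
    have "y (tgt a) ^ lx a * Yb a * \<pi> (src a) = \<pi> (tgt a) * (x (tgt a) ^ lx a * Y a)"
      using \<pi>xpA[OF tgt_lt[OF a]] Yb\<pi>[OF a] by (simp add: mult.assoc)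
    also have "\<dots> = Yb a * y (src a) ^ rx a * \<pi> (src a)"
      unfolding Y(3)[OF a] using Yb\<pi>A[OF a] \<pi>xp[OF src_lt[OF a]] by (simp add: mult.assoc)
    finally show "y (tgt a) ^ lx a * Yb a * \<pi> (src a) = Yb a * y (src a) ^ rx a * \<pi> (src a)" .
  qed
  have Eps0: "Yb (Eps i) = 0" if "i < n" for i
  proof -
    have "D (Eps i) = 0" unfolding D_def using xf[OF that] by (simp add: x_def)
    then have "Y (Eps i) = 0" using Y(4)[OF Eps_Ar[OF that]] by simp
    then show ?thesis by (simp add: Yb_def)
  qed
  \<comment> \<open>D is a commutator with an idempotent, so \<open>f * D + D * f = D\<close>. The
    factor \<open>E ^ l\<close> can be cancelled only after applying \<open>\<pi>\<close>, by
    \<open>E_kernel\<close>, and this needs l < k.\<close>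
  have eY: "e (tgt a) * Yb a + Yb a * e (src a) = Yb a" if a: "a \<in> Ar" for a
  proof (rule cancel[OF a _ YbH[OF a]])
    note t = tgt_lt[OF a] and u = src_lt[OF a]
    show "e (tgt a) * Yb a + Yb a * e (src a) \<in> Hom (s (tgt a)) (s (src a))"
      using eH[OF t] eH[OF u] YbH[OF a] by (intro Hom_add Hom_mult)
    let ?Z = "f (tgt a) * Y a + Y a * f (src a) - Y a"
    have ZH: "?Z \<in> Hom (d (tgt a)) (d (src a))" using fH[OF t] fH[OF u] Y(1)[OF a] by (intro Hom_add Hom_diff Hom_mult)
    have "E (tgt a) ^ l * ?Z = f (tgt a) * D a + D a * f (src a) - D a"
      using EcommA[OF xf[OF t]] Y(2)[OF a] assoc_eq[OF Y(2)[OF a]] by (simp add: right_diff_distrib distrib_left)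
    also have "\<dots> = 0" unfolding D_def using ffA[OF t] ff[OF u]
      by (simp add: right_diff_distrib left_diff_distrib mult.assoc)
    finally have "\<pi> (tgt a) * ?Z = 0" using E_kernel[OF M R N t l(2) ZH] by (simp add: E_def x_def)
    then show "(e (tgt a) * Yb a + Yb a * e (src a)) * \<pi> (src a) = Yb a * \<pi> (src a)"
      using \<pi>fA[OF t] Yb\<pi>[OF a] Yb\<pi>A[OF a] \<pi>f[OF u]
      by (simp add: right_diff_distrib distrib_left distrib_right mult.assoc)
  qed
  have eYe: "e (tgt a) * (Yb a * e (src a)) = 0" if a: "a \<in> Ar" for a
    using arg_cong[OF eY[OF a], of "\<lambda>z. e (tgt a) * z"] ee[OF tgt_lt[OF a]] by (simp add: distrib_left)
  \<comment> \<open>Since \<open>Yb\<close> is off-diagonal for e, taking the commutator with e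
    twice gives it back: [e,X] = \<open>Yb\<close>. So the error has the form that unobstructedness
    controls.\<close>
  define X where "X a = e (tgt a) * Yb a - Yb a * e (src a)" for a
  have eX: "e (tgt a) * X a - X a * e (src a) = Yb a" if a: "a \<in> Ar" for a
    unfolding X_def using eY[OF a] eYe[OF a] ee[OF tgt_lt[OF a]] e(2)[OF src_lt[OF a]]
    by (simp add: right_diff_distrib left_diff_distrib mult.assoc)
  have yeA: "y i ^ t * (e i * Z) = e i * (y i ^ t * Z)" if "i < n" for i t Z
    unfolding y_def using hom_powA[OF e(1) that] by simp
  have ye: "y i ^ t * e i = e i * y i ^ t" if "i < n" for i t
    unfolding y_def using hom_pow[OF e(1) that] by simp
  have "cocycle s N X" unfolding cocycle_def is_rep_def
  proof (intro conjI allI impI ballI)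
    show "X (Eps i) = 0" if "i < n" for i using Eps0[OF that] by (simp add: X_def)
    fix a assume a: "a \<in> Ar"
    note t = tgt_lt[OF a] and u = src_lt[OF a]
    show "X a \<in> Hom (s (tgt a)) (s (src a))"
      unfolding X_def using eH[OF t] eH[OF u] YbH[OF a] by (intro Hom_diff Hom_mult)
    have "y (tgt a) ^ lx a * X a = e (tgt a) * (y (tgt a) ^ lx a * Yb a) - (y (tgt a) ^ lx a * Yb a) * e (src a)"
      unfolding X_def using yeA[OF t] by (simp add: right_diff_distrib mult.assoc)
    also have "\<dots> = X a * y (src a) ^ rx a"
      unfolding Ybrel[OF a] X_def using ye[OF u] by (simp add: left_diff_distrib mult.assoc)
    finally show "N (Eps (tgt a)) ^ lx a * X a = X a * N (Eps (src a)) ^ rx a" unfolding y_def .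
  qed
  then obtain h where h: "\<And>i. i < n \<Longrightarrow> h i \<in> Hom (s i) (s i)"
    "\<And>a. a \<in> Ar \<Longrightarrow> e (tgt a) * X a - X a * e (src a) = N a * h (src a) - h (tgt a) * N a"
    using S e(1) unfolding unobstructed_def by blast
  have hY: "Yb a = N a * h (src a) - h (tgt a) * N a" if "a \<in> Ar" for a
    using h(2)[OF that] eX[OF that] by simp
  have "N (Eps i) * h i = h i * N (Eps i)" if "i < n" for i
    using hY[OF Eps_Ar[OF that]] Eps0[OF that] by simp
  then have "\<forall>i. i < n \<longrightarrow> (\<exists>h'\<in>Hom (d i) (d i). M (Eps i) * h' = h' * M (Eps i) \<and> \<pi> i * h' = h i * \<pi> i)"
    using end_lift[OF M R N _ h(1)] by blast
  then obtain h' where h': "\<And>i. i < n \<Longrightarrow> h' i \<in> Hom (d i) (d i)" "\<And>i. i < n \<Longrightarrow> x i * h' i = h' i * x i"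
     "\<And>i. i < n \<Longrightarrow> \<pi> i * h' i = h i * \<pi> i" unfolding x_def by metis
  \<comment> \<open>\<open>z\<close> lies over \<open>zb\<close> = [e,h] and not over h: then [zb,N]
    = -X, and a further commutator with e produces -\<open>Yb\<close>, which is the correction
    required.\<close>
  define z where "z i = f i * h' i - h' i * f i" for i
  define zb where "zb i = e i * h i - h i * e i" for i
  have zH: "z i \<in> Hom (d i) (d i)" if "i < n" for i
    unfolding z_def using fH[OF that] h'(1)[OF that] by (intro Hom_diff Hom_mult)
  have xz: "x i * z i = z i * x i" if "i < n" for i
  proof -
    have "x i * (f i * h' i) = f i * h' i * x i" "x i * (h' i * f i) = h' i * f i * x i"
      using assoc_eq[OF xf[OF that], of "h' i"] assoc_eq[OF h'(2)[OF that], of "f i"] xf[OF that] h'(2)[OF that]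
      by (simp_all add: mult.assoc)
    then show ?thesis by (simp add: z_def right_diff_distrib left_diff_distrib)
  qed
  have \<pi>z: "\<pi> i * z i = zb i * \<pi> i" if "i < n" for i
    unfolding z_def zb_def using \<pi>fA[OF that] \<pi>f[OF that] h'(3)[OF that] assoc_eq[OF h'(3)[OF that]]
    by (simp add: right_diff_distrib left_diff_distrib mult.assoc)
  define q where "q i = E i ^ l * z i" for i
  obtain j where j: "l = Suc j" using l(1) gr0_implies_Suc by blast
  have xq: "x i * q i = q i * x i" if "i < n" for i
  proof -
    have "x i * E i ^ l = E i ^ l * x i" unfolding E_def power_mult[symmetric] by (simp add: power_commutes)
    then show ?thesis unfolding q_def using xz[OF that] assoc_eq[of "x i" "E i ^ l"] by (simp add: mult.assoc)
  qed
  \<comment> \<open>Powers of q are multiples of the same powers of E, because z commutes with E and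
    l is positive; hence q is nilpotent.\<close>
  have "\<exists>w. q i ^ t = E i ^ t * w" if "i < n" for i t
  proof (induction t)
    case (Suc t)
    then obtain w where w: "q i ^ t = E i ^ t * w" by blast
    have "q i ^ Suc t = E i ^ l * (z i * (E i ^ t * w))" unfolding power_Suc w by (simp add: q_def mult.assoc)
    also have "\<dots> = E i ^ l * (E i ^ t * (z i * w))" using EcommA[OF xz[OF that]] by simp
    also have "\<dots> = E i ^ Suc t * (E i ^ j * (z i * w))"
      unfolding j mult.assoc[symmetric] power_add[symmetric] by (simp add: add.commute)
    finally show ?case by blast
  qed simp
  then have "\<exists>g'. (1 + q i) * g' = 1 \<and> g' * (1 + q i) = 1" if "i < n" for i
    using one_plus_nilpotent_unit[of "q i" k] loc_free_Eps_higman(2)[OF M that] that unfolding E_def x_def by (metis mult_zero_left)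
  then obtain g' where g': "\<And>i. i < n \<Longrightarrow> (1 + q i) * g' i = 1" "\<And>i. i < n \<Longrightarrow> g' i * (1 + q i) = 1" by metis
  define g where "g i = 1 + q i" for i
  have gg: "g i * g' i = 1" "g' i * g i = 1" if "i < n" for i using g' that by (auto simp: g_def)
  have ggA: "g i * (g' i * Z) = Z" if "i < n" for i Z using assoc_eq[OF gg(1)[OF that]] by simp
  have xg: "x i * g i = g i * x i" if "i < n" for i
    unfolding g_def using xq[OF that] by (simp add: distrib_left distrib_right)
  have xg': "x i * g' i = g' i * x i" if "i < n" for i
    using commute_inverse[OF gg[OF that] xg[OF that]] .
  have qH: "q i \<in> Hom (d i) (d i)" if "i < n" for i
    unfolding q_def using EH[OF that] zH[OF that] by (rule Hom_pow_mult)
  \<comment> \<open>\<open>g\<close> is a unit of the ambient ring and not an element of the corner.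
    It commutes with \<open>idop\<close>, so conjugation by it preserves the corner.\<close>
  have ig: "idop (d i) * g i = g i * idop (d i)" if "i < n" for i
    unfolding g_def using qH[OF that] by (simp add: distrib_left distrib_right Hom_left Hom_right)
  have ig': "idop (d i) * g' i = g' i * idop (d i)" if "i < n" for i
    using commute_inverse[OF gg[OF that] ig[OF that]] .
  have \<pi>q: "\<pi> i * (q i * Z) = 0" if "i < n" for i Z
    unfolding q_def j using \<pi>E[OF that] by (simp add: mult.assoc)
  have \<pi>g: "\<pi> i * (g i * Z) = \<pi> i * Z" if "i < n" for i Z
    using \<pi>q[OF that] by (simp add: g_def distrib_left distrib_right)
  have \<pi>g': "\<pi> i * (g' i * Z) = \<pi> i * Z" if "i < n" for i Z
    using \<pi>g[OF that, of "g' i * Z"] ggA[OF that] by simp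
  define f' where "f' i = g' i * (f i * g i)" for i
  have Q: "f' i \<in> Hom (d i) (d i) \<and> M (Eps i) * f' i = f' i * M (Eps i) \<and> \<pi> i * f' i = e i * \<pi> i \<and> f' i * f' i = f' i"
    if i: "i < n" for i
  proof (intro conjI)
    show "f' i \<in> Hom (d i) (d i)"
    proof (rule Hom_I)
      show "idop (d i) * f' i = f' i"
        unfolding f'_def using assoc_eq[OF ig'[OF i]] Hom_leftA[OF fH[OF i]] by (simp add: mult.assoc)
      show "f' i * idop (d i) = f' i"
        unfolding f'_def using ig[OF i, symmetric] Hom_rightA[OF fH[OF i]] by (simp add: mult.assoc)
    qed
    have "x i * f' i = f' i * x i" unfolding f'_def
      using assoc_eq[OF xg'[OF i]] assoc_eq[OF xf[OF i]] xg[OF i] by (simp add: mult.assoc)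
    then show "M (Eps i) * f' i = f' i * M (Eps i)" by (simp add: x_def)
    show "\<pi> i * f' i = e i * \<pi> i" unfolding f'_def using \<pi>g'[OF i] \<pi>fA[OF i] \<pi>g[OF i, of 1] by simp
    show "f' i * f' i = f' i" unfolding f'_def using ggA[OF i] ffA[OF i] by (simp add: mult.assoc)
  qed
  have "E (tgt a) ^ (k - Suc l) * (f' (tgt a) * M a - M a * f' (src a)) = 0" if a: "a \<in> Ar" for a
  proof -
    note t = tgt_lt[OF a] and u = src_lt[OF a]
    define V where "V = (z (tgt a) * M a - M a * z (src a)) * g' (src a)"
    \<comment> \<open>Conjugating f by the inverse of g amounts to replacing M by L =
      \<open>g M g'\<close> and keeping f. V is the change of L divided by \<open>E ^ l\<close>, and
      U is the new error divided by \<open>E ^ l\<close>, which has to vanish modulo E.\<close>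
    define U where "U = Y a + (f (tgt a) * V - V * f (src a))"
    define L where "L = g (tgt a) * M a * g' (src a)"
    have "g (tgt a) * M a = M a * g (src a) + E (tgt a) ^ l * (z (tgt a) * M a - M a * z (src a))"
      unfolding g_def q_def using EM[OF a, of l] assoc_eq[OF EM[OF a, of l]]
      by (simp add: distrib_left distrib_right right_diff_distrib mult.assoc)
    then have L: "L = M a + E (tgt a) ^ l * V"
      unfolding L_def V_def using gg(1)[OF u] by (simp add: distrib_right mult.assoc)
    have fL: "f (tgt a) * L - L * f (src a) = E (tgt a) ^ l * U"
      unfolding L U_def using Y(2)[OF a] EcommA[OF xf[OF t], symmetric]
      by (simp add: D_def distrib_left distrib_right right_diff_distrib mult.assoc)
    have VH: "V * idop (d (src a)) = V" "idop (d (tgt a)) * V = V"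
    proof -
      have "z (tgt a) * M a - M a * z (src a) \<in> Hom (d (tgt a)) (d (src a))" (is "?v \<in> _")
        using zH[OF t] zH[OF u] MH[OF a] by (intro Hom_diff Hom_mult)
      note v = this
      show "V * idop (d (src a)) = V" unfolding V_def using ig'[OF u, symmetric] Hom_rightA[OF v] by (simp add: mult.assoc)
      show "idop (d (tgt a)) * V = V" unfolding V_def using Hom_leftA[OF v] .
    qed
    then have "V \<in> Hom (d (tgt a)) (d (src a))" by (intro Hom_I)
    then have UH: "U \<in> Hom (d (tgt a)) (d (src a))"
      unfolding U_def using Y(1)[OF a] fH[OF t] fH[OF u] by (intro Hom_add Hom_diff Hom_mult)
    have \<pi>V: "\<pi> (tgt a) * (V * Z) = (zb (tgt a) * N a - N a * zb (src a)) * (\<pi> (src a) * Z)" for Z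
    proof -
      have "\<pi> (tgt a) * (V * Z) = zb (tgt a) * (\<pi> (tgt a) * (M a * (g' (src a) * Z))) - N a * (\<pi> (src a) * (z (src a) * (g' (src a) * Z)))"
        unfolding V_def using assoc_eq[OF \<pi>z[OF t]] \<pi>NA[OF a]
        by (simp add: right_diff_distrib left_diff_distrib mult.assoc)
      also have "\<dots> = (zb (tgt a) * N a - N a * zb (src a)) * (\<pi> (src a) * (g' (src a) * Z))"
        using assoc_eq[OF \<pi>z[OF u]] \<pi>NA[OF a] by (simp add: left_diff_distrib mult.assoc)
      finally show ?thesis using \<pi>g'[OF u] by simp
    qed
    have zbN: "zb (tgt a) * N a - N a * zb (src a) = - X a"
    proof -
      have "zb (tgt a) * N a - N a * zb (src a) = - (e (tgt a) * (N a * h (src a) - h (tgt a) * N a)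
          - (N a * h (src a) - h (tgt a) * N a) * e (src a))"
        unfolding zb_def using eN[OF a] eNA[OF a] by (simp add: algebra_simps)
      then show ?thesis unfolding X_def hY[OF a] .
    qed
    have "\<pi> (tgt a) * U = (Yb a - (e (tgt a) * X a - X a * e (src a))) * \<pi> (src a)"
    proof -
      have "\<pi> (tgt a) * (f (tgt a) * V) = - (e (tgt a) * (X a * \<pi> (src a)))"
        using \<pi>fA[OF t] \<pi>V[of 1] unfolding zbN by simp
      moreover have "\<pi> (tgt a) * (V * f (src a)) = - (X a * (e (src a) * \<pi> (src a)))"
        using \<pi>V[of "f (src a)"] \<pi>f[OF u] unfolding zbN by simp
      ultimately show ?thesis unfolding U_def using Yb\<pi>[OF a]
        by (simp add: distrib_left left_diff_distrib right_diff_distrib mult.assoc)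
    qed
    also have "\<dots> = 0" unfolding eX[OF a] by simp
    finally have U: "U = E (tgt a) * (\<kappa> (tgt a) * U)" by (rule kill[OF t UH])
    \<comment> \<open>U contributes the missing factor E, so the exponents add up to exactly k,
      where E vanishes.\<close>
    have ks: "k - Suc l + l + 1 = k" using l(2) by simp
    have "E (tgt a) ^ (k - Suc l) * (E (tgt a) ^ l * U) = E (tgt a) ^ (k - Suc l + l + 1) * (\<kappa> (tgt a) * U)"
      by (subst U) (simp only: power_add power_one_right mult.assoc)
    also have "\<dots> = 0" unfolding ks using loc_free_Eps_higman(2)[OF M t] by (simp add: E_def x_def)
    finally have zero: "E (tgt a) ^ (k - Suc l) * (f (tgt a) * L - L * f (src a)) = 0" unfolding fL .
    have "f' (tgt a) * M a - M a * f' (src a) = g' (tgt a) * ((f (tgt a) * L - L * f (src a)) * g (src a))"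
    proof -
      have A: "g' (tgt a) * (g (tgt a) * Z) = Z" for Z using assoc_eq[OF gg(2)[OF t]] by simp
      have B: "g' (src a) * (g (src a) * Z) = Z" for Z using assoc_eq[OF gg(2)[OF u]] by simp
      show ?thesis unfolding f'_def L_def using gg(2)[OF u]
        by (simp add: left_diff_distrib right_diff_distrib mult.assoc A B)
    qed
    then show ?thesis using EcommA[OF xg'[OF t]] assoc_eq[OF zero] by simp
  qed
  then show ?thesis unfolding near_end_def using Q by (auto simp: E_def x_def)
qed

text \<open>The lifts at the vertices come from \<open>lift_idem\<close>. They start at l = 1, since
  e commutes with the arrows of N and so the commutators with M vanish modulo E. At l = k the
  annihilating power is \<open>E ^ 0\<close>, and the commutators are zero.\<close>

lemma lift_idempotent:
  assumes M: "loc_free k d M" and k: "k \<ge> 1" and R: "reduces_by d M s N \<pi> \<rho> \<kappa>" and N: "is_mod 1 s N" and S: "unobstructed s N"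
    and e: "hom s N s N e" "\<And>i. i < n \<Longrightarrow> e i * e i = e i"
  shows "\<exists>f. hom d M d M f \<and> (\<forall>i<n. f i * f i = f i \<and> \<pi> i * f i = e i * \<pi> i)"
proof -
  have "\<exists>f\<in>Hom (d i) (d i). M (Eps i) * f = f * M (Eps i) \<and> \<pi> i * f = e i * \<pi> i \<and> f * f = f" if i: "i < n" for i
  proof -
    have "N (Eps i) * e i = e i * N (Eps i)" using hom_eq[OF e(1) Eps_Ar[OF i]] by simp
    from end_lift[OF M R N i hom_Hom[OF e(1) i] this] obtain h where
      h: "h \<in> Hom (d i) (d i)" "M (Eps i) * h = h * M (Eps i)" "\<pi> i * h = e i * \<pi> i" by blast
    show ?thesis
      by (rule lift_idem[OF k loc_free_Eps_higman(2)[OF M i] reduces_by_D(5)[OF R i] _ h e(2)[OF i]]) (rule commute_power)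
  qed
  then obtain f where f: "\<And>i. i < n \<Longrightarrow> f i \<in> Hom (d i) (d i)" "\<And>i. i < n \<Longrightarrow> M (Eps i) * f i = f i * M (Eps i)"
     "\<And>i. i < n \<Longrightarrow> \<pi> i * f i = e i * \<pi> i" "\<And>i. i < n \<Longrightarrow> f i * f i = f i" by metis
  have "near_end d M \<pi> e k 1 f" unfolding near_end_def
  proof (intro conjI allI impI ballI f)
    fix a assume a: "a \<in> Ar"
    note t = tgt_lt[OF a] and u = src_lt[OF a]
    let ?D = "f (tgt a) * M a - M a * f (src a)" and ?E = "M (Eps (tgt a)) ^ c (tgt a)"
    have DH: "?D \<in> Hom (d (tgt a)) (d (src a))"
      using f(1)[OF t] f(1)[OF u] is_mod_Hom[OF loc_free_is_mod[OF M] a] by (intro Hom_diff Hom_mult)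
    have "\<pi> (tgt a) * ?D = e (tgt a) * (\<pi> (tgt a) * M a) - N a * (\<pi> (src a) * f (src a))"
      using assoc_eq[OF f(3)[OF t]] hom_eqA[OF reduces_hom1[OF R] a] by (simp add: right_diff_distrib mult.assoc)
    also have "\<dots> = 0"
      using hom_eq[OF reduces_hom1[OF R] a] f(3)[OF u] hom_eqA[OF e(1) a] by simp
    finally have D: "?D = ?E * (\<kappa> (tgt a) * ?D)" by (rule reduces_kill[OF R t DH])
    have "?E ^ (k - 1) * ?D = ?E ^ Suc (k - 1) * (\<kappa> (tgt a) * ?D)"
      by (subst D) (simp only: power_Suc2 mult.assoc)
    then show "?E ^ (k - 1) * ?D = 0" using loc_free_Eps_higman(2)[OF M t] k by simp
  qed
  then have "\<exists>f. near_end d M \<pi> e k (Suc l) f" if "Suc l \<le> k" for l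
    using that
  proof (induction l)
    case (Suc l)
    then show ?case using near_end_step[OF M R N S e, of "Suc l"] by auto
  qed auto
  from this[of "k - 1"] k obtain f where "near_end d M \<pi> e k k f" by auto
  then show ?thesis unfolding near_end_def hom_def by auto
qed


section \<open>Lifting and reducing decompositions\<close>

definition nonzero_dim :: "(nat \<Rightarrow> nat) \<Rightarrow> bool" where
  "nonzero_dim d \<longleftrightarrow> (\<exists>i<n. d i \<noteq> 0)"

definition indec :: "nat \<Rightarrow> (nat \<Rightarrow> nat) \<Rightarrow> (arrow \<Rightarrow> 'a::field lop) \<Rightarrow> bool" where
  "indec k d M \<longleftrightarrow> is_mod k d M \<and> nonzero_dim d \<and>
     \<not> (\<exists>d1 A d2 B. nonzero_dim d1 \<and> nonzero_dim d2 \<and> is_mod k d1 A \<and> is_mod k d2 B \<and> biprod d M d1 A d2 B)"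

definition iso where
  "iso d M N \<longleftrightarrow> (\<exists>P Q. hom d M d N P \<and> hom d N d M Q \<and>
      (\<forall>i<n. P i * Q i = idop (d i) \<and> Q i * P i = idop (d i)))"

lemma isoE:
  assumes "iso d M N"
  obtains P Q where "hom d M d N P" "hom d N d M Q" "\<And>i. i < n \<Longrightarrow> P i * Q i = idop (d i)"
    "\<And>i. i < n \<Longrightarrow> Q i * P i = idop (d i)"
  using assms unfolding iso_def by blast

lemma iso_sym: "iso d M N \<Longrightarrow> iso d N M"
  unfolding iso_def by blast

lemma idop_0: "idop 0 = 0"
  by (rule lop_eqI) (simp add: app_idop)

text \<open>An isomorphism presents N as a direct summand of M with zero complement.\<close>

lemma unobstructed_iso:
  assumes "iso d M N" "is_rep d N" "unobstructed d M"
  shows "unobstructed d N"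
proof -
  obtain P Q where PQ: "hom d M d N P" "hom d N d M Q" "\<And>i. i < n \<Longrightarrow> P i * Q i = idop (d i)"
    "\<And>i. i < n \<Longrightarrow> Q i * P i = idop (d i)" using isoE[OF assms(1)] by blast
  have "biprod_by d M d N (\<lambda>_. 0) (\<lambda>_. 0) Q P (\<lambda>_. 0) (\<lambda>_. 0)"
    unfolding biprod_by_def using PQ assms(2) by (auto simp: idop_0 is_rep_def hom_def Hom_0)
  then show ?thesis using unobstructed_summand[OF assms(3)] by blast
qed

lemma reduces_iso:
  assumes "reduces d M s N" "iso s N N'"
  shows "reduces d M s N'"
proof -
  obtain P Q where PQ: "hom s N s N' P" "hom s N' s N Q" "\<And>i. i < n \<Longrightarrow> P i * Q i = idop (s i)"
    "\<And>i. i < n \<Longrightarrow> Q i * P i = idop (s i)" using isoE[OF assms(2)] by blast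
  obtain \<pi> \<rho> \<kappa> where R: "reduces_by d M s N \<pi> \<rho> \<kappa>" using assms(1) by (auto simp: reduces_def)
  have "reduces_by d M s N' (\<lambda>i. P i * \<pi> i) (\<lambda>i. \<rho> i * Q i) \<kappa>" unfolding reduces_by_def
  proof (intro conjI allI impI)
    show "hom d M s N' (\<lambda>i. P i * \<pi> i)" by (rule hom_comp[OF reduces_hom1[OF R] PQ(1)])
    fix i assume i: "i < n"
    note rd = reduces_by_D[OF R i]
    show "\<rho> i * Q i \<in> Hom (d i) (s i)" using rd(2) hom_Hom[OF PQ(2) i] by (rule Hom_mult)
    show "\<kappa> i \<in> Hom (d i) (d i)" by (rule rd)
    show "P i * \<pi> i * (\<rho> i * Q i) = idop (s i)"
      using assoc_eq[OF rd(4)] Hom_left[OF hom_Hom[OF PQ(2) i]] PQ(3)[OF i] by (simp add: mult.assoc)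
    show "\<rho> i * Q i * (P i * \<pi> i) + M (Eps i) ^ c i * \<kappa> i = idop (d i)"
      using assoc_eq[OF PQ(4)[OF i]] Hom_left[OF rd(1)] rd(5) by (simp add: mult.assoc)
  qed
  then show ?thesis unfolding reduces_def by blast
qed

lemma reduces_iso_source:
  assumes "reduces d M s N" "iso d M M'"
  shows "reduces d M' s N"
proof -
  obtain P Q where PQ: "hom d M d M' P" "hom d M' d M Q" "\<And>i. i < n \<Longrightarrow> P i * Q i = idop (d i)"
    "\<And>i. i < n \<Longrightarrow> Q i * P i = idop (d i)" using isoE[OF assms(2)] by blast
  obtain \<pi> \<rho> \<kappa> where R: "reduces_by d M s N \<pi> \<rho> \<kappa>" using assms(1) by (auto simp: reduces_def)
  have "reduces_by d M' s N (\<lambda>i. \<pi> i * Q i) (\<lambda>i. P i * \<rho> i) (\<lambda>i. P i * (\<kappa> i * Q i))" unfolding reduces_by_def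
  proof (intro conjI allI impI)
    show "hom d M' s N (\<lambda>i. \<pi> i * Q i)" by (rule hom_comp[OF PQ(2) reduces_hom1[OF R]])
    fix i assume i: "i < n"
    note rd = reduces_by_D[OF R i] and P = hom_Hom[OF PQ(1) i] and Q = hom_Hom[OF PQ(2) i]
    show "P i * \<rho> i \<in> Hom (d i) (s i)" using P rd(2) by (rule Hom_mult)
    show "P i * (\<kappa> i * Q i) \<in> Hom (d i) (d i)" by (rule Hom_mult[OF P Hom_mult[OF rd(3) Q]])
    show "\<pi> i * Q i * (P i * \<rho> i) = idop (s i)"
      using assoc_eq[OF PQ(4)[OF i]] Hom_left[OF rd(2)] rd(4) by (simp add: mult.assoc)
    have "P i * \<rho> i * (\<pi> i * Q i) + M' (Eps i) ^ c i * (P i * (\<kappa> i * Q i)) =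
        P i * ((\<rho> i * \<pi> i + M (Eps i) ^ c i * \<kappa> i) * Q i)"
      using hom_powA[OF PQ(1) i] by (simp add: distrib_left distrib_right mult.assoc)
    then show "P i * \<rho> i * (\<pi> i * Q i) + M' (Eps i) ^ c i * (P i * (\<kappa> i * Q i)) = idop (d i)"
      unfolding rd(5) using Hom_left[OF Q] PQ(3)[OF i] by simp
  qed
  then show ?thesis unfolding reduces_def by blast
qed

text \<open>The identity of M induces maps between the two reductions in both directions, and these
  are inverse to each other because the projections from M can be cancelled.\<close>

lemma reduces_unique:
  assumes R: "reduces_by d M s N \<pi> \<rho> \<kappa>" and N: "is_mod 1 s N" and R': "reduces_by d M s' N' \<pi>' \<rho>' \<kappa>'" and N': "is_mod 1 s' N'"
    and M: "is_rep d M"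
  shows "\<And>i. i < n \<Longrightarrow> s i = s' i" and "s = s' \<Longrightarrow> iso s N N'"
proof -
  note a = reduces_hom[OF R is_mod_is_rep[OF N] R' N' hom_id[OF M]]
  note b = reduces_hom[OF R' is_mod_is_rep[OF N'] R N hom_id[OF M]]
  let ?P = "\<lambda>i. \<pi>' i * idop (d i) * \<rho> i" and ?Q = "\<lambda>i. \<pi> i * idop (d i) * \<rho>' i"
  have 1: "?P i * ?Q i = idop (s' i)" if i: "i < n" for i
  proof (rule reduces_cancel[OF R' i Hom_mult[OF hom_Hom[OF a(2) i] hom_Hom[OF b(2) i]] Hom_idop])
    show "?P i * ?Q i * \<pi>' i = idop (s' i) * \<pi>' i"
      using a(1)[OF i] b(1)[OF i] Hom_right[OF reduces_by_D(1)[OF R i]] Hom_right[OF reduces_by_D(1)[OF R' i]]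
        Hom_left[OF reduces_by_D(1)[OF R' i]] by (simp add: mult.assoc)
  qed
  have 2: "?Q i * ?P i = idop (s i)" if i: "i < n" for i
  proof (rule reduces_cancel[OF R i Hom_mult[OF hom_Hom[OF b(2) i] hom_Hom[OF a(2) i]] Hom_idop])
    show "?Q i * ?P i * \<pi> i = idop (s i) * \<pi> i"
      using a(1)[OF i] b(1)[OF i] Hom_right[OF reduces_by_D(1)[OF R i]] Hom_right[OF reduces_by_D(1)[OF R' i]]
        Hom_left[OF reduces_by_D(1)[OF R i]] by (simp add: mult.assoc)
  qed
  show "s i = s' i" if i: "i < n" for i
    using Hom_dim_eq[OF hom_Hom[OF b(2) i] hom_Hom[OF a(2) i] 2[OF i] 1[OF i]] .
  show "iso s N N'" if "s = s'" using a(2) b(2) 1 2 unfolding iso_def that by blast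
qed

lemma reduces_dim:
  assumes M: "loc_free k d M" and k: "k \<ge> 1" and R: "reduces d M s N" and N: "is_mod 1 s N" and i: "i < n"
  shows "d i = k * s i"
proof -
  obtain s' N' where N': "loc_free 1 s' N'" "reduces d M s' N'" "\<forall>i<n. d i = k * s' i" using reduces_ex[OF M k] by blast
  obtain \<pi> \<rho> \<kappa> \<pi>' \<rho>' \<kappa>' where R2: "reduces_by d M s N \<pi> \<rho> \<kappa>" "reduces_by d M s' N' \<pi>' \<rho>' \<kappa>'"
    using R N'(2) unfolding reduces_def by blast
  have "s i = s' i" by (rule reduces_unique(1)[OF R2(1) N R2(2) loc_free_is_mod[OF N'(1)] is_mod_is_rep[OF loc_free_is_mod[OF M]] i])
  then show ?thesis using N'(3) i by simp
qed

lemma loc_free_biprod: "loc_free k d M \<Longrightarrow> biprod d M d1 A d2 B \<Longrightarrow> loc_free k d1 A \<and> loc_free k d2 B"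
  unfolding biprod_def using loc_free_summand biprod_by_sym by metis

lemma unobstructed_biprod: "unobstructed d M \<Longrightarrow> biprod d M d1 A d2 B \<Longrightarrow> unobstructed d1 A \<and> unobstructed d2 B"
  unfolding biprod_def using unobstructed_summand biprod_by_sym by metis

lemma reduce_biprod:
  assumes M: "loc_free k d M" and k: "k \<ge> 1" and R: "reduces d M s N" and N: "is_mod 1 s N" and b: "biprod d M d1 A d2 B"
  shows "\<exists>s1 N1 s2 N2. biprod s N s1 N1 s2 N2 \<and> loc_free 1 s1 N1 \<and> loc_free 1 s2 N2 \<and> reduces d1 A s1 N1 \<and> reduces d2 B s2 N2 \<and>
     (\<forall>i<n. d1 i = k * s1 i \<and> d2 i = k * s2 i)"
proof -
  have AB: "loc_free k d1 A" "loc_free k d2 B" using loc_free_biprod[OF M b] by auto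
  obtain s1 N1 where 1: "loc_free 1 s1 N1" "reduces d1 A s1 N1" "\<forall>i<n. d1 i = k * s1 i" using reduces_ex[OF AB(1) k] by blast
  obtain s2 N2 where 2: "loc_free 1 s2 N2" "reduces d2 B s2 N2" "\<forall>i<n. d2 i = k * s2 i" using reduces_ex[OF AB(2) k] by blast
  have "biprod s N s1 N1 s2 N2"
    using b R 1(2) 2(2) unfolding biprod_def[of d] reduces_def
    using reduces_biprod[OF _ _ _ _ N loc_free_is_mod[OF 1(1)] loc_free_is_mod[OF 2(1)]] by blast
  then show ?thesis using 1 2 by blast
qed

text \<open>The projection of N onto its first summand is an idempotent endomorphism; its lift
  splits M, and the complementary idempotents correspond as well.\<close>

lemma lift_biprod:
  assumes M: "loc_free k d M" and k: "k \<ge> 1" and R: "reduces d M s N" and N: "is_mod 1 s N" and S: "unobstructed s N"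
    and b: "biprod s N s1 N1 s2 N2"
  shows "\<exists>d1 A d2 B. biprod d M d1 A d2 B \<and> loc_free k d1 A \<and> loc_free k d2 B \<and> reduces d1 A s1 N1 \<and> reduces d2 B s2 N2"
proof -
  obtain \<pi> \<rho> \<kappa> where R': "reduces_by d M s N \<pi> \<rho> \<kappa>" using R by (auto simp: reduces_def)
  obtain \<iota> p \<iota>' p' where b': "biprod_by s N s1 N1 s2 N2 \<iota> p \<iota>' p'" using b by (auto simp: biprod_def)
  then have bb: "hom s1 N1 s N \<iota>" "hom s N s1 N1 p"
    "\<And>i. i < n \<Longrightarrow> p i * \<iota> i = idop (s1 i)" "\<And>i. i < n \<Longrightarrow> \<iota> i * p i + \<iota>' i * p' i = idop (s i)"
    by (auto simp: biprod_by_def)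
  have e: "hom s N s N (\<lambda>i. \<iota> i * p i)" by (rule hom_comp[OF bb(2,1)])
  have "\<iota> i * p i * (\<iota> i * p i) = \<iota> i * p i" if "i < n" for i
    using assoc_eq[OF bb(3)[OF that], of "p i"] Hom_left[OF hom_Hom[OF bb(2) that]] by (simp add: mult.assoc)
  from lift_idempotent[OF M k R' N S e this] obtain f where f: "hom d M d M f"
    "\<And>i. i < n \<Longrightarrow> f i * f i = f i" "\<And>i. i < n \<Longrightarrow> \<pi> i * f i = \<iota> i * p i * \<pi> i" by blast
  obtain d1 A d2 B j q j' q' where m: "biprod_by d M d1 A d2 B j q j' q'" "\<forall>i<n. j i * q i = f i"
    using is_mod_split[OF loc_free_is_mod[OF M] f(1,2)] by blast
  have "reduces_by d1 A s1 N1 (\<lambda>i. p i * \<pi> i * j i) (\<lambda>i. q i * \<rho> i * \<iota> i) (\<lambda>i. q i * \<kappa> i * j i)"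
    by (rule reduces_summand[OF m(1) b' R']) (use f m in auto)
  moreover have "reduces_by d2 B s2 N2 (\<lambda>i. p' i * \<pi> i * j' i) (\<lambda>i. q' i * \<rho> i * \<iota>' i) (\<lambda>i. q' i * \<kappa> i * j' i)"
  proof (rule reduces_summand[OF biprod_by_sym[OF m(1)] biprod_by_sym[OF b'] R'])
    fix i assume i: "i < n"
    have "j i * q i + j' i * q' i = idop (d i)" using m(1) i by (auto simp: biprod_by_def)
    then have 1: "j' i * q' i = idop (d i) - f i" using m(2) i by (simp add: eq_diff_eq add.commute)
    have 2: "\<iota>' i * p' i = idop (s i) - \<iota> i * p i" using bb(4)[OF i] by (simp add: eq_diff_eq add.commute)
    show "\<pi> i * (j' i * q' i) = \<iota>' i * p' i * \<pi> i" unfolding 1 2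
      using f(3)[OF i] Hom_left[OF reduces_by_D(1)[OF R' i]] Hom_right[OF reduces_by_D(1)[OF R' i]]
      by (simp add: left_diff_distrib right_diff_distrib)
  qed
  moreover have "biprod d M d1 A d2 B" using m(1) by (auto simp: biprod_def)
  ultimately show ?thesis using loc_free_biprod[OF M] unfolding reduces_def by blast
qed

text \<open>A decomposition of M reduces to one of N by functoriality, and \<open>d = k s\<close>
  keeps both parts nonzero.\<close>

lemma indec_lift:
  assumes M: "loc_free k d M" and k: "k \<ge> 1" and R: "reduces d M s N" and N: "indec 1 s N"
  shows "indec k d M"
  unfolding indec_def
proof (intro conjI notI)
  have N1: "is_mod 1 s N" and nzs: "nonzero_dim s" using N by (auto simp: indec_def)
  show "is_mod k d M" by (rule loc_free_is_mod[OF M])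
  show "nonzero_dim d" using nzs reduces_dim[OF M k R N1] k by (auto simp: nonzero_dim_def)
  assume "\<exists>d1 A d2 B. nonzero_dim d1 \<and> nonzero_dim d2 \<and> is_mod k d1 A \<and> is_mod k d2 B \<and> biprod d M d1 A d2 B"
  then obtain d1 A d2 B where d: "nonzero_dim d1" "nonzero_dim d2" "biprod d M d1 A d2 B" by blast
  obtain s1 A' s2 B' where "biprod s N s1 A' s2 B'" "loc_free 1 s1 A'" "loc_free 1 s2 B'" "\<forall>i<n. d1 i = k * s1 i \<and> d2 i = k * s2 i"
    using reduce_biprod[OF M k R N1 d(3)] by blast
  moreover from this have "nonzero_dim s1" "nonzero_dim s2" using d(1,2) by (auto simp: nonzero_dim_def)
  ultimately show False using N loc_free_is_mod unfolding indec_def by blast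
qed

text \<open>A decomposition of N lifts to M; here unobstructedness enters.\<close>

lemma indec_reduce:
  assumes M: "loc_free k d M" and k: "k \<ge> 1" and R: "reduces d M s N" and N: "is_mod 1 s N" and S: "unobstructed s N" and I: "indec k d M"
  shows "indec 1 s N"
  unfolding indec_def
proof (intro conjI notI)
  show "is_mod 1 s N" by (rule N)
  show "nonzero_dim s" using I reduces_dim[OF M k R N] k by (auto simp: nonzero_dim_def indec_def)
  assume "\<exists>d1 A d2 B. nonzero_dim d1 \<and> nonzero_dim d2 \<and> is_mod 1 d1 A \<and> is_mod 1 d2 B \<and> biprod s N d1 A d2 B"
  then obtain s1 A s2 B where d: "nonzero_dim s1" "nonzero_dim s2" "is_mod 1 s1 A" "is_mod 1 s2 B" "biprod s N s1 A s2 B" by blast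
  obtain d1 A' d2 B' where e: "biprod d M d1 A' d2 B'" "loc_free k d1 A'" "loc_free k d2 B'" "reduces d1 A' s1 A" "reduces d2 B' s2 B"
    using lift_biprod[OF M k R N S d(5)] by blast
  have "nonzero_dim d1" "nonzero_dim d2"
    using d(1,2) reduces_dim[OF e(2) k e(4) d(3)] reduces_dim[OF e(3) k e(5) d(4)] k by (auto simp: nonzero_dim_def)
  then show False using I e loc_free_is_mod unfolding indec_def by blast
qed

text \<open>Summands are split off one after the other with an unnamed complement, so no model of
  the direct sum has to be chosen. By \<open>biprod_list_unique\<close> the list still determines
  the representation up to isomorphism.\<close>

fun biprod_list :: "(nat \<Rightarrow> nat) \<Rightarrow> (arrow \<Rightarrow> 'a::field lop) \<Rightarrow> ((nat \<Rightarrow> nat) \<times> (arrow \<Rightarrow> 'a lop)) list \<Rightarrow> bool" where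
  "biprod_list d M [] \<longleftrightarrow> (\<forall>i<n. d i = 0)"
| "biprod_list d M (P # L) \<longleftrightarrow> (\<exists>d2 B. biprod d M (fst P) (snd P) d2 B \<and> biprod_list d2 B L)"

text \<open>Splitting off one summand leaves complements that again form a locally free module with
  an unobstructed reduction, which is what the induction needs.\<close>

lemma decomposition_lift:
  assumes "biprod_list s N L" "loc_free k d M" "k \<ge> 1" "loc_free 1 s N" "reduces d M s N" "unobstructed s N"
    "\<And>P. P \<in> set L \<Longrightarrow> indec 1 (fst P) (snd P)"
  shows "\<exists>L'. biprod_list d M L' \<and>
    list_all2 (\<lambda>P' P. loc_free k (fst P') (snd P') \<and> indec k (fst P') (snd P') \<and> (\<forall>i<n. fst P' i = k * fst P i)) L' L"
  using assms
proof (induction L arbitrary: s N d M)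
  case Nil
  then have "\<forall>i<n. d i = 0" using reduces_dim[OF Nil(2,3,5) loc_free_is_mod[OF Nil(4)]] by auto
  then show ?case by (intro exI[of _ "[]"]) auto
next
  case (Cons P L)
  then obtain s2 N2 where N2: "biprod s N (fst P) (snd P) s2 N2" "biprod_list s2 N2 L" by auto
  have I: "indec 1 (fst P) (snd P)" and IL: "\<And>Q. Q \<in> set L \<Longrightarrow> indec 1 (fst Q) (snd Q)" using Cons.prems(7) by auto
  obtain d1 A d2 B where d: "biprod d M d1 A d2 B" "loc_free k d1 A" "loc_free k d2 B" "reduces d1 A (fst P) (snd P)" "reduces d2 B s2 N2"
    using lift_biprod[OF Cons.prems(2,3,5) loc_free_is_mod[OF Cons.prems(4)] Cons.prems(6) N2(1)] by blast
  have S2: "unobstructed s2 N2" using unobstructed_biprod[OF Cons.prems(6) N2(1)] by simp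
  have L2: "loc_free 1 s2 N2" using loc_free_biprod[OF Cons.prems(4) N2(1)] by simp
  obtain L' where L': "biprod_list d2 B L'"
    "list_all2 (\<lambda>P' P. loc_free k (fst P') (snd P') \<and> indec k (fst P') (snd P') \<and> (\<forall>i<n. fst P' i = k * fst P i)) L' L"
    using Cons.IH[OF N2(2) d(3) Cons.prems(3) L2 d(5) S2 IL] by blast
  have "indec k d1 A" by (rule indec_lift[OF d(2) Cons.prems(3) d(4) I])
  moreover have "\<forall>i<n. d1 i = k * fst P i" using reduces_dim[OF d(2) Cons.prems(3) d(4)] I by (auto simp: indec_def)
  ultimately show ?case using d L' by (intro exI[of _ "(d1, A) # L'"]) auto
qed

lemma decomposition_reduce:
  assumes "biprod_list d M L'" "loc_free k d M" "k \<ge> 1" "loc_free 1 s N" "reduces d M s N" "unobstructed s N"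
    "\<And>P. P \<in> set L' \<Longrightarrow> indec k (fst P) (snd P)"
  shows "\<exists>L. biprod_list s N L \<and>
    list_all2 (\<lambda>P' P. loc_free 1 (fst P) (snd P) \<and> indec 1 (fst P) (snd P) \<and> (\<forall>i<n. fst P' i = k * fst P i)) L' L"
  using assms
proof (induction L' arbitrary: s N d M)
  case Nil
  then have "\<forall>i<n. s i = 0" using reduces_dim[OF Nil(2,3,5) loc_free_is_mod[OF Nil(4)]] by auto
  then show ?case by (intro exI[of _ "[]"]) auto
next
  case (Cons P L')
  then obtain d2 B where B: "biprod d M (fst P) (snd P) d2 B" "biprod_list d2 B L'" by auto
  have I: "indec k (fst P) (snd P)" and IL: "\<And>Q. Q \<in> set L' \<Longrightarrow> indec k (fst Q) (snd Q)" using Cons.prems(7) by auto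
  obtain s1 N1 s2 N2 where s: "biprod s N s1 N1 s2 N2" "loc_free 1 s1 N1" "loc_free 1 s2 N2" "reduces (fst P) (snd P) s1 N1" "reduces d2 B s2 N2"
    "\<forall>i<n. fst P i = k * s1 i \<and> d2 i = k * s2 i"
    using reduce_biprod[OF Cons.prems(2,3,5) loc_free_is_mod[OF Cons.prems(4)] B(1)] by blast
  have S: "unobstructed s1 N1" "unobstructed s2 N2" using unobstructed_biprod[OF Cons.prems(6) s(1)] by auto
  have lfB: "loc_free k (fst P) (snd P)" "loc_free k d2 B" using loc_free_biprod[OF Cons.prems(2) B(1)] by auto
  obtain L where L: "biprod_list s2 N2 L"
    "list_all2 (\<lambda>P' P. loc_free 1 (fst P) (snd P) \<and> indec 1 (fst P) (snd P) \<and> (\<forall>i<n. fst P' i = k * fst P i)) L' L"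
    using Cons.IH[OF B(2) lfB(2) Cons.prems(3) s(3,5) S(2) IL] by blast
  have "indec 1 s1 N1" by (rule indec_reduce[OF lfB(1) Cons.prems(3) s(4) loc_free_is_mod[OF s(2)] S(1) I])
  then show ?case using s L by (intro exI[of _ "(s1, N1) # L"]) auto
qed

end

section \<open>Block matrices as biproducts\<close>

lift_definition second_incl :: "nat \<Rightarrow> nat \<Rightarrow> 'a::field lop" is
  "\<lambda>r1 r2 x p. if r1 \<le> p \<and> p < r1 + r2 then x (p - r1) else 0"
  by (auto simp: fun_eq_iff)

lift_definition second_proj :: "nat \<Rightarrow> nat \<Rightarrow> 'a::field lop" is
  "\<lambda>r1 r2 x p. if p < r2 then x (r1 + p) else 0"
  by (auto simp: fun_eq_iff)

lemma inr_op_Hom: "second_incl r1 r2 \<in> Hom (r1 + r2) r2"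
  by (intro Hom_I lop_eqI) (auto simp: second_incl.rep_eq app_idop)

lemma prr_op_Hom: "second_proj r1 r2 \<in> Hom r2 (r1 + r2)"
  by (intro Hom_I lop_eqI) (auto simp: second_proj.rep_eq app_idop)

lemma idop_Hom_block: "idop r1 \<in> Hom (r1 + r2) r1" "idop r1 \<in> Hom r1 (r1 + r2)"
  by (rule Hom_mono[OF Hom_idop]; simp)+

lemma block_ops: "second_proj r1 r2 * second_incl r1 r2 = idop r2" "idop r1 * second_incl r1 r2 = 0" "second_proj r1 r2 * idop r1 = 0"
    "idop r1 * idop r1 + second_incl r1 r2 * second_proj r1 r2 = idop (r1 + r2)"
  by (rule lop_eqI; auto simp: second_incl.rep_eq second_proj.rep_eq app_idop)+

lemma entry_idop_sandwich: "entry (idop r * (Z :: 'a::field lop) * idop c) p q = (if p < r \<and> q < c then entry Z p q else 0)"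
proof -
  have "app (idop c) (\<lambda>s. if s = q then 1 else 0 :: 'a) = (if q < c then (\<lambda>s. if s = q then 1 else 0) else (\<lambda>s. 0))"
    by (auto simp: fun_eq_iff app_idop)
  then show ?thesis unfolding entry_def by (simp add: app_idop app_zero)
qed

lemma entry_block_sandwich:
  "entry (second_incl r1 r2 * (Z :: 'a::field lop) * second_proj c1 c2) p q =
     (if r1 \<le> p \<and> p < r1 + r2 \<and> c1 \<le> q \<and> q < c1 + c2 then entry Z (p - r1) (q - c1) else 0)"
proof -
  have "app (second_proj c1 c2) (\<lambda>s. if s = q then 1 else 0 :: 'a) =
      (if c1 \<le> q \<and> q < c1 + c2 then (\<lambda>s. if s = q - c1 then 1 else 0) else (\<lambda>s. 0))"
    by (auto simp: fun_eq_iff second_proj.rep_eq)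
  then show ?thesis unfolding entry_def by (auto simp: second_incl.rep_eq app_zero)
qed

text \<open>The first summand of K^(r1 + r2) consists of the first coordinates, so
  \<open>idop r1\<close> is both its inclusion and its projection; only the second summand needs a
  shift.\<close>

lemma mat_op_four_block:
  assumes "A \<in> carrier_mat r1 c1" "B \<in> carrier_mat r2 c2"
  shows "mat_op (four_block_mat A (0\<^sub>m r1 c2) (0\<^sub>m r2 c1) B) =
    idop r1 * mat_op A * idop c1 + second_incl r1 r2 * mat_op B * second_proj c1 c2"
proof (rule Hom_eqI[of _ "r1 + r2" "c1 + c2"])
  show "mat_op (four_block_mat A (0\<^sub>m r1 c2) (0\<^sub>m r2 c1) B) \<in> Hom (r1 + r2) (c1 + c2)"
    using assms by (intro mat_op_Hom) auto
  show "idop r1 * mat_op A * idop c1 + second_incl r1 r2 * mat_op B * second_proj c1 c2 \<in> Hom (r1 + r2) (c1 + c2)"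
    by (intro Hom_add Hom_mult[OF Hom_mult[OF idop_Hom_block(1) mat_op_Hom[OF assms(1)]] idop_Hom_block(2)]
      Hom_mult[OF Hom_mult[OF inr_op_Hom mat_op_Hom[OF assms(2)]] prr_op_Hom])
  fix p q assume "p < r1 + r2" "q < c1 + c2"
  then show "entry (mat_op (four_block_mat A (0\<^sub>m r1 c2) (0\<^sub>m r2 c1) B)) p q =
    entry (idop r1 * mat_op A * idop c1 + second_incl r1 r2 * mat_op B * second_proj c1 c2) p q"
    using assms by (auto simp: entry_idop_sandwich entry_block_sandwich entry_mat_op)
qed

section \<open>Isomorphism invariance and uniqueness of biproducts\<close>

context quiver_relations begin

text \<open>Dimension functions coming from vectors carry information only below n, and
  representations only on \<open>Ar\<close>. The congruence rules allow a change of the values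
  elsewhere.\<close>

lemma hom_cong:
  assumes "\<And>i. i < n \<Longrightarrow> d i = e i" "\<And>i. i < n \<Longrightarrow> d' i = e' i"
    "\<And>a. a \<in> Ar \<Longrightarrow> M a = M' a" "\<And>a. a \<in> Ar \<Longrightarrow> N a = N' a"
  shows "hom d M d' N h \<longleftrightarrow> hom e M' e' N' h"
  using assms by (auto simp: hom_def)

lemma is_rep_cong:
  assumes "\<And>i. i < n \<Longrightarrow> d i = e i" "\<And>a. a \<in> Ar \<Longrightarrow> M a = M' a"
  shows "is_rep d M \<longleftrightarrow> is_rep e M'"
  using assms tgt_lt src_lt by (auto simp: is_rep_def)

lemma is_mod_cong:
  assumes "\<And>i. i < n \<Longrightarrow> d i = e i" "\<And>a. a \<in> Ar \<Longrightarrow> M a = M' a"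
  shows "is_mod k d M \<longleftrightarrow> is_mod k e M'"
  using is_rep_cong[of d e M M', OF assms] assms(2) Eps_Ar tgt_lt src_lt by (simp add: is_mod_def)

lemma loc_free_cong:
  assumes "\<And>i. i < n \<Longrightarrow> d i = e i" "\<And>a. a \<in> Ar \<Longrightarrow> M a = M' a"
  shows "loc_free k d M \<longleftrightarrow> loc_free k e M'"
  using is_mod_cong[of d e M M' k, OF assms] assms Eps_Ar by (simp add: loc_free_def)

lemma biprod_cong:
  assumes "\<And>i. i < n \<Longrightarrow> d i = e i" "\<And>a. a \<in> Ar \<Longrightarrow> M a = M' a"
    "\<And>i. i < n \<Longrightarrow> d1 i = e1 i" "\<And>a. a \<in> Ar \<Longrightarrow> A a = A' a"
    "\<And>i. i < n \<Longrightarrow> d2 i = e2 i" "\<And>a. a \<in> Ar \<Longrightarrow> B a = B' a"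
  shows "biprod d M d1 A d2 B \<longleftrightarrow> biprod e M' e1 A' e2 B'"
proof -
  have "biprod_by d M d1 A d2 B \<iota> p \<iota>' p' \<longleftrightarrow> biprod_by e M' e1 A' e2 B' \<iota> p \<iota>' p'" for \<iota> p \<iota>' p'
    unfolding biprod_by_def
    using is_rep_cong[of d1 e1 A A', OF assms(3,4)] is_rep_cong[of d2 e2 B B', OF assms(5,6)]
      hom_cong[of d1 e1 d e A A' M M', OF assms(3,1,4,2)] hom_cong[of d e d1 e1 M M' A A', OF assms(1,3,2,4)]
      hom_cong[of d2 e2 d e B B' M M', OF assms(5,1,6,2)] hom_cong[of d e d2 e2 M M' B B', OF assms(1,5,2,6)] assms(1,3,5)
    by auto
  then have "biprod_by d M d1 A d2 B = biprod_by e M' e1 A' e2 B'" by (intro ext)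
  then show ?thesis unfolding biprod_def by simp
qed

lemma iso_cong:
  assumes "\<And>i. i < n \<Longrightarrow> d i = e i" "\<And>a. a \<in> Ar \<Longrightarrow> M a = M' a" "\<And>a. a \<in> Ar \<Longrightarrow> N a = N' a"
  shows "iso d M N \<longleftrightarrow> iso e M' N'"
proof -
  have "hom d M d N h = hom e M' e N' h" for h by (rule hom_cong) (simp_all add: assms)
  moreover have "hom d N d M h = hom e N' e M' h" for h by (rule hom_cong) (simp_all add: assms)
  ultimately show ?thesis unfolding iso_def using assms(1) by simp
qed

lemma biprod_iso:
  assumes "biprod d M d1 A d2 B" "iso d M M'"
  shows "biprod d M' d1 A d2 B"
proof -
  obtain P Q where PQ: "hom d M d M' P" "hom d M' d M Q" "\<And>i. i < n \<Longrightarrow> P i * Q i = idop (d i)"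
    "\<And>i. i < n \<Longrightarrow> Q i * P i = idop (d i)" using isoE[OF assms(2)] by blast
  obtain \<iota> p \<iota>' p' where b: "biprod_by d M d1 A d2 B \<iota> p \<iota>' p'" using assms(1) by (auto simp: biprod_def)
  then have h: "hom d1 A d M \<iota>" "hom d M d1 A p" "hom d2 B d M \<iota>'" "hom d M d2 B p'"
    and eq: "\<And>i. i < n \<Longrightarrow> p i * \<iota> i = idop (d1 i)" "\<And>i. i < n \<Longrightarrow> p' i * \<iota>' i = idop (d2 i)"
     "\<And>i. i < n \<Longrightarrow> \<iota> i * p i + \<iota>' i * p' i = idop (d i)"
    by (auto simp: biprod_by_def)
  have "biprod_by d M' d1 A d2 B (\<lambda>i. P i * \<iota> i) (\<lambda>i. p i * Q i) (\<lambda>i. P i * \<iota>' i) (\<lambda>i. p' i * Q i)"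
    unfolding biprod_by_def
  proof (intro conjI allI impI)
    show "is_rep d1 A" "is_rep d2 B" using b by (auto simp: biprod_by_def)
    fix i assume i: "i < n"
    have QP: "Q i * (P i * \<iota> i) = \<iota> i" "Q i * (P i * \<iota>' i) = \<iota>' i"
      using assoc_eq[OF PQ(4)[OF i]] Hom_left[OF hom_Hom[OF h(1) i]] Hom_left[OF hom_Hom[OF h(3) i]] by simp_all
    show "p i * Q i * (P i * \<iota> i) = idop (d1 i)" "p' i * Q i * (P i * \<iota>' i) = idop (d2 i)"
      using QP eq(1,2)[OF i] by (simp_all add: mult.assoc)
    have "P i * \<iota> i * (p i * Q i) + P i * \<iota>' i * (p' i * Q i) = P i * ((\<iota> i * p i + \<iota>' i * p' i) * Q i)"
      by (simp add: distrib_left distrib_right mult.assoc)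
    then show "P i * \<iota> i * (p i * Q i) + P i * \<iota>' i * (p' i * Q i) = idop (d i)"
      unfolding eq(3)[OF i] using Hom_left[OF hom_Hom[OF PQ(2) i]] PQ(3)[OF i] by simp
  qed (rule hom_comp[OF h(1) PQ(1)] hom_comp[OF PQ(2) h(2)] hom_comp[OF h(3) PQ(1)] hom_comp[OF PQ(2) h(4)])+
  then show ?thesis unfolding biprod_def by blast
qed

lemma biprod_iso_right:
  assumes "biprod d M d1 A d2 B" "iso d2 B B'" "is_rep d2 B'"
  shows "biprod d M d1 A d2 B'"
proof -
  obtain P Q where PQ: "hom d2 B d2 B' P" "hom d2 B' d2 B Q" "\<And>i. i < n \<Longrightarrow> P i * Q i = idop (d2 i)"
    "\<And>i. i < n \<Longrightarrow> Q i * P i = idop (d2 i)" using isoE[OF assms(2)] by blast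
  obtain \<iota> p \<iota>' p' where b: "biprod_by d M d1 A d2 B \<iota> p \<iota>' p'" using assms(1) by (auto simp: biprod_def)
  then have h: "hom d2 B d M \<iota>'" "hom d M d2 B p'"
    and eq: "\<And>i. i < n \<Longrightarrow> p' i * \<iota>' i = idop (d2 i)"
    by (auto simp: biprod_by_def)
  have "biprod_by d M d1 A d2 B' \<iota> p (\<lambda>i. \<iota>' i * Q i) (\<lambda>i. P i * p' i)"
    using b assms(3) hom_comp[OF PQ(2) h(1)] hom_comp[OF h(2) PQ(1)] unfolding biprod_by_def
  proof (intro conjI allI impI; (elim conjE)?)
    fix i assume i: "i < n"
    show "P i * p' i * (\<iota>' i * Q i) = idop (d2 i)"
      using assoc_eq[OF eq[OF i]] Hom_left[OF hom_Hom[OF PQ(2) i]] PQ(3)[OF i] by (simp add: mult.assoc)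
    show "\<iota> i * p i + \<iota>' i * Q i * (P i * p' i) = idop (d i)"
      using assoc_eq[OF PQ(4)[OF i]] Hom_left[OF hom_Hom[OF h(2) i]] b i by (simp add: mult.assoc biprod_by_def)
  qed auto
  then show ?thesis unfolding biprod_def by blast
qed

lemma biprod_unique:
  assumes "biprod d M d1 A d2 B" "biprod d' M' d1 A d2 B"
  shows "\<And>i. i < n \<Longrightarrow> d i = d' i" "iso d M M'"
proof -
  obtain \<iota> p \<iota>' p' where b: "biprod_by d M d1 A d2 B \<iota> p \<iota>' p'" using assms(1) by (auto simp: biprod_def)
  obtain j q j' q' where b2: "biprod_by d' M' d1 A d2 B j q j' q'" using assms(2) by (auto simp: biprod_def)
  \<comment> \<open>Applying the resolution of the identity to \<open>\<iota>'\<close> leaves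
    \<open>\<iota> * (p * \<iota>') = 0\<close>, and p is a left inverse of
    \<open>\<iota>\<close>.\<close>
  have orth: "p i * \<iota>' i = 0" if b: "biprod_by d M d1 A d2 B \<iota> p \<iota>' p'" and i: "i < n" for d d1 d2 i and M A B :: "arrow \<Rightarrow> 'a lop" and \<iota> p \<iota>' p'
  proof -
    have h: "hom d M d1 A p" "hom d2 B d M \<iota>'" and eq: "p i * \<iota> i = idop (d1 i)" "p' i * \<iota>' i = idop (d2 i)" "\<iota> i * p i + \<iota>' i * p' i = idop (d i)"
      using b i by (auto simp: biprod_by_def)
    have "\<iota>' i = (\<iota> i * p i + \<iota>' i * p' i) * \<iota>' i" unfolding eq(3) using Hom_left[OF hom_Hom[OF h(2) i]] by simp
    also have "\<dots> = \<iota> i * (p i * \<iota>' i) + \<iota>' i"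
      using eq(2) Hom_right[OF hom_Hom[OF h(2) i]] by (simp add: distrib_right mult.assoc)
    finally have "\<iota> i * (p i * \<iota>' i) = 0" by simp
    then have "p i * (\<iota> i * (p i * \<iota>' i)) = 0" by simp
    then show ?thesis using assoc_eq[OF eq(1)] Hom_leftA[OF hom_Hom[OF h(1) i]] by simp
  qed
  define P where "P i = j i * p i + j' i * p' i" for i
  define Q where "Q i = \<iota> i * q i + \<iota>' i * q' i" for i
  have hadd: "hom e1 X e2 Y (\<lambda>i. f i + g i)" if "hom e1 X e2 Y f" "hom e1 X e2 Y g" for e1 e2 f g and X Y :: "arrow \<Rightarrow> 'a lop"
    using that unfolding hom_def by (auto intro: Hom_add simp: distrib_left distrib_right)
  have P: "hom d M d' M' P" unfolding P_def using b b2
    by (intro hadd hom_comp[of d M d1 A p] hom_comp[of d M d2 B p']) (auto simp: biprod_by_def)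
  have Q: "hom d' M' d M Q" unfolding Q_def using b b2
    by (intro hadd hom_comp[of d' M' d1 A q] hom_comp[of d' M' d2 B q']) (auto simp: biprod_by_def)
  have *: "(j i * p i + j' i * p' i) * (\<iota> i * q i + \<iota>' i * q' i) = idop (d' i)"
    if b: "biprod_by d M d1 A d2 B \<iota> p \<iota>' p'" and b2: "biprod_by d' M' d1 A d2 B j q j' q'" and i: "i < n"
    for i d M \<iota> p \<iota>' p' d' M' j q j' q'
  proof -
    have o: "p i * (\<iota>' i * Z) = 0" "p' i * (\<iota> i * Z) = 0" for Z
      using assoc_eq[OF orth[OF b i]] assoc_eq[OF orth[OF biprod_by_sym[OF b] i]] by simp_all
    have p: "p i * (\<iota> i * q i) = q i" "p' i * (\<iota>' i * q' i) = q' i"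
      using b b2 i assoc_eq[of "p i" "\<iota> i"] assoc_eq[of "p' i" "\<iota>' i"] by (auto simp: biprod_by_def hom_def Hom_left)
    show ?thesis using b2 i by (simp add: distrib_left distrib_right mult.assoc o p biprod_by_def)
  qed
  have 1: "P i * Q i = idop (d' i)" if "i < n" for i unfolding P_def Q_def by (rule *[OF b b2 that])
  have 2: "Q i * P i = idop (d i)" if "i < n" for i unfolding P_def Q_def by (rule *[OF b2 b that])
  show dd: "d i = d' i" if i: "i < n" for i
    using Hom_dim_eq[OF hom_Hom[OF Q i] hom_Hom[OF P i] 2[OF i] 1[OF i]] .
  have "hom d M d M' P = hom d M d' M' P" by (rule hom_cong) (simp_all add: dd)
  moreover have "hom d M' d M Q = hom d' M' d M Q" by (rule hom_cong) (simp_all add: dd)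
  moreover have "\<forall>i<n. P i * Q i = idop (d i) \<and> Q i * P i = idop (d i)" using 1 2 dd by simp
  ultimately show "iso d M M'" unfolding iso_def using P Q by blast
qed

lemma biprod_list_iso:
  assumes "biprod_list d M L" "iso d M M'"
  shows "biprod_list d M' L"
  using assms by (cases L) (auto intro: biprod_iso)

lemma biprod_list_unique:
  assumes "biprod_list d M L" "biprod_list d' M' L" "is_rep d M" "is_rep d' M'"
  shows "(\<forall>i<n. d i = d' i) \<and> iso d M M'"
  using assms
proof (induction L arbitrary: d M d' M')
  case Nil
  have z: "X a = 0" if "\<forall>i<n. e i = 0" "is_rep e X" "a \<in> Ar" for e a and X :: "arrow \<Rightarrow> 'a lop"
  proof -
    have "X a \<in> Hom 0 (e (src a))" using that tgt_lt[OF that(3)] by (auto simp: is_rep_def)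
    then have "X a = idop 0 * X a" using Hom_left by metis
    then show ?thesis by (simp add: idop_0)
  qed
  have "M a = 0" "M' a = 0" if "a \<in> Ar" for a using z Nil that by auto
  then have "hom d M d M' (\<lambda>_. 0)" "hom d M' d M (\<lambda>_. 0)" by (auto simp: hom_def Hom_0)
  moreover have "\<forall>i<n. 0 * 0 = (idop (d i) :: 'a lop)" using Nil by (simp add: idop_0)
  ultimately have "iso d M M'" unfolding iso_def by metis
  then show ?case using Nil by simp
next
  case (Cons P L)
  from Cons.prems(1) obtain d2 B where B: "biprod d M (fst P) (snd P) d2 B" "biprod_list d2 B L" by auto
  from Cons.prems(2) obtain d2' B' where B': "biprod d' M' (fst P) (snd P) d2' B'" "biprod_list d2' B' L" by auto
  have r: "is_rep d2 B" "is_rep d2' B'" using B(1) B'(1) by (auto simp: biprod_def biprod_by_def)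
  have IH: "\<forall>i<n. d2 i = d2' i" "iso d2 B B'" using Cons.IH[OF B(2) B'(2) r] by auto
  have r': "is_rep d2 B'" using r(2) IH(1) is_rep_cong[of d2 d2' B' B'] by auto
  have "biprod d' M' (fst P) (snd P) d2 B'" using B'(1) biprod_cong[of d' d' M' M' "fst P" "fst P" "snd P" "snd P" d2 d2' B' B'] IH(1) by auto
  from biprod_unique[OF biprod_iso_right[OF B(1) IH(2) r'] this] show ?case by blast
qed

end

section \<open>Freeness by bases and freeness by Higman's equation\<close>

lemma entry_unit_op: "entry (unit_op p q) a b = (if a = p \<and> b = q then 1 else 0)"
  by (simp add: entry_def app_unit_op)

lemma unit_op_mult: "unit_op p q * unit_op q r = unit_op p r"
  by (rule lop_eqI) (simp add: app_unit_op)

lemma sum_unit_op: "(\<Sum>q<d. unit_op q q) = idop d"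
proof (induction d)
  case (Suc d)
  have "idop d + unit_op d d = idop (Suc d)"
    by (rule lop_eqI) (auto simp: app_idop app_unit_op less_Suc_eq)
  with Suc show ?case by simp
qed (rule lop_eqI, simp add: app_idop)

definition vec_op :: "nat \<Rightarrow> 'a::field vec \<Rightarrow> 'a lop" where
  "vec_op d v = mat_op (mat d 1 (\<lambda>(p,_). v $ p))"

definition coef_op :: "nat \<Rightarrow> (nat \<Rightarrow> 'a::field poly) \<Rightarrow> nat \<Rightarrow> 'a lop" where
  "coef_op r h t = mat_op (mat r 1 (\<lambda>(s,_). coeff (h s) t))"

lemma vec_op_Hom: "vec_op d v \<in> Hom d 1" and coef_op_Hom: "coef_op r h t \<in> Hom r 1"
  unfolding vec_op_def coef_op_def by (intro mat_op_Hom; simp)+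

lemma entry_vec_op: "entry (vec_op d v) p q = (if p < d \<and> q = 0 then v $ p else 0)"
  and entry_coef_op: "entry (coef_op r h t) p q = (if p < r \<and> q = 0 then coeff (h p) t else 0)"
  unfolding vec_op_def coef_op_def by (auto simp: entry_mat_op)

lemma vec_op_inj: "v \<in> carrier_vec d \<Longrightarrow> w \<in> carrier_vec d \<Longrightarrow> vec_op d v = vec_op d w \<Longrightarrow> v = w"
proof (intro eq_vecI)
  fix i assume a: "v \<in> carrier_vec d" "w \<in> carrier_vec d" "vec_op d v = vec_op d w" "i < dim_vec w"
  have "v $ i = entry (vec_op d v) i 0" using a(1,2,4) by (auto simp: entry_vec_op)
  also have "\<dots> = entry (vec_op d w) i 0" by (simp only: a(3))
  also have "\<dots> = w $ i" using a(1,2,4) by (auto simp: entry_vec_op)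
  finally show "v $ i = w $ i" .
qed auto

lemma entry_mat_pow_mult:
  assumes E: "E \<in> carrier_mat d d" and Z: "Z \<in> Hom d c" and p: "p < d"
  shows "entry (mat_op E ^ t * Z) p q = (\<Sum>s<d. (E ^\<^sub>m t) $$ (p,s) * entry Z s q)"
proof -
  have "mat_op E ^ t * Z = idop d * (mat_op E ^ t * Z)" using Hom_left[OF Hom_pow_mult[OF mat_op_Hom[OF E] Z]] by simp
  also have "\<dots> = mat_op (E ^\<^sub>m t) * Z" by (simp add: mat_op_pow[OF E] mult.assoc)
  finally have *: "mat_op E ^ t * Z = mat_op (E ^\<^sub>m t) * Z" .
  have P: "E ^\<^sub>m t \<in> carrier_mat d d" using E by (rule pow_carrier_mat)
  show ?thesis unfolding * entry_mult[OF mat_op_Hom[OF P]] using p P by (intro sum.cong) (auto simp: entry_mat_op)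
qed

lemma eval_mat_carrier: "E \<in> carrier_mat d d \<Longrightarrow> eval_mat p E \<in> carrier_mat d d"
  by (simp add: eval_mat_def)

text \<open>Sorting a combination of basis vectors with polynomial coefficients by powers of E turns
  it into a sum of \<open>E ^ t * B * G t\<close>, where the column \<open>G t\<close> holds the
  coefficients of degree t.\<close>

lemma eval_mat_combination:
  fixes E :: "'a::field mat"
  assumes E: "E \<in> carrier_mat d d" and b: "b \<in> {..<r} \<rightarrow> carrier_vec d"
    and h: "h \<in> {..<r} \<rightarrow> {p. degree p < m}"
  shows "vec_op d (finsum_vec TYPE('a) d (\<lambda>s. eval_mat (h s) E *\<^sub>v b s) {..<r}) =
    (\<Sum>t<m. mat_op E ^ t * (mat_op (mat d r (\<lambda>(p,s). b s $ p)) * coef_op r h t))"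
    (is "_ = (\<Sum>t<m. _ * (?B * _))")
proof (rule Hom_eqI[OF vec_op_Hom])
  have BH: "?B \<in> Hom d r" by (rule mat_op_Hom) simp
  show "(\<Sum>t<m. mat_op E ^ t * (?B * coef_op r h t)) \<in> Hom d 1"
    by (intro Hom_sum Hom_pow_mult mat_op_Hom E Hom_mult[OF BH coef_op_Hom])
  fix p q :: nat assume p: "p < d" and "q < 1"
  then have q: "q = 0" by simp
  have ev: "eval_mat (h s) E $$ (p, u) = (\<Sum>t<m. coeff (h s) t * (E ^\<^sub>m t) $$ (p, u))" if "s < r" "u < d" for s u
  proof -
    have "eval_mat (h s) E $$ (p, u) = (\<Sum>t\<le>degree (h s). coeff (h s) t * (E ^\<^sub>m t) $$ (p, u))"
      using E p that by (simp add: eval_mat_def)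
    also have "\<dots> = (\<Sum>t<m. coeff (h s) t * (E ^\<^sub>m t) $$ (p, u))"
      using funcset_mem[OF h, of s] that(1) by (intro sum.mono_neutral_left) (auto simp: coeff_eq_0)
    finally show ?thesis .
  qed
  have eH: "eval_mat (h s) E \<in> carrier_mat d d" for s using E by (simp add: eval_mat_def)
  have "entry (vec_op d (finsum_vec TYPE('a) d (\<lambda>s. eval_mat (h s) E *\<^sub>v b s) {..<r})) p q =
      (\<Sum>s<r. (eval_mat (h s) E *\<^sub>v b s) $ p)"
    unfolding entry_vec_op using p q eH b
    by (subst index_finsum_vec) (auto intro!: mult_mat_vec_carrier)
  also have "\<dots> = (\<Sum>s<r. \<Sum>u<d. (\<Sum>t<m. coeff (h s) t * (E ^\<^sub>m t) $$ (p, u)) * b s $ u)"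
  proof (rule sum.cong[OF refl])
    fix s assume s: "s \<in> {..<r}"
    then have bs: "dim_vec (b s) = d" using funcset_mem[OF b s] by auto
    have "(eval_mat (h s) E *\<^sub>v b s) $ p = (\<Sum>u<d. eval_mat (h s) E $$ (p, u) * b s $ u)"
      using eH[of s] p bs by (auto simp: scalar_prod_def atLeast0LessThan carrier_matD intro!: sum.cong)
    then show "(eval_mat (h s) E *\<^sub>v b s) $ p = (\<Sum>u<d. (\<Sum>t<m. coeff (h s) t * (E ^\<^sub>m t) $$ (p, u)) * b s $ u)"
      using ev s by simp
  qed
  also have "\<dots> = (\<Sum>s<r. \<Sum>u<d. \<Sum>t<m. (E ^\<^sub>m t) $$ (p, u) * (b s $ u * coeff (h s) t))"
    by (intro sum.cong refl) (simp add: sum_distrib_left sum_distrib_right mult_ac)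
  also have "\<dots> = (\<Sum>s<r. \<Sum>t<m. \<Sum>u<d. (E ^\<^sub>m t) $$ (p, u) * (b s $ u * coeff (h s) t))"
    by (rule sum.cong[OF refl], rule sum.swap)
  also have "\<dots> = (\<Sum>t<m. \<Sum>s<r. \<Sum>u<d. (E ^\<^sub>m t) $$ (p, u) * (b s $ u * coeff (h s) t))"
    by (rule sum.swap)
  also have "\<dots> = (\<Sum>t<m. \<Sum>u<d. \<Sum>s<r. (E ^\<^sub>m t) $$ (p, u) * (b s $ u * coeff (h s) t))"
    by (rule sum.cong[OF refl], rule sum.swap)
  also have "\<dots> = entry (\<Sum>t<m. mat_op E ^ t * (?B * coef_op r h t)) p q"
    unfolding entry_sum
    by (intro sum.cong refl, subst entry_mat_pow_mult[OF E Hom_mult[OF BH coef_op_Hom] p])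
      (auto simp: entry_mult[OF BH] entry_coef_op entry_mat_op q sum_distrib_left intro!: sum.cong)
  finally show "entry (vec_op d (finsum_vec TYPE('a) d (\<lambda>s. eval_mat (h s) E *\<^sub>v b s) {..<r})) p q =
      entry (\<Sum>t<m. mat_op E ^ t * (?B * coef_op r h t)) p q" .
qed

text \<open>Inverse to \<open>coef_op\<close>. It is restricted to indices below r because
  uniqueness in \<open>free_of_rank\<close> is stated for extensional functions.\<close>

definition polys_of :: "nat \<Rightarrow> nat \<Rightarrow> (nat \<Rightarrow> 'a::field lop) \<Rightarrow> nat \<Rightarrow> 'a poly" where
  "polys_of m r G = (\<lambda>s\<in>{..<r}. \<Sum>t<m. monom (entry (G t) s 0) t)"

lemma coeff_polys_of: "s < r \<Longrightarrow> coeff (polys_of m r G s) t = (if t < m then entry (G t) s 0 else 0)"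
  by (simp add: polys_of_def coeff_sum)

lemma polys_of_in: "m > 0 \<Longrightarrow> polys_of m r G \<in> {..<r} \<rightarrow>\<^sub>E {p. degree p < m}"
proof (intro PiE_I)
  fix s assume m: "m > 0" and s: "s \<in> {..<r}"
  have "degree (polys_of m r G s) \<le> m - 1" using s by (intro degree_le) (auto simp: coeff_polys_of)
  then show "polys_of m r G s \<in> {p. degree p < m}" using m by simp
qed (simp add: polys_of_def)

lemma coef_op_polys_of: "t < m \<Longrightarrow> G t \<in> Hom r 1 \<Longrightarrow> coef_op r (polys_of m r G) t = G t"
  by (rule Hom_eqI[OF coef_op_Hom]) (auto simp: entry_coef_op coeff_polys_of)

lemma coef_op_inj:
  assumes "h \<in> {..<r} \<rightarrow>\<^sub>E {p. degree p < m}" "h' \<in> {..<r} \<rightarrow>\<^sub>E {p. degree p < m}"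
    "\<And>t. t < m \<Longrightarrow> coef_op r h t = coef_op r h' t"
  shows "h = h'"
proof (rule PiE_ext[OF assms(1,2)])
  fix s assume s: "s \<in> {..<r}"
  show "h s = h' s"
  proof (rule poly_eqI)
    fix t
    show "coeff (h s) t = coeff (h' s) t"
    proof (cases "t < m")
      case True
      from arg_cong[OF assms(3)[OF True], of "\<lambda>z. entry z s 0"] show ?thesis using s by (simp add: entry_coef_op)
    next
      case False
      moreover have "degree (h s) < m" "degree (h' s) < m"
        using PiE_mem[OF assms(1) s] PiE_mem[OF assms(2) s] by auto
      ultimately show ?thesis by (simp add: coeff_eq_0)
    qed
  qed
qed

text \<open>From bases to operators: the columns of \<open>R t\<close> are the degree t coefficients
  of the unit vectors, and duality is uniqueness of coefficients. Conversely the coefficients of v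
  are \<open>R t\<close> applied to v.\<close>

lemma free_of_rank_iff_basis:
  fixes E :: "'a::field mat"
  assumes E: "E \<in> carrier_mat d d" and m: "m > 0"
  shows "free_of_rank m E r \<longleftrightarrow> (\<exists>B R. B \<in> Hom d r \<and> (\<forall>t. R t \<in> Hom r d) \<and>
    (\<Sum>t<m. mat_op E ^ t * B * R t) = idop d \<and>
    (\<forall>u<m. \<forall>t<m. R u * (mat_op E ^ t * B) = (if u = t then idop r else 0)))"
    (is "?l \<longleftrightarrow> ?r")
proof
  let ?x = "mat_op E"
  note xH = mat_op_Hom[OF E]
  have dE: "dim_row E = d" using E by auto
  assume ?l
  then obtain b where b: "b \<in> {..<r} \<rightarrow> carrier_vec d" and
    bex: "\<forall>v\<in>carrier_vec d. \<exists>!h. h \<in> {..<r} \<rightarrow>\<^sub>E {p. degree p < m} \<and>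
             v = finsum_vec TYPE('a) d (\<lambda>s. eval_mat (h s) E *\<^sub>v b s) {..<r}"
    unfolding free_of_rank_def dE by (rule bexE)
  note ex1 = bspec[OF bex]
  define B where "B = mat_op (mat d r (\<lambda>(p,s). b s $ p))"
  have BH: "B \<in> Hom d r" unfolding B_def by (rule mat_op_Hom) simp
  define comb where "comb h = finsum_vec TYPE('a) d (\<lambda>s. eval_mat (h s) E *\<^sub>v b s) {..<r}" for h
  have comb: "vec_op d (comb h) = (\<Sum>t<m. ?x ^ t * (B * coef_op r h t))" if "h \<in> {..<r} \<rightarrow>\<^sub>E {p. degree p < m}" for h
    unfolding comb_def B_def by (rule eval_mat_combination[OF E b]) (use that in auto)
  have combc: "comb h \<in> carrier_vec d" for h unfolding comb_def
    by (rule finsum_vec_closed, rule Pi_I, rule mult_mat_vec_carrier[OF eval_mat_carrier[OF E] funcset_mem[OF b]])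
  have uniq: "G t = G' t" if "\<And>t. t < m \<Longrightarrow> G t \<in> Hom r 1" "\<And>t. t < m \<Longrightarrow> G' t \<in> Hom r 1"
    "(\<Sum>t<m. ?x ^ t * (B * G t)) = (\<Sum>t<m. ?x ^ t * (B * G' t))" "t < m" for G G' t
  proof -
    have "vec_op d (comb (polys_of m r G)) = vec_op d (comb (polys_of m r G'))"
      unfolding comb[OF polys_of_in[OF m]] using that by (simp add: coef_op_polys_of)
    then have "comb (polys_of m r G) = comb (polys_of m r G')" by (rule vec_op_inj[OF combc combc])
    then have "polys_of m r G = polys_of m r G'"
      using ex1[OF combc[of "polys_of m r G"]] polys_of_in[OF m] unfolding comb_def[symmetric] by metis
    then show ?thesis using coef_op_polys_of[OF that(4)] that by metis
  qed
  have "\<exists>G. \<forall>t<m. G t \<in> Hom r 1" by (intro exI[of _ "\<lambda>_. 0"]) (simp add: Hom_0)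
  have exG: "\<exists>G. (\<forall>t. G t \<in> Hom r 1) \<and> (\<Sum>t<m. ?x ^ t * (B * G t)) = unit_op q 0" if q: "q < d" for q
  proof -
    obtain h where h: "h \<in> {..<r} \<rightarrow>\<^sub>E {p. degree p < m}" "unit_vec d q = comb h"
      using ex1[OF unit_vec_carrier] unfolding comb_def[symmetric] by metis
    have "unit_op q 0 = vec_op d (unit_vec d q)"
      by (rule Hom_eqI[OF unit_op_Hom[OF q] vec_op_Hom]) (use q in \<open>auto simp: entry_vec_op entry_unit_op\<close>)
    then show ?thesis using comb[OF h(1)] h(2) coef_op_Hom by metis
  qed
  then obtain G where G: "\<And>q t. q < d \<Longrightarrow> G q t \<in> Hom r 1" "\<And>q. q < d \<Longrightarrow> (\<Sum>t<m. ?x ^ t * (B * G q t)) = unit_op q 0"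
    by metis
  define R where "R t = (\<Sum>q<d. G q t * unit_op 0 q)" for t
  have RH: "R t \<in> Hom r d" for t unfolding R_def by (intro Hom_sum Hom_mult[OF G(1) unit_op_Hom]) auto
  have sum: "(\<Sum>t<m. ?x ^ t * B * R t) = idop d"
  proof -
    have "(\<Sum>t<m. ?x ^ t * B * R t) = (\<Sum>t<m. \<Sum>q<d. ?x ^ t * (B * G q t) * unit_op 0 q)"
      by (simp add: R_def sum_distrib_left mult.assoc)
    also have "\<dots> = (\<Sum>q<d. (\<Sum>t<m. ?x ^ t * (B * G q t)) * unit_op 0 q)"
      unfolding sum_distrib_right by (rule sum.swap)
    also have "\<dots> = (\<Sum>q<d. unit_op q q)" using G(2) by (simp add: unit_op_mult)
    finally show ?thesis by (simp add: sum_unit_op)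
  qed
  have "R u * (?x ^ t * B) = (if u = t then idop r else 0)" if u: "u < m" and t: "t < m" for u t
  proof -
    have col: "R u * (?x ^ t * B) * unit_op s 0 = (if u = t then idop r else 0) * unit_op s 0" if s: "s < r" for s
    proof -
      define V where "V = ?x ^ t * B * unit_op s 0"
      have VH: "V \<in> Hom d 1" unfolding V_def by (intro Hom_mult[OF Hom_pow_mult[OF xH BH] unit_op_Hom[OF s]]) simp
      have 1: "(\<Sum>u<m. ?x ^ u * (B * (R u * V))) = V"
      proof -
        have "(\<Sum>u<m. ?x ^ u * (B * (R u * V))) = (\<Sum>u<m. ?x ^ u * B * R u) * V"
          by (simp add: sum_distrib_right mult.assoc)
        then show ?thesis unfolding sum using Hom_left[OF VH] by simp
      qed
      have 2: "(\<Sum>u<m. ?x ^ u * (B * (if u = t then unit_op s 0 else 0))) = V"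
      proof -
        have "(\<Sum>u<m. ?x ^ u * (B * (if u = t then unit_op s 0 else 0))) = (\<Sum>u<m. if u = t then V else 0)"
          by (intro sum.cong) (auto simp: V_def mult.assoc)
        then show ?thesis using t by simp
      qed
      \<comment> \<open>Both sides are the coefficient families of one vector, namely
        \<open>E ^ t\<close> applied to the s-th basis vector.\<close>
      have "R u * V = (if u = t then unit_op s 0 else 0)"
        by (rule uniq[OF _ _ _ u]) (use RH VH s 1 2 in \<open>auto intro: Hom_mult Hom_0 unit_op_Hom\<close>)
      moreover have "idop r * unit_op s 0 = (unit_op s 0 :: 'a lop)" using Hom_left[OF unit_op_Hom[of s r 0 1]] s by simp
      ultimately show ?thesis by (simp add: V_def mult.assoc)
    qed
    have XH: "R u * (?x ^ t * B) \<in> Hom r r" by (rule Hom_mult[OF RH Hom_pow_mult[OF xH BH]])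
    have "R u * (?x ^ t * B) = R u * (?x ^ t * B) * (\<Sum>s<r. unit_op s 0 * unit_op 0 s)"
      using Hom_right[OF XH] by (simp add: unit_op_mult sum_unit_op)
    also have "\<dots> = (\<Sum>s<r. (R u * (?x ^ t * B) * unit_op s 0) * unit_op 0 s)"
      by (simp add: sum_distrib_left mult.assoc)
    also have "\<dots> = (\<Sum>s<r. (if u = t then idop r else 0) * (unit_op s 0 * unit_op 0 s))"
    proof (rule sum.cong[OF refl])
      fix s assume "s \<in> {..<r}"
      then show "(R u * (?x ^ t * B) * unit_op s 0) * unit_op 0 s = (if u = t then idop r else 0) * (unit_op s 0 * unit_op 0 s)"
        using col[of s] by (simp add: mult.assoc[symmetric])
    qed
    also have "\<dots> = (if u = t then idop r else 0) * idop r"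
      by (simp add: sum_distrib_left[symmetric] unit_op_mult sum_unit_op)
    finally show ?thesis by (simp add: idop_idem)
  qed
  then show ?r using BH RH sum by blast
next
  let ?x = "mat_op E"
  note xH = mat_op_Hom[OF E]
  have dE: "dim_row E = d" using E by auto
  assume ?r
  then obtain B R where B: "B \<in> Hom d r" "\<And>t. R t \<in> Hom r d" "(\<Sum>t<m. ?x ^ t * B * R t) = idop d"
    "\<And>u t. u < m \<Longrightarrow> t < m \<Longrightarrow> R u * (?x ^ t * B) = (if u = t then idop r else 0)" by blast
  define b where "b s = vec d (\<lambda>p. entry B p s)" for s
  have b: "b \<in> {..<r} \<rightarrow> carrier_vec d" by (auto simp: b_def)
  have Bb: "mat_op (mat d r (\<lambda>(p,s). b s $ p)) = B"
    by (rule Hom_eqI[OF mat_op_Hom B(1)]) (auto simp: entry_mat_op b_def)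
  show ?l unfolding free_of_rank_def dE
  proof (intro bexI[OF _ b] ballI)
    fix v :: "'a vec" assume v: "v \<in> carrier_vec d"
    let ?c = "\<lambda>h. finsum_vec TYPE('a) d (\<lambda>s. eval_mat (h s) E *\<^sub>v b s) {..<r}"
    have cc: "?c h \<in> carrier_vec d" for h
      by (rule finsum_vec_closed, rule Pi_I, rule mult_mat_vec_carrier[OF eval_mat_carrier[OF E] funcset_mem[OF b]])
    have comb: "v = ?c h \<longleftrightarrow> vec_op d v = (\<Sum>t<m. ?x ^ t * (B * coef_op r h t))"
      if "h \<in> {..<r} \<rightarrow>\<^sub>E {p. degree p < m}" for h
      using eval_mat_combination[OF E b, of h m] that vec_op_inj[OF v cc] unfolding Bb by (auto simp: PiE_iff)
    show "\<exists>!h. h \<in> {..<r} \<rightarrow>\<^sub>E {p. degree p < m} \<and> v = ?c h"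
    proof (rule ex1I[of _ "polys_of m r (\<lambda>t. R t * vec_op d v)"], intro conjI polys_of_in[OF m])
      have "(\<Sum>t<m. ?x ^ t * (B * (R t * vec_op d v))) = idop d * vec_op d v"
        unfolding B(3)[symmetric] by (simp add: sum_distrib_right mult.assoc)
      also have "\<dots> = vec_op d v" by (rule Hom_left[OF vec_op_Hom])
      finally show "v = ?c (polys_of m r (\<lambda>t. R t * vec_op d v))"
        unfolding comb[OF polys_of_in[OF m]] using Hom_mult[OF B(2) vec_op_Hom] by (simp add: coef_op_polys_of)
    next
      fix h assume h: "h \<in> {..<r} \<rightarrow>\<^sub>E {p. degree p < m} \<and> v = ?c h"
      then have v': "vec_op d v = (\<Sum>t<m. ?x ^ t * (B * coef_op r h t))" using comb by blast
      have "coef_op r h u = R u * vec_op d v" if "u < m" for u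
      proof -
        have "R u * vec_op d v = (\<Sum>t<m. R u * (?x ^ t * B) * coef_op r h t)"
          unfolding v' by (simp add: sum_distrib_left mult.assoc)
        also have "\<dots> = (\<Sum>t<m. if t = u then coef_op r h t else 0)"
          by (intro sum.cong) (use that in \<open>auto simp: B(4) Hom_left[OF coef_op_Hom]\<close>)
        finally show ?thesis using that by simp
      qed
      then show "h = polys_of m r (\<lambda>t. R t * vec_op d v)"
        using h polys_of_in[OF m] Hom_mult[OF B(2) vec_op_Hom] by (intro coef_op_inj[of h r m]) (auto simp: coef_op_polys_of)
    qed
  qed
qed

lemma free_of_rank_iff_higman:
  fixes E :: "'a::field mat"
  assumes E: "E \<in> carrier_mat d d" and m: "m > 0" and nil: "mat_op E ^ m = 0" and d: "d = m * r"
  shows "free_of_rank m E r \<longleftrightarrow> (\<exists>\<Theta>\<in>Hom d d. higman m (mat_op E) \<Theta> (mat_op E) = idop d)"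
proof
  let ?x = "mat_op E"
  note xH = mat_op_Hom[OF E]
  assume "free_of_rank m E r"
  then obtain B R where B: "B \<in> Hom d r" "\<And>t. R t \<in> Hom r d" "(\<Sum>t<m. ?x ^ t * B * R t) = idop d"
    "\<And>u t. u < m \<Longrightarrow> t < m \<Longrightarrow> R u * (?x ^ t * B) = (if u = t then idop r else 0)"
    unfolding free_of_rank_iff_basis[OF E m] by blast
  \<comment> \<open>\<open>\<Theta>\<close> moves the coefficient of the top power down to degree 0.
    The t-th summand of the trace shifts the coefficient of degree t to the top, takes it to the
    bottom and shifts it back, so the sum is the identity.\<close>
  define \<Theta> where "\<Theta> = B * R (m - 1)"
  have L: "R (m - 1) * (?x ^ y * B) = (if y = m - 1 then idop r else 0)" for y
  proof (cases "y < m")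
    case True then show ?thesis using B(4)[of "m - 1" y] m by auto
  next
    case False
    then have "?x ^ y = ?x ^ (y - m) * ?x ^ m" by (metis le_add_diff_inverse2 not_less power_add)
    then show ?thesis using nil False m by auto
  qed
  have Z: "higman m ?x \<Theta> ?x * (?x ^ u * B) = ?x ^ u * B" if u: "u < m" for u
  proof -
    have "higman m ?x \<Theta> ?x * (?x ^ u * B) = (\<Sum>t<m. ?x ^ t * B * (R (m - 1) * (?x ^ (m - 1 - t + u) * B)))"
      unfolding higman_def \<Theta>_def by (simp only: sum_distrib_right mult.assoc power_add)
    also have "\<dots> = (\<Sum>t<m. if t = u then ?x ^ t * B * idop r else 0)"
      unfolding L by (intro sum.cong) (use u in auto)
    finally show ?thesis using u Hom_right[OF B(1)] by (simp add: mult.assoc)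
  qed
  have \<Theta>H: "\<Theta> \<in> Hom d d" unfolding \<Theta>_def by (rule Hom_mult[OF B(1,2)])
  have "higman m ?x \<Theta> ?x = higman m ?x \<Theta> ?x * (\<Sum>t<m. ?x ^ t * B * R t)"
    unfolding B(3) using Hom_right[OF higman_Hom[OF xH xH \<Theta>H]] by simp
  also have "\<dots> = (\<Sum>t<m. (higman m ?x \<Theta> ?x * (?x ^ t * B)) * R t)" by (simp add: sum_distrib_left mult.assoc)
  also have "\<dots> = (\<Sum>t<m. ?x ^ t * B * R t)" by (intro sum.cong) (simp_all add: Z)
  also have "\<dots> = idop d" by (rule B(3))
  finally show "\<exists>\<Theta>\<in>Hom d d. higman m ?x \<Theta> ?x = idop d" using \<Theta>H by blast
next
  assume "\<exists>\<Theta>\<in>Hom d d. higman m (mat_op E) \<Theta> (mat_op E) = idop d"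
  then obtain \<Theta> where \<Theta>: "\<Theta> \<in> Hom d d" "higman m (mat_op E) \<Theta> (mat_op E) = idop d" by blast
  obtain r' B R where B: "B \<in> Hom d r'" "\<And>t. R t \<in> Hom r' d" "(\<Sum>t<m. mat_op E ^ t * B * R t) = idop d"
    "\<And>u t. u < m \<Longrightarrow> t < m \<Longrightarrow> R u * (mat_op E ^ t * B) = (if u = t then idop r' else 0)"
    using free_basis[OF mat_op_Hom[OF E] \<Theta>(1) nil m \<Theta>(2)] by blast
  have "d = m * r'" by (rule free_basis_dim[OF mat_op_Hom[OF E] B])
  then have "r' = r" using d m by simp
  then show "free_of_rank m E r" unfolding free_of_rank_iff_basis[OF E m] using B by blast
qed

context quiver_relations begin

lemma isoI:
  assumes P: "hom d M d N P" and Q: "\<And>i. i < n \<Longrightarrow> Q i \<in> Hom (d i) (d i)"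
    and PQ: "\<And>i. i < n \<Longrightarrow> P i * Q i = idop (d i)" "\<And>i. i < n \<Longrightarrow> Q i * P i = idop (d i)"
    and r: "is_rep d M" "is_rep d N"
  shows "iso d M N"
proof -
  have "Q (tgt a) * N a = M a * Q (src a)" if a: "a \<in> Ar" for a
  proof -
    have H: "N a \<in> Hom (d (tgt a)) (d (src a))" "M a \<in> Hom (d (tgt a)) (d (src a))" using r a by (auto simp: is_rep_def)
    have "Q (tgt a) * N a = Q (tgt a) * (N a * (P (src a) * Q (src a)))"
      unfolding PQ(1)[OF src_lt[OF a]] using Hom_right[OF H(1)] by simp
    also have "\<dots> = Q (tgt a) * ((P (tgt a) * M a) * Q (src a))"
      unfolding hom_eq[OF P a] by (simp add: mult.assoc)
    also have "\<dots> = M a * Q (src a)"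
      using assoc_eq[OF PQ(2)[OF tgt_lt[OF a]]] Hom_leftA[OF H(2)] by (simp add: mult.assoc)
    finally show ?thesis .
  qed
  then have "hom d N d M Q" using Q by (auto simp: hom_def)
  then show ?thesis unfolding iso_def using P PQ by blast
qed

lemma biprod_canonical:
  assumes A: "is_rep d1 A" and B: "is_rep d2 B"
    and S: "\<And>a. a \<in> Ar \<Longrightarrow> S a = idop (d1 (tgt a)) * A a * idop (d1 (src a))
        + second_incl (d1 (tgt a)) (d2 (tgt a)) * B a * second_proj (d1 (src a)) (d2 (src a))"
  shows "biprod (\<lambda>i. d1 i + d2 i) S d1 A d2 B"
proof -
  have AH: "A a \<in> Hom (d1 (tgt a)) (d1 (src a))" and BH: "B a \<in> Hom (d2 (tgt a)) (d2 (src a))" if "a \<in> Ar" for a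
    using A B that by (auto simp: is_rep_def)
  note ops = block_ops idop_idem
  have opsA: "second_proj r1 r2 * (second_incl r1 r2 * Z) = idop r2 * Z" "idop r1 * (second_incl r1 r2 * Z) = 0"
    "second_proj r1 r2 * (idop r1 * Z) = 0" "idop r1 * (idop r1 * Z) = idop r1 * Z" for r1 r2 Z
    using block_ops(1-3)[THEN assoc_eq] idop_idem[THEN assoc_eq] by simp_all
  have AI: "A a * second_incl (d1 (src a)) r = 0" and PA: "second_proj (d1 (tgt a)) r * A a = 0" if "a \<in> Ar" for a r
  proof -
    have "A a * second_incl (d1 (src a)) r = A a * (idop (d1 (src a)) * second_incl (d1 (src a)) r)"
      by (rule Hom_rightA[OF AH[OF that], symmetric])
    then show "A a * second_incl (d1 (src a)) r = 0" unfolding block_ops by simp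
    have "second_proj (d1 (tgt a)) r * A a = second_proj (d1 (tgt a)) r * (idop (d1 (tgt a)) * A a)"
      using Hom_left[OF AH[OF that]] by simp
    then show "second_proj (d1 (tgt a)) r * A a = 0" unfolding opsA by simp
  qed
  have "biprod_by (\<lambda>i. d1 i + d2 i) S d1 A d2 B (\<lambda>i. idop (d1 i)) (\<lambda>i. idop (d1 i))
      (\<lambda>i. second_incl (d1 i) (d2 i)) (\<lambda>i. second_proj (d1 i) (d2 i))"
    unfolding biprod_by_def hom_def
    using A B idop_Hom_block inr_op_Hom prr_op_Hom AH BH
    by (auto simp: S ops block_ops(4)[unfolded idop_idem] AI PA opsA distrib_left distrib_right mult.assoc Hom_left Hom_right Hom_leftA Hom_rightA Hom_left[OF AH] Hom_right[OF AH] Hom_leftA[OF AH] Hom_left[OF BH] Hom_right[OF BH] Hom_leftA[OF BH] Hom_leftA[OF prr_op_Hom] Hom_left[OF prr_op_Hom] Hom_right[OF inr_op_Hom])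
  then show ?thesis unfolding biprod_def by blast
qed

lemma biprod_list_cong:
  assumes "list_all2 (\<lambda>P P'. (\<forall>i<n. fst P i = fst P' i) \<and> (\<forall>a\<in>Ar. snd P a = snd P' a)) L L'"
  shows "biprod_list d M L = biprod_list d M L'"
  using assms
proof (induction L L' arbitrary: d M rule: list_all2_induct)
  case (Cons P L P' L')
  have "biprod d M (fst P) (snd P) d2 B = biprod d M (fst P') (snd P') d2 B" for d2 B
    by (rule biprod_cong) (use Cons in simp_all)
  with Cons show ?case by simp
qed simp

end

section \<open>The algebras of Geiss, Leclerc and Schroer\<close>

fun left_exp :: "int mat \<Rightarrow> arrow \<Rightarrow> nat" where
  "left_exp C (Eps i) = 1"
| "left_exp C (Alpha i j g) = f_num C j i"

fun right_exp :: "int mat \<Rightarrow> arrow \<Rightarrow> nat" where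
  "right_exp C (Eps i) = 1"
| "right_exp C (Alpha i j g) = f_num C i j"

locale gls_algebra =
  fixes n :: nat and C :: "int mat" and D :: "nat mat" and \<Omega> :: "(nat \<times> nat) set"
  assumes gcm: "generalized_cartan_matrix n C" and symm: "symmetrizer n C D" and ori: "orientation n C \<Omega>"
begin

lemma Omega_lt: "(i,j) \<in> \<Omega> \<Longrightarrow> i < n" "(i,j) \<in> \<Omega> \<Longrightarrow> j < n"
  using ori by (auto simp: orientation_def)

text \<open>Dividing the symmetry of \<open>D * C\<close> by g gives
  \<open>c_i f_ij = c_j f_ji\<close>, where the two f are coprime. Hence \<open>f_ji\<close> divides
  \<open>c_i\<close>, and the quotient u serves for both vertices.\<close>

lemma factor_exponents:
  assumes "(i,j) \<in> \<Omega>"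
  shows "\<exists>u. D $$ (i,i) = f_num C j i * u \<and> D $$ (j,j) = f_num C i j * u"
proof -
  note ij = Omega_lt[OF assms]
  have neg: "C $$ (i,j) < 0" "C $$ (j,i) < 0"
  proof -
    have o: "{(p,q), (q,p)} \<inter> \<Omega> \<noteq> {} \<longleftrightarrow> C $$ (p,q) < 0" if "p < n" "q < n" for p q
      using ori that by (simp add: orientation_def)
    show "C $$ (i,j) < 0" "C $$ (j,i) < 0" using o[OF ij] o[OF ij(2,1)] assms by auto
  qed
  define a where "a = nat \<bar>C $$ (i,j)\<bar>"
  define b where "b = nat \<bar>C $$ (j,i)\<bar>"
  define g where "g = gcd a b"
  have a: "int a = - C $$ (i,j)" and b: "int b = - C $$ (j,i)" using neg by (auto simp: a_def b_def)
  have gg: "g_num C i j = g" "g_num C j i = g"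
  proof -
    show "g_num C i j = g" unfolding g_num_def g_def a_def b_def gcd_int_def by simp
    have "g_num C j i = gcd b a" unfolding g_num_def a_def b_def gcd_int_def by simp
    then show "g_num C j i = g" unfolding g_def using gcd.commute[of b a] by simp
  qed
  have "int (D $$ (i,i)) * C $$ (i,j) = int (D $$ (j,j)) * C $$ (j,i)"
    using symm ij by (auto simp: symmetrizer_def)
  then have "int (D $$ (i,i) * a) = int (D $$ (j,j) * b)" using a b by simp
  then have ab: "D $$ (i,i) * a = D $$ (j,j) * b" by linarith
  have g0: "g > 0" using neg unfolding g_def a_def by (intro gcd_pos_nat[THEN iffD2]) simp
  have fa: "a = f_num C i j * g" and fb: "b = f_num C j i * g"
    unfolding f_num_def gg a_def[symmetric] b_def[symmetric] by (simp_all add: g_def)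
  have vec_op: "coprime (f_num C i j) (f_num C j i)"
    unfolding f_num_def gg a_def[symmetric] b_def[symmetric] g_def
    using g0 by (intro div_gcd_coprime) (auto simp: g_def)
  have eq: "D $$ (i,i) * f_num C i j = D $$ (j,j) * f_num C j i"
    using ab g0 unfolding fa fb by simp
  have "f_num C j i dvd D $$ (i,i) * f_num C i j" using eq by simp
  then have "f_num C j i dvd D $$ (i,i)" using vec_op by (simp add: coprime_commute coprime_dvd_mult_left_iff)
  then obtain u where u: "D $$ (i,i) = f_num C j i * u" by blast
  have "f_num C j i > 0" using fb b neg by (cases "f_num C j i") auto
  then have "D $$ (j,j) = f_num C i j * u" using eq unfolding u by (simp add: mult_ac)
  with u show ?thesis by blast
qed

sublocale quiver_relations n "arrows n C \<Omega>" "\<lambda>i. D $$ (i,i)" "left_exp C" "right_exp C"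
proof
  fix i assume "i < n"
  then show "Eps i \<in> arrows n C \<Omega>" "D $$ (i,i) > 0" using symm by (auto simp: arrows_def symmetrizer_def)
next
  fix a assume "a \<in> arrows n C \<Omega>"
  then show "tgt a < n" "src a < n" "\<exists>u. D $$ (tgt a, tgt a) = left_exp C a * u \<and> D $$ (src a, src a) = right_exp C a * u"
    using Omega_lt factor_exponents by (auto simp: arrows_def)
qed

abbreviation "Ar \<equiv> arrows n C \<Omega>"

definition rep_ops :: "'a::field rep \<Rightarrow> arrow \<Rightarrow> 'a lop" where
  "rep_ops M = (\<lambda>a. mat_op (M a))"

definition to_rep :: "nat vec \<Rightarrow> (arrow \<Rightarrow> 'a::field lop) \<Rightarrow> 'a rep" where
  "to_rep d A = (\<lambda>a\<in>Ar. mat_of (d $ tgt a) (d $ src a) (A a))"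

lemma to_rep_space: "to_rep d A \<in> rep_space n C \<Omega> d"
  by (simp add: to_rep_def rep_space_def)

lemma rep_ops_to_rep: "a \<in> Ar \<Longrightarrow> A a \<in> Hom (d $ tgt a) (d $ src a) \<Longrightarrow> rep_ops (to_rep d A) a = A a"
  by (simp add: to_rep_def rep_ops_def mat_op_mat_of)

lemma rep_space_carrier: "M \<in> rep_space n C \<Omega> d \<Longrightarrow> a \<in> Ar \<Longrightarrow> M a \<in> carrier_mat (d $ tgt a) (d $ src a)"
  unfolding rep_space_def by (rule PiE_mem)

lemma rep_space_is_rep: "M \<in> rep_space n C \<Omega> d \<Longrightarrow> is_rep (\<lambda>i. d $ i) (rep_ops M)"
  using rep_space_carrier by (auto simp: is_rep_def rep_ops_def intro: mat_op_Hom)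

lemma mat_op_eq_iff: "A \<in> carrier_mat r c \<Longrightarrow> B \<in> carrier_mat r c \<Longrightarrow> mat_op A = mat_op B \<longleftrightarrow> A = B"
  using mat_op_inj by blast

lemma smult_D: "i < n \<Longrightarrow> (k \<cdot>\<^sub>m D) $$ (i,i) = k * D $$ (i,i)"
  using symm by (auto simp: symmetrizer_def)

lemma D_pos: "i < n \<Longrightarrow> D $$ (i,i) > 0"
  using symm by (auto simp: symmetrizer_def)

lemma rep_variety_iff:
  fixes M :: "'a::field rep"
  assumes k: "k \<ge> 1"
  shows "M \<in> rep_variety n C (k \<cdot>\<^sub>m D) \<Omega> d \<longleftrightarrow> M \<in> rep_space n C \<Omega> d \<and> is_mod k (\<lambda>i. d $ i) (rep_ops M)"
proof (cases "M \<in> rep_space n C \<Omega> d")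
  case M: True
  note cr = rep_space_carrier[OF M]
  have E: "M (Eps i) \<in> carrier_mat (d $ i) (d $ i)" if "i < n" for i using cr[OF Eps_Ar[OF that]] by simp
  have nil: "M (Eps i) ^\<^sub>m ((k \<cdot>\<^sub>m D) $$ (i,i)) = 0\<^sub>m (d $ i) (d $ i) \<longleftrightarrow> rep_ops M (Eps i) ^ (k * D $$ (i,i)) = 0"
    if i: "i < n" for i
  proof -
    have p: "k * D $$ (i,i) > 0" using k D_pos[OF i] by simp
    have "M (Eps i) ^\<^sub>m (k * D $$ (i,i)) = 0\<^sub>m (d $ i) (d $ i) \<longleftrightarrow> mat_op (M (Eps i) ^\<^sub>m (k * D $$ (i,i))) = mat_op (0\<^sub>m (d $ i) (d $ i))"
      using mat_op_eq_iff[OF pow_carrier_mat[OF E[OF i]]] by simp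
    also have "\<dots> \<longleftrightarrow> rep_ops M (Eps i) ^ (k * D $$ (i,i)) = 0"
      unfolding mat_op_pow[OF E[OF i]] mat_op_zero rep_ops_def Hom_left[OF Hom_pow[OF mat_op_Hom[OF E[OF i]] p]] ..
    finally show ?thesis unfolding smult_D[OF i] .
  qed
  have rel: "M (Eps (tgt a)) ^\<^sub>m l * M a = M a * M (Eps (src a)) ^\<^sub>m r \<longleftrightarrow>
      rep_ops M (Eps (tgt a)) ^ l * rep_ops M a = rep_ops M a * rep_ops M (Eps (src a)) ^ r" if a: "a \<in> Ar" for a l r
  proof -
    note t = tgt_lt[OF a] and u = src_lt[OF a]
    note Et = E[OF t] and Eu = E[OF u] and Ma = cr[OF a]
    have "M (Eps (tgt a)) ^\<^sub>m l * M a = M a * M (Eps (src a)) ^\<^sub>m r \<longleftrightarrow>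
        mat_op (M (Eps (tgt a)) ^\<^sub>m l * M a) = mat_op (M a * M (Eps (src a)) ^\<^sub>m r)"
      by (rule mat_op_eq_iff[OF mult_carrier_mat[OF pow_carrier_mat[OF Et] Ma] mult_carrier_mat[OF Ma pow_carrier_mat[OF Eu]], symmetric])
    also have "mat_op (M (Eps (tgt a)) ^\<^sub>m l * M a) = rep_ops M (Eps (tgt a)) ^ l * rep_ops M a"
      unfolding mat_op_mult[OF pow_carrier_mat[OF Et] Ma] mat_op_pow[OF Et] mult.assoc rep_ops_def
      by (rule Hom_left[OF Hom_pow_mult[OF mat_op_Hom[OF Et] mat_op_Hom[OF Ma]]])
    also have "mat_op (M a * M (Eps (src a)) ^\<^sub>m r) = rep_ops M a * rep_ops M (Eps (src a)) ^ r"
      unfolding mat_op_mult[OF Ma pow_carrier_mat[OF Eu]] mat_op_pow[OF Eu] rep_ops_def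
      by (rule Hom_rightA[OF mat_op_Hom[OF Ma]])
    finally show ?thesis .
  qed
  have "(\<forall>i j g. (i,j) \<in> \<Omega> \<and> 1 \<le> g \<and> g \<le> g_num C i j \<longrightarrow>
           M (Eps i) ^\<^sub>m (f_num C j i) * M (Alpha i j g) = M (Alpha i j g) * M (Eps j) ^\<^sub>m (f_num C i j)) \<longleftrightarrow>
    (\<forall>a\<in>Ar. rep_ops M (Eps (tgt a)) ^ left_exp C a * rep_ops M a = rep_ops M a * rep_ops M (Eps (src a)) ^ right_exp C a)" (is "?l = ?r")
  proof
    assume l: ?l
    show ?r
    proof
      fix a assume a: "a \<in> Ar"
      show "rep_ops M (Eps (tgt a)) ^ left_exp C a * rep_ops M a = rep_ops M a * rep_ops M (Eps (src a)) ^ right_exp C a"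
      proof (cases a)
        case (Eps i) then show ?thesis by simp
      next
        case (Alpha i j g)
        then show ?thesis using l a rel[OF a, of "f_num C j i" "f_num C i j"] by (auto simp: arrows_def)
      qed
    qed
  next
    assume r: ?r
    show ?l
    proof (intro allI impI)
      fix i j g assume "(i,j) \<in> \<Omega> \<and> 1 \<le> g \<and> g \<le> g_num C i j"
      then have a: "Alpha i j g \<in> Ar" by (auto simp: arrows_def)
      show "M (Eps i) ^\<^sub>m (f_num C j i) * M (Alpha i j g) = M (Alpha i j g) * M (Eps j) ^\<^sub>m (f_num C i j)"
        using rel[OF a, of "f_num C j i" "f_num C i j"] bspec[OF r a] by simp
    qed
  qed
  then show ?thesis unfolding rep_variety_def is_mod_def using M nil rep_space_is_rep[OF M] by simp
qed (simp add: rep_variety_def)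

abbreviation dv :: "nat \<Rightarrow> nat vec \<Rightarrow> nat vec" where
  "dv k r \<equiv> dimension_vector n (k \<cdot>\<^sub>m D) r"

lemma dv_index: "i < n \<Longrightarrow> dv k r $ i = k * (D $$ (i,i) * r $ i)"
  by (simp add: dimension_vector_def smult_D mult.assoc)

lemma dv_carrier: "dv k r \<in> carrier_vec n"
  by (simp add: dimension_vector_def)

lemma rep_lf_iff:
  fixes M :: "'a::field rep"
  assumes k: "k \<ge> 1"
  shows "M \<in> rep_lf n C (k \<cdot>\<^sub>m D) \<Omega> r \<longleftrightarrow> M \<in> rep_space n C \<Omega> (dv k r) \<and> loc_free k (\<lambda>i. dv k r $ i) (rep_ops M)"
proof -
  have "free_of_rank ((k \<cdot>\<^sub>m D) $$ (i,i)) (M (Eps i)) (r $ i) \<longleftrightarrow>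
    (\<exists>\<Theta>\<in>Hom (dv k r $ i) (dv k r $ i). higman (k * D $$ (i,i)) (rep_ops M (Eps i)) \<Theta> (rep_ops M (Eps i)) = idop (dv k r $ i))"
    if M: "M \<in> rep_space n C \<Omega> (dv k r)" "is_mod k (\<lambda>i. dv k r $ i) (rep_ops M)" and i: "i < n" for i
  proof -
    have E: "M (Eps i) \<in> carrier_mat (dv k r $ i) (dv k r $ i)" using rep_space_carrier[OF M(1) Eps_Ar[OF i]] by simp
    have p: "k * D $$ (i,i) > 0" using k D_pos[OF i] by simp
    have nil: "mat_op (M (Eps i)) ^ (k * D $$ (i,i)) = 0" using M(2) i by (simp add: is_mod_def rep_ops_def)
    show ?thesis unfolding smult_D[OF i] rep_ops_def
      by (rule free_of_rank_iff_higman[OF E p nil]) (simp add: dv_index i)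
  qed
  then show ?thesis unfolding rep_lf_def locally_free_of_rank_def loc_free_def using rep_variety_iff[OF k, of M "dv k r"] by auto
qed

lemma rep_iso_iff:
  fixes M N :: "'a::field rep"
  assumes M: "M \<in> rep_space n C \<Omega> d" and N: "N \<in> rep_space n C \<Omega> d"
  shows "rep_iso n C \<Omega> d M N \<longleftrightarrow> iso (\<lambda>i. d $ i) (rep_ops M) (rep_ops N)"
proof
  assume "rep_iso n C \<Omega> d M N"
  then obtain P where P: "\<And>i. i < n \<Longrightarrow> P i \<in> carrier_mat (d $ i) (d $ i)" "\<And>i. i < n \<Longrightarrow> invertible_mat (P i)"
    "\<And>a. a \<in> Ar \<Longrightarrow> P (tgt a) * M a = N a * P (src a)" unfolding rep_iso_def by blast
  have "\<exists>Q. Q \<in> carrier_mat (d $ i) (d $ i) \<and> P i * Q = 1\<^sub>m (d $ i) \<and> Q * P i = 1\<^sub>m (d $ i)" if i: "i < n" for i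
  proof -
    obtain Q where Q: "P i * Q = 1\<^sub>m (d $ i)" "Q * P i = 1\<^sub>m (dim_row Q)"
      using P(1,2)[OF i] unfolding invertible_mat_def inverts_mat_def by auto
    have "dim_col Q = d $ i" using arg_cong[OF Q(1), of dim_col] by simp
    moreover have "dim_row Q = d $ i" using arg_cong[OF Q(2), of dim_col] P(1)[OF i] by simp
    ultimately show ?thesis using Q by (intro exI[of _ Q]) auto
  qed
  then obtain Q where Q: "\<And>i. i < n \<Longrightarrow> Q i \<in> carrier_mat (d $ i) (d $ i)" "\<And>i. i < n \<Longrightarrow> P i * Q i = 1\<^sub>m (d $ i)"
    "\<And>i. i < n \<Longrightarrow> Q i * P i = 1\<^sub>m (d $ i)" by metis
  show "iso (\<lambda>i. d $ i) (rep_ops M) (rep_ops N)"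
  proof (rule isoI[of _ _ _ "\<lambda>i. mat_op (P i)" "\<lambda>i. mat_op (Q i)"])
    show "hom (\<lambda>i. d $ i) (rep_ops M) (\<lambda>i. d $ i) (rep_ops N) (\<lambda>i. mat_op (P i))"
      unfolding hom_def
    proof (intro conjI allI impI ballI)
      fix a assume a: "a \<in> Ar"
      show "mat_op (P (tgt a)) * rep_ops M a = rep_ops N a * mat_op (P (src a))"
        using arg_cong[OF P(3)[OF a], of mat_op] mat_op_mult[OF P(1)[OF tgt_lt[OF a]] rep_space_carrier[OF M a]]
          mat_op_mult[OF rep_space_carrier[OF N a] P(1)[OF src_lt[OF a]]] by (simp add: rep_ops_def)
    qed (rule mat_op_Hom[OF P(1)])
    fix i assume i: "i < n"
    show "mat_op (Q i) \<in> Hom (d $ i) (d $ i)" using mat_op_Hom[OF Q(1)[OF i]] .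
    show "mat_op (P i) * mat_op (Q i) = idop (d $ i)" "mat_op (Q i) * mat_op (P i) = idop (d $ i)"
      using mat_op_mult[OF P(1)[OF i] Q(1)[OF i]] mat_op_mult[OF Q(1)[OF i] P(1)[OF i]] Q(2,3)[OF i] mat_op_one by metis+
  qed (rule rep_space_is_rep M N)+
next
  assume "iso (\<lambda>i. d $ i) (rep_ops M) (rep_ops N)"
  then obtain P Q where PQ: "hom (\<lambda>i. d $ i) (rep_ops M) (\<lambda>i. d $ i) (rep_ops N) P" "hom (\<lambda>i. d $ i) (rep_ops N) (\<lambda>i. d $ i) (rep_ops M) Q"
    "\<And>i. i < n \<Longrightarrow> P i * Q i = idop (d $ i)" "\<And>i. i < n \<Longrightarrow> Q i * P i = idop (d $ i)" by (rule isoE) auto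
  define P' where "P' i = mat_of (d $ i) (d $ i) (P i)" for i
  define Q' where "Q' i = mat_of (d $ i) (d $ i) (Q i)" for i
  have c: "P' i \<in> carrier_mat (d $ i) (d $ i)" "Q' i \<in> carrier_mat (d $ i) (d $ i)" for i
    by (simp_all add: P'_def Q'_def)
  have m: "mat_op (P' i) = P i" "mat_op (Q' i) = Q i" if "i < n" for i
    unfolding P'_def Q'_def using hom_Hom[OF PQ(1) that] hom_Hom[OF PQ(2) that] by (auto intro: mat_op_mat_of)
  show "rep_iso n C \<Omega> d M N" unfolding rep_iso_def
  proof (intro exI[of _ P'] conjI allI impI ballI)
    fix i assume i: "i < n"
    have "P' i * Q' i = 1\<^sub>m (d $ i)" "Q' i * P' i = 1\<^sub>m (d $ i)"
      using mat_op_mult[OF c(1)[of i] c(2)[of i]] mat_op_mult[OF c(2)[of i] c(1)[of i]] m[OF i] PQ(3,4)[OF i] mat_op_one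
        mat_op_inj[OF mult_carrier_mat[OF c(1)[of i] c(2)[of i]] one_carrier_mat]
        mat_op_inj[OF mult_carrier_mat[OF c(2)[of i] c(1)[of i]] one_carrier_mat] by metis+
    then show "invertible_mat (P' i)" unfolding invertible_mat_def inverts_mat_def using c[of i] by auto
    show "P' i \<in> carrier_mat (d $ i) (d $ i)" by (rule c)
  next
    fix a assume a: "a \<in> Ar"
    note t = tgt_lt[OF a] and u = src_lt[OF a]
    show "P' (tgt a) * M a = N a * P' (src a)"
    proof (rule mat_op_inj[OF mult_carrier_mat[OF c(1) rep_space_carrier[OF M a]] mult_carrier_mat[OF rep_space_carrier[OF N a] c(1)]])
      show "mat_op (P' (tgt a) * M a) = mat_op (N a * P' (src a))"
        unfolding mat_op_mult[OF c(1) rep_space_carrier[OF M a]] mat_op_mult[OF rep_space_carrier[OF N a] c(1)] m[OF t] m[OF u]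
        using hom_eq[OF PQ(1) a] by (simp add: rep_ops_def)
    qed
  qed
qed

lemma direct_sum_block:
  fixes A B S :: "'a::field rep"
  assumes A: "A \<in> rep_space n C \<Omega> d1" and B: "B \<in> rep_space n C \<Omega> d2" and d: "d1 \<in> carrier_vec n" "d2 \<in> carrier_vec n"
    and S: "\<And>a. a \<in> Ar \<Longrightarrow> S a = four_block_mat (A a) (0\<^sub>m (dim_row (A a)) (dim_col (B a))) (0\<^sub>m (dim_row (B a)) (dim_col (A a))) (B a)"
    and ext: "S \<in> extensional Ar"
  shows "S \<in> rep_space n C \<Omega> (d1 + d2)"
    and "biprod (\<lambda>i. (d1 + d2) $ i) (rep_ops S) (\<lambda>i. d1 $ i) (rep_ops A) (\<lambda>i. d2 $ i) (rep_ops B)"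
proof -
  have ix: "(d1 + d2) $ i = d1 $ i + d2 $ i" if "i < n" for i using d that by simp
  have "S a \<in> carrier_mat ((d1 + d2) $ tgt a) ((d1 + d2) $ src a)" if a: "a \<in> Ar" for a
    using rep_space_carrier[OF A a] rep_space_carrier[OF B a] ix[OF tgt_lt[OF a]] ix[OF src_lt[OF a]]
    unfolding S[OF a] by auto
  then show "S \<in> rep_space n C \<Omega> (d1 + d2)" unfolding rep_space_def using ext by (auto simp: PiE_def)
  have "biprod (\<lambda>i. d1 $ i + d2 $ i) (rep_ops S) (\<lambda>i. d1 $ i) (rep_ops A) (\<lambda>i. d2 $ i) (rep_ops B)"
  proof (rule biprod_canonical[OF rep_space_is_rep[OF A] rep_space_is_rep[OF B]])
    fix a assume a: "a \<in> Ar"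
    note ca = rep_space_carrier[OF A a] and cb = rep_space_carrier[OF B a]
    show "rep_ops S a = idop (d1 $ tgt a) * rep_ops A a * idop (d1 $ src a) +
        second_incl (d1 $ tgt a) (d2 $ tgt a) * rep_ops B a * second_proj (d1 $ src a) (d2 $ src a)"
      unfolding rep_ops_def S[OF a] using mat_op_four_block[OF ca cb] ca cb by simp
  qed
  then show "biprod (\<lambda>i. (d1 + d2) $ i) (rep_ops S) (\<lambda>i. d1 $ i) (rep_ops A) (\<lambda>i. d2 $ i) (rep_ops B)"
    using biprod_cong[of "\<lambda>i. (d1 + d2) $ i" "\<lambda>i. d1 $ i + d2 $ i" "rep_ops S" "rep_ops S" "\<lambda>i. d1 $ i" "\<lambda>i. d1 $ i" "rep_ops A" "rep_ops A" "\<lambda>i. d2 $ i" "\<lambda>i. d2 $ i" "rep_ops B" "rep_ops B"] ix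
    by simp
qed

lemma direct_sum_ext: "direct_sum n C \<Omega> Ms \<in> extensional Ar"
  by (simp add: direct_sum_def)

lemma foldr_carrier: "set ds \<subseteq> carrier_vec n \<Longrightarrow> foldr (+) ds (0\<^sub>v n) \<in> carrier_vec n"
  by (induction ds) auto

lemma direct_sum_biprod_list:
  fixes Ps :: "(nat vec \<times> 'a::field rep) list"
  assumes "\<And>P. P \<in> set Ps \<Longrightarrow> fst P \<in> carrier_vec n \<and> snd P \<in> rep_space n C \<Omega> (fst P)"
  shows "direct_sum n C \<Omega> (map snd Ps) \<in> rep_space n C \<Omega> (foldr (+) (map fst Ps) (0\<^sub>v n)) \<and>
    biprod_list (\<lambda>i. foldr (+) (map fst Ps) (0\<^sub>v n) $ i) (rep_ops (direct_sum n C \<Omega> (map snd Ps)))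
      (map (\<lambda>P. (\<lambda>i. fst P $ i, rep_ops (snd P))) Ps)"
  using assms
proof (induction Ps)
  case Nil
  have "direct_sum n C \<Omega> [] \<in> rep_space n C \<Omega> (0\<^sub>v n)"
    unfolding direct_sum_def rep_space_def using tgt_lt src_lt by auto
  then show ?case by simp
next
  case (Cons P Ps)
  let ?d = "foldr (+) (map fst Ps) (0\<^sub>v n)" and ?S = "direct_sum n C \<Omega> (map snd Ps)"
  have IH: "?S \<in> rep_space n C \<Omega> ?d" "biprod_list (\<lambda>i. ?d $ i) (rep_ops ?S) (map (\<lambda>P. (\<lambda>i. fst P $ i, rep_ops (snd P))) Ps)"
    using Cons by auto
  have P: "fst P \<in> carrier_vec n" "snd P \<in> rep_space n C \<Omega> (fst P)" using Cons.prems by auto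
  have d: "?d \<in> carrier_vec n" using Cons.prems by (intro foldr_carrier) auto
  have S: "direct_sum n C \<Omega> (map snd (P # Ps)) a = four_block_mat (snd P a) (0\<^sub>m (dim_row (snd P a)) (dim_col (?S a)))
      (0\<^sub>m (dim_row (?S a)) (dim_col (snd P a))) (?S a)" if "a \<in> Ar" for a
    using that by (simp add: direct_sum_def Let_def comp_def)
  note b = direct_sum_block[OF P(2) IH(1) P(1) d S direct_sum_ext]
  show ?case using b IH(2) by auto
qed

lemma direct_sum_pair:
  fixes A B :: "'a::field rep"
  assumes A: "A \<in> rep_space n C \<Omega> d1" and B: "B \<in> rep_space n C \<Omega> d2" and d: "d1 \<in> carrier_vec n" "d2 \<in> carrier_vec n"
  shows "direct_sum n C \<Omega> [A, B] \<in> rep_space n C \<Omega> (d1 + d2)"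
    and "biprod (\<lambda>i. (d1 + d2) $ i) (rep_ops (direct_sum n C \<Omega> [A, B])) (\<lambda>i. d1 $ i) (rep_ops A) (\<lambda>i. d2 $ i) (rep_ops B)"
proof -
  have S: "direct_sum n C \<Omega> [A, B] a = four_block_mat (A a) (0\<^sub>m (dim_row (A a)) (dim_col (B a)))
      (0\<^sub>m (dim_row (B a)) (dim_col (A a))) (B a)" if "a \<in> Ar" for a
    using that diag_block_mat_singleton[of "B a"] by (simp add: direct_sum_def Let_def del: diag_block_mat_singleton)
  show "direct_sum n C \<Omega> [A, B] \<in> rep_space n C \<Omega> (d1 + d2)"
    "biprod (\<lambda>i. (d1 + d2) $ i) (rep_ops (direct_sum n C \<Omega> [A, B])) (\<lambda>i. d1 $ i) (rep_ops A) (\<lambda>i. d2 $ i) (rep_ops B)"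
    by (rule direct_sum_block[OF A B d S direct_sum_ext]; simp)+
qed

lemma nonzero_dim_iff: "d \<in> carrier_vec n \<Longrightarrow> nonzero_dim (\<lambda>i. d $ i) \<longleftrightarrow> d \<noteq> 0\<^sub>v n"
proof -
  assume d: "d \<in> carrier_vec n"
  have "d = 0\<^sub>v n" if "\<forall>i<n. d $ i = 0" using d that by (intro eq_vecI) auto
  then show ?thesis by (auto simp: nonzero_dim_def)
qed

text \<open>A biproduct with abstract dimension functions is realized by matrices through
  \<open>to_rep\<close>; uniqueness of biproducts identifies M with the block sum of the
  realizations.\<close>

lemma indecomposable_iff:
  fixes M :: "'a::field rep"
  assumes k: "k \<ge> 1" and d: "d \<in> carrier_vec n"
  shows "indecomposable n C (k \<cdot>\<^sub>m D) \<Omega> d M \<longleftrightarrow> M \<in> rep_space n C \<Omega> d \<and> indec k (\<lambda>i. d $ i) (rep_ops M)"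
proof -
  have "(\<exists>d1 d2 M1 M2.
          d1 \<in> carrier_vec n \<and> d1 \<noteq> 0\<^sub>v n \<and> d2 \<in> carrier_vec n \<and> d2 \<noteq> 0\<^sub>v n \<and> d = d1 + d2 \<and>
          M1 \<in> rep_variety n C (k \<cdot>\<^sub>m D) \<Omega> d1 \<and> M2 \<in> rep_variety n C (k \<cdot>\<^sub>m D) \<Omega> d2 \<and>
          rep_iso n C \<Omega> d M (direct_sum n C \<Omega> [M1, M2])) \<longleftrightarrow>
     (\<exists>d1 A d2 B. nonzero_dim d1 \<and> nonzero_dim d2 \<and> is_mod k d1 A \<and> is_mod k d2 B \<and> biprod (\<lambda>i. d $ i) (rep_ops M) d1 A d2 B)" (is "?l = ?r")
    if M: "M \<in> rep_space n C \<Omega> d"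
  proof
    assume ?l
    then obtain d1 d2 M1 M2 where h: "d1 \<in> carrier_vec n" "d1 \<noteq> 0\<^sub>v n" "d2 \<in> carrier_vec n" "d2 \<noteq> 0\<^sub>v n" "d = d1 + d2"
       "M1 \<in> rep_variety n C (k \<cdot>\<^sub>m D) \<Omega> d1" "M2 \<in> rep_variety n C (k \<cdot>\<^sub>m D) \<Omega> d2"
       "rep_iso n C \<Omega> d M (direct_sum n C \<Omega> [M1, M2])" by blast
    have m: "M1 \<in> rep_space n C \<Omega> d1" "is_mod k (\<lambda>i. d1 $ i) (rep_ops M1)" "M2 \<in> rep_space n C \<Omega> d2" "is_mod k (\<lambda>i. d2 $ i) (rep_ops M2)"
      using h(6,7) rep_variety_iff[OF k] by auto
    note b = direct_sum_pair[OF m(1,3) h(1,3)]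
    have "iso (\<lambda>i. d $ i) (rep_ops M) (rep_ops (direct_sum n C \<Omega> [M1, M2]))"
      using h(8) rep_iso_iff[OF M, of "direct_sum n C \<Omega> [M1, M2]"] b(1) h(5) by simp
    then have "biprod (\<lambda>i. d $ i) (rep_ops M) (\<lambda>i. d1 $ i) (rep_ops M1) (\<lambda>i. d2 $ i) (rep_ops M2)"
      using biprod_iso[OF b(2)[folded h(5)]] iso_sym by blast
    then show ?r using nonzero_dim_iff h m by blast
  next
    assume ?r
    then obtain d1 A d2 B where h: "nonzero_dim d1" "nonzero_dim d2" "is_mod k d1 A" "is_mod k d2 B" "biprod (\<lambda>i. d $ i) (rep_ops M) d1 A d2 B" by blast
    define e1 where "e1 = vec n d1"
    define e2 where "e2 = vec n d2"
    have e: "e1 \<in> carrier_vec n" "e2 \<in> carrier_vec n" "\<And>i. i < n \<Longrightarrow> e1 $ i = d1 i" "\<And>i. i < n \<Longrightarrow> e2 $ i = d2 i"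
      by (simp_all add: e1_def e2_def)
    have lA: "rep_ops (to_rep e1 A) a = A a" "rep_ops (to_rep e2 B) a = B a" if "a \<in> Ar" for a
      using that is_mod_Hom[OF h(3) that] is_mod_Hom[OF h(4) that] e tgt_lt src_lt by (auto intro: rep_ops_to_rep)
    have m: "is_mod k (\<lambda>i. e1 $ i) (rep_ops (to_rep e1 A))" "is_mod k (\<lambda>i. e2 $ i) (rep_ops (to_rep e2 B))"
      using h(3,4) is_mod_cong[of "\<lambda>i. e1 $ i" d1 "rep_ops (to_rep e1 A)" A] is_mod_cong[of "\<lambda>i. e2 $ i" d2 "rep_ops (to_rep e2 B)" B] e lA
      by auto
    note b = direct_sum_pair[OF to_rep_space to_rep_space e(1,2), of A B]
    have "biprod (\<lambda>i. (e1 + e2) $ i) (rep_ops (direct_sum n C \<Omega> [to_rep e1 A, to_rep e2 B])) d1 A d2 B"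
    proof -
      have "biprod (\<lambda>i. (e1 + e2) $ i) (rep_ops (direct_sum n C \<Omega> [to_rep e1 A, to_rep e2 B])) d1 A d2 B =
        biprod (\<lambda>i. (e1 + e2) $ i) (rep_ops (direct_sum n C \<Omega> [to_rep e1 A, to_rep e2 B])) (\<lambda>i. e1 $ i) (rep_ops (to_rep e1 A)) (\<lambda>i. e2 $ i) (rep_ops (to_rep e2 B))"
        by (rule biprod_cong) (simp_all add: e lA)
      then show ?thesis using b(2) by simp
    qed
    note un = biprod_unique[OF h(5) this]
    have de: "d = e1 + e2" using un(1) d e by (intro eq_vecI) auto
    have "rep_iso n C \<Omega> d M (direct_sum n C \<Omega> [to_rep e1 A, to_rep e2 B])"
      using rep_iso_iff[OF M b(1)[folded de]] un(2) by simp
    moreover have "e1 \<noteq> 0\<^sub>v n" "e2 \<noteq> 0\<^sub>v n" using h(1,2) e nonzero_dim_iff by (auto simp: nonzero_dim_def)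
    ultimately show ?l using de e rep_variety_iff[OF k] to_rep_space m by blast
  qed
  note step = this
  show ?thesis
  proof (cases "M \<in> rep_space n C \<Omega> d")
    case True
    show ?thesis
      unfolding indecomposable_def indec_def step[OF True] nonzero_dim_iff[OF d] rep_variety_iff[OF k, of M d] using True by simp
  next
    case False
    then show ?thesis by (simp add: indecomposable_def rep_variety_def)
  qed
qed

lemma dv_foldr: "set rs \<subseteq> carrier_vec n \<Longrightarrow> dv k (foldr (+) rs (0\<^sub>v n)) = foldr (+) (map (dv k) rs) (0\<^sub>v n)"
proof (induction rs)
  case Nil show ?case by (auto simp: dimension_vector_def)
next
  case (Cons r rs)
  have "dv k (r + foldr (+) rs (0\<^sub>v n)) = dv k r + dv k (foldr (+) rs (0\<^sub>v n))"
    using Cons.prems foldr_carrier[of rs] by (intro eq_vecI) (auto simp: dimension_vector_def algebra_simps)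
  with Cons show ?case by simp
qed

definition decomposes :: "nat \<Rightarrow> nat vec \<Rightarrow> nat vec list \<Rightarrow> 'a::field rep \<Rightarrow> bool" where
  "decomposes k r rs M \<longleftrightarrow> (\<exists>Ms. length Ms = length rs \<and>
       (\<forall>s<length rs. Ms ! s \<in> rep_lf n C (k \<cdot>\<^sub>m D) \<Omega> (rs ! s) \<and>
          indecomposable n C (k \<cdot>\<^sub>m D) \<Omega> (dv k (rs ! s)) (Ms ! s)) \<and>
       rep_iso n C \<Omega> (dv k r) M (direct_sum n C \<Omega> Ms))"

text \<open>This removes matrices from the notion: an abstract list of summands has the same content
  as a block sum, since both are biproducts of the same list.\<close>

lemma decomposes_iff:
  fixes M :: "'a::field rep"
  assumes k: "k \<ge> 1" and M: "M \<in> rep_space n C \<Omega> (dv k r)" and rs: "set rs \<subseteq> carrier_vec n" "r = foldr (+) rs (0\<^sub>v n)"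
  shows "decomposes k r rs M \<longleftrightarrow> (\<exists>L. biprod_list (\<lambda>i. dv k r $ i) (rep_ops M) L \<and>
    list_all2 (\<lambda>P \<rho>. loc_free k (fst P) (snd P) \<and> indec k (fst P) (snd P) \<and> (\<forall>i<n. fst P i = k * (D $$ (i,i) * \<rho> $ i))) L rs)"
    (is "_ \<longleftrightarrow> ?r")
proof
  have dvr: "dv k r = foldr (+) (map (dv k) rs) (0\<^sub>v n)" unfolding rs(2) by (rule dv_foldr[OF rs(1)])
  assume "decomposes k r rs M"
  then obtain Ms where Ms: "length Ms = length rs"
    "\<And>s. s < length rs \<Longrightarrow> Ms ! s \<in> rep_lf n C (k \<cdot>\<^sub>m D) \<Omega> (rs ! s)"
    "\<And>s. s < length rs \<Longrightarrow> indecomposable n C (k \<cdot>\<^sub>m D) \<Omega> (dv k (rs ! s)) (Ms ! s)"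
    "rep_iso n C \<Omega> (dv k r) M (direct_sum n C \<Omega> Ms)" unfolding decomposes_def by blast
  define Ps where "Ps = zip (map (dv k) rs) Ms"
  have f: "map fst Ps = map (dv k) rs" "map snd Ps = Ms" using Ms(1) by (simp_all add: Ps_def)
  have lPs: "length Ps = length rs" using Ms(1) by (simp add: Ps_def)
  have Psn: "Ps ! s = (dv k (rs ! s), Ms ! s)" if "s < length rs" for s using that Ms(1) by (simp add: Ps_def)
  have "fst P \<in> carrier_vec n \<and> snd P \<in> rep_space n C \<Omega> (fst P)" if "P \<in> set Ps" for P
  proof -
    obtain s where s: "s < length rs" "P = Ps ! s" using \<open>P \<in> set Ps\<close> lPs by (metis in_set_conv_nth)
    then show ?thesis using Psn[OF s(1)] Ms(2)[OF s(1)] rep_lf_iff[OF k] dv_carrier by auto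
  qed
  note b = direct_sum_biprod_list[of Ps, OF this, unfolded f, folded dvr]
  let ?L = "map (\<lambda>P. (\<lambda>i. fst P $ i, rep_ops (snd P))) Ps"
  have "iso (\<lambda>i. dv k r $ i) (rep_ops M) (rep_ops (direct_sum n C \<Omega> Ms))"
    using Ms(4) rep_iso_iff[OF M, of "direct_sum n C \<Omega> Ms"] b by blast
  then have "biprod_list (\<lambda>i. dv k r $ i) (rep_ops M) ?L" using b biprod_list_iso iso_sym by blast
  moreover have "list_all2 (\<lambda>P \<rho>. loc_free k (fst P) (snd P) \<and> indec k (fst P) (snd P) \<and> (\<forall>i<n. fst P i = k * (D $$ (i,i) * \<rho> $ i))) ?L rs"
  proof -
    have "loc_free k (\<lambda>i. dv k (rs ! s) $ i) (rep_ops (Ms ! s))" "indec k (\<lambda>i. dv k (rs ! s) $ i) (rep_ops (Ms ! s))"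
      if "s < length rs" for s
      using Ms(2,3)[OF that] rep_lf_iff[OF k, of "Ms ! s"] indecomposable_iff[OF k dv_carrier, of k "rs ! s" "Ms ! s"] by simp_all
    then show ?thesis unfolding list_all2_conv_all_nth using lPs Psn by (simp add: dv_index)
  qed
  ultimately show ?r by blast
next
  have dvr: "dv k r = foldr (+) (map (dv k) rs) (0\<^sub>v n)" unfolding rs(2) by (rule dv_foldr[OF rs(1)])
  assume ?r
  then obtain L :: "((nat \<Rightarrow> nat) \<times> (arrow \<Rightarrow> 'a lop)) list" where L: "biprod_list (\<lambda>i. dv k r $ i) (rep_ops M) L" "length L = length rs"
    "\<And>s. s < length rs \<Longrightarrow> loc_free k (fst (L ! s)) (snd (L ! s))" "\<And>s. s < length rs \<Longrightarrow> indec k (fst (L ! s)) (snd (L ! s))"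
    "\<And>s i. s < length rs \<Longrightarrow> i < n \<Longrightarrow> fst (L ! s) i = k * (D $$ (i,i) * (rs ! s) $ i)"
    unfolding list_all2_conv_all_nth by auto
  define Ms where "Ms = map (\<lambda>s. to_rep (dv k (rs ! s)) (snd (L ! s))) [0..<length rs]"
  have Msl: "length Ms = length rs" by (simp add: Ms_def)
  have Msn: "Ms ! s = to_rep (dv k (rs ! s)) (snd (L ! s))" if "s < length rs" for s using that by (simp add: Ms_def)
  have dd: "dv k (rs ! s) $ i = fst (L ! s) i" if "s < length rs" "i < n" for s i using L(5)[OF that] that by (simp add: dv_index)
  have ll: "rep_ops (Ms ! s) a = snd (L ! s) a" if "s < length rs" "a \<in> Ar" for s a
    unfolding Msn[OF that(1)] using is_mod_Hom[OF loc_free_is_mod[OF L(3)[OF that(1)]] that(2)] dd[OF that(1)] tgt_lt[OF that(2)] src_lt[OF that(2)]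
    by (intro rep_ops_to_rep[OF that(2)]) simp
  have Mss: "Ms ! s \<in> rep_space n C \<Omega> (dv k (rs ! s))" if "s < length rs" for s unfolding Msn[OF that] by (rule to_rep_space)
  have lfM: "loc_free k (\<lambda>i. dv k (rs ! s) $ i) (rep_ops (Ms ! s))" if "s < length rs" for s
    using L(3)[OF that] loc_free_cong[of "\<lambda>i. dv k (rs ! s) $ i" "fst (L ! s)" "rep_ops (Ms ! s)" "snd (L ! s)"] dd[OF that] ll[OF that] by auto
  have indM: "indec k (\<lambda>i. dv k (rs ! s) $ i) (rep_ops (Ms ! s))" if "s < length rs" for s
  proof -
    have "is_mod k (\<lambda>i. dv k (rs ! s) $ i) (rep_ops (Ms ! s)) = is_mod k (fst (L ! s)) (snd (L ! s))"
      by (rule is_mod_cong) (simp_all add: dd ll that)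
    moreover have "biprod (\<lambda>i. dv k (rs ! s) $ i) (rep_ops (Ms ! s)) d1 A d2 B = biprod (fst (L ! s)) (snd (L ! s)) d1 A d2 B" for d1 A d2 B
      by (rule biprod_cong) (simp_all add: dd ll that)
    moreover have "nonzero_dim (\<lambda>i. dv k (rs ! s) $ i) = nonzero_dim (fst (L ! s))" using dd[OF that] by (auto simp: nonzero_dim_def)
    ultimately show ?thesis using L(4)[OF that] unfolding indec_def by simp
  qed
  define Ps where "Ps = zip (map (dv k) rs) Ms"
  have f: "map fst Ps = map (dv k) rs" "map snd Ps = Ms" using Msl by (simp_all add: Ps_def)
  have lPs: "length Ps = length rs" using Msl by (simp add: Ps_def)
  have Psn: "Ps ! s = (dv k (rs ! s), Ms ! s)" if "s < length rs" for s using that Msl by (simp add: Ps_def)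
  have "fst P \<in> carrier_vec n \<and> snd P \<in> rep_space n C \<Omega> (fst P)" if "P \<in> set Ps" for P
  proof -
    obtain s where s: "s < length rs" "P = Ps ! s" using \<open>P \<in> set Ps\<close> lPs by (metis in_set_conv_nth)
    then show ?thesis using Psn[OF s(1)] Mss[OF s(1)] dv_carrier by auto
  qed
  note b = direct_sum_biprod_list[of Ps, OF this, unfolded f, folded dvr]
  let ?L = "map (\<lambda>P. (\<lambda>i. fst P $ i, rep_ops (snd P))) Ps"
  have "list_all2 (\<lambda>P P'. (\<forall>i<n. fst P i = fst P' i) \<and> (\<forall>a\<in>Ar. snd P a = snd P' a)) ?L L"
    unfolding list_all2_conv_all_nth using lPs L(2) Psn dd ll by auto
  from biprod_list_cong[OF this] have "biprod_list (\<lambda>i. dv k r $ i) (rep_ops (direct_sum n C \<Omega> Ms)) L" using b by simp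
  from biprod_list_unique[OF L(1) this rep_space_is_rep[OF M] rep_space_is_rep] b
  have "iso (\<lambda>i. dv k r $ i) (rep_ops M) (rep_ops (direct_sum n C \<Omega> Ms))" by blast
  then have "rep_iso n C \<Omega> (dv k r) M (direct_sum n C \<Omega> Ms)" using rep_iso_iff[OF M] b by blast
  then show "decomposes k r rs M" unfolding decomposes_def
    using Msl Mss lfM indM rep_lf_iff[OF k] indecomposable_iff[OF k dv_carrier] by blast
qed

end

section \<open>Functions regular near a point\<close>

text \<open>Local algebraic geometry at a point \<open>M0\<close> of X with coordinate functions P:
  \<open>near\<close> means on a basic open neighbourhood, \<open>reg\<close> means equal there to
  one fraction. Used with polynomials on \<open>rep_lf\<close>, and with one-variable polynomials on
  the field for arguments along a line.\<close>

locale local_functions =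
  fixes P :: "('x \<Rightarrow> 'a::field) set" and X :: "'x set" and M0 :: 'x
  assumes const: "(\<lambda>_. c) \<in> P"
    and add: "f \<in> P \<Longrightarrow> g \<in> P \<Longrightarrow> (\<lambda>M. f M + g M) \<in> P"
    and mult: "f \<in> P \<Longrightarrow> g \<in> P \<Longrightarrow> (\<lambda>M. f M * g M) \<in> P"
    and M0: "M0 \<in> X"
begin

definition near :: "('x \<Rightarrow> bool) \<Rightarrow> bool" where
  "near Q \<longleftrightarrow> (\<exists>H\<in>P. H M0 \<noteq> 0 \<and> (\<forall>M\<in>X. H M \<noteq> 0 \<longrightarrow> Q M))"

definition reg :: "('x \<Rightarrow> 'a) \<Rightarrow> bool" where
  "reg \<phi> \<longleftrightarrow> (\<exists>F\<in>P. \<exists>G\<in>P. G M0 \<noteq> 0 \<and> (\<forall>M\<in>X. G M \<noteq> 0 \<longrightarrow> \<phi> M = F M / G M))"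

definition op_reg :: "nat \<Rightarrow> nat \<Rightarrow> ('x \<Rightarrow> 'a lop) \<Rightarrow> bool" where
  "op_reg r c \<Phi> \<longleftrightarrow> (\<forall>M\<in>X. \<Phi> M \<in> Hom r c) \<and> (\<forall>p<r. \<forall>q<c. reg (\<lambda>M. entry (\<Phi> M) p q))"

lemma near_triv: "(\<And>M. M \<in> X \<Longrightarrow> Q M) \<Longrightarrow> near Q"
  unfolding near_def by (rule bexI[OF _ const[of 1]]) auto

lemma near_mono: "near Q \<Longrightarrow> (\<And>M. M \<in> X \<Longrightarrow> Q M \<Longrightarrow> R M) \<Longrightarrow> near R"
  unfolding near_def by blast

lemma near_conj: "near Q \<Longrightarrow> near R \<Longrightarrow> near (\<lambda>M. Q M \<and> R M)"
proof -
  assume "near Q" "near R"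
  then obtain H K where "H \<in> P" "K \<in> P" "H M0 \<noteq> 0" "K M0 \<noteq> 0"
    "\<forall>M\<in>X. H M \<noteq> 0 \<longrightarrow> Q M" "\<forall>M\<in>X. K M \<noteq> 0 \<longrightarrow> R M" unfolding near_def by blast
  then show ?thesis unfolding near_def by (intro bexI[OF _ mult[of H K]]) auto
qed

lemma near_all: "(\<And>i. i < (m::nat) \<Longrightarrow> near (Q i)) \<Longrightarrow> near (\<lambda>M. \<forall>i<m. Q i M)"
proof (induction m)
  case 0 show ?case by (rule near_triv) simp
next
  case (Suc m)
  then have "near (\<lambda>M. (\<forall>i<m. Q i M) \<and> Q m M)" by (intro near_conj) auto
  then show ?case by (rule near_mono) (auto simp: less_Suc_eq)
qed

lemma reg_P: "f \<in> P \<Longrightarrow> reg f"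
  unfolding reg_def by (intro bexI[of _ f] bexI[OF _ const[of 1]]) auto

lemma reg_cong: "reg \<phi> \<Longrightarrow> (\<And>M. M \<in> X \<Longrightarrow> \<phi> M = \<psi> M) \<Longrightarrow> reg \<psi>"
  unfolding reg_def by metis

lemma reg_const: "reg (\<lambda>_. c)"
  by (rule reg_P[OF const])

lemma reg_add: "reg f \<Longrightarrow> reg g \<Longrightarrow> reg (\<lambda>M. f M + g M)"
proof -
  assume "reg f" "reg g"
  then obtain F G F' G' where h: "F \<in> P" "G \<in> P" "G M0 \<noteq> 0" "\<forall>M\<in>X. G M \<noteq> 0 \<longrightarrow> f M = F M / G M"
    "F' \<in> P" "G' \<in> P" "G' M0 \<noteq> 0" "\<forall>M\<in>X. G' M \<noteq> 0 \<longrightarrow> g M = F' M / G' M" unfolding reg_def by blast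
  show ?thesis unfolding reg_def
    by (rule bexI[OF _ add[OF mult[OF h(1,6)] mult[OF h(5,2)]]], rule bexI[OF _ mult[OF h(2,6)]])
      (use h in \<open>auto simp: field_simps\<close>)
qed

lemma reg_mult: "reg f \<Longrightarrow> reg g \<Longrightarrow> reg (\<lambda>M. f M * g M)"
proof -
  assume "reg f" "reg g"
  then obtain F G F' G' where h: "F \<in> P" "G \<in> P" "G M0 \<noteq> 0" "\<forall>M\<in>X. G M \<noteq> 0 \<longrightarrow> f M = F M / G M"
    "F' \<in> P" "G' \<in> P" "G' M0 \<noteq> 0" "\<forall>M\<in>X. G' M \<noteq> 0 \<longrightarrow> g M = F' M / G' M" unfolding reg_def by blast
  show ?thesis unfolding reg_def
    by (rule bexI[OF _ mult[OF h(1,5)]], rule bexI[OF _ mult[OF h(2,6)]])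
      (use h in auto)
qed

lemma reg_sum: "(\<And>s. s \<in> S \<Longrightarrow> reg (f s)) \<Longrightarrow> reg (\<lambda>M. \<Sum>s\<in>S. f s M)"
  by (induction S rule: infinite_finite_induct) (auto intro: reg_const reg_add)

lemma reg_prod: "(\<And>s. s \<in> S \<Longrightarrow> reg (f s)) \<Longrightarrow> reg (\<lambda>M. \<Prod>s\<in>S. f s M)"
  by (induction S rule: infinite_finite_induct) (auto intro: reg_const reg_mult)

lemma reg_near_nonzero_dim: "reg f \<Longrightarrow> f M0 \<noteq> 0 \<Longrightarrow> near (\<lambda>M. f M \<noteq> 0)"
proof -
  assume "reg f" and nonzero_dim: "f M0 \<noteq> 0"
  then obtain F G where h: "F \<in> P" "G \<in> P" "G M0 \<noteq> 0" "\<forall>M\<in>X. G M \<noteq> 0 \<longrightarrow> f M = F M / G M"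
    unfolding reg_def by blast
  have "F M0 \<noteq> 0" using h M0 nonzero_dim by auto
  then show ?thesis unfolding near_def by (intro bexI[OF _ mult[OF h(1,2)]]) (use h in auto)
qed

lemma reg_inverse: "reg f \<Longrightarrow> f M0 \<noteq> 0 \<Longrightarrow> reg (\<lambda>M. inverse (f M))"
proof -
  assume "reg f" and nonzero_dim: "f M0 \<noteq> 0"
  then obtain F G where h: "F \<in> P" "G \<in> P" "G M0 \<noteq> 0" "\<forall>M\<in>X. G M \<noteq> 0 \<longrightarrow> f M = F M / G M"
    unfolding reg_def by blast
  have F0: "F M0 \<noteq> 0" using h M0 nonzero_dim by auto
  show ?thesis unfolding reg_def
    by (rule bexI[OF _ mult[OF h(2,2)]], rule bexI[OF _ mult[OF h(1,2)]]) (use h F0 in auto)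
qed

lemma reg_det:
  assumes "\<And>M. M \<in> X \<Longrightarrow> B M \<in> carrier_mat e e" "\<And>p q. p < e \<Longrightarrow> q < e \<Longrightarrow> reg (\<lambda>M. B M $$ (p,q))"
  shows "reg (\<lambda>M. det (B M))"
proof (rule reg_cong)
  show "reg (\<lambda>M. \<Sum>p \<in> {p. p permutes {0 ..< e}}. signof p * (\<Prod>i = 0 ..< e. B M $$ (i, p i)))"
  proof (intro reg_sum reg_mult reg_prod reg_const)
    fix p i assume "p \<in> {p. p permutes {0..<e}}" and i: "i \<in> {0..<e}"
    then have "p i < e" using permutes_in_image[of p "{0..<e}" i] by auto
    then show "reg (\<lambda>M. B M $$ (i, p i))" using i by (intro assms(2)) auto
  qed
  show "(\<Sum>p \<in> {p. p permutes {0 ..< e}}. signof p * (\<Prod>i = 0 ..< e. B M $$ (i, p i))) = det (B M)" if "M \<in> X" for M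
    by (rule det_def'[OF assms(1)[OF that], symmetric])
qed

lemma op_reg_Hom: "op_reg r c \<Phi> \<Longrightarrow> M \<in> X \<Longrightarrow> \<Phi> M \<in> Hom r c"
  by (simp add: op_reg_def)

lemma op_reg_cong: "op_reg r c \<Phi> \<Longrightarrow> (\<And>M. M \<in> X \<Longrightarrow> \<Phi> M = \<Psi> M) \<Longrightarrow> op_reg r c \<Psi>"
  unfolding op_reg_def using reg_cong by (metis (no_types, lifting))

lemma op_reg_const: "Z \<in> Hom r c \<Longrightarrow> op_reg r c (\<lambda>_. Z)"
  by (simp add: op_reg_def reg_const)

lemma op_reg_add: "op_reg r c \<Phi> \<Longrightarrow> op_reg r c \<Psi> \<Longrightarrow> op_reg r c (\<lambda>M. \<Phi> M + \<Psi> M)"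
  by (auto simp: op_reg_def intro: Hom_add reg_add)

lemma op_reg_mult:
  assumes "op_reg r m \<Phi>" "op_reg m c \<Psi>"
  shows "op_reg r c (\<lambda>M. \<Phi> M * \<Psi> M)"
  unfolding op_reg_def
proof (intro conjI ballI allI impI)
  show "\<Phi> M * \<Psi> M \<in> Hom r c" if "M \<in> X" for M using assms that by (auto simp: op_reg_def intro: Hom_mult)
  fix p q assume pq: "p < r" "q < c"
  show "reg (\<lambda>M. entry (\<Phi> M * \<Psi> M) p q)"
  proof (rule reg_cong)
    show "reg (\<lambda>M. \<Sum>s<m. entry (\<Phi> M) p s * entry (\<Psi> M) s q)"
      using assms pq by (intro reg_sum reg_mult) (auto simp: op_reg_def)
    show "(\<Sum>s<m. entry (\<Phi> M) p s * entry (\<Psi> M) s q) = entry (\<Phi> M * \<Psi> M) p q" if "M \<in> X" for M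
      by (rule entry_mult[OF op_reg_Hom[OF assms(1) that], symmetric])
  qed
qed

lemma op_reg_scal: "reg f \<Longrightarrow> op_reg r c \<Phi> \<Longrightarrow> op_reg r c (\<lambda>M. scal (f M) * \<Phi> M)"
  unfolding op_reg_def by (auto intro: Hom_scal reg_mult)

lemma op_reg_diff: "op_reg r c \<Phi> \<Longrightarrow> op_reg r c \<Psi> \<Longrightarrow> op_reg r c (\<lambda>M. \<Phi> M - \<Psi> M)"
proof -
  assume a: "op_reg r c \<Phi>" "op_reg r c \<Psi>"
  have "op_reg r c (\<lambda>M. \<Phi> M + scal (-1) * \<Psi> M)" by (intro op_reg_add op_reg_scal reg_const a)
  moreover have "scal (-1) * Z = - Z" for Z :: "'a lop" by (rule lop_eqI) (simp add: app_scal)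
  ultimately show ?thesis by simp
qed

lemma op_reg_sum: "(\<And>s. s \<in> S \<Longrightarrow> op_reg r c (\<Phi> s)) \<Longrightarrow> op_reg r c (\<lambda>M. \<Sum>s\<in>S. \<Phi> s M)"
  by (induction S rule: infinite_finite_induct) (auto intro: op_reg_const op_reg_add Hom_0)

lemma op_reg_pow_mult: "op_reg d d \<Phi> \<Longrightarrow> op_reg d c \<Psi> \<Longrightarrow> op_reg d c (\<lambda>M. \<Phi> M ^ t * \<Psi> M)"
  by (induction t) (auto simp: mult.assoc intro: op_reg_mult)

lemma op_reg_higman_left:
  assumes "op_reg d d \<Phi>" "Z \<in> Hom d e" "y \<in> Hom e e"
  shows "op_reg d e (\<lambda>M. higman m (\<Phi> M) Z y)"
  unfolding higman_def mult.assoc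
  by (intro op_reg_sum op_reg_pow_mult assms op_reg_const Hom_mult_pow)

lemma op_reg_higman_mid:
  assumes "op_reg d e \<Phi>" "x \<in> Hom d d" "y \<in> Hom e e"
  shows "op_reg d e (\<lambda>M. higman m x (\<Phi> M) y)"
proof (rule op_reg_cong)
  have xi: "x ^ t * idop d \<in> Hom d d" for t by (rule Hom_pow_mult[OF assms(2) Hom_idop])
  have yi: "idop e * y ^ t \<in> Hom e e" for t by (rule Hom_mult_pow[OF assms(3) Hom_idop])
  show "op_reg d e (\<lambda>M. \<Sum>t<m. (x ^ t * idop d) * (\<Phi> M * (idop e * y ^ (m - 1 - t))))"
    by (intro op_reg_sum op_reg_mult[OF op_reg_const[OF xi]] op_reg_mult[OF assms(1) op_reg_const[OF yi]])
  show "(\<Sum>t<m. (x ^ t * idop d) * (\<Phi> M * (idop e * y ^ (m - 1 - t)))) = higman m x (\<Phi> M) y" if "M \<in> X" for M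
    unfolding higman_def using op_reg_Hom[OF assms(1) that]
    by (simp add: mult.assoc Hom_leftA Hom_rightA)
qed

end

text \<open>Cramer's rule is used because the adjugate has polynomial entries, so that inverting a
  regular family gives a regular family.\<close>

definition inv_op :: "nat \<Rightarrow> 'a::field lop \<Rightarrow> 'a lop" where
  "inv_op d Z = scal (inverse (det (mat_of d d Z))) * mat_op (adj_mat (mat_of d d Z))"

lemma inv_op_Hom: "inv_op d Z \<in> Hom d d"
  unfolding inv_op_def by (intro Hom_scal mat_op_Hom adj_mat(1)) simp

lemma inv_op:
  assumes Z: "Z \<in> Hom d d" and nonzero_dim: "det (mat_of d d Z) \<noteq> 0"
  shows "Z * inv_op d Z = idop d" "inv_op d Z * Z = idop d"
proof -
  let ?A = "mat_of d d Z"
  have A: "?A \<in> carrier_mat d d" by simp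
  have sm: "mat_op (a \<cdot>\<^sub>m 1\<^sub>m d) = scal a * idop d" for a :: 'a
    by (rule Hom_eqI[OF mat_op_Hom Hom_scal[OF Hom_idop]]) (auto simp: entry_mat_op entry_idop)
  have "mat_op (?A * adj_mat ?A) = scal (det ?A) * idop d" unfolding adj_mat(2)[OF A] by (rule sm)
  then have 1: "Z * mat_op (adj_mat ?A) = scal (det ?A) * idop d"
    unfolding mat_op_mult[OF A adj_mat(1)[OF A]] mat_op_mat_of[OF Z] .
  have "mat_op (adj_mat ?A * ?A) = scal (det ?A) * idop d" unfolding adj_mat(3)[OF A] by (rule sm)
  then have 2: "mat_op (adj_mat ?A) * Z = scal (det ?A) * idop d"
    unfolding mat_op_mult[OF adj_mat(1)[OF A] A] mat_op_mat_of[OF Z] .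
  have inv: "scal (inverse (det ?A)) * (scal (det ?A) * idop d) = idop d"
    using nonzero_dim assoc_eq[OF scal_mult(1), of "inverse (det ?A)" "det ?A" "idop d"] by (simp add: scal_mult(2))
  show "Z * inv_op d Z = idop d" unfolding inv_op_def scal_left_comm[of Z] 1 by (rule inv)
  show "inv_op d Z * Z = idop d" unfolding inv_op_def mult.assoc 2 by (rule inv)
qed

lemma mat_of_idop: "mat_of d d (idop d) = 1\<^sub>m d"
  by (intro eq_matI) (auto simp: mat_of_def entry_idop)

context local_functions begin

lemma op_reg_reg_det: "op_reg d d \<Phi> \<Longrightarrow> reg (\<lambda>M. det (mat_of d d (\<Phi> M)))"
  by (rule reg_det[of _ d]) (auto simp: mat_of_def op_reg_def)

lemma op_reg_inv_op:
  assumes \<Phi>: "op_reg d d \<Phi>" and nonzero_dim: "det (mat_of d d (\<Phi> M0)) \<noteq> 0"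
  shows "op_reg d d (\<lambda>M. inv_op d (\<Phi> M))"
  unfolding inv_op_def
proof (intro op_reg_scal reg_inverse op_reg_reg_det \<Phi> nonzero_dim)
  let ?A = "\<lambda>M. mat_of d d (\<Phi> M)"
  show "op_reg d d (\<lambda>M. mat_op (adj_mat (?A M)))" unfolding op_reg_def
  proof (intro conjI ballI allI impI)
    show "mat_op (adj_mat (?A M)) \<in> Hom d d" for M by (intro mat_op_Hom adj_mat(1)) simp
    fix p q assume pq: "p < d" "q < d"
    have "reg (\<lambda>M. cofactor (?A M) q p)"
      unfolding cofactor_def
    proof (intro reg_mult reg_const reg_det[of _ "d - 1"])
      show "mat_delete (?A M) q p \<in> carrier_mat (d - 1) (d - 1)" for M by (simp add: mat_delete_def mat_of_def)
      fix i j assume "i < d - 1" "j < d - 1"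
      then have "(if i < q then i else Suc i) < d" "(if j < p then j else Suc j) < d" by auto
      then have "reg (\<lambda>M. entry (\<Phi> M) (if i < q then i else Suc i) (if j < p then j else Suc j))"
        using \<Phi> unfolding op_reg_def by blast
      then show "reg (\<lambda>M. mat_delete (?A M) q p $$ (i, j))"
        using \<open>i < d - 1\<close> \<open>j < d - 1\<close> by (simp add: mat_delete_def mat_of_def split: if_splits)
    qed
    then show "reg (\<lambda>M. entry (mat_op (adj_mat (?A M))) p q)"
      using pq by (simp add: entry_mat_op adj_mat_def mat_of_def)
  qed
qed

end

text \<open>Over a finite field the product of all [:- a, 1:], increased by 1, would have no
  root.\<close>

lemma infinite_alg_closed: "infinite (UNIV :: 'a::alg_closed_field set)"
proof
  assume fin: "finite (UNIV :: 'a set)"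
  define q :: "'a poly" where "q = (\<Prod>a\<in>UNIV. [:- a, 1:])"
  have "degree q = (\<Sum>a\<in>(UNIV :: 'a set). 1)" unfolding q_def
    by (subst degree_prod_eq_sum_degree) auto
  then have "degree q > 0" using fin by (simp add: card_gt_0_iff)
  then have "degree (q + 1) > 0" by (subst degree_add_eq_left) auto
  then obtain x where "poly (q + 1) x = 0" using alg_closed_imp_poly_has_root by blast
  moreover have "poly q x = 0" unfolding q_def poly_prod using fin by (intro prod_zero) auto
  ultimately show False by simp
qed

text \<open>J moves block t to block t + 1, and \<open>\<Theta>\<close> takes the last block back to
  the first; the t-th summand of the trace is then the projection onto block t.\<close>

lemma free_exists:
  assumes m: "m > 0"
  shows "\<exists>J\<in>Hom (m * r) (m * r). \<exists>\<Theta>\<in>Hom (m * r) (m * r). (J :: 'a::field lop) ^ m = 0 \<and> higman m J \<Theta> J = idop (m * r)"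
proof -
  obtain l where l: "m = Suc l" using m gr0_implies_Suc by blast
  define V W where "V t = (block_proj r t :: 'a lop)" and "W t = (block_incl r t :: 'a lop)" for t
  have VH: "V t \<in> Hom r (m * r)" and WH: "W t \<in> Hom (m * r) r" if "t < m" for t
    using that unfolding V_def W_def by (auto intro: block_proj_Hom block_incl_Hom)
  have VW: "V t * W u = (if u = t then idop r else 0)" for t u
    unfolding V_def W_def by (rule block_proj_block_incl)
  have VWA: "V t * (W u * Z) = (if u = t then idop r * Z else 0)" for t u Z
    using assoc_eq[OF VW, of t u Z] by simp
  have WV: "(\<Sum>t<m. W t * V t) = idop (m * r)" unfolding V_def W_def by (rule sum_block_incl_block_proj)
  define J where "J = (\<Sum>t<l. W (Suc t) * V t)"
  have JH: "J \<in> Hom (m * r) (m * r)" unfolding J_def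
    by (intro Hom_sum Hom_mult[OF WH VH]) (auto simp: l)
  have JW: "J * W t = (if t < l then W (Suc t) else 0)" for t
  proof -
    have "J * W t = (\<Sum>u<l. if u = t then W (Suc u) * idop r else 0)"
      unfolding J_def sum_distrib_right mult.assoc VW by (intro sum.cong) auto
    also have "\<dots> = (if t < l then W (Suc t) else 0)"
      using Hom_right[OF WH] by (auto simp: l)
    finally show ?thesis .
  qed
  have VJ: "V (Suc t) * J = V t" if "t < l" for t
  proof -
    have "V (Suc t) * J = (\<Sum>u<l. if u = t then idop r * V u else 0)"
      unfolding J_def sum_distrib_left VWA by (intro sum.cong) auto
    then show ?thesis using that Hom_left[OF VH, of t] by (simp add: l)
  qed
  have JpW: "J ^ j * W t = (if t + j \<le> l then W (t + j) else 0)" if "t \<le> l" for j t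
  proof (induction j)
    case (Suc j)
    have "J ^ Suc j * W t = J * (J ^ j * W t)" by (simp add: mult.assoc)
    also have "\<dots> = (if t + Suc j \<le> l then W (t + Suc j) else 0)" unfolding Suc by (auto simp: JW)
    finally show ?case .
  qed (use that in simp)
  have VJp: "V l * J ^ j = V (l - j)" if "j \<le> l" for j
    using that
  proof (induction j)
    case (Suc j)
    have "V l * J ^ Suc j = (V l * J ^ j) * J" by (simp only: power_Suc2 mult.assoc)
    also have "\<dots> = V (Suc (l - Suc j)) * J" using Suc by (simp add: Suc_diff_Suc)
    also have "\<dots> = V (l - Suc j)" using Suc.prems by (intro VJ) simp
    finally show ?case .
  qed simp
  define \<Theta> where "\<Theta> = W 0 * V l"
  have \<Theta>H: "\<Theta> \<in> Hom (m * r) (m * r)" unfolding \<Theta>_def by (intro Hom_mult[OF WH VH]) (auto simp: l)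
  have "higman m J \<Theta> J = (\<Sum>t<m. W t * V t)" unfolding higman_def
  proof (rule sum.cong[OF refl])
    fix t assume "t \<in> {..<m}"
    then have t: "t \<le> l" by (simp add: l)
    have "J ^ t * \<Theta> * J ^ (m - 1 - t) = (J ^ t * W 0) * (V l * J ^ (l - t))" by (simp add: \<Theta>_def l mult.assoc)
    then show "J ^ t * \<Theta> * J ^ (m - 1 - t) = W t * V t" using JpW[of 0 t] VJp[of "l - t"] t by simp
  qed
  moreover have "J ^ m = 0"
  proof -
    have "J ^ m = J ^ m * (\<Sum>t<m. W t * V t)" unfolding WV using Hom_right[OF Hom_pow[OF JH m]] by simp
    also have "\<dots> = (\<Sum>t<m. (J ^ m * W t) * V t)" by (simp add: sum_distrib_left mult.assoc)
    also have "\<dots> = 0" by (intro sum.neutral) (auto simp: JpW l simp del: power_Suc)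
    finally show ?thesis .
  qed
  ultimately show ?thesis using WV JH \<Theta>H by metis
qed

section \<open>Modules with prescribed loops\<close>

context quiver_relations begin

lemma loc_free_iso:
  assumes "iso d M N" "is_rep d N" "loc_free k d M"
  shows "loc_free k d N"
proof -
  obtain P Q where PQ: "hom d M d N P" "hom d N d M Q" "\<And>i. i < n \<Longrightarrow> P i * Q i = idop (d i)"
    "\<And>i. i < n \<Longrightarrow> Q i * P i = idop (d i)" using isoE[OF assms(1)] by blast
  have "biprod_by d M d N (\<lambda>_. 0) (\<lambda>_. 0) Q P (\<lambda>_. 0) (\<lambda>_. 0)"
    unfolding biprod_by_def using PQ assms(2) by (auto simp: idop_0 is_rep_def hom_def Hom_0)
  then show ?thesis by (rule loc_free_summand[OF assms(3)])
qed

lemma conj_iso: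
  assumes M: "is_rep d M" and g: "\<And>i. i < n \<Longrightarrow> g i \<in> Hom (d i) (d i)" "\<And>i. i < n \<Longrightarrow> g' i \<in> Hom (d i) (d i)"
    "\<And>i. i < n \<Longrightarrow> g i * g' i = idop (d i)" "\<And>i. i < n \<Longrightarrow> g' i * g i = idop (d i)"
  shows "is_rep d (\<lambda>a. g (tgt a) * M a * g' (src a))" "iso d M (\<lambda>a. g (tgt a) * M a * g' (src a))"
proof -
  show r: "is_rep d (\<lambda>a. g (tgt a) * M a * g' (src a))"
    unfolding is_rep_def
  proof
    fix a assume a: "a \<in> Ar"
    have "M a \<in> Hom (d (tgt a)) (d (src a))" using M a by (simp add: is_rep_def)
    then show "g (tgt a) * M a * g' (src a) \<in> Hom (d (tgt a)) (d (src a))"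
      by (rule Hom_mult[OF Hom_mult[OF g(1)[OF tgt_lt[OF a]]] g(2)[OF src_lt[OF a]]])
  qed
  show "iso d M (\<lambda>a. g (tgt a) * M a * g' (src a))"
  proof (rule isoI[OF _ g(2) g(3) g(4) M r])
    show "hom d M d (\<lambda>a. g (tgt a) * M a * g' (src a)) g" unfolding hom_def
    proof (intro conjI allI impI ballI g)
      fix a assume a: "a \<in> Ar"
      have "M a \<in> Hom (d (tgt a)) (d (src a))" using M a by (simp add: is_rep_def)
      then show "g (tgt a) * M a = g (tgt a) * M a * g' (src a) * g (src a)"
        using g(4)[OF src_lt[OF a]] Hom_right[of "M a" "d (tgt a)" "d (src a)"] by (simp add: mult.assoc)
    qed
  qed
qed

lemma conjugate_Eps:
  assumes M: "loc_free k d M" and N: "loc_free k d N" and k: "k \<ge> 1"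
  shows "\<exists>g g'. \<forall>i<n. g i \<in> Hom (d i) (d i) \<and> g' i \<in> Hom (d i) (d i) \<and> g i * g' i = idop (d i) \<and>
      g' i * g i = idop (d i) \<and> g i * M (Eps i) = N (Eps i) * g i"
proof -
  have "\<exists>g g'. g \<in> Hom (d i) (d i) \<and> g' \<in> Hom (d i) (d i) \<and> g * g' = idop (d i) \<and>
      g' * g = idop (d i) \<and> g * M (Eps i) = N (Eps i) * g" if i: "i < n" for i
  proof -
    obtain \<Theta> where \<Theta>: "\<Theta> \<in> Hom (d i) (d i)" "higman (k * c i) (M (Eps i)) \<Theta> (M (Eps i)) = idop (d i)"
      using M i by (auto simp: loc_free_def)
    obtain \<Phi> where \<Phi>: "\<Phi> \<in> Hom (d i) (d i)" "higman (k * c i) (N (Eps i)) \<Phi> (N (Eps i)) = idop (d i)"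
      using N i by (auto simp: loc_free_def)
    have nil: "M (Eps i) ^ (k * c i) = 0" "N (Eps i) ^ (k * c i) = 0"
      using loc_free_is_mod[OF M] loc_free_is_mod[OF N] i by (auto simp: is_mod_def)
    have "k * c i > 0" using k c_pos[OF i] by simp
    from free_iso[OF is_mod_Eps[OF loc_free_is_mod[OF M] i] \<Theta>(1) is_mod_Eps[OF loc_free_is_mod[OF N] i] \<Phi>(1) nil this \<Theta>(2) \<Phi>(2)]
    show ?thesis by blast
  qed
  then show ?thesis by metis
qed

text \<open>With fixed loops the relations are linear in the other arrows, so such modules form a
  linear space and differences are cocycles. \<open>loc_free_perturb\<close> is the
  converse.\<close>

lemma cocycle_diff:
  assumes "is_mod k d M" "is_mod k d N" "\<And>i. i < n \<Longrightarrow> N (Eps i) = M (Eps i)"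
  shows "cocycle d M (\<lambda>a. N a - M a)"
  unfolding cocycle_def
proof (intro conjI allI impI ballI)
  show "is_rep d (\<lambda>a. N a - M a)" using assms(1,2) by (auto simp: is_mod_def is_rep_def intro: Hom_diff)
  fix a assume a: "a \<in> Ar"
  show "M (Eps (tgt a)) ^ lx a * (N a - M a) = (N a - M a) * M (Eps (src a)) ^ rx a"
    using is_mod_rel[OF assms(1) a] is_mod_rel[OF assms(2) a] assms(3)[OF tgt_lt[OF a]] assms(3)[OF src_lt[OF a]]
    by (simp add: right_diff_distrib left_diff_distrib)
qed (use assms(3) in simp)

lemma cocycle_scal: "cocycle d M X \<Longrightarrow> cocycle d M (\<lambda>a. scal t * X a)"
  unfolding cocycle_def is_rep_def by (auto intro: Hom_scal simp: scal_left_comm mult.assoc)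

lemma loc_free_perturb:
  assumes M: "loc_free k d M" and X: "cocycle d M X"
  shows "loc_free k d (\<lambda>a. M a + X a)"
proof -
  have E: "M (Eps i) + X (Eps i) = M (Eps i)" if "i < n" for i using X that by (simp add: cocycle_def)
  have "is_rep d (\<lambda>a. M a + X a)" using loc_free_is_mod[OF M] X by (auto simp: is_mod_def cocycle_def is_rep_def intro: Hom_add)
  moreover have "M (Eps (tgt a)) ^ lx a * (M a + X a) = (M a + X a) * M (Eps (src a)) ^ rx a" if "a \<in> Ar" for a
    using is_mod_rel[OF loc_free_is_mod[OF M] that] X that by (simp add: cocycle_def distrib_left distrib_right)
  ultimately have "is_mod k d (\<lambda>a. M a + X a)"
    using loc_free_is_mod[OF M] E tgt_lt src_lt by (simp add: is_mod_def)
  then show ?thesis using M E by (simp add: loc_free_def)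
qed

text \<open>Unlike \<open>cocycle_lift\<close> this names the lift: the formula is linear in X and
  therefore depends regularly on parameters.\<close>

lemma cocycle_lift_explicit:
  assumes M: "loc_free k d M" and R: "reduces_by d M s N \<pi> \<rho> \<kappa>" and a: "a \<in> Ar"
    and \<Theta>: "\<Theta> \<in> Hom (d (src a)) (d (src a))"
      "higman m (M (Eps (src a)) ^ rx a) \<Theta> (M (Eps (src a)) ^ rx a) = idop (d (src a))"
      "(M (Eps (src a)) ^ rx a) ^ m = 0" "(M (Eps (tgt a)) ^ lx a) ^ m = 0"
    and X: "X \<in> Hom (s (tgt a)) (s (src a))" "N (Eps (tgt a)) ^ lx a * X = X * N (Eps (src a)) ^ rx a"
    and Y: "Y = higman m (M (Eps (tgt a)) ^ lx a) (\<rho> (tgt a) * X * \<pi> (src a) * \<Theta>) (M (Eps (src a)) ^ rx a)"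
  shows "Y \<in> Hom (d (tgt a)) (d (src a))" "\<pi> (tgt a) * Y = X * \<pi> (src a)"
    "M (Eps (tgt a)) ^ lx a * Y = Y * M (Eps (src a)) ^ rx a"
proof -
  note t = tgt_lt[OF a] and u = src_lt[OF a]
  note rt = reduces_by_D[OF R t] and ru = reduces_by_D[OF R u]
  have pos: "lx a > 0" "rx a > 0" using factor_pos c_factor a by blast+
  have x: "M (Eps (tgt a)) ^ lx a \<in> Hom (d (tgt a)) (d (tgt a))" "M (Eps (src a)) ^ rx a \<in> Hom (d (src a)) (d (src a))"
    using is_mod_Eps[OF loc_free_is_mod[OF M]] t u pos by (auto intro: Hom_pow)
  have D': "\<rho> (tgt a) * X * \<pi> (src a) \<in> Hom (d (tgt a)) (d (src a))"
    by (rule Hom_mult[OF Hom_mult[OF rt(2) X(1)] ru(1)])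
  show "Y \<in> Hom (d (tgt a)) (d (src a))" unfolding Y by (intro higman_Hom x Hom_mult[OF D' \<Theta>(1)])
  have D: "X * \<pi> (src a) * idop (d (src a)) = X * \<pi> (src a)" using Hom_right[OF Hom_mult[OF X(1) ru(1)]] .
  have Dx: "X * \<pi> (src a) * M (Eps (src a)) ^ rx a = N (Eps (tgt a)) ^ lx a * (X * \<pi> (src a))"
    using hom_pow[OF reduces_hom1[OF R] u] assoc_eq[OF X(2)] by (simp add: mult.assoc)
  have px: "\<pi> (tgt a) * M (Eps (tgt a)) ^ lx a = N (Eps (tgt a)) ^ lx a * \<pi> (tgt a)" by (rule hom_pow[OF reduces_hom1[OF R] t])
  have pD: "\<pi> (tgt a) * (\<rho> (tgt a) * X * \<pi> (src a)) = X * \<pi> (src a)"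
    using assoc_eq[OF rt(4)] Hom_leftA[OF X(1)] by (simp add: mult.assoc)
  note pr = higman_projective[OF \<Theta>(2) D Dx px pD \<Theta>(3,4)]
  show "\<pi> (tgt a) * Y = X * \<pi> (src a)" "M (Eps (tgt a)) ^ lx a * Y = Y * M (Eps (src a)) ^ rx a"
    unfolding Y using pr by auto
qed

lemma reduces_by_perturb:
  assumes R: "reduces_by d M s N \<pi> \<rho> \<kappa>" and X: "cocycle s N X" and Y: "cocycle d M Y"
    and XY: "\<And>a. a \<in> Ar \<Longrightarrow> \<pi> (tgt a) * Y a = X a * \<pi> (src a)"
  shows "reduces_by d (\<lambda>a. M a + Y a) s (\<lambda>a. N a + X a) \<pi> \<rho> \<kappa>"
  using R Y unfolding reduces_by_def hom_def cocycle_def by (auto simp: distrib_left distrib_right XY)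

lemma reduces_by_cong:
  assumes "\<And>i. i < n \<Longrightarrow> d i = d' i" "\<And>a. a \<in> Ar \<Longrightarrow> M a = M' a" "\<And>i. i < n \<Longrightarrow> s i = s' i" "\<And>a. a \<in> Ar \<Longrightarrow> N a = N' a"
  shows "reduces_by d M s N \<pi> \<rho> \<kappa> \<longleftrightarrow> reduces_by d' M' s' N' \<pi> \<rho> \<kappa>"
proof -
  have "hom d M s N \<pi> = hom d' M' s' N' \<pi>" by (rule hom_cong) (simp_all add: assms)
  then show ?thesis unfolding reduces_by_def using assms Eps_Ar by simp
qed

text \<open>The witnesses \<open>\<pi>\<close>, \<open>\<rho>\<close>, \<open>\<kappa>\<close>
  involve only the loops. For all modules with these loops one and the same linear formula computes
  the reduction.\<close>

lemma reduces_by_same_Eps: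
  assumes R: "reduces_by d M s N \<pi> \<rho> \<kappa>" and N: "loc_free 1 s N" and M': "is_mod k d M'" and E: "\<And>i. i < n \<Longrightarrow> M' (Eps i) = M (Eps i)"
  defines "N' \<equiv> \<lambda>a. \<pi> (tgt a) * M' a * \<rho> (src a)"
  shows "reduces_by d M' s N' \<pi> \<rho> \<kappa>" "loc_free 1 s N'" "\<And>i. i < n \<Longrightarrow> N' (Eps i) = N (Eps i)"
proof -
  note mN = loc_free_is_mod[OF N]
  have NE: "N' (Eps i) = N (Eps i)" if i: "i < n" for i
  proof -
    have "N' (Eps i) = (\<pi> i * M (Eps i)) * \<rho> i" unfolding N'_def by (simp add: E[OF i])
    also have "\<dots> = N (Eps i) * (\<pi> i * \<rho> i)" using hom_eq[OF reduces_hom1[OF R] Eps_Ar[OF i]] by (simp add: mult.assoc)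
    also have "\<dots> = N (Eps i)" unfolding reduces_by_D(4)[OF R i] by (rule Hom_right[OF is_mod_Eps[OF mN i]])
    finally show ?thesis .
  qed
  then show "\<And>i. i < n \<Longrightarrow> N' (Eps i) = N (Eps i)" .
  have H: "N' a \<in> Hom (s (tgt a)) (s (src a))" if "a \<in> Ar" for a
    unfolding N'_def by (rule Hom_mult[OF Hom_mult[OF reduces_by_D(1)[OF R tgt_lt[OF that]] is_mod_Hom[OF M' that]] reduces_by_D(2)[OF R src_lt[OF that]]])
  have h: "hom d M' s N' \<pi>" unfolding hom_def
  proof (intro conjI allI impI ballI)
    fix a assume a: "a \<in> Ar"
    note t = tgt_lt[OF a] and u = src_lt[OF a]
    have "M' a * M (Eps (src a)) ^ c (src a) = M (Eps (tgt a)) ^ c (tgt a) * M' a"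
      using is_mod_E[OF M' a] E[OF t] E[OF u] by simp
    then show "\<pi> (tgt a) * M' a = N' a * \<pi> (src a)"
      unfolding N'_def using reduces_factor[OF R mN R t u is_mod_Hom[OF M' a]] by simp
  qed (rule reduces_by_D(1)[OF R])
  show R': "reduces_by d M' s N' \<pi> \<rho> \<kappa>" using h R E unfolding reduces_by_def by simp
  have "N' (Eps (tgt a)) ^ lx a * N' a = N' a * N' (Eps (src a)) ^ rx a" if a: "a \<in> Ar" for a
  proof (rule reduces_cancel[OF R' src_lt[OF a]])
    note t = tgt_lt[OF a] and u = src_lt[OF a]
    have e: "N' (Eps (tgt a)) \<in> Hom (s (tgt a)) (s (tgt a))" "N' (Eps (src a)) \<in> Hom (s (src a)) (s (src a))"
      using H[OF Eps_Ar[OF t]] H[OF Eps_Ar[OF u]] by simp_all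
    show "N' (Eps (tgt a)) ^ lx a * N' a \<in> Hom (s (tgt a)) (s (src a))" by (rule Hom_pow_mult[OF e(1) H[OF a]])
    show "N' a * N' (Eps (src a)) ^ rx a \<in> Hom (s (tgt a)) (s (src a))" by (rule Hom_mult_pow[OF e(2) H[OF a]])
    have "N' (Eps (tgt a)) ^ lx a * N' a * \<pi> (src a) = \<pi> (tgt a) * (M' (Eps (tgt a)) ^ lx a * M' a)"
      using hom_powA[OF h t] hom_eq[OF h a] by (simp add: mult.assoc)
    also have "\<dots> = N' a * (N' (Eps (src a)) ^ rx a * \<pi> (src a))"
      unfolding is_mod_rel[OF M' a] using hom_eqA[OF h a] hom_pow[OF h u] by (simp add: mult.assoc)
    finally show "N' (Eps (tgt a)) ^ lx a * N' a * \<pi> (src a) = N' a * N' (Eps (src a)) ^ rx a * \<pi> (src a)"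
      by (simp add: mult.assoc)
  qed
  then have "is_mod 1 s N'" using mN NE H by (simp add: is_mod_def is_rep_def)
  then show "loc_free 1 s N'" using N NE by (simp add: loc_free_def)
qed

lemma reduces_by_ex:
  assumes M: "loc_free k d M" and k: "k \<ge> 1" and e: "\<And>i. i < n \<Longrightarrow> d i = k * e i"
  shows "\<exists>N \<pi> \<rho> \<kappa>. loc_free 1 e N \<and> reduces_by d M e N \<pi> \<rho> \<kappa>"
proof -
  obtain s N where N: "loc_free 1 s N" "reduces d M s N" "\<forall>i<n. d i = k * s i" using reduces_ex[OF M k] by blast
  have s: "s i = e i" if "i < n" for i using N(3) e[OF that] that k by auto
  obtain \<pi> \<rho> \<kappa> where R: "reduces_by d M s N \<pi> \<rho> \<kappa>" using N(2) by (auto simp: reduces_def)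
  have "loc_free 1 e N" using N(1) loc_free_cong[of s e N N 1] s by auto
  moreover have "reduces_by d M e N \<pi> \<rho> \<kappa>" using R reduces_by_cong[of d d M M s e N N] s by auto
  ultimately show ?thesis by blast
qed

end

context gls_algebra begin

section \<open>Generic representations\<close>

definition nearby :: "nat \<Rightarrow> nat vec \<Rightarrow> 'a::field rep \<Rightarrow> ('a rep \<Rightarrow> bool) \<Rightarrow> bool" where
  "nearby k r M0 Q \<longleftrightarrow> (\<exists>f\<in>polynomial_functions n C \<Omega> (dv k r). f M0 \<noteq> 0 \<and>
     (\<forall>M\<in>rep_lf n C (k \<cdot>\<^sub>m D) \<Omega> r. f M \<noteq> 0 \<longrightarrow> Q M))"

lemma local_functions_loc_free:
  "M0 \<in> rep_lf n C (k \<cdot>\<^sub>m D) \<Omega> r \<Longrightarrow>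
    local_functions (polynomial_functions n C \<Omega> (dv k r)) (rep_lf n C (k \<cdot>\<^sub>m D) \<Omega> r) M0"
  by unfold_locales (auto intro: polynomial_functions.intros)

lemma nearby_near:
  assumes "M0 \<in> rep_lf n C (k \<cdot>\<^sub>m D) \<Omega> r"
  shows "nearby k r M0 Q \<longleftrightarrow>
    local_functions.near (polynomial_functions n C \<Omega> (dv k r)) (rep_lf n C (k \<cdot>\<^sub>m D) \<Omega> r) M0 Q"
  unfolding nearby_def local_functions.near_def[OF local_functions_loc_free[OF assms]] ..

lemma to_rep_rep_ops: "M \<in> rep_space n C \<Omega> d \<Longrightarrow> to_rep d (rep_ops M) = M"
proof
  fix a assume M: "M \<in> rep_space n C \<Omega> d"
  show "to_rep d (rep_ops M) a = M a"
  proof (cases "a \<in> Ar")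
    case True
    have "to_rep d (rep_ops M) a = mat_of (d $ tgt a) (d $ src a) (mat_op (M a))"
      unfolding to_rep_def rep_ops_def using True by (rule restrict_apply')
    also have "\<dots> = M a" by (rule mat_of_mat_op[OF rep_space_carrier[OF M True]])
    finally show ?thesis .
  next
    case False
    have "M a = undefined" using M False unfolding rep_space_def by (rule PiE_arb)
    moreover have "to_rep d (rep_ops M) a = undefined" unfolding to_rep_def restrict_def using False by (rule if_not_P)
    ultimately show ?thesis by simp
  qed
qed

lemma to_rep_cong: "(\<And>a. a \<in> Ar \<Longrightarrow> A a = B a) \<Longrightarrow> to_rep d A = to_rep d B"
  by (auto simp: to_rep_def fun_eq_iff)

lemma to_rep_lf:
  assumes "k \<ge> 1" "loc_free k (\<lambda>i. dv k r $ i) A"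
  shows "to_rep (dv k r) A \<in> rep_lf n C (k \<cdot>\<^sub>m D) \<Omega> r" "\<And>a. a \<in> Ar \<Longrightarrow> rep_ops (to_rep (dv k r) A) a = A a"
proof -
  show l: "rep_ops (to_rep (dv k r) A) a = A a" if "a \<in> Ar" for a
    by (rule rep_ops_to_rep[where A = A and d = "dv k r", OF that is_mod_Hom[OF loc_free_is_mod[OF assms(2)] that]])
  show "to_rep (dv k r) A \<in> rep_lf n C (k \<cdot>\<^sub>m D) \<Omega> r"
    unfolding rep_lf_iff[OF assms(1)]
    using to_rep_space assms(2) loc_free_cong[of "\<lambda>i. dv k r $ i" "\<lambda>i. dv k r $ i" "rep_ops (to_rep (dv k r) A)" A k] l by auto
qed

lemma rep_lfD:
  assumes "k \<ge> 1" "M \<in> rep_lf n C (k \<cdot>\<^sub>m D) \<Omega> r"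
  shows "M \<in> rep_space n C \<Omega> (dv k r)" "loc_free k (\<lambda>i. dv k r $ i) (rep_ops M)" "is_rep (\<lambda>i. dv k r $ i) (rep_ops M)"
proof -
  show "M \<in> rep_space n C \<Omega> (dv k r)" and l: "loc_free k (\<lambda>i. dv k r $ i) (rep_ops M)"
    using assms(2) rep_lf_iff[OF assms(1)] by auto
  show "is_rep (\<lambda>i. dv k r $ i) (rep_ops M)" by (rule is_mod_is_rep[OF loc_free_is_mod[OF l]])
qed

lemma op_reg_rep_ops:
  assumes "k \<ge> 1" and M0: "M0 \<in> rep_lf n C (k \<cdot>\<^sub>m D) \<Omega> r" and a: "a \<in> Ar"
  shows "local_functions.op_reg (polynomial_functions n C \<Omega> (dv k r)) (rep_lf n C (k \<cdot>\<^sub>m D) \<Omega> r) M0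
      (dv k r $ tgt a) (dv k r $ src a) (\<lambda>M. rep_ops M a)"
proof -
  interpret local_functions "polynomial_functions n C \<Omega> (dv k r)" "rep_lf n C (k \<cdot>\<^sub>m D) \<Omega> r" M0
    by (rule local_functions_loc_free[OF M0])
  show ?thesis unfolding op_reg_def
  proof (intro conjI ballI allI impI)
    show "rep_ops M a \<in> Hom (dv k r $ tgt a) (dv k r $ src a)" if "M \<in> rep_lf n C (k \<cdot>\<^sub>m D) \<Omega> r" for M
      using rep_lfD(3)[OF assms(1) that] a by (simp add: is_rep_def)
    fix p q assume pq: "p < dv k r $ tgt a" "q < dv k r $ src a"
    show "reg (\<lambda>M. entry (rep_ops M a) p q)"
    proof (rule reg_cong[OF reg_P[OF polynomial_functions.coord[OF a pq]]])
      fix M assume "M \<in> rep_lf n C (k \<cdot>\<^sub>m D) \<Omega> r"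
      from rep_space_carrier[OF rep_lfD(1)[OF assms(1) this] a]
      show "M a $$ (p, q) = entry (rep_ops M a) p q" using pq by (auto simp: rep_ops_def entry_mat_op)
    qed
  qed
qed

text \<open>Pulling back a polynomial along a family of representations with regular entries gives a
  regular function.\<close>

lemma reg_substitute:
  assumes L: "local_functions P X M0" and f: "f \<in> polynomial_functions n C \<Omega> d"
    and A: "\<And>a. a \<in> Ar \<Longrightarrow> local_functions.op_reg P X M0 (d $ tgt a) (d $ src a) (\<lambda>M. A M a)"
  shows "local_functions.reg P X M0 (\<lambda>M. f (to_rep d (A M)))"
proof -
  interpret local_functions P X M0 by (rule L)
  show ?thesis using f
  proof induction
    case (coord a p q)
    then have "reg (\<lambda>M. entry (A M a) p q)" using A[OF coord(1)] by (simp add: op_reg_def)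
    then show ?case using coord by (simp add: to_rep_def mat_of_def)
  qed (auto intro: reg_const reg_add reg_mult)
qed

text \<open>Near \<open>M0\<close> every module can be conjugated so that its loops become those of
  \<open>M0\<close>, with entries depending rationally on the module and nothing changed at
  \<open>M0\<close> itself.\<close>

lemma normal_form:
  assumes k: "k \<ge> 1" and M0: "M0 \<in> rep_lf n C (k \<cdot>\<^sub>m D) \<Omega> r"
  shows "\<exists>\<Phi>. (\<forall>a\<in>Ar. local_functions.op_reg (polynomial_functions n C \<Omega> (dv k r)) (rep_lf n C (k \<cdot>\<^sub>m D) \<Omega> r) M0
      (dv k r $ tgt a) (dv k r $ src a) (\<lambda>M. \<Phi> M a)) \<and> (\<forall>a\<in>Ar. \<Phi> M0 a = rep_ops M0 a) \<and>
    nearby k r M0 (\<lambda>M. (\<forall>i<n. \<Phi> M (Eps i) = rep_ops M0 (Eps i)) \<and> is_rep (\<lambda>i. dv k r $ i) (\<Phi> M) \<and> iso (\<lambda>i. dv k r $ i) (rep_ops M) (\<Phi> M))"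
proof -
  let ?d = "\<lambda>i. dv k r $ i" and ?X = "rep_lf n C (k \<cdot>\<^sub>m D) \<Omega> r"
  interpret local_functions "polynomial_functions n C \<Omega> (dv k r)" ?X M0
    by (rule local_functions_loc_free[OF M0])
  define x where "x M i = rep_ops M (Eps i)" for M :: "'a rep" and i
  have lfM: "loc_free k ?d (rep_ops M)" if "M \<in> ?X" for M using rep_lfD(2)[OF k that] .
  have xH: "x M i \<in> Hom (?d i) (?d i)" if "M \<in> ?X" "i < n" for M i
    unfolding x_def using is_mod_Eps[OF loc_free_is_mod[OF lfM[OF that(1)]] that(2)] .
  have nil: "x M i ^ (k * D $$ (i,i)) = 0" if "M \<in> ?X" "i < n" for M i
    using loc_free_is_mod[OF lfM[OF that(1)]] that(2) by (simp add: is_mod_def x_def)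
  have "\<forall>i. \<exists>\<Theta>. i < n \<longrightarrow> \<Theta> \<in> Hom (?d i) (?d i) \<and> higman (k * D $$ (i,i)) (x M0 i) \<Theta> (x M0 i) = idop (?d i)"
    using lfM[OF M0] unfolding loc_free_def x_def by blast
  then obtain \<Theta> where \<Theta>: "\<And>i. i < n \<Longrightarrow> \<Theta> i \<in> Hom (?d i) (?d i)"
    "\<And>i. i < n \<Longrightarrow> higman (k * D $$ (i,i)) (x M0 i) (\<Theta> i) (x M0 i) = idop (?d i)" by metis
  \<comment> \<open>The trace of \<open>\<Theta>\<close> taken between the loop of M and the loop of
    \<open>M0\<close>. It intertwines the two, depends polynomially on M and is the identity at
    \<open>M0\<close>, so it is invertible nearby.\<close>
  define g where "g M i = higman (k * D $$ (i,i)) (x M i) (\<Theta> i) (x M0 i)" for M i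
  define h where "h M i = inv_op (?d i) (g M i)" for M i
  define \<Phi> where "\<Phi> M a = h M (tgt a) * rep_ops M a * g M (src a)" for M a
  have gH: "g M i \<in> Hom (?d i) (?d i)" if "M \<in> ?X" "i < n" for M i
    unfolding g_def by (rule higman_Hom[OF xH[OF that] xH[OF M0 that(2)] \<Theta>(1)[OF that(2)]])
  have hH: "h M i \<in> Hom (?d i) (?d i)" for M i unfolding h_def by (rule inv_op_Hom)
  have greg: "op_reg (?d i) (?d i) (\<lambda>M. g M i)" if i: "i < n" for i
    unfolding g_def x_def using op_reg_rep_ops[OF k M0 Eps_Ar[OF i]]
    by (intro op_reg_higman_left) (use \<Theta>(1)[OF i] xH[OF M0 i] in \<open>auto simp: x_def\<close>)
  have g0: "g M0 i = idop (?d i)" if "i < n" for i unfolding g_def by (rule \<Theta>(2)[OF that])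
  have det0: "det (mat_of (?d i) (?d i) (g M0 i)) \<noteq> 0" if "i < n" for i
    unfolding g0[OF that] mat_of_idop by simp
  have hreg: "op_reg (?d i) (?d i) (\<lambda>M. h M i)" if i: "i < n" for i
    unfolding h_def by (rule op_reg_inv_op[OF greg[OF i] det0[OF i]])
  have \<Phi>reg: "op_reg (?d (tgt a)) (?d (src a)) (\<lambda>M. \<Phi> M a)" if a: "a \<in> Ar" for a
    unfolding \<Phi>_def by (rule op_reg_mult[OF op_reg_mult[OF hreg[OF tgt_lt[OF a]] op_reg_rep_ops[OF k M0 a]] greg[OF src_lt[OF a]]])
  have h0: "h M0 i = idop (?d i)" if "i < n" for i
    using inv_op(1)[OF gH[OF M0 that] det0[OF that]] Hom_left[OF inv_op_Hom[of "?d i" "idop (?d i)"]]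
    unfolding h_def g0[OF that] by metis
  have \<Phi>0: "\<Phi> M0 a = rep_ops M0 a" if a: "a \<in> Ar" for a
    unfolding \<Phi>_def h0[OF tgt_lt[OF a]] g0[OF src_lt[OF a]]
    using op_reg_Hom[OF op_reg_rep_ops[OF k M0 a] M0] by (simp add: Hom_left Hom_right)
  have "near (\<lambda>M. \<forall>i<n. det (mat_of (?d i) (?d i) (g M i)) \<noteq> 0)"
    by (intro near_all reg_near_nonzero_dim op_reg_reg_det greg det0)
  then have "near (\<lambda>M. (\<forall>i<n. \<Phi> M (Eps i) = rep_ops M0 (Eps i)) \<and> is_rep ?d (\<Phi> M) \<and> iso ?d (rep_ops M) (\<Phi> M))"
  proof (rule near_mono)
    fix M assume M: "M \<in> ?X" and "\<forall>i<n. det (mat_of (?d i) (?d i) (g M i)) \<noteq> 0"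
    then have inv: "g M i * h M i = idop (?d i)" "h M i * g M i = idop (?d i)" if "i < n" for i
      unfolding h_def using inv_op[OF gH[OF M that]] that by auto
    have "\<Phi> M (Eps i) = rep_ops M0 (Eps i)" if i: "i < n" for i
    proof -
      have "x M i * g M i = g M i * x M0 i"
        unfolding g_def using higman_intertwine[of "x M i" "k * D $$ (i,i)" "\<Theta> i" "x M0 i"] nil[OF M i] nil[OF M0 i] by simp
      then have "\<Phi> M (Eps i) = h M i * (g M i * x M0 i)" by (simp add: \<Phi>_def x_def mult.assoc)
      also have "\<dots> = x M0 i" using assoc_eq[OF inv(2)[OF i]] Hom_left[OF xH[OF M0 i]] by simp
      finally show ?thesis by (simp add: x_def)
    qed
    moreover note conj_iso[OF rep_lfD(3)[OF k M], of "h M" "g M", OF hH gH[OF M] inv(2) inv(1), folded \<Phi>_def]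
    ultimately show "(\<forall>i<n. \<Phi> M (Eps i) = rep_ops M0 (Eps i)) \<and> is_rep ?d (\<Phi> M) \<and> iso ?d (rep_ops M) (\<Phi> M)"
      unfolding \<Phi>_def by blast
  qed
  then show ?thesis using \<Phi>reg \<Phi>0 nearby_near[OF M0] by blast
qed

lemma rep_lf_nonempty:
  assumes k: "k \<ge> 1"
  shows "\<exists>M :: 'a::field rep. M \<in> rep_lf n C (k \<cdot>\<^sub>m D) \<Omega> r"
proof -
  have "\<exists>J\<in>Hom (dv k r $ i) (dv k r $ i). \<exists>\<Theta>\<in>Hom (dv k r $ i) (dv k r $ i).
      (J :: 'a lop) ^ (k * D $$ (i,i)) = 0 \<and> higman (k * D $$ (i,i)) J \<Theta> J = idop (dv k r $ i)" if i: "i < n" for i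
    using free_exists[of "k * D $$ (i,i)" "r $ i"] k D_pos[OF i] dv_index[OF i] by (simp add: mult.assoc)
  then obtain J where J: "\<And>i. i < n \<Longrightarrow> J i \<in> Hom (dv k r $ i) (dv k r $ i)" "\<And>i. i < n \<Longrightarrow> (J i :: 'a lop) ^ (k * D $$ (i,i)) = 0"
    "\<And>i. i < n \<Longrightarrow> \<exists>\<Theta>\<in>Hom (dv k r $ i) (dv k r $ i). higman (k * D $$ (i,i)) (J i) \<Theta> (J i) = idop (dv k r $ i)"
    by metis
  define A where "A a = (case a of Eps i \<Rightarrow> J i | Alpha i j g \<Rightarrow> 0)" for a
  have "is_rep (\<lambda>i. dv k r $ i) A" unfolding is_rep_def
  proof
    fix a assume "a \<in> Ar"
    then show "A a \<in> Hom (dv k r $ tgt a) (dv k r $ src a)"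
      using J(1) tgt_lt[of a] by (cases a) (auto simp: A_def Hom_0)
  qed
  moreover have "A (Eps (tgt a)) ^ left_exp C a * A a = A a * A (Eps (src a)) ^ right_exp C a" for a
    by (cases a) (simp_all add: A_def)
  ultimately have "loc_free k (\<lambda>i. dv k r $ i) A" using J(2,3) by (simp add: loc_free_def is_mod_def A_def)
  then show ?thesis using to_rep_lf(1)[OF k] by blast
qed

section \<open>Transfer of open sets between k and 1\<close>

lemma dv_one: "i < n \<Longrightarrow> dv k r $ i = k * dv 1 r $ i"
  by (simp add: dv_index)

text \<open>A local section of reduction. Let L be the reduction of \<open>M0\<close>; for N in
  normal form the cocycle \<open>\<Phi> N - L\<close> is lifted linearly to \<open>Y N\<close>, and
  \<open>A N\<close>, which is \<open>M0\<close> plus \<open>Y N\<close>, reduces to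
  \<open>\<Phi> N\<close>. Since \<open>A N0\<close> is \<open>M0\<close>, the function f is nonzero
  at \<open>A N\<close> for N near \<open>N0\<close>.\<close>

lemma transfer_down:
  fixes M0 :: "'a::field rep"
  assumes k: "k \<ge> 1" and hM0: "M0 \<in> rep_lf n C (k \<cdot>\<^sub>m D) \<Omega> r"
    and f: "f \<in> polynomial_functions n C \<Omega> (dv k r)" "f M0 \<noteq> 0"
  shows "\<exists>N0\<in>rep_lf n C (1 \<cdot>\<^sub>m D) \<Omega> r. nearby 1 r N0 (\<lambda>N. \<exists>M\<in>rep_lf n C (k \<cdot>\<^sub>m D) \<Omega> r. f M \<noteq> 0 \<and>
     reduces (\<lambda>i. dv k r $ i) (rep_ops M) (\<lambda>i. dv 1 r $ i) (rep_ops N))"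
proof -
  let ?d = "\<lambda>i. dv k r $ i" and ?s = "\<lambda>i. dv 1 r $ i"
  let ?M = "rep_ops M0"
  note lM = rep_lfD(2)[OF k hM0]
  obtain L \<pi> \<rho> \<kappa> where L: "loc_free 1 ?s L" and R: "reduces_by ?d ?M ?s L \<pi> \<rho> \<kappa>"
    using reduces_by_ex[OF lM k dv_one] by blast
  define N0 where "N0 = to_rep (dv 1 r) L"
  have N0: "N0 \<in> rep_lf n C (1 \<cdot>\<^sub>m D) \<Omega> r" and lN0: "\<And>a. a \<in> Ar \<Longrightarrow> rep_ops N0 a = L a"
    unfolding N0_def using to_rep_lf[of 1 r L] L by auto
  let ?P = "polynomial_functions n C \<Omega> (dv 1 r)" and ?X = "rep_lf n C (1 \<cdot>\<^sub>m D) \<Omega> r"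
  interpret local_functions ?P ?X N0 by (rule local_functions_loc_free[OF N0])
  obtain \<Phi> where \<Phi>: "\<And>a. a \<in> Ar \<Longrightarrow> op_reg (?s (tgt a)) (?s (src a)) (\<lambda>M. \<Phi> M a)" "\<And>a. a \<in> Ar \<Longrightarrow> \<Phi> N0 a = rep_ops N0 a"
    "near (\<lambda>M. (\<forall>i<n. \<Phi> M (Eps i) = rep_ops N0 (Eps i)) \<and> is_rep ?s (\<Phi> M) \<and> iso ?s (rep_ops M) (\<Phi> M))"
    using normal_form[OF le_refl N0] nearby_near[OF N0] by blast
  have "\<forall>a. \<exists>m \<Theta>. a \<in> Ar \<longrightarrow> \<Theta> \<in> Hom (?d (src a)) (?d (src a)) \<and>
      higman m (?M (Eps (src a)) ^ right_exp C a) \<Theta> (?M (Eps (src a)) ^ right_exp C a) = idop (?d (src a)) \<and>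
      (?M (Eps (src a)) ^ right_exp C a) ^ m = 0 \<and> (?M (Eps (tgt a)) ^ left_exp C a) ^ m = 0"
    using loc_free_arrow_higman[OF lM] by blast
  then obtain m \<Theta> where "\<forall>a. a \<in> Ar \<longrightarrow> \<Theta> a \<in> Hom (?d (src a)) (?d (src a)) \<and>
      higman (m a) (?M (Eps (src a)) ^ right_exp C a) (\<Theta> a) (?M (Eps (src a)) ^ right_exp C a) = idop (?d (src a)) \<and>
      (?M (Eps (src a)) ^ right_exp C a) ^ m a = 0 \<and> (?M (Eps (tgt a)) ^ left_exp C a) ^ m a = 0"
    by metis
  then have \<Theta>: "\<Theta> a \<in> Hom (?d (src a)) (?d (src a))"
      "higman (m a) (?M (Eps (src a)) ^ right_exp C a) (\<Theta> a) (?M (Eps (src a)) ^ right_exp C a) = idop (?d (src a))"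
      "(?M (Eps (src a)) ^ right_exp C a) ^ m a = 0" "(?M (Eps (tgt a)) ^ left_exp C a) ^ m a = 0" if "a \<in> Ar" for a
    using that by auto
  define \<Delta> where "\<Delta> N a = \<Phi> N a - L a" for N a
  define Y where "Y N a = higman (m a) (?M (Eps (tgt a)) ^ left_exp C a) (\<rho> (tgt a) * \<Delta> N a * \<pi> (src a) * \<Theta> a) (?M (Eps (src a)) ^ right_exp C a)" for N a
  define A where "A N a = ?M a + Y N a" for N a
  have Areg: "op_reg (?d (tgt a)) (?d (src a)) (\<lambda>N. A N a)" if a: "a \<in> Ar" for a
  proof -
    note t = tgt_lt[OF a] and u = src_lt[OF a]
    have pos: "left_exp C a > 0" "right_exp C a > 0" using factor_pos c_factor a by blast+
    have x: "?M (Eps (tgt a)) ^ left_exp C a \<in> Hom (?d (tgt a)) (?d (tgt a))" "?M (Eps (src a)) ^ right_exp C a \<in> Hom (?d (src a)) (?d (src a))"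
      using is_mod_Eps[OF loc_free_is_mod[OF lM]] t u pos by (auto intro: Hom_pow)
    have "op_reg (?s (tgt a)) (?s (src a)) (\<lambda>N. \<Delta> N a)" unfolding \<Delta>_def
      by (rule op_reg_diff[OF \<Phi>(1)[OF a] op_reg_const[OF is_mod_Hom[OF loc_free_is_mod[OF L] a]]])
    then have "op_reg (?d (tgt a)) (?d (src a)) (\<lambda>N. Y N a)" unfolding Y_def
      by (intro op_reg_higman_mid x op_reg_mult[OF op_reg_mult[OF op_reg_mult[OF op_reg_const[OF reduces_by_D(2)[OF R t]]] op_reg_const[OF reduces_by_D(1)[OF R u]]] op_reg_const[OF \<Theta>(1)[OF a]]])
    then show ?thesis unfolding A_def
      by (rule op_reg_add[OF op_reg_const[OF is_mod_Hom[OF loc_free_is_mod[OF lM] a]]])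
  qed
  have hg0: "higman j x 0 y = 0" for j and x y :: "'a lop" by (simp add: higman_def)
  have "Y N0 a = 0" if "a \<in> Ar" for a
    using \<Phi>(2)[OF that] lN0[OF that] by (simp add: Y_def \<Delta>_def hg0)
  then have "to_rep (dv k r) (A N0) = to_rep (dv k r) ?M" by (intro to_rep_cong) (simp add: A_def)
  then have "f (to_rep (dv k r) (A N0)) \<noteq> 0" using to_rep_rep_ops[OF rep_lfD(1)[OF k hM0]] f(2) by simp
  then have "near (\<lambda>N. f (to_rep (dv k r) (A N)) \<noteq> 0)"
    by (intro reg_near_nonzero_dim reg_substitute[OF local_functions_axioms f(1)] Areg)
  from near_conj[OF this \<Phi>(3)]
  have "near (\<lambda>N. \<exists>M\<in>rep_lf n C (k \<cdot>\<^sub>m D) \<Omega> r. f M \<noteq> 0 \<and> reduces ?d (rep_ops M) ?s (rep_ops N))"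
  proof (rule near_mono, elim conjE)
    fix N assume N: "N \<in> ?X" and fN: "f (to_rep (dv k r) (A N)) \<noteq> 0" and E: "\<forall>i<n. \<Phi> N (Eps i) = rep_ops N0 (Eps i)"
      and rN: "is_rep ?s (\<Phi> N)" and iN: "iso ?s (rep_ops N) (\<Phi> N)"
    have lN: "loc_free 1 ?s (\<Phi> N)" by (rule loc_free_iso[OF iN rN rep_lfD(2)[OF le_refl N]])
    have \<Delta>c: "cocycle ?s L (\<Delta> N)" unfolding \<Delta>_def
      by (rule cocycle_diff[OF loc_free_is_mod[OF L] loc_free_is_mod[OF lN]]) (use E lN0 Eps_Ar in auto)
    have Ya: "Y N a \<in> Hom (?d (tgt a)) (?d (src a))" "\<pi> (tgt a) * Y N a = \<Delta> N a * \<pi> (src a)"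
        "?M (Eps (tgt a)) ^ left_exp C a * Y N a = Y N a * ?M (Eps (src a)) ^ right_exp C a" if a: "a \<in> Ar" for a
    proof -
      have X: "\<Delta> N a \<in> Hom (?s (tgt a)) (?s (src a))" "L (Eps (tgt a)) ^ left_exp C a * \<Delta> N a = \<Delta> N a * L (Eps (src a)) ^ right_exp C a"
        using \<Delta>c a by (auto simp: cocycle_def is_rep_def)
      note cl = cocycle_lift_explicit[OF lM R a \<Theta>[OF a] X refl]
      show "Y N a \<in> Hom (?d (tgt a)) (?d (src a))" "\<pi> (tgt a) * Y N a = \<Delta> N a * \<pi> (src a)"
        "?M (Eps (tgt a)) ^ left_exp C a * Y N a = Y N a * ?M (Eps (src a)) ^ right_exp C a"
        unfolding Y_def by (rule cl)+
    qed
    have "Y N (Eps i) = 0" if i: "i < n" for i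
    proof -
      have "\<Delta> N (Eps i) = 0" using \<Delta>c i by (simp add: cocycle_def)
      then show ?thesis by (simp add: Y_def hg0)
    qed
    then have Yc: "cocycle ?d ?M (Y N)" unfolding cocycle_def is_rep_def using Ya by auto
    have lA: "loc_free k ?d (A N)" unfolding A_def by (rule loc_free_perturb[OF lM Yc])
    have "reduces_by ?d (A N) ?s (\<lambda>a. L a + \<Delta> N a) \<pi> \<rho> \<kappa>"
      unfolding A_def by (rule reduces_by_perturb[OF R \<Delta>c Yc Ya(2)])
    then have RA: "reduces_by ?d (A N) ?s (\<Phi> N) \<pi> \<rho> \<kappa>" by (simp add: \<Delta>_def)
    define M where "M = to_rep (dv k r) (A N)"
    have M: "M \<in> rep_lf n C (k \<cdot>\<^sub>m D) \<Omega> r" "\<And>a. a \<in> Ar \<Longrightarrow> rep_ops M a = A N a"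
      unfolding M_def using to_rep_lf[OF k lA] by auto
    have "reduces_by ?d (rep_ops M) ?s (\<Phi> N) \<pi> \<rho> \<kappa>"
      using RA reduces_by_cong[of ?d ?d "rep_ops M" "A N" ?s ?s "\<Phi> N" "\<Phi> N"] M(2) by auto
    then have "reduces ?d (rep_ops M) ?s (rep_ops N)" using reduces_iso[OF _ iso_sym[OF iN]] unfolding reduces_def by blast
    then show "\<exists>M\<in>rep_lf n C (k \<cdot>\<^sub>m D) \<Omega> r. f M \<noteq> 0 \<and> reduces ?d (rep_ops M) ?s (rep_ops N)"
      using M(1) fN unfolding M_def[symmetric] by blast
  qed
  then show ?thesis using N0 nearby_near[OF N0] by blast
qed

text \<open>Reduction made regular near one module: a lift \<open>M0\<close> of a copy of
  \<open>N0\<close> is built, modules near it are brought to its loops, and then the fixed linear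
  reduction formula applies.\<close>

lemma transfer_up:
  fixes N0 :: "'a::field rep"
  assumes k: "k \<ge> 1" and N0: "N0 \<in> rep_lf n C (1 \<cdot>\<^sub>m D) \<Omega> r"
    and f: "f \<in> polynomial_functions n C \<Omega> (dv 1 r)" "f N0 \<noteq> 0"
  shows "\<exists>M0\<in>rep_lf n C (k \<cdot>\<^sub>m D) \<Omega> r. nearby k r M0 (\<lambda>M. \<exists>N\<in>rep_lf n C (1 \<cdot>\<^sub>m D) \<Omega> r. f N \<noteq> 0 \<and>
     reduces (\<lambda>i. dv k r $ i) (rep_ops M) (\<lambda>i. dv 1 r $ i) (rep_ops N))"
proof -
  let ?d = "\<lambda>i. dv k r $ i" and ?s = "\<lambda>i. dv 1 r $ i"
  obtain M1 :: "'a rep" where M1: "M1 \<in> rep_lf n C (k \<cdot>\<^sub>m D) \<Omega> r" using rep_lf_nonempty[OF k] by blast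
  note l1 = rep_lfD(2)[OF k M1] and lN0 = rep_lfD(2)[OF le_refl N0] and rN0 = rep_lfD(3)[OF le_refl N0]
  obtain L \<pi> \<rho> \<kappa> where L: "loc_free 1 ?s L" and R: "reduces_by ?d (rep_ops M1) ?s L \<pi> \<rho> \<kappa>"
    using reduces_by_ex[OF l1 k dv_one] by blast
  \<comment> \<open>\<open>N0\<close> is not assumed to be the reduction of \<open>M1\<close>.
    Conjugation by g gives it the loops of L, and lifting the difference of the arrows modifies
    \<open>M1\<close> into a lift of it.\<close>
  obtain g g' where "\<forall>i<n. g i \<in> Hom (?s i) (?s i) \<and> g' i \<in> Hom (?s i) (?s i) \<and> g i * g' i = idop (?s i) \<and>
      g' i * g i = idop (?s i) \<and> g i * rep_ops N0 (Eps i) = L (Eps i) * g i"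
    using conjugate_Eps[OF lN0 L le_refl] by blast
  then have g: "g i \<in> Hom (?s i) (?s i)" "g' i \<in> Hom (?s i) (?s i)" "g i * g' i = idop (?s i)" "g' i * g i = idop (?s i)"
    "g i * rep_ops N0 (Eps i) = L (Eps i) * g i" if "i < n" for i using that by auto
  define L' where "L' a = g (tgt a) * rep_ops N0 a * g' (src a)" for a
  note ci = conj_iso[OF rN0 g(1,2,3,4), folded L'_def]
  have L': "loc_free 1 ?s L'" unfolding L'_def by (rule loc_free_iso[OF conj_iso(2,1)[OF rN0 g(1,2,3,4)] lN0])
  have LE: "L' (Eps i) = L (Eps i)" if i: "i < n" for i
  proof -
    have "L' (Eps i) = L (Eps i) * (g i * g' i)" unfolding L'_def using g(5)[OF i] by (simp add: mult.assoc[symmetric])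
    then show ?thesis using g(3)[OF i] Hom_right[OF is_mod_Eps[OF loc_free_is_mod[OF L] i]] by simp
  qed
  have X: "cocycle ?s L (\<lambda>a. L' a - L a)" by (rule cocycle_diff[OF loc_free_is_mod[OF L] loc_free_is_mod[OF L'] LE])
  have "\<exists>Y. Y \<in> Hom (?d (tgt a)) (?d (src a)) \<and> \<pi> (tgt a) * Y = (L' a - L a) * \<pi> (src a) \<and>
      rep_ops M1 (Eps (tgt a)) ^ left_exp C a * Y = Y * rep_ops M1 (Eps (src a)) ^ right_exp C a \<and> (L' a - L a = 0 \<longrightarrow> Y = 0)" if a: "a \<in> Ar" for a
  proof (cases "L' a - L a = 0")
    case True then show ?thesis by (intro exI[of _ 0]) (simp add: Hom_0)
  next
    case False
    obtain m \<Theta> where \<Theta>: "\<Theta> \<in> Hom (?d (src a)) (?d (src a))"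
      "higman m (rep_ops M1 (Eps (src a)) ^ right_exp C a) \<Theta> (rep_ops M1 (Eps (src a)) ^ right_exp C a) = idop (?d (src a))"
      "(rep_ops M1 (Eps (src a)) ^ right_exp C a) ^ m = 0" "(rep_ops M1 (Eps (tgt a)) ^ left_exp C a) ^ m = 0"
      using loc_free_arrow_higman[OF l1 a] by blast
    have Xa: "L' a - L a \<in> Hom (?s (tgt a)) (?s (src a))" "L (Eps (tgt a)) ^ left_exp C a * (L' a - L a) = (L' a - L a) * L (Eps (src a)) ^ right_exp C a"
      using X a by (auto simp: cocycle_def is_rep_def)
    show ?thesis using cocycle_lift_explicit[OF l1 R a \<Theta> Xa refl] False by blast
  qed
  then obtain Y where Y: "\<And>a. a \<in> Ar \<Longrightarrow> Y a \<in> Hom (?d (tgt a)) (?d (src a))" "\<And>a. a \<in> Ar \<Longrightarrow> \<pi> (tgt a) * Y a = (L' a - L a) * \<pi> (src a)"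
    "\<And>a. a \<in> Ar \<Longrightarrow> rep_ops M1 (Eps (tgt a)) ^ left_exp C a * Y a = Y a * rep_ops M1 (Eps (src a)) ^ right_exp C a"
    "\<And>a. a \<in> Ar \<Longrightarrow> L' a - L a = 0 \<Longrightarrow> Y a = 0" by metis
  have Yc: "cocycle ?d (rep_ops M1) Y" unfolding cocycle_def is_rep_def using Y(1,3) Y(4)[OF Eps_Ar] LE by auto
  define B where "B a = rep_ops M1 a + Y a" for a
  have lB: "loc_free k ?d B" unfolding B_def by (rule loc_free_perturb[OF l1 Yc])
  have "reduces_by ?d B ?s (\<lambda>a. L a + (L' a - L a)) \<pi> \<rho> \<kappa>" unfolding B_def by (rule reduces_by_perturb[OF R X Yc Y(2)])
  then have RB: "reduces_by ?d B ?s L' \<pi> \<rho> \<kappa>" by simp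
  define M0 where "M0 = to_rep (dv k r) B"
  have M0: "M0 \<in> rep_lf n C (k \<cdot>\<^sub>m D) \<Omega> r" and lM0: "\<And>a. a \<in> Ar \<Longrightarrow> rep_ops M0 a = B a"
    unfolding M0_def using to_rep_lf[OF k lB] by auto
  let ?P = "polynomial_functions n C \<Omega> (dv k r)" and ?X = "rep_lf n C (k \<cdot>\<^sub>m D) \<Omega> r"
  interpret local_functions ?P ?X M0 by (rule local_functions_loc_free[OF M0])
  obtain \<Phi> where \<Phi>: "\<And>a. a \<in> Ar \<Longrightarrow> op_reg (?d (tgt a)) (?d (src a)) (\<lambda>M. \<Phi> M a)" "\<And>a. a \<in> Ar \<Longrightarrow> \<Phi> M0 a = rep_ops M0 a"
    "near (\<lambda>M. (\<forall>i<n. \<Phi> M (Eps i) = rep_ops M0 (Eps i)) \<and> is_rep ?d (\<Phi> M) \<and> iso ?d (rep_ops M) (\<Phi> M))"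
    using normal_form[OF k M0] nearby_near[OF M0] by blast
  \<comment> \<open>Conjugation by \<open>g'\<close> undoes the change of loops, so that the value
    at \<open>M0\<close> is \<open>N0\<close> itself: f is not invariant under isomorphism.\<close>
  define A where "A M a = g' (tgt a) * (\<pi> (tgt a) * \<Phi> M a * \<rho> (src a)) * g (src a)" for M a
  have Areg: "op_reg (?s (tgt a)) (?s (src a)) (\<lambda>M. A M a)" if a: "a \<in> Ar" for a
    unfolding A_def
    by (intro op_reg_mult[OF op_reg_mult[OF op_reg_const[OF g(2)[OF tgt_lt[OF a]]]] op_reg_const[OF g(1)[OF src_lt[OF a]]]]
      op_reg_mult[OF op_reg_mult[OF op_reg_const[OF reduces_by_D(1)[OF R tgt_lt[OF a]]] \<Phi>(1)[OF a]] op_reg_const[OF reduces_by_D(2)[OF R src_lt[OF a]]]])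
  have "A M0 a = rep_ops N0 a" if a: "a \<in> Ar" for a
  proof -
    note t = tgt_lt[OF a] and u = src_lt[OF a]
    have NH: "rep_ops N0 a \<in> Hom (?s (tgt a)) (?s (src a))" using rN0 a by (simp add: is_rep_def)
    have "\<pi> (tgt a) * \<Phi> M0 a * \<rho> (src a) = L' a * (\<pi> (src a) * \<rho> (src a))"
      using hom_eq[OF reduces_hom1[OF RB] a] \<Phi>(2)[OF a] lM0[OF a] by (simp add: mult.assoc[symmetric])
    also have "\<dots> = L' a" unfolding reduces_by_D(4)[OF R u] using Hom_right[OF is_mod_Hom[OF loc_free_is_mod[OF L'] a]] .
    finally have "A M0 a = (g' (tgt a) * g (tgt a)) * rep_ops N0 a * (g' (src a) * g (src a))"
      unfolding A_def L'_def by (simp add: mult.assoc)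
    then show ?thesis unfolding g(4)[OF t] g(4)[OF u] using Hom_left[OF NH] Hom_right[OF NH] by simp
  qed
  then have "to_rep (dv 1 r) (A M0) = N0" using to_rep_cong to_rep_rep_ops[OF rep_lfD(1)[OF le_refl N0]] by metis
  then have "near (\<lambda>M. f (to_rep (dv 1 r) (A M)) \<noteq> 0)" using f(2)
    by (intro reg_near_nonzero_dim reg_substitute[OF local_functions_axioms f(1)] Areg) simp_all
  from near_conj[OF this \<Phi>(3)]
  have "near (\<lambda>M. \<exists>N\<in>rep_lf n C (1 \<cdot>\<^sub>m D) \<Omega> r. f N \<noteq> 0 \<and> reduces ?d (rep_ops M) ?s (rep_ops N))"
  proof (rule near_mono, elim conjE)
    fix M assume M: "M \<in> ?X" and fM: "f (to_rep (dv 1 r) (A M)) \<noteq> 0" and E: "\<forall>i<n. \<Phi> M (Eps i) = rep_ops M0 (Eps i)"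
      and rM: "is_rep ?d (\<Phi> M)" and iM: "iso ?d (rep_ops M) (\<Phi> M)"
    have lM: "loc_free k ?d (\<Phi> M)" by (rule loc_free_iso[OF iM rM rep_lfD(2)[OF k M]])
    have EB: "\<Phi> M (Eps i) = B (Eps i)" if "i < n" for i using E lM0[OF Eps_Ar[OF that]] that by simp
    define T where "T a = \<pi> (tgt a) * \<Phi> M a * \<rho> (src a)" for a
    have T: "reduces_by ?d (\<Phi> M) ?s T \<pi> \<rho> \<kappa>" "loc_free 1 ?s T"
      unfolding T_def using reduces_by_same_Eps[OF RB L' loc_free_is_mod[OF lM] EB] by auto
    note cT = conj_iso[OF is_mod_is_rep[OF loc_free_is_mod[OF T(2)]] g(2,1,4,3)]
    have AT: "A M = (\<lambda>a. g' (tgt a) * T a * g (src a))" by (simp add: A_def T_def fun_eq_iff)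
    have iA: "iso ?s T (A M)" and rA: "is_rep ?s (A M)" unfolding AT using cT by auto
    have lA: "loc_free 1 ?s (A M)" by (rule loc_free_iso[OF iA rA T(2)])
    define N where "N = to_rep (dv 1 r) (A M)"
    have N: "N \<in> rep_lf n C (1 \<cdot>\<^sub>m D) \<Omega> r" "\<And>a. a \<in> Ar \<Longrightarrow> rep_ops N a = A M a"
      unfolding N_def using to_rep_lf[OF le_refl lA] by auto
    have "reduces ?d (\<Phi> M) ?s (A M)" using reduces_iso[OF _ iA] T(1) unfolding reduces_def by blast
    then have "reduces ?d (rep_ops M) ?s (A M)" by (rule reduces_iso_source[OF _ iso_sym[OF iM]])
    then obtain p q u where 1: "reduces_by ?d (rep_ops M) ?s (A M) p q u" unfolding reduces_def by blast
    have "reduces_by ?d (rep_ops M) ?s (rep_ops N) p q u = reduces_by ?d (rep_ops M) ?s (A M) p q u"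
      by (rule reduces_by_cong) (simp_all add: N(2))
    with 1 have "reduces_by ?d (rep_ops M) ?s (rep_ops N) p q u" by simp
    then have "reduces ?d (rep_ops M) ?s (rep_ops N)" unfolding reduces_def by blast
    then show "\<exists>N\<in>rep_lf n C (1 \<cdot>\<^sub>m D) \<Omega> r. f N \<noteq> 0 \<and> reduces ?d (rep_ops M) ?s (rep_ops N)"
      using N(1) fM unfolding N_def[symmetric] by blast
  qed
  then show ?thesis using M0 nearby_near[OF M0] by blast
qed

end

section \<open>Bordered determinants and polynomials on a line\<close>

lemma kernel_trivial:
  fixes F :: "nat \<Rightarrow> nat \<Rightarrow> 'a::field"
  assumes "det (mat l l (\<lambda>(x,y). F x y)) \<noteq> 0" and "\<And>x. x < l \<Longrightarrow> (\<Sum>y<l. F x y * w y) = 0" and "y < l"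
  shows "w y = 0"
proof (rule ccontr)
  assume "w y \<noteq> 0"
  let ?v = "vec l w"
  have "mat l l (\<lambda>(x,y). F x y) *\<^sub>v ?v = 0\<^sub>v l"
    using assms(2) by (intro eq_vecI) (auto simp: scalar_prod_def atLeast0LessThan)
  moreover have "?v \<noteq> 0\<^sub>v l"
  proof
    assume "?v = 0\<^sub>v l"
    then have "?v $ y = 0\<^sub>v l $ y" by simp
    then show False using \<open>w y \<noteq> 0\<close> assms(3) by simp
  qed
  moreover have "mat l l (\<lambda>(x,y). F x y) \<in> carrier_mat l l" by simp
  ultimately have "det (mat l l (\<lambda>(x,y). F x y)) = 0"
    using det_0_iff_vec_prod_zero_field vec_carrier[of l w] by blast
  then show False using assms(1) by simp
qed

text \<open>A kernel vector of the bordered matrix has a nonzero last coordinate, since otherwise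
  the invertible block would have a kernel. Normalized, it expresses the last column by the
  others.\<close>

lemma bordered_solution:
  fixes F :: "nat \<Rightarrow> nat \<Rightarrow> 'a::field"
  assumes nonzero_dim: "det (mat l l (\<lambda>(x,y). F x y)) \<noteq> 0" and z: "det (mat (Suc l) (Suc l) (\<lambda>(x,y). F x y)) = 0"
  shows "\<exists>w. \<forall>x\<le>l. (\<Sum>y<l. F x y * w y) = F x l"
proof -
  let ?B = "mat (Suc l) (Suc l) (\<lambda>(x,y). F x y)"
  have "?B \<in> carrier_mat (Suc l) (Suc l)" by simp
  from det_0_iff_vec_prod_zero_field[OF this] z obtain v where
    v: "v \<in> carrier_vec (Suc l)" "v \<noteq> 0\<^sub>v (Suc l)" "?B *\<^sub>v v = 0\<^sub>v (Suc l)" by blast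
  have row: "(\<Sum>y<l. F x y * v $ y) + F x l * v $ l = 0" if "x \<le> l" for x
  proof -
    have "(?B *\<^sub>v v) $ x = (\<Sum>y<Suc l. F x y * v $ y)"
      using that v(1) by (auto simp: scalar_prod_def atLeast0LessThan intro!: sum.cong)
    then show ?thesis using v(3) that by simp
  qed
  have vl: "v $ l \<noteq> 0"
  proof
    assume z: "v $ l = 0"
    have "v $ y = 0" if "y < l" for y
      using kernel_trivial[OF nonzero_dim _ that, of "\<lambda>y. v $ y"] row z by simp
    then have "v = 0\<^sub>v (Suc l)" using v(1) z by (intro eq_vecI) (auto simp: less_Suc_eq)
    then show False using v(2) by simp
  qed
  show ?thesis
  proof (intro exI[of _ "\<lambda>y. - (v $ y / v $ l)"] allI impI)
    fix x assume "x \<le> l"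
    have "(\<Sum>y<l. F x y * - (v $ y / v $ l)) = - (\<Sum>y<l. F x y * v $ y) / v $ l"
      by (simp add: sum_divide_distrib sum_negf)
    also have "(\<Sum>y<l. F x y * v $ y) = - (F x l * v $ l)" using row[OF \<open>x \<le> l\<close>] by (simp add: eq_neg_iff_add_eq_0)
    finally show "(\<Sum>y<l. F x y * - (v $ y / v $ l)) = F x l" using vl by simp
  qed
qed

lemma local_functions_poly: "local_functions (range poly) UNIV (t :: 'a::field)"
proof
  show "(\<lambda>_. c) \<in> range poly" for c :: 'a by (rule range_eqI[of _ _ "[:c:]"]) auto
  fix f g :: "'a \<Rightarrow> 'a" assume "f \<in> range poly" "g \<in> range poly"
  then obtain p q where "f = poly p" "g = poly q" by blast
  then show "(\<lambda>M. f M + g M) \<in> range poly" "(\<lambda>M. f M * g M) \<in> range poly"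
    by (auto simp: fun_eq_iff intro: range_eqI[of _ _ "p + q"] range_eqI[of _ _ "p * q"])
qed simp

text \<open>Two nonempty open sets of the line meet, even after removing one point v: the product of
  their equations and of X - v is a nonzero polynomial, and the field is infinite.\<close>

lemma poly_near_meet:
  fixes t u :: "'a::alg_closed_field"
  assumes "local_functions.near (range poly) UNIV t Q" "local_functions.near (range poly) UNIV u R"
  shows "\<exists>s. s \<noteq> v \<and> Q s \<and> R s"
proof -
  obtain p q where p: "poly p t \<noteq> 0" "\<And>s. poly p s \<noteq> 0 \<Longrightarrow> Q s" and q: "poly q u \<noteq> 0" "\<And>s. poly q s \<noteq> 0 \<Longrightarrow> R s"
    using assms unfolding local_functions.near_def[OF local_functions_poly] by auto
  have "p \<noteq> 0" "q \<noteq> 0" "[:- v, 1:] \<noteq> 0" using p(1) q(1) by auto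
  then have "p * q * [:- v, 1:] \<noteq> 0" by (intro no_zero_divisors)
  then have "finite {s. poly (p * q * [:- v, 1:]) s = 0}" by (rule poly_roots_finite)
  then have "\<exists>s. poly (p * q * [:- v, 1:]) s \<noteq> 0" using infinite_alg_closed ex_new_if_finite by blast
  then show ?thesis using p q by auto
qed

context gls_algebra begin

text \<open>After conjugation \<open>M2\<close> has the loops of \<open>M1\<close>, and the line
  through both consists of locally free modules. Both open conditions hold somewhere on it, so they
  hold at a common parameter t. The second condition is tested after a fixed conjugation, so near
  the resulting module it holds up to isomorphism.\<close>

lemma generic_common:
  fixes M1 M2 :: "'a::alg_closed_field rep"
  assumes k: "k \<ge> 1" and hM: "M1 \<in> rep_lf n C (k \<cdot>\<^sub>m D) \<Omega> r" "M2 \<in> rep_lf n C (k \<cdot>\<^sub>m D) \<Omega> r"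
    and f: "f1 \<in> polynomial_functions n C \<Omega> (dv k r)" "f2 \<in> polynomial_functions n C \<Omega> (dv k r)" "f1 M1 \<noteq> 0" "f2 M2 \<noteq> 0"
  shows "\<exists>M0\<in>rep_lf n C (k \<cdot>\<^sub>m D) \<Omega> r. f1 M0 \<noteq> 0 \<and>
    nearby k r M0 (\<lambda>M. \<exists>M'\<in>rep_lf n C (k \<cdot>\<^sub>m D) \<Omega> r. f2 M' \<noteq> 0 \<and> iso (\<lambda>i. dv k r $ i) (rep_ops M') (rep_ops M))"
proof -
  let ?d = "\<lambda>i. dv k r $ i" and ?X = "rep_lf n C (k \<cdot>\<^sub>m D) \<Omega> r"
  note l1 = rep_lfD(2)[OF k hM(1)] and l2 = rep_lfD(2)[OF k hM(2)] and r2 = rep_lfD(3)[OF k hM(2)]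
  obtain g g' where "\<forall>i<n. g i \<in> Hom (?d i) (?d i) \<and> g' i \<in> Hom (?d i) (?d i) \<and> g i * g' i = idop (?d i) \<and>
      g' i * g i = idop (?d i) \<and> g i * rep_ops M2 (Eps i) = rep_ops M1 (Eps i) * g i"
    using conjugate_Eps[OF l2 l1 k] by blast
  then have g: "g i \<in> Hom (?d i) (?d i)" "g' i \<in> Hom (?d i) (?d i)" "g i * g' i = idop (?d i)" "g' i * g i = idop (?d i)"
    "g i * rep_ops M2 (Eps i) = rep_ops M1 (Eps i) * g i" if "i < n" for i using that by auto
  define L where "L a = g (tgt a) * rep_ops M2 a * g' (src a)" for a
  have iL: "iso ?d (rep_ops M2) L" and rL: "is_rep ?d L" unfolding L_def using conj_iso[OF r2 g(1,2,3,4)] by auto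
  have lL: "loc_free k ?d L" by (rule loc_free_iso[OF iL rL l2])
  have LE: "L (Eps i) = rep_ops M1 (Eps i)" if i: "i < n" for i
  proof -
    have "L (Eps i) = rep_ops M1 (Eps i) * (g i * g' i)" unfolding L_def using g(5)[OF i] by (simp add: mult.assoc[symmetric])
    then show ?thesis using g(3)[OF i] Hom_right[OF is_mod_Eps[OF loc_free_is_mod[OF l1] i]] by simp
  qed
  define Z where "Z a = L a - rep_ops M1 a" for a
  have Zc: "cocycle ?d (rep_ops M1) Z" unfolding Z_def by (rule cocycle_diff[OF loc_free_is_mod[OF l1] loc_free_is_mod[OF lL] LE])
  define T where "T t a = rep_ops M1 a + scal t * Z a" for t a
  have lT: "loc_free k ?d (T t)" for t unfolding T_def by (rule loc_free_perturb[OF l1 cocycle_scal[OF Zc]])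
  \<comment> \<open>The same line in the original coordinates of \<open>M2\<close>, which it meets
    at t = 1.\<close>
  define K where "K t a = g' (tgt a) * T t a * g (src a)" for t a
  have Treg: "local_functions.op_reg (range poly) UNIV s (?d (tgt a)) (?d (src a)) (\<lambda>t. T t a)" if a: "a \<in> Ar" for s a
  proof -
    interpret local_functions "range poly" UNIV s by (rule local_functions_poly)
    have "(\<lambda>t::'a. t) \<in> range poly" by (rule range_eqI[of _ _ "[:0,1:]"]) auto
    then show ?thesis unfolding T_def
      by (intro op_reg_add op_reg_scal op_reg_const reg_P) (use is_mod_Hom[OF loc_free_is_mod[OF l1] a] Zc a in \<open>auto simp: cocycle_def is_rep_def\<close>)
  qed
  have Kreg: "local_functions.op_reg (range poly) UNIV s (?d (tgt a)) (?d (src a)) (\<lambda>t. K t a)" if a: "a \<in> Ar" for s a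
  proof -
    interpret local_functions "range poly" UNIV s by (rule local_functions_poly)
    show ?thesis unfolding K_def
      by (rule op_reg_mult[OF op_reg_mult[OF op_reg_const[OF g(2)[OF tgt_lt[OF a]]] Treg[OF a]] op_reg_const[OF g(1)[OF src_lt[OF a]]]])
  qed
  have s0: "scal 0 = (0 :: 'a lop)" by (rule lop_eqI) (simp add: app_scal)
  have "T 0 a = rep_ops M1 a" for a by (simp add: T_def s0)
  then have e1: "to_rep (dv k r) (T 0) = M1" using to_rep_rep_ops[OF rep_lfD(1)[OF k hM(1)]] by (metis to_rep_cong)
  have n1: "local_functions.near (range poly) UNIV 0 (\<lambda>t. f1 (to_rep (dv k r) (T t)) \<noteq> 0)"
    by (intro local_functions.reg_near_nonzero_dim[OF local_functions_poly] reg_substitute[OF local_functions_poly f(1)] Treg) (simp_all add: e1 f(3))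
  have "K 1 a = rep_ops M2 a" if a: "a \<in> Ar" for a
  proof -
    note t = tgt_lt[OF a] and u = src_lt[OF a]
    have NH: "rep_ops M2 a \<in> Hom (?d (tgt a)) (?d (src a))" using r2 a by (simp add: is_rep_def)
    have "K 1 a = (g' (tgt a) * g (tgt a)) * rep_ops M2 a * (g' (src a) * g (src a))"
      by (simp add: K_def T_def Z_def L_def scal_mult mult.assoc)
    then show ?thesis unfolding g(4)[OF t] g(4)[OF u] using Hom_left[OF NH] Hom_right[OF NH] by simp
  qed
  then have e2: "to_rep (dv k r) (K 1) = M2" using to_rep_rep_ops[OF rep_lfD(1)[OF k hM(2)]] by (metis to_rep_cong)
  have n2: "local_functions.near (range poly) UNIV 1 (\<lambda>t. f2 (to_rep (dv k r) (K t)) \<noteq> 0)"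
    by (intro local_functions.reg_near_nonzero_dim[OF local_functions_poly] reg_substitute[OF local_functions_poly f(2)] Kreg) (simp_all add: e2 f(4))
  obtain t where t: "f1 (to_rep (dv k r) (T t)) \<noteq> 0" "f2 (to_rep (dv k r) (K t)) \<noteq> 0"
    using poly_near_meet[OF n1 n2] by blast
  define M0 where "M0 = to_rep (dv k r) (T t)"
  have M0: "M0 \<in> ?X" "\<And>a. a \<in> Ar \<Longrightarrow> rep_ops M0 a = T t a" unfolding M0_def using to_rep_lf[OF k lT] by auto
  note X0 = M0(1) and T0 = M0(2)
  interpret local_functions "polynomial_functions n C \<Omega> (dv k r)" ?X M0 by (rule local_functions_loc_free[OF M0(1)])
  define A where "A M a = g' (tgt a) * rep_ops M a * g (src a)" for M a
  have "op_reg (?d (tgt a)) (?d (src a)) (\<lambda>M. A M a)" if a: "a \<in> Ar" for a unfolding A_def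
    by (rule op_reg_mult[OF op_reg_mult[OF op_reg_const[OF g(2)[OF tgt_lt[OF a]]] op_reg_rep_ops[OF k X0 a]] op_reg_const[OF g(1)[OF src_lt[OF a]]]])
  moreover have "to_rep (dv k r) (A M0) = to_rep (dv k r) (K t)"
    by (rule to_rep_cong) (simp add: A_def K_def T0)
  ultimately have "near (\<lambda>M. f2 (to_rep (dv k r) (A M)) \<noteq> 0)"
    using t(2) by (intro reg_near_nonzero_dim reg_substitute[OF local_functions_axioms f(2)]) simp_all
  then have "near (\<lambda>M. \<exists>M'\<in>?X. f2 M' \<noteq> 0 \<and> iso ?d (rep_ops M') (rep_ops M))"
  proof (rule near_mono)
    fix M assume M: "M \<in> ?X" and fM: "f2 (to_rep (dv k r) (A M)) \<noteq> 0"
    note ci = conj_iso[OF rep_lfD(3)[OF k M] g(2,1,4,3)]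
    have AM: "A M = (\<lambda>a. g' (tgt a) * rep_ops M a * g (src a))" by (simp add: A_def fun_eq_iff)
    have iA: "iso ?d (rep_ops M) (A M)" and rA: "is_rep ?d (A M)" unfolding AM using ci by auto
    have lA: "loc_free k ?d (A M)" by (rule loc_free_iso[OF iA rA rep_lfD(2)[OF k M]])
    define M' where "M' = to_rep (dv k r) (A M)"
    have M': "M' \<in> ?X" "\<And>a. a \<in> Ar \<Longrightarrow> rep_ops M' a = A M a" unfolding M'_def using to_rep_lf[OF k lA] by auto
    have "iso ?d (rep_ops M') (rep_ops M) = iso ?d (A M) (rep_ops M)" by (rule iso_cong) (simp_all add: M'(2))
    then have "iso ?d (rep_ops M') (rep_ops M)" using iso_sym[OF iA] by simp
    then show "\<exists>M'\<in>?X. f2 M' \<noteq> 0 \<and> iso ?d (rep_ops M') (rep_ops M)" using M'(1) fM unfolding M'_def[symmetric] by blast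
  qed
  then show ?thesis using X0 t(1) nearby_near[OF X0] unfolding M0_def[symmetric] by blast
qed

section \<open>Generic modules are unobstructed\<close>

lemma finite_arrows: "finite Ar"
proof -
  have "finite \<Omega>" using ori by (auto simp: orientation_def intro: finite_subset)
  moreover have "Ar = Eps ` {..<n} \<union> (\<Union>ij\<in>\<Omega>. Alpha (fst ij) (snd ij) ` {1..g_num C (fst ij) (snd ij)})"
    by (force simp: arrows_def)
  ultimately show ?thesis by simp
qed

text \<open>The rank of \<open>h \<mapsto> [N,h]\<close> is maximal on an open set.  If \<open>v\<close> is an endomorphism of such an
  \<open>N\<close>, then along the line \<open>N + t X\<close> the vector \<open>[N + t X, v] = t [X,v]\<close> cannot increase the rank,
  so that \<open>[X,v]\<close> lies in the image of \<open>h \<mapsto> [N,h]\<close>.\<close>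

lemma unobstructed_nearby:
  shows "\<exists>N0 \<in> (rep_lf n C (1 \<cdot>\<^sub>m D) \<Omega> r :: 'a::alg_closed_field rep set). nearby 1 r N0 (\<lambda>N. unobstructed (\<lambda>i. dv 1 r $ i) (rep_ops N))"
proof -
  let ?s = "\<lambda>i. dv 1 r $ i" and ?X = "rep_lf n C (1 \<cdot>\<^sub>m D) \<Omega> r :: 'a rep set"
  define \<Psi> where "\<Psi> A h a = A a * h (src a) - h (tgt a) * A a" for A :: "arrow \<Rightarrow> 'a lop" and h :: "nat \<Rightarrow> 'a lop" and a :: arrow
  define cf where "cf Z co = (case co of (a,p,q) \<Rightarrow> entry (Z a) p q)" for Z :: "arrow \<Rightarrow> 'a lop" and co
  define Co where "Co = (SIGMA a:Ar. {..<?s (tgt a)} \<times> {..<?s (src a)})"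
  have finCo: "finite Co" unfolding Co_def using finite_arrows by auto
  define minor where "minor A hs cs = det (mat (length hs) (length hs) (\<lambda>(x,y). cf (\<Psi> A (hs ! y)) (cs ! x)))" for A hs cs
  define fam where "fam h \<longleftrightarrow> (\<forall>i<n. h i \<in> Hom (?s i) (?s i))" for h :: "nat \<Rightarrow> 'a lop"
  \<comment> \<open>A certificate that the map sending h to [N,h] has rank at least l: a
    nonvanishing minor with columns \<open>hs\<close> and rows given by the matrix coordinates
    \<open>cs\<close>.\<close>
  define good where "good l N hs cs \<longleftrightarrow> N \<in> ?X \<and> length hs = l \<and> length cs = l \<and> set cs \<subseteq> Co \<and>
     (\<forall>h\<in>set hs. fam h) \<and> minor (rep_ops N) hs cs \<noteq> 0" for l N hs cs
  \<comment> \<open>A minor with a repeated row vanishes, so the rows are distinct coordinates and l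
    is at most \<open>card Co\<close>.\<close>
  have bound: "l \<le> card Co" if g: "good l N hs cs" for l N hs cs
  proof -
    have "distinct cs"
    proof (rule ccontr)
      assume "\<not> distinct cs"
      then obtain x y where xy: "x < l" "y < l" "x \<noteq> y" "cs ! x = cs ! y"
        using g by (auto simp: distinct_conv_nth good_def)
      have l: "length hs = l" using g by (simp add: good_def)
      have "minor (rep_ops N) hs cs = 0" unfolding minor_def l
        by (rule det_identical_rows[of _ l x y]) (use xy in \<open>auto intro!: eq_vecI\<close>)
      then show False using g by (simp add: good_def)
    qed
    then have "length cs = card (set cs)" by (simp add: distinct_card)
    also have "\<dots> \<le> card Co" using g finCo by (intro card_mono) (auto simp: good_def)
    finally show ?thesis using g by (simp add: good_def)
  qed
  obtain N1 :: "'a rep" where N1: "N1 \<in> ?X" using rep_lf_nonempty[of 1 r] by auto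
  have "good 0 N1 [] []" unfolding good_def minor_def using N1 by (simp add: det_def)
  then have ex: "\<exists>N hs cs. good 0 N hs cs" by blast
  obtain l where "\<exists>N hs cs. good l N hs cs" and maxl: "\<And>l' N hs cs. good l' N hs cs \<Longrightarrow> l' \<le> l"
    using Nat.ex_has_greatest_nat[of "\<lambda>l. \<exists>N hs cs. good l N hs cs" 0 "card Co"] ex bound by blast
  then obtain N0 hs cs where g0: "good l N0 hs cs" by blast
  then have N0: "N0 \<in> ?X" and len: "length hs = l" "length cs = l" and csC: "set cs \<subseteq> Co" and hsf: "\<And>h. h \<in> set hs \<Longrightarrow> fam h"
    and m0: "minor (rep_ops N0) hs cs \<noteq> 0" by (auto simp: good_def)
  interpret local_functions "polynomial_functions n C \<Omega> (dv 1 r)" ?X N0 by (rule local_functions_loc_free[OF N0])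
  have csx: "cs ! x \<in> Co" if "x < l" for x using csC len that by auto
  have hsy: "fam (hs ! y)" if "y < l" for y using hsf len that by auto
  have "reg (\<lambda>N. minor (rep_ops N) hs cs)" unfolding minor_def len
  proof (rule reg_det[of _ l])
    fix x y assume xy: "x < l" "y < l"
    obtain a p q where c: "cs ! x = (a,p,q)" "a \<in> Ar" "p < ?s (tgt a)" "q < ?s (src a)"
      using csx[OF xy(1)] by (auto simp: Co_def)
    have "op_reg (?s (tgt a)) (?s (src a)) (\<lambda>N. \<Psi> (rep_ops N) (hs ! y) a)" unfolding \<Psi>_def
      using hsy[OF xy(2)] tgt_lt[OF c(2)] src_lt[OF c(2)]
      by (intro op_reg_diff op_reg_mult[OF op_reg_rep_ops[OF le_refl N0 c(2)] op_reg_const]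
          op_reg_mult[OF op_reg_const op_reg_rep_ops[OF le_refl N0 c(2)]]) (auto simp: fam_def)
    then have "reg (\<lambda>N. entry (\<Psi> (rep_ops N) (hs ! y) a) p q)" using c(3,4) unfolding op_reg_def by blast
    then show "reg (\<lambda>N. mat l l (\<lambda>(x, y). cf (\<Psi> (rep_ops N) (hs ! y)) (cs ! x)) $$ (x, y))"
      using xy c(1) by (simp add: cf_def)
  qed simp
  from reg_near_nonzero_dim[OF this m0] have "near (\<lambda>N. minor (rep_ops N) hs cs \<noteq> 0)" .
  then have "near (\<lambda>N. unobstructed ?s (rep_ops N))"
  proof (rule near_mono)
    fix N assume N: "N \<in> ?X" and mN: "minor (rep_ops N) hs cs \<noteq> 0"
    note lN = rep_lfD(2)[OF le_refl N]
    show "unobstructed ?s (rep_ops N)" unfolding unobstructed_def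
    proof (intro allI impI)
      fix v X assume v: "hom ?s (rep_ops N) ?s (rep_ops N) v" and X: "cocycle ?s (rep_ops N) X"
      have vf: "fam v" using hom_Hom[OF v] by (simp add: fam_def)
      have XH: "X a \<in> Hom (?s (tgt a)) (?s (src a))" if "a \<in> Ar" for a using X that by (simp add: cocycle_def is_rep_def)
      have NH: "rep_ops N a \<in> Hom (?s (tgt a)) (?s (src a))" if "a \<in> Ar" for a using is_mod_Hom[OF loc_free_is_mod[OF lN] that] .
      have \<Psi>H: "\<Psi> A h a \<in> Hom (?s (tgt a)) (?s (src a))" if "a \<in> Ar" "fam h" "A a \<in> Hom (?s (tgt a)) (?s (src a))" for A h a
        using that tgt_lt[OF that(1)] src_lt[OF that(1)] unfolding \<Psi>_def fam_def by (auto intro: Hom_diff Hom_mult)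
      define T where "T t a = rep_ops N a + scal t * X a" for t a
      have lT: "loc_free 1 ?s (T t)" for t unfolding T_def by (rule loc_free_perturb[OF lN cocycle_scal[OF X]])
      have TH: "T t a \<in> Hom (?s (tgt a)) (?s (src a))" if "a \<in> Ar" for t a using is_mod_Hom[OF loc_free_is_mod[OF lT] that] .
      \<comment> \<open>The certified minor along the line N + tX, bordered by the column [X,v] and
        by the row of an arbitrary coordinate \<open>co\<close>.\<close>
      define F where "F t co x y = (if y < l then cf (\<Psi> (T t) (hs ! y)) ((cs @ [co]) ! x) else cf (\<Psi> X v) ((cs @ [co]) ! x))" for t co x y
      have coC: "(cs @ [co]) ! x \<in> Co" if "co \<in> Co" "x < Suc l" for co x
        using that csx len by (auto simp: nth_append less_Suc_eq)
      have nzt: "det (mat (Suc l) (Suc l) (\<lambda>(x,y). F t co x y)) = 0" if co: "co \<in> Co" and t: "t \<noteq> 0" for co t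
      proof -
        \<comment> \<open>As [N,v] = 0, scaling v by 1/t gives [N + tX, v'] = [X,v]. For nonzero t
          the bordered matrix is therefore a genuine minor of size l + 1, and it vanishes by
          maximality of l.\<close>
        define v' where "v' i = scal (inverse t) * v i" for i
        have v'f: "fam v'" using vf unfolding fam_def v'_def by (auto intro: Hom_scal)
        have vX: "\<Psi> (T t) v' a = \<Psi> X v a" if a: "a \<in> Ar" for a
        proof -
          have "\<Psi> (T t) v' a = scal (inverse t) * (rep_ops N a * v (src a) - v (tgt a) * rep_ops N a) + (scal (inverse t) * scal t) * \<Psi> X v a"
            unfolding \<Psi>_def T_def v'_def
            by (simp add: distrib_left distrib_right right_diff_distrib mult.assoc
               scal_left_comm[of "rep_ops N a"] scal_left_comm[of "X a"] scal_left_comm[of "v (tgt a)"])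
              (simp only: mult.assoc[symmetric] scal_mult(1) mult.commute[of t])
          then show ?thesis using hom_eq[OF v a] t by (simp add: scal_mult)
        qed
        define Nt where "Nt = to_rep (dv 1 r) (T t)"
        have Nt: "Nt \<in> ?X" "\<And>a. a \<in> Ar \<Longrightarrow> rep_ops Nt a = T t a" unfolding Nt_def using to_rep_lf[OF le_refl lT] by auto
        have "\<not> good (Suc l) Nt (hs @ [v']) (cs @ [co])" using maxl by fastforce
        then have "minor (rep_ops Nt) (hs @ [v']) (cs @ [co]) = 0"
          unfolding good_def using Nt(1) len csC hsf v'f co by auto
        moreover have "mat (Suc l) (Suc l) (\<lambda>(x,y). cf (\<Psi> (rep_ops Nt) ((hs @ [v']) ! y)) ((cs @ [co]) ! x)) = mat (Suc l) (Suc l) (\<lambda>(x,y). F t co x y)"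
        proof (intro eq_matI; clarsimp)
          fix x y assume xy: "x < Suc l" "y < Suc l"
          obtain a p q where c: "(cs @ [co]) ! x = (a,p,q)" "a \<in> Ar" using coC[OF co xy(1)] by (auto simp: Co_def)
          have e: "\<Psi> (rep_ops Nt) h a = \<Psi> (T t) h a" for h unfolding \<Psi>_def by (simp add: Nt(2)[OF c(2)])
          show "cf (\<Psi> (rep_ops Nt) ((hs @ [v']) ! y)) ((cs @ [co]) ! x) = F t co x y"
            unfolding F_def c(1) using len xy(2) by (auto simp: cf_def e vX[OF c(2)] nth_append less_Suc_eq)
        qed
        ultimately show ?thesis unfolding minor_def using len by simp
      qed
      \<comment> \<open>The determinant is regular in t; if it were nonzero at 0, it would be
        nonzero at some other t as well.\<close>
      have z0: "det (mat (Suc l) (Suc l) (\<lambda>(x,y). F 0 co x y)) = 0" if co: "co \<in> Co" for co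
      proof (rule ccontr)
        assume nonzero_dim: "det (mat (Suc l) (Suc l) (\<lambda>(x,y). F 0 co x y)) \<noteq> 0"
        interpret pl: local_functions "range poly" UNIV "0 :: 'a" by (rule local_functions_poly)
        have tp: "(\<lambda>t::'a. t) \<in> range poly" by (rule range_eqI[of _ _ "[:0,1:]"]) auto
        have "pl.reg (\<lambda>t. det (mat (Suc l) (Suc l) (\<lambda>(x,y). F t co x y)))"
        proof (rule pl.reg_det[of _ "Suc l"])
          fix x y assume xy: "x < Suc l" "y < Suc l"
          obtain a p q where c: "(cs @ [co]) ! x = (a,p,q)" "a \<in> Ar" "p < ?s (tgt a)" "q < ?s (src a)"
            using coC[OF co xy(1)] by (auto simp: Co_def)
          have Treg: "pl.op_reg (?s (tgt a)) (?s (src a)) (\<lambda>t. T t a)" unfolding T_def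
            by (intro pl.op_reg_add pl.op_reg_scal pl.op_reg_const pl.reg_P tp NH[OF c(2)] XH[OF c(2)])
          have "pl.reg (\<lambda>t. F t co x y)"
          proof (cases "y < l")
            case True
            have "pl.op_reg (?s (tgt a)) (?s (src a)) (\<lambda>t. \<Psi> (T t) (hs ! y) a)" unfolding \<Psi>_def
              using hsy[OF True] tgt_lt[OF c(2)] src_lt[OF c(2)]
              by (intro pl.op_reg_diff pl.op_reg_mult[OF Treg pl.op_reg_const] pl.op_reg_mult[OF pl.op_reg_const Treg]) (auto simp: fam_def)
            then have "pl.reg (\<lambda>t. entry (\<Psi> (T t) (hs ! y) a) p q)" using c(3,4) unfolding pl.op_reg_def by blast
            then show ?thesis using True c(1) by (simp add: F_def cf_def)
          next
            case False then show ?thesis by (simp add: F_def pl.reg_const)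
          qed
          then show "pl.reg (\<lambda>t. mat (Suc l) (Suc l) (\<lambda>(x, y). F t co x y) $$ (x, y))" using xy by simp
        qed simp
        from pl.reg_near_nonzero_dim[OF this nonzero_dim] have n: "pl.near (\<lambda>t. det (mat (Suc l) (Suc l) (\<lambda>(x,y). F t co x y)) \<noteq> 0)" .
        obtain t where "t \<noteq> 0" "det (mat (Suc l) (Suc l) (\<lambda>(x,y). F t co x y)) \<noteq> 0"
          using poly_near_meet[OF n n] by blast
        then show False using nzt[OF co] by blast
      qed
      have s0: "scal 0 = (0 :: 'a lop)" by (rule lop_eqI) (simp add: app_scal)
      have T0: "T 0 a = rep_ops N a" for a by (simp add: T_def s0)
      define G where "G x y = cf (\<Psi> (rep_ops N) (hs ! y)) (cs ! x)" for x y
      have Gnz: "det (mat l l (\<lambda>(x,y). G x y)) \<noteq> 0" using mN unfolding minor_def len G_def .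
      have T0': "T 0 = rep_ops N" by (simp add: T0 fun_eq_iff)
      have FG: "mat l l (\<lambda>(x,y). F 0 co x y) = mat l l (\<lambda>(x,y). G x y)" for co
        unfolding F_def G_def T0' by (intro eq_matI) (auto simp: nth_append len)
      have sol: "\<exists>w. (\<forall>x<l. (\<Sum>y<l. G x y * w y) = cf (\<Psi> X v) (cs ! x)) \<and>
          (\<Sum>y<l. cf (\<Psi> (rep_ops N) (hs ! y)) co * w y) = cf (\<Psi> X v) co" if co: "co \<in> Co" for co
      proof -
        obtain w where w: "\<And>x. x \<le> l \<Longrightarrow> (\<Sum>y<l. F 0 co x y * w y) = F 0 co x l"
          using bordered_solution[of l "F 0 co"] Gnz z0[OF co] unfolding FG by blast
        have "(\<Sum>y<l. G x y * w y) = cf (\<Psi> X v) (cs ! x)" if "x < l" for x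
          using w[of x] that unfolding F_def G_def T0' by (simp add: nth_append len)
        moreover have "(\<Sum>y<l. cf (\<Psi> (rep_ops N) (hs ! y)) co * w y) = cf (\<Psi> X v) co"
          using w[of l] unfolding F_def T0' by (simp add: nth_append len)
        ultimately show ?thesis by blast
      qed
      \<comment> \<open>The solution w is determined by the rows of the invertible minor alone, so
        the same w works for every coordinate.\<close>
      have "\<exists>w. \<forall>co\<in>Co. (\<Sum>y<l. cf (\<Psi> (rep_ops N) (hs ! y)) co * w y) = cf (\<Psi> X v) co"
      proof (cases "Co = {}")
        case False
        then obtain c0 where c0: "c0 \<in> Co" by blast
        obtain w where w: "\<And>x. x < l \<Longrightarrow> (\<Sum>y<l. G x y * w y) = cf (\<Psi> X v) (cs ! x)" using sol[OF c0] by blast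
        have "(\<Sum>y<l. cf (\<Psi> (rep_ops N) (hs ! y)) co * w y) = cf (\<Psi> X v) co" if co: "co \<in> Co" for co
        proof -
          obtain w' where w': "\<And>x. x < l \<Longrightarrow> (\<Sum>y<l. G x y * w' y) = cf (\<Psi> X v) (cs ! x)"
            "(\<Sum>y<l. cf (\<Psi> (rep_ops N) (hs ! y)) co * w' y) = cf (\<Psi> X v) co" using sol[OF co] by blast
          have "w y - w' y = 0" if "y < l" for y
            using kernel_trivial[OF Gnz _ that, of "\<lambda>y. w y - w' y"] w w'(1) by (simp add: right_diff_distrib sum_subtractf)
          then show ?thesis using w'(2) by simp
        qed
        then show ?thesis by blast
      qed simp
      then obtain w where w: "\<And>co. co \<in> Co \<Longrightarrow> (\<Sum>y<l. cf (\<Psi> (rep_ops N) (hs ! y)) co * w y) = cf (\<Psi> X v) co" by blast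
      define h where "h i = (\<Sum>y<l. scal (w y) * (hs ! y) i)" for i
      have hf: "fam h" unfolding fam_def h_def using hsy by (auto simp: fam_def intro!: Hom_sum Hom_scal)
      have \<Psi>h: "\<Psi> (rep_ops N) h a = (\<Sum>y<l. scal (w y) * \<Psi> (rep_ops N) (hs ! y) a)" for a
        unfolding \<Psi>_def h_def
        by (simp add: sum_distrib_left sum_distrib_right sum_subtractf right_diff_distrib scal_left_comm[of "rep_ops N a"] mult.assoc)
      have eq: "\<Psi> (rep_ops N) h a = \<Psi> X v a" if a: "a \<in> Ar" for a
      proof (rule Hom_eqI[OF \<Psi>H[of a h "rep_ops N", OF a hf NH[OF a]] \<Psi>H[of a v X, OF a vf XH[OF a]]])
        fix p q assume "p < ?s (tgt a)" "q < ?s (src a)"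
        then have "(a,p,q) \<in> Co" using a by (simp add: Co_def)
        from w[OF this] show "entry (\<Psi> (rep_ops N) h a) p q = entry (\<Psi> X v a) p q"
          unfolding \<Psi>h entry_sum by (simp add: cf_def mult.commute)
      qed
      show "\<exists>h. (\<forall>i<n. h i \<in> Hom (?s i) (?s i)) \<and>
          (\<forall>a\<in>Ar. v (tgt a) * X a - X a * v (src a) = rep_ops N a * h (src a) - h (tgt a) * rep_ops N a)"
      proof (intro exI[of _ "\<lambda>i. - h i"] conjI allI impI ballI)
        show "- h i \<in> Hom (?s i) (?s i)" if "i < n" for i using hf that by (auto simp: fam_def intro: Hom_uminus)
        fix a assume "a \<in> Ar"
        from eq[OF this] show "v (tgt a) * X a - X a * v (src a) = rep_ops N a * - h (src a) - - h (tgt a) * rep_ops N a"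
          unfolding \<Psi>_def by (simp add: algebra_simps)
      qed
    qed
  qed
  then show ?thesis using N0 nearby_near[OF N0] by blast
qed

section \<open>Canonical decompositions\<close>

lemma openin_lf_topology:
  fixes U :: "'a::field rep set"
  assumes "k \<ge> 1"
  shows "openin (lf_topology n C (k \<cdot>\<^sub>m D) \<Omega> r) U \<longleftrightarrow>
    (\<exists>S\<subseteq>polynomial_functions n C \<Omega> (dv k r). U = {M\<in>rep_lf n C (k \<cdot>\<^sub>m D) \<Omega> r. \<exists>f\<in>S. f M \<noteq> 0})"
    (is "?l \<longleftrightarrow> ?r")
proof
  assume ?l
  then obtain S where "S \<subseteq> polynomial_functions n C \<Omega> (dv k r)"
    "U = (rep_space n C \<Omega> (dv k r) - zero_locus n C \<Omega> (dv k r) S) \<inter> rep_lf n C (k \<cdot>\<^sub>m D) \<Omega> r"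
    unfolding lf_topology_def openin_subtopology openin_zariski by blast
  then show ?r using rep_lfD(1)[OF assms] unfolding zero_locus_def by blast
next
  assume ?r
  then obtain S where S: "S \<subseteq> polynomial_functions n C \<Omega> (dv k r)"
    and U: "U = {M\<in>rep_lf n C (k \<cdot>\<^sub>m D) \<Omega> r. \<exists>f\<in>S. f M \<noteq> 0}" by blast
  have "U = (rep_space n C \<Omega> (dv k r) - zero_locus n C \<Omega> (dv k r) S) \<inter> rep_lf n C (k \<cdot>\<^sub>m D) \<Omega> r"
    unfolding U zero_locus_def using rep_lfD(1)[OF assms] by blast
  then show ?l unfolding lf_topology_def openin_subtopology openin_zariski using S by blast
qed

lemma topspace_lf_topology:
  assumes "k \<ge> 1"
  shows "topspace (lf_topology n C (k \<cdot>\<^sub>m D) \<Omega> r) = (rep_lf n C (k \<cdot>\<^sub>m D) \<Omega> r :: 'a::field rep set)"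
  unfolding lf_topology_def topspace_subtopology topspace_zariski using rep_lfD(1)[OF assms] by blast

lemma decomposes_iso:
  fixes M M' :: "'a::field rep"
  assumes k: "k \<ge> 1" and rs: "set rs \<subseteq> carrier_vec n" "r = foldr (+) rs (0\<^sub>v n)"
    and M: "M \<in> rep_lf n C (k \<cdot>\<^sub>m D) \<Omega> r" "M' \<in> rep_lf n C (k \<cdot>\<^sub>m D) \<Omega> r"
    and "iso (\<lambda>i. dv k r $ i) (rep_ops M) (rep_ops M')" "decomposes k r rs M"
  shows "decomposes k r rs M'"
  using assms(6,7) biprod_list_iso
  unfolding decomposes_iff[OF k rep_lfD(1)[OF k M(1)] rs] decomposes_iff[OF k rep_lfD(1)[OF k M(2)] rs] by blast

lemma nearby_conj:
  assumes "M0 \<in> rep_lf n C (k \<cdot>\<^sub>m D) \<Omega> r" "nearby k r M0 Q" "nearby k r M0 R"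
  shows "nearby k r M0 (\<lambda>M. Q M \<and> R M)"
  using assms(2,3) local_functions.near_conj[OF local_functions_loc_free[OF assms(1)]] unfolding nearby_near[OF assms(1)] by blast

text \<open>Density is automatic: decompositions are invariant under isomorphism, and nonempty open
  sets meet up to isomorphism. One neighbourhood on which the decomposition holds is therefore
  enough.\<close>

lemma canonical_decomposition_iff:
  assumes k: "k \<ge> 1" and rs: "set rs \<subseteq> carrier_vec n" "r = foldr (+) rs (0\<^sub>v n)"
  shows "canonical_decomposition TYPE('a::alg_closed_field) n C (k \<cdot>\<^sub>m D) \<Omega> r rs \<longleftrightarrow>
    (\<exists>M0\<in>(rep_lf n C (k \<cdot>\<^sub>m D) \<Omega> r :: 'a rep set). nearby k r M0 (decomposes k r rs))"
    (is "_ \<longleftrightarrow> ?r")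
proof -
  let ?T = "lf_topology n C (k \<cdot>\<^sub>m D) \<Omega> r :: 'a rep topology" and ?X = "rep_lf n C (k \<cdot>\<^sub>m D) \<Omega> r :: 'a rep set"
  let ?P = "polynomial_functions n C \<Omega> (dv k r) :: ('a rep \<Rightarrow> 'a) set"
  have "canonical_decomposition TYPE('a) n C (k \<cdot>\<^sub>m D) \<Omega> r rs \<longleftrightarrow>
    (\<exists>U. openin ?T U \<and> ?T closure_of U = topspace ?T \<and> (\<forall>M\<in>U. decomposes k r rs M))"
    unfolding canonical_decomposition_def decomposes_def using rs by simp
  also have "\<dots> \<longleftrightarrow> ?r"
  proof
    assume "\<exists>U. openin ?T U \<and> ?T closure_of U = topspace ?T \<and> (\<forall>M\<in>U. decomposes k r rs M)"
    then obtain U where U: "openin ?T U" "?T closure_of U = ?X" "\<And>M. M \<in> U \<Longrightarrow> decomposes k r rs M"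
      unfolding topspace_lf_topology[OF k] by blast
    have "U \<noteq> {}" using U(2) rep_lf_nonempty[OF k, of r] by fastforce
    then obtain M0 where M0: "M0 \<in> U" by blast
    obtain S where S: "S \<subseteq> ?P" "U = {M\<in>?X. \<exists>f\<in>S. f M \<noteq> 0}" using U(1)[unfolded openin_lf_topology[OF k]] by blast
    then obtain f where f: "f \<in> S" "f M0 \<noteq> 0" "M0 \<in> ?X" using M0 by blast
    then have "nearby k r M0 (decomposes k r rs)" unfolding nearby_def using S U(3) by blast
    then show ?r using f(3) by blast
  next
    assume ?r
    then obtain M0 f2 where M0: "M0 \<in> ?X" and f2: "f2 \<in> ?P" "f2 M0 \<noteq> 0" "\<And>M. M \<in> ?X \<Longrightarrow> f2 M \<noteq> 0 \<Longrightarrow> decomposes k r rs M"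
      unfolding nearby_def by blast
    \<comment> \<open>U becomes the interior of the decomposition locus, the union of all basic open
      sets inside it.\<close>
    define S where "S = {h\<in>?P. \<forall>M\<in>?X. h M \<noteq> 0 \<longrightarrow> decomposes k r rs M}"
    define U where "U = {M\<in>?X. \<exists>h\<in>S. h M \<noteq> 0}"
    have "openin ?T U" unfolding openin_lf_topology[OF k] U_def by (rule exI[of _ S]) (auto simp: S_def)
    moreover have "\<forall>M\<in>U. decomposes k r rs M" by (auto simp: U_def S_def)
    moreover have "?T closure_of U = topspace ?T"
    proof
      show "?T closure_of U \<subseteq> topspace ?T" by (rule closure_of_subset_topspace)
      show "topspace ?T \<subseteq> ?T closure_of U"
      proof
        fix M1 assume M1: "M1 \<in> topspace ?T"
        show "M1 \<in> ?T closure_of U" unfolding in_closure_of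
        proof (intro conjI allI impI; (elim conjE)?)
          fix V assume V: "M1 \<in> V" "openin ?T V"
          obtain S1 where S1: "S1 \<subseteq> ?P" "V = {M\<in>?X. \<exists>f\<in>S1. f M \<noteq> 0}" using V(2)[unfolded openin_lf_topology[OF k]] by blast
          from V(1)[unfolded S1(2)] obtain f1 where f1: "f1 \<in> S1" "f1 M1 \<noteq> 0" "M1 \<in> ?X" by blast
          have f1P: "f1 \<in> ?P" using f1(1) S1(1) by (rule set_mp[rotated])
          obtain M where M: "M \<in> ?X" "f1 M \<noteq> 0"
            "nearby k r M (\<lambda>N. \<exists>M'\<in>?X. f2 M' \<noteq> 0 \<and> iso (\<lambda>i. dv k r $ i) (rep_ops M') (rep_ops N))"
            using generic_common[OF k f1(3) M0 f1P f2(1) f1(2) f2(2)] by blast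
          then obtain h where h: "h \<in> ?P" "h M \<noteq> 0"
            "\<And>N. N \<in> ?X \<Longrightarrow> h N \<noteq> 0 \<Longrightarrow> \<exists>M'\<in>?X. f2 M' \<noteq> 0 \<and> iso (\<lambda>i. dv k r $ i) (rep_ops M') (rep_ops N)"
            unfolding nearby_def by blast
          have "h \<in> S" unfolding S_def using h(1,3) f2(3) decomposes_iso[OF k rs] by blast
          then have "M \<in> U" unfolding U_def using M(1) h(2) by blast
          moreover have "M \<in> V" using S1(2) M f1(1) by blast
          ultimately show "\<exists>M. M \<in> U \<and> M \<in> V" by blast
        qed (rule M1)
      qed
    qed
    ultimately show "\<exists>U. openin ?T U \<and> ?T closure_of U = topspace ?T \<and> (\<forall>M\<in>U. decomposes k r rs M)" by blast
  qed
  finally show ?thesis .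
qed

text \<open>Unobstructedness passes along isomorphisms, so its open set can be moved to meet the one
  where Q holds.\<close>

lemma unobstructed_near_generic:
  fixes N1 :: "'a::alg_closed_field rep"
  assumes N1: "N1 \<in> rep_lf n C (1 \<cdot>\<^sub>m D) \<Omega> r" "nearby 1 r N1 Q"
  shows "\<exists>N0\<in>rep_lf n C (1 \<cdot>\<^sub>m D) \<Omega> r. nearby 1 r N0 (\<lambda>N. Q N \<and> unobstructed (\<lambda>i. dv 1 r $ i) (rep_ops N))"
proof -
  let ?X = "rep_lf n C (1 \<cdot>\<^sub>m D) \<Omega> r :: 'a rep set" and ?s = "\<lambda>i. dv 1 r $ i"
  let ?P = "polynomial_functions n C \<Omega> (dv 1 r) :: ('a rep \<Rightarrow> 'a) set"
  obtain f1 where f1: "f1 \<in> ?P" "f1 N1 \<noteq> 0" "\<And>N. N \<in> ?X \<Longrightarrow> f1 N \<noteq> 0 \<Longrightarrow> Q N" using N1(2) unfolding nearby_def by blast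
  obtain N2 f2 where f2: "N2 \<in> ?X" "f2 \<in> ?P" "f2 N2 \<noteq> 0" "\<And>N. N \<in> ?X \<Longrightarrow> f2 N \<noteq> 0 \<Longrightarrow> unobstructed ?s (rep_ops N)"
    using unobstructed_nearby[of r, where 'a = 'a] unfolding nearby_def by blast
  obtain N0 where N0: "N0 \<in> ?X" "f1 N0 \<noteq> 0" "nearby 1 r N0 (\<lambda>N. \<exists>M'\<in>?X. f2 M' \<noteq> 0 \<and> iso ?s (rep_ops M') (rep_ops N))"
    using generic_common[OF le_refl N1(1) f2(1) f1(1) f2(2) f1(2) f2(3)] by blast
  have 1: "nearby 1 r N0 (\<lambda>N. f1 N \<noteq> 0)" unfolding nearby_def using f1(1) N0(2) by blast
  have "Q N \<and> unobstructed ?s (rep_ops N)"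
    if N: "N \<in> ?X" and h: "f1 N \<noteq> 0 \<and> (\<exists>M'\<in>?X. f2 M' \<noteq> 0 \<and> iso ?s (rep_ops M') (rep_ops N))" for N
    using h f1(3)[OF N] f2(4) unobstructed_iso[OF _ rep_lfD(3)[OF le_refl N]] by blast
  then have "nearby 1 r N0 (\<lambda>N. Q N \<and> unobstructed ?s (rep_ops N))"
    using nearby_conj[OF N0(1) 1 N0(3)] unfolding nearby_def by blast
  then show ?thesis using N0(1) by blast
qed

text \<open>The summands correspond one by one under lifting and reduction, and the factor k in
  their dimensions is the one relating \<open>dv k\<close> to \<open>dv 1\<close>, so the rank
  vectors agree.\<close>

lemma decomposes_lift_reduce:
  fixes M N :: "'a::field rep"
  assumes k: "k \<ge> 1" and rs: "set rs \<subseteq> carrier_vec n" "r = foldr (+) rs (0\<^sub>v n)"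
    and M: "M \<in> rep_lf n C (k \<cdot>\<^sub>m D) \<Omega> r" and N: "N \<in> rep_lf n C (1 \<cdot>\<^sub>m D) \<Omega> r"
    and R: "reduces (\<lambda>i. dv k r $ i) (rep_ops M) (\<lambda>i. dv 1 r $ i) (rep_ops N)" and st: "unobstructed (\<lambda>i. dv 1 r $ i) (rep_ops N)"
  shows "decomposes k r rs M \<longleftrightarrow> decomposes 1 r rs N"
proof
  note lM = rep_lfD(2)[OF k M] and lN = rep_lfD(2)[OF le_refl N]
  note dM = decomposes_iff[OF k rep_lfD(1)[OF k M] rs] and dN = decomposes_iff[OF le_refl rep_lfD(1)[OF le_refl N] rs]
  {
    assume "decomposes k r rs M"
    then obtain L' where L': "biprod_list (\<lambda>i. dv k r $ i) (rep_ops M) L'"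
      "list_all2 (\<lambda>P \<rho>. loc_free k (fst P) (snd P) \<and> indec k (fst P) (snd P) \<and> (\<forall>i<n. fst P i = k * (D $$ (i,i) * \<rho> $ i))) L' rs"
      unfolding dM by blast
    have "indec k (fst P) (snd P)" if "P \<in> set L'" for P
      using that L'(2) by (auto simp: in_set_conv_nth list_all2_conv_all_nth)
    from decomposition_reduce[OF L'(1) lM k lN R st this] obtain L where
      L: "biprod_list (\<lambda>i. dv 1 r $ i) (rep_ops N) L" "list_all2 (\<lambda>P' P. loc_free 1 (fst P) (snd P) \<and> indec 1 (fst P) (snd P) \<and> (\<forall>i<n. fst P' i = k * fst P i)) L' L"
      by blast
    have "list_all2 (\<lambda>P \<rho>. loc_free 1 (fst P) (snd P) \<and> indec 1 (fst P) (snd P) \<and> (\<forall>i<n. fst P i = 1 * (D $$ (i,i) * \<rho> $ i))) L rs"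
      using L(2) L'(2) k by (fastforce simp: list_all2_conv_all_nth)
    then show "decomposes 1 r rs N" unfolding dN using L(1) by blast
  next
    assume "decomposes 1 r rs N"
    then obtain L where L: "biprod_list (\<lambda>i. dv 1 r $ i) (rep_ops N) L"
      "list_all2 (\<lambda>P \<rho>. loc_free 1 (fst P) (snd P) \<and> indec 1 (fst P) (snd P) \<and> (\<forall>i<n. fst P i = 1 * (D $$ (i,i) * \<rho> $ i))) L rs"
      unfolding dN by blast
    have "indec 1 (fst P) (snd P)" if "P \<in> set L" for P
      using that L(2) by (auto simp: in_set_conv_nth list_all2_conv_all_nth)
    from decomposition_lift[OF L(1) lM k lN R st this] obtain L' where
      L': "biprod_list (\<lambda>i. dv k r $ i) (rep_ops M) L'" "list_all2 (\<lambda>P' P. loc_free k (fst P') (snd P') \<and> indec k (fst P') (snd P') \<and> (\<forall>i<n. fst P' i = k * fst P i)) L' L"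
      by blast
    have "list_all2 (\<lambda>P \<rho>. loc_free k (fst P) (snd P) \<and> indec k (fst P) (snd P) \<and> (\<forall>i<n. fst P i = k * (D $$ (i,i) * \<rho> $ i))) L' rs"
      using L(2) L'(2) by (fastforce simp: list_all2_conv_all_nth)
    then show "decomposes k r rs M" unfolding dM using L'(1) by blast
  }
qed

text \<open>The comparison of M with N requires N unobstructed. Going down, this is imposed after
  the transfer; going up, before it, because the transfer only says that the reductions lie in a
  given open set.\<close>

lemma canonical_decomposition_one:
  assumes k: "k \<ge> 1" and rs: "set rs \<subseteq> carrier_vec n" "r = foldr (+) rs (0\<^sub>v n)"
  shows "canonical_decomposition TYPE('a::alg_closed_field) n C (k \<cdot>\<^sub>m D) \<Omega> r rs \<longleftrightarrow>
    canonical_decomposition TYPE('a) n C (1 \<cdot>\<^sub>m D) \<Omega> r rs"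
proof -
  let ?Xk = "rep_lf n C (k \<cdot>\<^sub>m D) \<Omega> r :: 'a rep set" and ?X1 = "rep_lf n C (1 \<cdot>\<^sub>m D) \<Omega> r :: 'a rep set"
  let ?R = "\<lambda>M N. reduces (\<lambda>i. dv k r $ i) (rep_ops M) (\<lambda>i. dv 1 r $ i) (rep_ops N)"
  note dec = decomposes_lift_reduce[OF k rs]
  show ?thesis unfolding canonical_decomposition_iff[OF k rs] canonical_decomposition_iff[OF le_refl rs]
  proof
    assume "\<exists>M0\<in>?Xk. nearby k r M0 (decomposes k r rs)"
    then obtain M0 f where M0: "M0 \<in> ?Xk" "f \<in> polynomial_functions n C \<Omega> (dv k r)" "f M0 \<noteq> 0"
      and f: "\<And>M. M \<in> ?Xk \<Longrightarrow> f M \<noteq> 0 \<Longrightarrow> decomposes k r rs M" unfolding nearby_def by blast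
    obtain N1 where "N1 \<in> ?X1" "nearby 1 r N1 (\<lambda>N. \<exists>M\<in>?Xk. f M \<noteq> 0 \<and> ?R M N)" using transfer_down[OF k M0] by blast
    from unobstructed_near_generic[OF this] obtain N0 where N0: "N0 \<in> ?X1"
      "nearby 1 r N0 (\<lambda>N. (\<exists>M\<in>?Xk. f M \<noteq> 0 \<and> ?R M N) \<and> unobstructed (\<lambda>i. dv 1 r $ i) (rep_ops N))" by blast
    have "nearby 1 r N0 (decomposes 1 r rs)" using N0(2) f dec unfolding nearby_def by blast
    then show "\<exists>N0\<in>?X1. nearby 1 r N0 (decomposes 1 r rs)" using N0(1) by blast
  next
    assume "\<exists>N0\<in>?X1. nearby 1 r N0 (decomposes 1 r rs)"
    then obtain N1 where "N1 \<in> ?X1" "nearby 1 r N1 (decomposes 1 r rs)" by blast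
    from unobstructed_near_generic[OF this] obtain N0 f where N0: "N0 \<in> ?X1" "f \<in> polynomial_functions n C \<Omega> (dv 1 r)" "f N0 \<noteq> 0"
      and f: "\<And>N. N \<in> ?X1 \<Longrightarrow> f N \<noteq> 0 \<Longrightarrow> decomposes 1 r rs N \<and> unobstructed (\<lambda>i. dv 1 r $ i) (rep_ops N)" unfolding nearby_def by blast
    obtain M0 where M0: "M0 \<in> ?Xk" "nearby k r M0 (\<lambda>M. \<exists>N\<in>?X1. f N \<noteq> 0 \<and> ?R M N)" using transfer_up[OF k N0] by blast
    have "nearby k r M0 (decomposes k r rs)" using M0(2) f dec unfolding nearby_def by blast
    then show "\<exists>M0\<in>?Xk. nearby k r M0 (decomposes k r rs)" using M0(1) by blast
  qed
qed

end

theorem theorem1p1: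
  fixes n :: nat and C :: "int mat" and D :: "nat mat" and \<Omega> :: "(nat \<times> nat) set"
    and k k' :: nat and r :: "nat vec" and rs :: "nat vec list"
  assumes "generalized_cartan_matrix n C"
    and "symmetrizer n C D"
    and "orientation n C \<Omega>"
    and "k \<ge> 1" and "k' \<ge> 1"
    and "r \<in> carrier_vec n"
    and "set rs \<subseteq> carrier_vec n"
    and "r = foldr (+) rs (0\<^sub>v n)"
  shows "canonical_decomposition TYPE('a::alg_closed_field) n C (k \<cdot>\<^sub>m D) \<Omega> r rs \<longleftrightarrow>
         canonical_decomposition TYPE('a) n C (k' \<cdot>\<^sub>m D) \<Omega> r rs"
proof -
  interpret gls_algebra n C D \<Omega> by unfold_locales (fact assms)+
  show ?thesis
    using canonical_decomposition_one[OF assms(4,7,8)] canonical_decomposition_one[OF assms(5,7,8)] by blast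
qed

end
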